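(* Let $k$ be a field and let $S$ be a numerical semigroup of homogeneous type with multiplicity $m$. Suppose there exist $s\in M=S\setminus\{0\}$ and an odd integer $b\in S$ such that $2s+b\in\operatorname{Ap}_m(S)$, and let $E=\{s\}+S$. Then $S\Join^b E$ is of homogeneous type and not homogeneous. Moreover, $\operatorname{gr}_{\mathfrak n}(k[\![S\Join^b E]\!])$ is not a complete intersection, provided that $\operatorname{gr}_{\mathfrak m}(k[\![S]\!])$ is not a complete intersection, where $\mathfrak m$ and $\mathfrak n$ are the maximal ideals of $k[\![S]\!]$ and $k[\![S\Join^b E]\!]$ respectively.
   Context: A numerical semigroup is a submonoid $S$ of $(\mathbb N,+)$ with $\mathbb N\setminus S$ finite; its multiplicity $m$ is its smallest nonzero element; $\operatorname{Ap}_m(S)=\{x\in S\mid x-m\notin S\}$; $k[\![S]\!]=k[\![t^x\mid x\in S]\!]\subseteq k[\![t]\!]$, with maximal ideal $(t^x\mid0\ne x\in S)$. For an ideal $E$ of $S$ (non-empty $E\subseteq S$ with $E+S\subseteq E$) and odd $b\in S$, the numerical duplication is the numerical semigroup $S\Join^b E=\{2x\mid x\in S\}\cup\{2e+b\mid e\in E\}$. For a local ring $(A,\mathfrak a)$, $\operatorname{gr}_{\mathfrak a}(A)=\bigoplus_{i\ge0}\mathfrak a^i/\mathfrak a^{i+1}$. Let $U$ be a numerical semigroup minimally generated by $g_1,\dots,g_p$, and let $\mathfrak a$ be the maximal ideal of $k[\![U]\!]$. View $k[\![U]\!]$ and $\operatorname{gr}_{\mathfrak a}(k[\![U]\!])$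 as $k[\![x_1,\dots,x_p]\!]$-modules via $x_i\mapsto t^{g_i}$ (and, for the graded ring, its Betti numbers are those of its minimal graded free resolution over $k[x_1,\dots,x_p]$ via $x_i\mapsto$ class of $t^{g_i}$ in $\mathfrak a/\mathfrak a^2$). $U$ is of homogeneous type if the Betti numbers satisfy $\beta_i(k[\![U]\!])=\beta_i(\operatorname{gr}_{\mathfrak a}(k[\![U]\!]))$ for all $i$. $U$ is homogeneous if, for every $z$ in the Apéry set of $U$ with respect to its multiplicity, all representations $z=\sum_ic_ig_i$ ($c_i\in\mathbb N$) have the same length $\sum_ic_i$. *)

theory Defs
  imports
    "HOL-Library.Multiset"
    "HOL-Computational_Algebra.Formal_Power_Series"
    "HOL-Algebra.Ideal_Product"
    "HOL-Algebra.QuotRing"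
    "HOL-Algebra.Module"
begin

hide_const (open) Multiset.mult

section \<open>Numerical semigroups\<close>

definition numerical_semigroup :: "nat set \<Rightarrow> bool" where
  "numerical_semigroup S \<longleftrightarrow> 0 \<in> S \<and> (\<forall>x\<in>S. \<forall>y\<in>S. x + y \<in> S) \<and> finite (UNIV - S)"

definition ns_multiplicity :: "nat set \<Rightarrow> nat" where
  "ns_multiplicity S = (LEAST x. x \<in> S \<and> x \<noteq> 0)"

definition apery :: "nat \<Rightarrow> nat set \<Rightarrow> nat set" where
  "apery m S = {x \<in> S. int x - int m \<notin> int ` S}"

definition ns_ideal :: "nat set \<Rightarrow> nat set \<Rightarrow> bool" where
  "ns_ideal E S \<longleftrightarrow> E \<noteq> {} \<and> E \<subseteq> S \<and> (\<forall>e\<in>E. \<forall>x\<in>S. e + x \<in> E)"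

definition duplication :: "nat set \<Rightarrow> nat \<Rightarrow> nat set \<Rightarrow> nat set" where
  "duplication S b E = {2 * x | x. x \<in> S} \<union> {2 * e + b | e. e \<in> E}"

text \<open>A multiset \<open>c\<close> of generators stands for the representation \<open>\<Sum>\<^sub># c\<close>, in which \<open>g\<close> has
  the coefficient \<open>count c g\<close>; its length is \<open>size c\<close>.\<close>

definition generated :: "nat set \<Rightarrow> nat set" where
  "generated G = {\<Sum>\<^sub># c | c. set_mset c \<subseteq> G}"

definition minimally_generates :: "nat set \<Rightarrow> nat set \<Rightarrow> bool" where
  "minimally_generates G U \<longleftrightarrow> generated G = U \<and> (\<forall>H. H \<subset> G \<longrightarrow> generated H \<noteq> U)"

definition min_gens :: "nat set \<Rightarrow> nat set" where
  "min_gens U = (THE G. minimally_generates G U)"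

definition homogeneous :: "nat set \<Rightarrow> bool" where
  "homogeneous U \<longleftrightarrow>
    (\<forall>z \<in> apery (ns_multiplicity U) U. \<forall>c c'.
      set_mset c \<subseteq> min_gens U \<and> \<Sum>\<^sub># c = z \<and> set_mset c' \<subseteq> min_gens U \<and> \<Sum>\<^sub># c' = z
      \<longrightarrow> size c = size c')"

lemma numerical_semigroup_duplication:
  assumes S: "numerical_semigroup S" and E: "ns_ideal E S" and b: "b \<in> S" "odd b"
  shows "numerical_semigroup (duplication S b E)"
proof -
  let ?D = "duplication S b E"
  have zero: "0 \<in> ?D" using S by (auto simp: numerical_semigroup_def duplication_def)
  have even: "2 * x \<in> ?D" if "x \<in> S" for x using that by (auto simp: duplication_def)
  have odd: "2 * e + b \<in> ?D" if "e \<in> E" for e using that by (auto simp: duplication_def)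
  have SS: "x + y \<in> S" if "x \<in> S" "y \<in> S" for x y
    using that S by (auto simp: numerical_semigroup_def)
  have ES: "e + x \<in> E" if "e \<in> E" "x \<in> S" for e x
    using that E by (auto simp: ns_ideal_def)
  have EsubS: "e \<in> S" if "e \<in> E" for e using that E by (auto simp: ns_ideal_def)
  have closed: "x + y \<in> ?D" if xy: "x \<in> ?D" "y \<in> ?D" for x y
  proof -
    consider (a) u v where "x = 2*u" "u \<in> S" "y = 2*v" "v \<in> S"
      | (b) u v where "x = 2*u" "u \<in> S" "y = 2*v+b" "v \<in> E"
      | (c) u v where "x = 2*u+b" "u \<in> E" "y = 2*v" "v \<in> S"
      | (d) u v where "x = 2*u+b" "u \<in> E" "y = 2*v+b" "v \<in> E"
      using xy unfolding duplication_def by blast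
    then show ?thesis
    proof cases
      case a then show ?thesis using even[OF SS, of u v] by (simp add: algebra_simps)
    next
      case b then show ?thesis using odd[OF ES, of v u] by (simp add: algebra_simps)
    next
      case c then show ?thesis using odd[OF ES, of u v] by (simp add: algebra_simps)
    next
      case d
      then have "u + v + b \<in> S" using SS EsubS \<open>b \<in> S\<close> by blast
      from even[OF this] d show ?thesis by (simp add: algebra_simps)
    qed
  qed
  obtain e where e: "e \<in> E" using E by (auto simp: ns_ideal_def)
  obtain N where N: "\<And>x. x \<ge> N \<Longrightarrow> x \<in> S"
  proof -
    have "finite (UNIV - S)" using S by (simp add: numerical_semigroup_def)
    then obtain N where "\<forall>x\<in>UNIV - S. x < N" using finite_nat_set_iff_bounded by blast
    then show ?thesis using that[of N] by (metis DiffI UNIV_I leD)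
  qed
  have large: "x \<in> ?D" if x: "x \<ge> 2 * N + 2 * e + b" for x
  proof (cases "even x")
    case True
    then obtain y where y: "x = 2 * y" by blast
    then show ?thesis using even[OF N, of y] x by simp
  next
    case False
    then have "even (x - (2 * e + b))" using b x by simp
    then obtain y where y: "x - (2 * e + b) = 2 * y" by blast
    then have "x = 2 * (e + y) + b" "y \<ge> N" using x by auto
    then show ?thesis using odd[OF ES[OF e N], of y] by simp
  qed
  have "UNIV - ?D \<subseteq> {..<2 * N + 2 * e + b}" using large by (auto simp: not_le[symmetric])
  then have "finite (UNIV - ?D)" using finite_subset by blast
  with zero closed show ?thesis by (auto simp: numerical_semigroup_def)
qed

lemma minimally_generates_iff:
  assumes S: "numerical_semigroup U"
  shows "minimally_generates G U \<longleftrightarrow>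
    G = {g \<in> U - {0}. \<not> (\<exists>x \<in> U - {0}. \<exists>y \<in> U - {0}. g = x + y)}" (is "_ \<longleftrightarrow> G = ?A")
proof -
  have closed: "\<Sum>\<^sub># c \<in> U" if "set_mset c \<subseteq> U" for c
    using that S by (induction c) (auto simp: numerical_semigroup_def)
  have split: "\<exists>c. set_mset c \<subseteq> ?A \<and> \<Sum>\<^sub># c = x" if "x \<in> U" for x
    using that
  proof (induction x rule: less_induct)
    case (less x)
    consider "x = 0" | "x \<in> ?A" | u v where "u \<in> U - {0}" "v \<in> U - {0}" "x = u + v"
      using less.prems by blast
    then show ?case
    proof cases
      case 1 then show ?thesis by (intro exI[of _ "{#}"]) auto
    next
      case 2 then show ?thesis by (intro exI[of _ "{#x#}"]) auto
    next
      case 3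
      then have "u < x" "v < x" "u \<in> U" "v \<in> U" by auto
      then obtain c d where "set_mset c \<subseteq> ?A" "\<Sum>\<^sub># c = u" "set_mset d \<subseteq> ?A" "\<Sum>\<^sub># d = v"
        using less.IH by meson
      then show ?thesis using 3 by (intro exI[of _ "c + d"]) auto
    qed
  qed
  have genA: "generated ?A = U"
  proof
    show "generated ?A \<subseteq> U" using closed unfolding generated_def by blast
    show "U \<subseteq> generated ?A" using split unfolding generated_def by blast
  qed
  have sub: "?A \<subseteq> H" if H: "generated H = U" for H
  proof
    fix g assume g: "g \<in> ?A"
    have HU: "h \<in> U" if "h \<in> H" for h
    proof -
      have "\<Sum>\<^sub># {#h#} \<in> generated H" using that unfolding generated_def by fastforce
      then show ?thesis using H by simp
    qed
    have "\<Sum>\<^sub># c \<in> ?A \<Longrightarrow> set_mset c \<subseteq> H \<Longrightarrow> \<Sum>\<^sub># c \<in> H" for c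
    proof (induction c)
      case empty then show ?case by simp
    next
      case (add h c)
      have hU: "h \<in> U" and cU: "\<Sum>\<^sub># c \<in> U" using add.prems HU closed[of c] by auto
      have irred: "h + \<Sum>\<^sub># c \<noteq> x + y" if "x \<in> U - {0}" "y \<in> U - {0}" for x y
        using add.prems(1) that by simp
      have "\<not> (h \<in> U - {0} \<and> \<Sum>\<^sub># c \<in> U - {0})"
        using irred by blast
      with hU cU consider "h = 0" | "\<Sum>\<^sub># c = 0"
        by (meson Diff_iff singletonD)
      then show ?case
      proof cases
        case 1
        then have "\<Sum>\<^sub># (add_mset h c) = \<Sum>\<^sub># c" by simp
        moreover have "\<Sum>\<^sub># c \<in> H"
          using add.prems by (intro add.IH) (simp_all only: calculation, simp_all)
        ultimately show ?thesis by (simp only:)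
      next
        case 2
        then have "\<Sum>\<^sub># (add_mset h c) = h" by (simp only: sum_mset.add_mset add_0_right)
        moreover have "h \<in> H" using add.prems(2) by simp
        ultimately show ?thesis by (simp only:)
      qed
    qed
    moreover obtain c where "set_mset c \<subseteq> H" "\<Sum>\<^sub># c = g"
      using g H unfolding generated_def by blast
    ultimately show "g \<in> H" using g by auto
  qed
  show ?thesis
  proof
    assume "minimally_generates G U"
    then have G: "generated G = U" and min: "\<And>H. H \<subset> G \<Longrightarrow> generated H \<noteq> U"
      by (simp_all only: minimally_generates_def simp_thms)
    show "G = ?A" using sub[OF G] min[of ?A] genA by (simp only: psubset_eq) blast
  next
    assume "G = ?A"
    then show "minimally_generates G U"
      unfolding minimally_generates_def using genA sub by (simp only: psubset_eq) blast
  qed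
qed

lemma min_gens_eq:
  assumes "numerical_semigroup U"
  shows "min_gens U = {g \<in> U - {0}. \<not> (\<exists>x \<in> U - {0}. \<exists>y \<in> U - {0}. g = x + y)}"
  unfolding min_gens_def minimally_generates_iff[OF assms] by simp


section \<open>Minimal free resolutions\<close>

text \<open>The \<open>mult\<close> and \<open>one\<close> fields, which the module record inherits from the ring record, play no
  role below.\<close>

definition free_module :: "('a, 'm) ring_scheme \<Rightarrow> nat \<Rightarrow> ('a, nat \<Rightarrow> 'a) module" where
  "free_module R n =
    \<lparr>carrier = {..<n} \<rightarrow>\<^sub>E carrier R,
     mult = (\<lambda>u v. \<lambda>j\<in>{..<n}. u j \<otimes>\<^bsub>R\<^esub> v j),
     one = (\<lambda>j\<in>{..<n}. \<one>\<^bsub>R\<^esub>),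
     zero = (\<lambda>j\<in>{..<n}. \<zero>\<^bsub>R\<^esub>),
     add = (\<lambda>u v. \<lambda>j\<in>{..<n}. u j \<oplus>\<^bsub>R\<^esub> v j),
     smult = (\<lambda>r v. \<lambda>j\<in>{..<n}. r \<otimes>\<^bsub>R\<^esub> v j)\<rparr>"

text \<open>A ring \<open>A\<close> regarded as an \<open>R\<close>-module via a ring homomorphism \<open>\<phi>\<close> from \<open>R\<close> to \<open>A\<close>.\<close>

definition module_via :: "('r \<Rightarrow> 'a) \<Rightarrow> ('a, 'm) ring_scheme \<Rightarrow> ('r, 'a) module" where
  "module_via \<phi> A =
    \<lparr>carrier = carrier A, mult = mult A, one = one A, zero = zero A, add = add A,
     smult = (\<lambda>r x. \<phi> r \<otimes>\<^bsub>A\<^esub> x)\<rparr>"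

definition linear_maps ::
  "('r, 'm) ring_scheme \<Rightarrow> ('r, 'a) module \<Rightarrow> ('r, 'b) module \<Rightarrow> ('a \<Rightarrow> 'b) set" where
  "linear_maps R M N =
    {h \<in> carrier M \<rightarrow> carrier N.
      (\<forall>x\<in>carrier M. \<forall>y\<in>carrier M. h (x \<oplus>\<^bsub>M\<^esub> y) = h x \<oplus>\<^bsub>N\<^esub> h y) \<and>
      (\<forall>r\<in>carrier R. \<forall>x\<in>carrier M. h (r \<odot>\<^bsub>M\<^esub> x) = r \<odot>\<^bsub>N\<^esub> h x)}"

text \<open>The exact sequence
  \<open>\<dots> \<longrightarrow> R\<^bsup>\<beta> 2\<^esup> \<longrightarrow> R\<^bsup>\<beta> 1\<^esup> \<longrightarrow> R\<^bsup>\<beta> 0\<^esup> \<longrightarrow> M \<longrightarrow> 0\<close>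
  with augmentation \<open>\<epsilon>\<close> and differentials \<open>d i\<close> from \<open>R\<^bsup>\<beta> (i + 1)\<^esup>\<close> to \<open>R\<^bsup>\<beta> i\<^esup>\<close>.\<close>

definition free_resolution ::
  "('r, 'm) ring_scheme \<Rightarrow> ('r, 'a) module \<Rightarrow> (nat \<Rightarrow> nat) \<Rightarrow>
    ((nat \<Rightarrow> 'r) \<Rightarrow> 'a) \<Rightarrow> (nat \<Rightarrow> (nat \<Rightarrow> 'r) \<Rightarrow> (nat \<Rightarrow> 'r)) \<Rightarrow> bool" where
  "free_resolution R M \<beta> \<epsilon> d \<longleftrightarrow>
    (let F = (\<lambda>i. free_module R (\<beta> i)) in
      \<epsilon> \<in> linear_maps R (F 0) M \<and>
      (\<forall>i. d i \<in> linear_maps R (F (i + 1)) (F i)) \<and>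
      \<epsilon> ` carrier (F 0) = carrier M \<and>
      d 0 ` carrier (F 1) = {v \<in> carrier (F 0). \<epsilon> v = \<zero>\<^bsub>M\<^esub>} \<and>
      (\<forall>i. d (i + 1) ` carrier (F (i + 2)) = {v \<in> carrier (F (i + 1)). d i v = \<zero>\<^bsub>F i\<^esub>}))"

text \<open>Minimality with respect to an ideal \<open>\<mm>\<close>: the image of \<open>d i\<close> lies in \<open>\<mm> R\<^bsup>\<beta> i\<^esup>\<close>, which
  consists of the vectors all of whose entries belong to \<open>\<mm>\<close>.\<close>

definition minimal_differentials ::
  "('r, 'm) ring_scheme \<Rightarrow> 'r set \<Rightarrow> (nat \<Rightarrow> nat) \<Rightarrow>
    (nat \<Rightarrow> (nat \<Rightarrow> 'r) \<Rightarrow> (nat \<Rightarrow> 'r)) \<Rightarrow> bool" where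
  "minimal_differentials R \<mm> \<beta> d \<longleftrightarrow>
    (\<forall>i. \<forall>v \<in> carrier (free_module R (\<beta> (i + 1))). \<forall>j<\<beta> i. d i v j \<in> \<mm>)"

text \<open>Betti numbers are treated as a relation: \<open>\<beta>\<close> is the sequence of ranks of a minimal free
  resolution of \<open>M\<close> over the local ring \<open>R\<close> with maximal ideal \<open>\<mm>\<close>. For finitely generated
  modules over a Noetherian local ring there is exactly one such sequence.\<close>

definition has_betti_numbers ::
  "('r, 'm) ring_scheme \<Rightarrow> 'r set \<Rightarrow> ('r, 'a) module \<Rightarrow> (nat \<Rightarrow> nat) \<Rightarrow> bool" where
  "has_betti_numbers R \<mm> M \<beta> \<longleftrightarrow>
    (\<exists>\<epsilon> d. free_resolution R M \<beta> \<epsilon> d \<and> minimal_differentials R \<mm> \<beta> d)"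

text \<open>In the graded case \<open>RH e\<close> and \<open>MH e\<close> are the sets of homogeneous elements of degree \<open>e\<close>
  (including zero) of the ring and the module. The vector \<open>v\<close> is homogeneous of degree \<open>e\<close> in the
  graded free module whose \<open>j\<close>-th basis vector has degree \<open>a j\<close>, that is, in the direct sum of
  the \<open>R(- a j)\<close> for \<open>j < n\<close>, if each \<open>v j\<close> is homogeneous of degree \<open>e - a j\<close>.\<close>

definition free_hom ::
  "('r, 'm) ring_scheme \<Rightarrow> (int \<Rightarrow> 'r set) \<Rightarrow> nat \<Rightarrow> (nat \<Rightarrow> int) \<Rightarrow> int \<Rightarrow> (nat \<Rightarrow> 'r) set" where
  "free_hom R RH n a e = {v \<in> carrier (free_module R n). \<forall>j<n. v j \<in> RH (e - a j)}"

definition has_graded_betti_numbers ::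
  "('r, 'm) ring_scheme \<Rightarrow> (int \<Rightarrow> 'r set) \<Rightarrow> 'r set \<Rightarrow>
    ('r, 'a) module \<Rightarrow> (int \<Rightarrow> 'a set) \<Rightarrow> (nat \<Rightarrow> nat) \<Rightarrow> bool" where
  "has_graded_betti_numbers R RH \<mm> M MH \<beta> \<longleftrightarrow>
    (\<exists>\<epsilon> d a. free_resolution R M \<beta> \<epsilon> d \<and> minimal_differentials R \<mm> \<beta> d \<and>
      (\<forall>e. \<epsilon> ` free_hom R RH (\<beta> 0) (a 0) e \<subseteq> MH e) \<and>
      (\<forall>i e. d i ` free_hom R RH (\<beta> (i + 1)) (a (i + 1)) e \<subseteq> free_hom R RH (\<beta> i) (a i) e))"


section \<open>Power series and polynomials in several variables\<close>

text \<open>The variables are indexed by a set \<open>G\<close> and, as in the theory of indexed polynomials in HOL-Algebra,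
  monomials are multisets over \<open>G\<close> and a series maps each monomial to its coefficient.\<close>

definition mpower_series_ring :: "'g set \<Rightarrow> ('g multiset \<Rightarrow> 'k::field) ring" where
  "mpower_series_ring G =
    \<lparr>carrier = {f. \<forall>m. f m \<noteq> 0 \<longrightarrow> set_mset m \<subseteq> G},
     mult = (\<lambda>f g m. \<Sum>u | u \<subseteq># m. f u * g (m - u)),
     one = (\<lambda>m. if m = {#} then 1 else 0),
     zero = (\<lambda>m. 0),
     add = (\<lambda>f g m. f m + g m)\<rparr>"

definition mpoly_ring :: "'g set \<Rightarrow> ('g multiset \<Rightarrow> 'k::field) ring" where
  "mpoly_ring G = (mpower_series_ring G)
    \<lparr>carrier := {f \<in> carrier (mpower_series_ring G). finite {m. f m \<noteq> 0}}\<rparr>"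

definition mvar :: "'g \<Rightarrow> 'g multiset \<Rightarrow> 'k::field" where
  "mvar g = (\<lambda>m. if m = {#g#} then 1 else 0)"

definition mpoly_hom :: "'g set \<Rightarrow> int \<Rightarrow> ('g multiset \<Rightarrow> 'k::field) set" where
  "mpoly_hom G e = {f \<in> carrier (mpoly_ring G). \<forall>m. f m \<noteq> 0 \<longrightarrow> int (size m) = e}"


section \<open>Associated graded rings\<close>

primrec ideal_power :: "('a, 'm) ring_scheme \<Rightarrow> 'a set \<Rightarrow> nat \<Rightarrow> 'a set" where
  "ideal_power R I 0 = carrier R"
| "ideal_power R I (Suc n) = ideal_prod R (ideal_power R I n) I"

text \<open>An element of the associated graded ring is the sequence of its homogeneous components, the
  \<open>n\<close>-th one being a coset of \<open>I\<^bsup>n + 1\<^esup>\<close> with a representative in \<open>I\<^bsup>n\<^esup>\<close>.\<close>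

definition assoc_graded_ring :: "('a, 'm) ring_scheme \<Rightarrow> 'a set \<Rightarrow> (nat \<Rightarrow> 'a set) ring" where
  "assoc_graded_ring R I =
    \<lparr>carrier = {f. (\<forall>n. f n \<in> (\<lambda>x. ideal_power R I (n + 1) +>\<^bsub>R\<^esub> x) ` ideal_power R I n) \<and>
                   finite {n. f n \<noteq> ideal_power R I (n + 1)}},
     mult = (\<lambda>f g n. finsum (R Quot ideal_power R I (n + 1))
              (\<lambda>i. rcoset_mult R (ideal_power R I (n + 1)) (f i) (g (n - i))) {..n}),
     one = (\<lambda>n. if n = 0 then ideal_power R I 1 +>\<^bsub>R\<^esub> \<one>\<^bsub>R\<^esub> else ideal_power R I (n + 1)),
     zero = (\<lambda>n. ideal_power R I (n + 1)),
     add = (\<lambda>f g n. f n <+>\<^bsub>R\<^esub> g n)\<rparr>"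

text \<open>The class of \<open>x \<in> I\<^bsup>n\<^esup>\<close> in \<open>I\<^bsup>n\<^esup> / I\<^bsup>n + 1\<^esup>\<close>, as a homogeneous element of degree \<open>n\<close>.\<close>

definition graded_class :: "('a, 'm) ring_scheme \<Rightarrow> 'a set \<Rightarrow> nat \<Rightarrow> 'a \<Rightarrow> nat \<Rightarrow> 'a set" where
  "graded_class R I n x =
    (\<lambda>i. if i = n then ideal_power R I (n + 1) +>\<^bsub>R\<^esub> x else ideal_power R I (i + 1))"

definition assoc_graded_hom :: "('a, 'm) ring_scheme \<Rightarrow> 'a set \<Rightarrow> int \<Rightarrow> (nat \<Rightarrow> 'a set) set" where
  "assoc_graded_hom R I e =
    {f \<in> carrier (assoc_graded_ring R I). \<forall>i. int i \<noteq> e \<longrightarrow> f i = ideal_power R I (i + 1)}"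


section \<open>Semigroup rings and homogeneous type\<close>

definition sg_ring :: "nat set \<Rightarrow> 'k::field fps ring" where
  "sg_ring U =
    \<lparr>carrier = {f. \<forall>n. fps_nth f n \<noteq> 0 \<longrightarrow> n \<in> U},
     mult = (*), one = 1, zero = 0, add = (+)\<rparr>"

definition sg_max_ideal :: "nat set \<Rightarrow> 'k::field fps set" where
  "sg_max_ideal U = Idl\<^bsub>sg_ring U\<^esub> ((\<lambda>x. fps_X ^ x) ` (U - {0}))"

definition sg_gr :: "nat set \<Rightarrow> (nat \<Rightarrow> 'k::field fps set) ring" where
  "sg_gr U = assoc_graded_ring (sg_ring U) (sg_max_ideal U)"

text \<open>The substitutions sending the variable indexed by a minimal generator \<open>g\<close> to \<open>t\<^bsup>g\<^esup>\<close>,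
  respectively to the class of \<open>t\<^bsup>g\<^esup>\<close> in degree one. The set of monomials summed over in the first one
  is finite, since minimal generators are positive.\<close>

definition sg_subst :: "nat set \<Rightarrow> (nat multiset \<Rightarrow> 'k::field) \<Rightarrow> 'k fps" where
  "sg_subst U f = Abs_fps (\<lambda>n. \<Sum>m | set_mset m \<subseteq> min_gens U \<and> \<Sum>\<^sub># m = n. f m)"

definition gr_subst :: "nat set \<Rightarrow> (nat multiset \<Rightarrow> 'k::field) \<Rightarrow> nat \<Rightarrow> 'k fps set" where
  "gr_subst U f =
    (let A = sg_ring U; \<aa> = sg_max_ideal U in
      \<Oplus>\<^bsub>sg_gr U\<^esub> m \<in> {m. f m \<noteq> 0}.
        graded_class A \<aa> 0 (fps_const (f m)) \<otimes>\<^bsub>sg_gr U\<^esub>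
        (\<Otimes>\<^bsub>sg_gr U\<^esub> g \<in> set_mset m. graded_class A \<aa> 1 (fps_X ^ g) [^]\<^bsub>sg_gr U\<^esub> count m g))"

definition homogeneous_type :: "'k::field itself \<Rightarrow> nat set \<Rightarrow> bool" where
  "homogeneous_type (_ :: 'k itself) U \<longleftrightarrow>
    (let G = min_gens U;
         R = (mpower_series_ring G :: (nat multiset \<Rightarrow> 'k) ring);
         P = (mpoly_ring G :: (nat multiset \<Rightarrow> 'k) ring)
     in \<exists>\<beta>. has_betti_numbers R (Idl\<^bsub>R\<^esub> (mvar ` G)) (module_via (sg_subst U) (sg_ring U)) \<beta> \<and>
            has_graded_betti_numbers P (mpoly_hom G) (Idl\<^bsub>P\<^esub> (mvar ` G))
              (module_via (gr_subst U) (sg_gr U))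
              (assoc_graded_hom (sg_ring U) (sg_max_ideal U)) \<beta>)"


section \<open>Complete intersections\<close>

definition regular_sequence :: "('a, 'm) ring_scheme \<Rightarrow> 'a list \<Rightarrow> bool" where
  "regular_sequence R fs \<longleftrightarrow>
    set fs \<subseteq> carrier R \<and>
    (\<forall>i<length fs. \<forall>r\<in>carrier R.
      r \<otimes>\<^bsub>R\<^esub> fs ! i \<in> Idl\<^bsub>R\<^esub> (set (take i fs)) \<longrightarrow> r \<in> Idl\<^bsub>R\<^esub> (set (take i fs))) \<and>
    Idl\<^bsub>R\<^esub> (set fs) \<noteq> carrier R"

text \<open>The graded ring of \<open>U\<close> is a complete intersection if the homogeneous ideal of relations between
  the classes of the \<open>t\<^bsup>g\<^esup>\<close>, with \<open>g\<close> a minimal generator, is generated by a regular sequence of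
  homogeneous polynomials.\<close>

definition gr_complete_intersection :: "'k::field itself \<Rightarrow> nat set \<Rightarrow> bool" where
  "gr_complete_intersection (_ :: 'k itself) U \<longleftrightarrow>
    (let P = (mpoly_ring (min_gens U) :: (nat multiset \<Rightarrow> 'k) ring) in
      \<exists>fs. regular_sequence P fs \<and> (\<forall>f\<in>set fs. \<exists>e. f \<in> mpoly_hom (min_gens U) e) \<and>
        a_kernel P (sg_gr U) (gr_subst U) = Idl\<^bsub>P\<^esub> (set fs))"

end

theory Submission
  imports Defs "HOL-Library.Product_Plus"
begin

text \<open>Put \<open>c = 2 s + b\<close>. The duplication is \<open>D = 2 S \<union> (2 S + c)\<close>, so that
  \<open>k[[D]] = k[[S]][[y]] / (y\<^sup>2 - t\<^bsup>c\<^esup>)\<close> after rescaling the exponents of \<open>S\<close>. Since \<open>c\<close> is a sum of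
  three non-zero elements of \<open>S\<close>, the initial form of the relation is \<open>y\<^sup>2\<close>, and the associated graded
  ring of \<open>k[[D]]\<close> is that of \<open>k[[S]]\<close> with \<open>y\<close> adjoined subject to \<open>y\<^sup>2 = 0\<close>. Both \<open>y\<^sup>2 - t\<^bsup>c\<^esup>\<close> and
  \<open>y\<^sup>2\<close> are regular, hence the mapping cone of the multiplication by them turns a minimal resolution with
  Betti numbers \<open>\<beta>\<^sub>i\<close> into one with Betti numbers \<open>\<beta>\<^sub>i + \<beta>\<^bsub>i-1\<^esub>\<close>, in both cases.
  Homogeneity fails at \<open>2 c\<close>, an element of the Apery set with the factorization \<open>c + c\<close> and one of length
  at least three. Finally, if the ideal of relations of \<open>D\<close> is generated by a regular sequence of forms,
  one of them can be exchanged for \<open>y\<^sup>2\<close>, and the constant terms in \<open>y\<close> of the others form a regular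
  sequence that generates the ideal of relations of \<open>S\<close>.\<close>

unbundle fps_syntax

section \<open>Twisted convolution\<close>

text \<open>One boolean flag treats the ring and its associated graded ring together. The graded
  ring of a semigroup U has the basis t^z for z in U, with t^u t^v equal to t^(u + v) if the orders
  of u and v add up to that of u + v, and to 0 otherwise; \<open>tconv\<close> is this product for
  an arbitrary weight, and weight 0 gives the ordinary product. The flag also decides between
  polynomials and power series, so R[[y]] and P[y] are both sets of series in y over a coefficient
  ring. Exponents of S are doubled in D while c is odd, so the parity of an exponent tells the
  coefficient of 1 from that of y. Homogeneous type asks for one sequence of ranks that serves both
  rings, and the two cones have equal ranks if the two resolutions they start from have. The
  exchange for y^2 works by degrees: no non-zero relation has degree below 2, so y^2 is a scalar
  combination of the generators of degree 2. The others are then sorted by degree, which puts the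
  y-coefficient of each into the ideal of the constant terms before it; this lets regularity pass to
  the constant terms.\<close>

definition tconv :: "('a::comm_monoid_add \<Rightarrow> nat) \<Rightarrow> ('a \<Rightarrow> 'k::comm_ring_1) \<Rightarrow> ('a \<Rightarrow> 'k) \<Rightarrow> 'a \<Rightarrow> 'k" where
  "tconv \<delta> f g z = (\<Sum>(u, v) \<in> {(u, v). u + v = z \<and> \<delta> u + \<delta> v = \<delta> z}. f u * g v)"

text \<open>Superadditivity is what makes \<open>tconv\<close> associative; the order of a numerical
  semigroup has it because factorizations can be put together. It is demanded on the set
  \<open>A\<close> that carries the supports, since orders carry no information outside the
  semigroup.\<close>

definition superadd_on :: "'a::comm_monoid_add set \<Rightarrow> ('a \<Rightarrow> nat) \<Rightarrow> bool" where
  "superadd_on A \<delta> \<longleftrightarrow> (\<forall>u\<in>A. \<forall>v\<in>A. u + v \<in> A \<and> \<delta> u + \<delta> v \<le> \<delta> (u + v))"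

definition supp_on :: "'a set \<Rightarrow> ('a \<Rightarrow> 'k::zero) \<Rightarrow> bool" where
  "supp_on A f \<longleftrightarrow> (\<forall>x. f x \<noteq> 0 \<longrightarrow> x \<in> A)"

lemma finite_decomp_nat: "finite {(u, v). u + v = (z::nat)}"
  by (rule finite_subset[of _ "{..z} \<times> {..z}"]) auto

lemma finite_msets_bounded_size:
  assumes "finite A"
  shows "finite {u. set_mset u \<subseteq> A \<and> size u \<le> n}"
proof (rule finite_subset)
  show "{u. set_mset u \<subseteq> A \<and> size u \<le> n} \<subseteq> mset ` {xs. set xs \<subseteq> A \<and> length xs \<le> n}"
  proof
    fix u assume u: "u \<in> {u. set_mset u \<subseteq> A \<and> size u \<le> n}"
    obtain xs where "mset xs = u" using ex_mset by blast
    with u show "u \<in> mset ` {xs. set xs \<subseteq> A \<and> length xs \<le> n}"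
      by (intro image_eqI[of _ _ xs]) auto
  qed
qed (use assms finite_lists_length_le in auto)

lemma finite_decomp_mset: "finite {(u, v). u + v = (z::'a multiset)}"
proof (rule finite_subset)
  let ?B = "{u. set_mset u \<subseteq> set_mset z \<and> size u \<le> size z}"
  show "{(u, v). u + v = z} \<subseteq> ?B \<times> ?B" by auto
qed (simp add: finite_msets_bounded_size)

lemma finite_decomp_prod:
  assumes "\<And>x::'a::plus. finite {(u, v). u + v = x}" "\<And>x::'b::plus. finite {(u, v). u + v = x}"
  shows "finite {(u, v). u + v = (z::'a \<times> 'b)}"
proof (rule finite_subset)
  show "{(u, v). u + v = z} \<subseteq> (\<lambda>((a, b), (c, d)). ((a, c), (b, d))) `
      ({(u, v). u + v = fst z} \<times> {(u, v). u + v = snd z})"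
    by (auto simp: image_iff)
qed (use assms in auto)

lemma tconv_commute:
  shows "tconv \<delta> f g z = tconv \<delta> g f z"
  unfolding tconv_def
  by (rule sum.reindex_bij_witness[of _ "\<lambda>(u, v). (v, u)" "\<lambda>(u, v). (v, u)"])
    (auto simp: ac_simps)

lemma tconv_add_left:
  "tconv \<delta> (\<lambda>x. f x + f' x) g z = tconv \<delta> f g z + tconv \<delta> f' g z"
  unfolding tconv_def by (simp add: sum.distrib[symmetric] distrib_right case_prod_unfold)

lemma tconv_eq_sum:
  assumes fin: "finite {(u, v). u + v = z}" and "supp_on A f" "supp_on A g"
  shows "tconv \<delta> f g z = (\<Sum>(u, v) \<in> {(u, v). u \<in> A \<and> v \<in> A \<and> u + v = z \<and> \<delta> u + \<delta> v = \<delta> z}. f u * g v)"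
proof -
  have "f u * g v = 0" if "\<not> (u \<in> A \<and> v \<in> A)" for u v
    using that assms(2,3) by (metis mult_not_zero supp_on_def)
  then show ?thesis
    unfolding tconv_def by (intro sum.mono_neutral_right finite_subset[OF _ fin]) auto
qed

lemma supp_on_tconv:
  assumes "superadd_on A \<delta>" "supp_on A f" "supp_on A g"
  shows "supp_on A (tconv \<delta> f g)"
  unfolding supp_on_def
proof (intro allI impI)
  fix x assume "tconv \<delta> f g x \<noteq> 0"
  then obtain p where "p \<in> {(u, v). u + v = x \<and> \<delta> u + \<delta> v = \<delta> x}" "(case p of (u, v) \<Rightarrow> f u * g v) \<noteq> 0"
    unfolding tconv_def by (meson sum.not_neutral_contains_not_neutral)
  then obtain u v where "u + v = x" "f u * g v \<noteq> 0" by (cases p) auto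
  then have "u + v = x" "f u \<noteq> 0" "g v \<noteq> 0" by auto
  then show "x \<in> A" using assms unfolding superadd_on_def supp_on_def by blast
qed

text \<open>Both bracketings sum f u g v h w over the triples with u + v + w = z whose three weights
  add up to the weight of z: by superadditivity there can be no loss at the inner sum if there is
  none in total.\<close>

lemma tconv_assoc:
  fixes f g h :: "'a::comm_monoid_add \<Rightarrow> 'k::comm_ring_1"
  assumes fin: "\<And>x::'a. finite {(u, v). u + v = x}" and \<delta>: "superadd_on A \<delta>"
    and f: "supp_on A f" and g: "supp_on A g" and h: "supp_on A h"
  shows "tconv \<delta> (tconv \<delta> f g) h z = tconv \<delta> f (tconv \<delta> g h) z"
proof -
  define D where "D z = {(u, v). u \<in> A \<and> v \<in> A \<and> u + v = z \<and> \<delta> u + \<delta> v = \<delta> z}" for z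
  have finD: "finite (D z)" for z by (rule finite_subset[OF _ fin[of z]]) (auto simp: D_def)
  have cl: "u + v \<in> A" "\<delta> u + \<delta> v \<le> \<delta> (u + v)" if "u \<in> A" "v \<in> A" for u v
    using \<delta> that by (auto simp: superadd_on_def)
  have e: "tconv \<delta> f' g' x = (\<Sum>(u, v)\<in>D x. f' u * g' v)" if "supp_on A f'" "supp_on A g'" for f' g' x
    using tconv_eq_sum[OF fin that] by (simp add: D_def)
  have "tconv \<delta> (tconv \<delta> f g) h z = (\<Sum>(p, w)\<in>D z. (\<Sum>(u, v)\<in>D p. f u * g v) * h w)"
    by (subst e) (use f g h \<delta> in \<open>auto intro!: supp_on_tconv simp: e[OF f g]\<close>)
  also have "\<dots> = (\<Sum>q\<in>D z. \<Sum>r\<in>D (fst q). f (fst r) * g (snd r) * h (snd q))"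
    by (simp add: case_prod_unfold sum_distrib_right)
  also have "\<dots> = (\<Sum>(q, r)\<in>(SIGMA q:D z. D (fst q)). f (fst r) * g (snd r) * h (snd q))"
    by (rule sum.Sigma) (auto simp: finD)
  also have "\<dots> = (\<Sum>(q, r)\<in>(SIGMA q:D z. D (snd q)). f (fst q) * (g (fst r) * h (snd r)))"
  proof (rule sum.reindex_bij_witness[of _
        "\<lambda>((u, p), (v, w)). ((u + v, w), (u, v))" "\<lambda>((p, w), (u, v)). ((u, v + w), (v, w))"], goal_cases)
    case (2 a)
    then obtain u v w where a: "a = ((u + v, w), (u, v))" and *: "u \<in> A" "v \<in> A" "w \<in> A"
      "u + v + w = z" "\<delta> (u + v) + \<delta> w = \<delta> z" "\<delta> u + \<delta> v = \<delta> (u + v)"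
      by (auto simp: D_def)
    have "\<delta> u + \<delta> (v + w) \<le> \<delta> z" using cl[of u "v + w"] cl[of v w] * by (simp add: add.assoc)
    moreover have "\<delta> v + \<delta> w \<le> \<delta> (v + w)" using cl * by simp
    ultimately show ?case using * cl(1)[of v w] by (simp add: a D_def add.assoc)
  next
    case (4 a)
    then obtain u v w where a: "a = ((u, v + w), (v, w))" and *: "u \<in> A" "v \<in> A" "w \<in> A"
      "u + (v + w) = z" "\<delta> u + \<delta> (v + w) = \<delta> z" "\<delta> v + \<delta> w = \<delta> (v + w)"
      by (auto simp: D_def)
    have "\<delta> (u + v) + \<delta> w \<le> \<delta> z" using cl[of "u + v" w] cl[of u v] * by (simp add: add.assoc)
    moreover have "\<delta> u + \<delta> v \<le> \<delta> (u + v)" using cl * by simp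
    ultimately show ?case using * cl(1)[of u v] by (simp add: a D_def add.assoc)
  qed (auto simp: D_def mult.assoc)
  also have "\<dots> = (\<Sum>q\<in>D z. \<Sum>r\<in>D (snd q). f (fst q) * (g (fst r) * h (snd r)))"
    by (rule sum.Sigma[symmetric]) (auto simp: finD)
  also have "\<dots> = (\<Sum>(p, w)\<in>D z. f p * (\<Sum>(u, v)\<in>D w. g u * h v))"
    by (simp add: case_prod_unfold sum_distrib_left)
  also have "\<dots> = tconv \<delta> f (tconv \<delta> g h) z"
    by (subst e) (use f g h \<delta> in \<open>auto intro!: supp_on_tconv simp: e[OF g h]\<close>)
  finally show ?thesis .
qed

text \<open>Only the elements on which \<open>p\<close> preserves the degree survive the push-forward, which is what
  makes it multiplicative for the twisted convolutions.\<close>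

definition push :: "('a \<Rightarrow> nat) \<Rightarrow> ('b \<Rightarrow> nat) \<Rightarrow> ('a \<Rightarrow> 'b) \<Rightarrow> 'a set \<Rightarrow> ('a \<Rightarrow> 'k::comm_ring_1) \<Rightarrow> 'b \<Rightarrow> 'k" where
  "push \<delta> \<delta>' p A f z = (\<Sum>a | a \<in> A \<and> p a = z \<and> \<delta> a = \<delta>' z. f a)"

text \<open>Both sides equal the sum over \<open>T\<close>. For u, v in \<open>A\<close> the number
  \<delta> u + \<delta> v is at most \<delta> (u + v) and at most \<delta>' (p u) + \<delta>' (p v),
  and each of these is at most \<delta>' (p u + p v); equality of the outer terms therefore forces
  equality everywhere.\<close>

lemma push_tconv:
  fixes f g :: "'a::comm_monoid_add \<Rightarrow> 'k::comm_ring_1" and p :: "'a \<Rightarrow> 'b::comm_monoid_add"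
  assumes finA: "\<And>x::'a. finite {(u, v). u + v = x}" and finB: "\<And>x::'b. finite {(u, v). u + v = x}"
    and fib: "\<And>z. finite {a \<in> A. p a = z}"
    and A: "superadd_on A \<delta>" and B: "superadd_on (p ` A) \<delta>'"
    and le: "\<And>a. a \<in> A \<Longrightarrow> \<delta> a \<le> \<delta>' (p a)"
    and p: "\<And>a a'. a \<in> A \<Longrightarrow> a' \<in> A \<Longrightarrow> p (a + a') = p a + p a'"
    and f: "supp_on A f" and g: "supp_on A g"
  shows "push \<delta> \<delta>' p A (tconv \<delta> f g) z = tconv \<delta>' (push \<delta> \<delta>' p A f) (push \<delta> \<delta>' p A g) z"
proof -
  define F where "F z = {a. a \<in> A \<and> p a = z \<and> \<delta> a = \<delta>' z}" for z
  define D where "D x = {(u, v). u \<in> A \<and> v \<in> A \<and> u + v = x \<and> \<delta> u + \<delta> v = \<delta> x}" for x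
  define D' where "D' z = {(u, v). u + v = z \<and> \<delta>' u + \<delta>' v = \<delta>' z}" for z
  define T where "T = {(u, v). u \<in> A \<and> v \<in> A \<and> p u + p v = z \<and> \<delta> u + \<delta> v = \<delta>' z}"
  have finF: "finite (F z)" for z by (rule finite_subset[OF _ fib[of z]]) (auto simp: F_def)
  have finD: "finite (D z)" for z by (rule finite_subset[OF _ finA[of z]]) (auto simp: D_def)
  have finD': "finite (D' z)" for z by (rule finite_subset[OF _ finB[of z]]) (auto simp: D'_def)
  have clA: "u + v \<in> A" "\<delta> u + \<delta> v \<le> \<delta> (u + v)" if "u \<in> A" "v \<in> A" for u v
    using A that by (auto simp: superadd_on_def)
  have clB: "\<delta>' (p u) + \<delta>' (p v) \<le> \<delta>' (p u + p v)" if "u \<in> A" "v \<in> A" for u v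
    using B that by (auto simp: superadd_on_def)
  have "push \<delta> \<delta>' p A (tconv \<delta> f g) z = (\<Sum>x\<in>F z. \<Sum>(u, v)\<in>D x. f u * g v)"
    unfolding push_def F_def[symmetric] using tconv_eq_sum[OF finA f g] by (simp add: D_def)
  also have "\<dots> = (\<Sum>(x, u, v)\<in>(SIGMA x:F z. D x). f u * g v)"
    by (rule sum.Sigma) (auto simp: finD finF)
  also have "\<dots> = (\<Sum>(u, v)\<in>T. f u * g v)"
  proof (rule sum.reindex_bij_witness[of _ "\<lambda>(u, v). (u + v, u, v)" "\<lambda>(x, u, v). (u, v)"], goal_cases)
    case (4 q)
    then obtain u v where q: "q = (u, v)" "u \<in> A" "v \<in> A" "p u + p v = z" "\<delta> u + \<delta> v = \<delta>' z"
      by (auto simp: T_def)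
    have "\<delta> (u + v) \<le> \<delta>' z" using le[of "u + v"] clA[of u v] p[of u v] q by simp
    then show ?case using q clA[of u v] p[of u v] by (auto simp: F_def D_def)
  qed (auto simp: F_def D_def T_def p)
  also have "\<dots> = (\<Sum>(q, u, v)\<in>(SIGMA q:D' z. F (fst q) \<times> F (snd q)). f u * g v)"
  proof (rule sum.reindex_bij_witness[of _ "\<lambda>(q, u, v). (u, v)" "\<lambda>(u, v). ((p u, p v), u, v)"], goal_cases)
    case (2 q)
    then obtain u v where q: "q = (u, v)" "u \<in> A" "v \<in> A" "p u + p v = z" "\<delta> u + \<delta> v = \<delta>' z"
      by (auto simp: T_def)
    have "\<delta>' (p u) + \<delta>' (p v) \<le> \<delta>' z" using clB[of u v] q by simp
    then show ?case using q le[of u] le[of v] by (auto simp: F_def D'_def)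
  qed (auto simp: F_def D'_def T_def)
  also have "\<dots> = (\<Sum>q\<in>D' z. \<Sum>(u, v)\<in>F (fst q) \<times> F (snd q). f u * g v)"
    by (rule sum.Sigma[symmetric]) (auto simp: finD' finF)
  also have "\<dots> = (\<Sum>q\<in>D' z. (\<Sum>u\<in>F (fst q). f u) * (\<Sum>v\<in>F (snd q). g v))"
    by (simp add: sum_product sum.cartesian_product)
  also have "\<dots> = tconv \<delta>' (push \<delta> \<delta>' p A f) (push \<delta> \<delta>' p A g) z"
    by (simp add: tconv_def push_def F_def D'_def case_prod_unfold)
  finally show ?thesis .
qed

section \<open>Multivariate power series as a type\<close>

text \<open>A type of its own makes the class \<open>comm_ring_1\<close>, and with it univariate
  series over this ring, available. It contains all functions on monomials; the admissible variables
  and the finiteness of supports are imposed by the subsets \<open>mps_on\<close>.\<close>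

typedef ('g, 'k) mps = "UNIV :: ('g multiset \<Rightarrow> 'k) set"
  morphisms mcoeff Abs_mps by simp

lemma mcoeff_Abs [simp]: "mcoeff (Abs_mps f) = f"
  by (simp add: Abs_mps_inverse)

lemma mps_eqI: "(\<And>m. mcoeff f m = mcoeff g m) \<Longrightarrow> f = g"
  by (metis ext mcoeff_inject)

instantiation mps :: (type, comm_ring_1) comm_ring_1
begin

definition "zero_mps = Abs_mps (\<lambda>m. 0)"
definition "one_mps = Abs_mps (\<lambda>m. if m = {#} then 1 else 0)"
definition "plus_mps f g = Abs_mps (\<lambda>m. mcoeff f m + mcoeff g m)"
definition "minus_mps f g = Abs_mps (\<lambda>m. mcoeff f m - mcoeff g m)"
definition "uminus_mps f = Abs_mps (\<lambda>m. - mcoeff f m)"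
definition "times_mps f g = Abs_mps (tconv (\<lambda>_. 0) (mcoeff f) (mcoeff g))"

lemma one_mps_mult: "(1::('a, 'b) mps) * f = f"
proof (rule mps_eqI)
  fix m :: "'a multiset"
  have "mcoeff ((1::('a, 'b) mps) * f) m = (\<Sum>(u, v) \<in> {(u, v). u + v = m}. (if u = {#} then 1 else 0) * mcoeff f v)"
    by (simp add: times_mps_def one_mps_def tconv_def)
  also have "\<dots> = (\<Sum>(u, v) \<in> {({#} :: 'a multiset, m)}. (if u = {#} then 1 else 0) * mcoeff f v)"
    by (rule sum.mono_neutral_right[OF finite_decomp_mset]) (auto split: if_splits)
  finally show "mcoeff (1 * f) m = mcoeff f m" by simp
qed

instance
proof
  fix a b c :: "('a, 'b) mps"
  show "a * b * c = a * (b * c)"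
    by (rule mps_eqI) (simp add: times_mps_def, rule tconv_assoc[where A = UNIV],
        auto simp: finite_decomp_mset superadd_on_def supp_on_def)
  show "a * b = b * a"
    by (rule mps_eqI) (simp add: times_mps_def tconv_commute[of _ "mcoeff a"])
  show "1 * a = a" by (rule one_mps_mult)
  show "(a + b) * c = a * c + b * c"
    by (rule mps_eqI) (simp add: times_mps_def plus_mps_def tconv_add_left)
  have "mcoeff (0::('a, 'b) mps) {#} \<noteq> mcoeff (1::('a, 'b) mps) {#}"
    by (simp add: zero_mps_def one_mps_def)
  then show "(0::('a, 'b) mps) \<noteq> 1" by metis
qed (auto intro!: mps_eqI simp: plus_mps_def minus_mps_def uminus_mps_def zero_mps_def)

end

lemma mcoeff_simps [simp]:
  "mcoeff 0 m = 0"
  "mcoeff 1 m = (if m = {#} then 1 else 0)"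
  "mcoeff (f + g) m = mcoeff f m + mcoeff g m"
  "mcoeff (f - g) m = mcoeff f m - mcoeff g m"
  "mcoeff (- f) m = - mcoeff f m"
  by (simp_all add: zero_mps_def one_mps_def plus_mps_def minus_mps_def uminus_mps_def)

lemma mcoeff_mult: "mcoeff (f * g) m = (\<Sum>(u, v) \<in> {(u, v). u + v = m}. mcoeff f u * mcoeff g v)"
  by (simp add: times_mps_def tconv_def)

lemma mcoeff_sum: "mcoeff (\<Sum>i\<in>I. f i) m = (\<Sum>i\<in>I. mcoeff (f i) m)"
  by (induction I rule: infinite_finite_induct) auto

lemma mcoeff_mult_empty [simp]: "mcoeff (f * g) {#} = mcoeff f {#} * mcoeff g {#}"
proof -
  have "{(u, v). u + v = {#}} = {({#}, {#} :: 'a multiset)}" by auto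
  then show ?thesis by (simp add: mcoeff_mult)
qed

section \<open>Mapping cones\<close>

text \<open>Padding with 0 instead of an undefined value keeps pointwise sums, multiples and the
  splitting of a vector into blocks inside plain functions.\<close>

definition vecs :: "'r::zero set \<Rightarrow> nat \<Rightarrow> (nat \<Rightarrow> 'r) set" where
  "vecs C n = {u. (\<forall>j<n. u j \<in> C) \<and> (\<forall>j\<ge>n. u j = 0)}"

definition linear_form ::
  "'r::comm_ring_1 set \<Rightarrow> nat \<Rightarrow> ('r \<Rightarrow> 'm \<Rightarrow> 'm) \<Rightarrow> ((nat \<Rightarrow> 'r) \<Rightarrow> 'm::ab_group_add) \<Rightarrow> bool" where
  "linear_form C n act h \<longleftrightarrow>
    (\<forall>u\<in>vecs C n. \<forall>v\<in>vecs C n. h (\<lambda>j. u j + v j) = h u + h v) \<and>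
    (\<forall>r\<in>C. \<forall>u\<in>vecs C n. h (\<lambda>j. r * u j) = act r (h u))"

text \<open>The counterpart of \<open>free_resolution\<close> for a ring that is a subset
  \<open>C\<close> of a type. Linearity of a differential is demanded of each coordinate separately,
  so that \<open>linear_form\<close> serves the augmentation and the differentials alike.\<close>

definition resolution ::
  "'r::comm_ring_1 set \<Rightarrow> ('r \<Rightarrow> 'm \<Rightarrow> 'm) \<Rightarrow> 'm::ab_group_add set \<Rightarrow> (nat \<Rightarrow> nat) \<Rightarrow>
    ((nat \<Rightarrow> 'r) \<Rightarrow> 'm) \<Rightarrow> (nat \<Rightarrow> (nat \<Rightarrow> 'r) \<Rightarrow> nat \<Rightarrow> 'r) \<Rightarrow> bool" where
  "resolution C act M \<beta> \<epsilon> d \<longleftrightarrow>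
    linear_form C (\<beta> 0) act \<epsilon> \<and>
    (\<forall>i. \<forall>u\<in>vecs C (\<beta> (Suc i)). d i u \<in> vecs C (\<beta> i)) \<and>
    (\<forall>i j. linear_form C (\<beta> (Suc i)) (*) (\<lambda>u. d i u j)) \<and>
    \<epsilon> ` vecs C (\<beta> 0) = M \<and>
    d 0 ` vecs C (\<beta> (Suc 0)) = {v \<in> vecs C (\<beta> 0). \<epsilon> v = 0} \<and>
    (\<forall>i. d (Suc i) ` vecs C (\<beta> (Suc (Suc i))) = {v \<in> vecs C (\<beta> (Suc i)). d i v = (\<lambda>_. 0)})"

section \<open>Subrings of a type and linear forms over them\<close>

definition subring_on :: "'r::comm_ring_1 set \<Rightarrow> bool" where
  "subring_on C \<longleftrightarrow> 1 \<in> C \<and> (\<forall>x\<in>C. \<forall>y\<in>C. x + y \<in> C \<and> x * y \<in> C) \<and> (\<forall>x\<in>C. - x \<in> C)"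

lemma subring_onD:
  assumes "subring_on C"
  shows "0 \<in> C" "1 \<in> C" "x \<in> C \<Longrightarrow> y \<in> C \<Longrightarrow> x + y \<in> C" "x \<in> C \<Longrightarrow> y \<in> C \<Longrightarrow> x * y \<in> C"
    "x \<in> C \<Longrightarrow> - x \<in> C" "x \<in> C \<Longrightarrow> y \<in> C \<Longrightarrow> x - y \<in> C"
proof -
  show 1: "1 \<in> C" and 2: "x \<in> C \<Longrightarrow> y \<in> C \<Longrightarrow> x + y \<in> C" "x \<in> C \<Longrightarrow> y \<in> C \<Longrightarrow> x * y \<in> C"
    and 3: "\<And>x. x \<in> C \<Longrightarrow> - x \<in> C" for x y using assms by (auto simp: subring_on_def)
  show "0 \<in> C" using 2(1)[OF 1 3[OF 1]] by simp
  show "x \<in> C \<Longrightarrow> y \<in> C \<Longrightarrow> x - y \<in> C" using 2(1)[of x "- y"] 3[of y] by simp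
qed

lemma subring_on_sum:
  assumes "subring_on C" "\<And>i. i \<in> I \<Longrightarrow> f i \<in> C"
  shows "sum f I \<in> C"
  using assms(2) by (induction I rule: infinite_finite_induct) (auto simp: subring_onD[OF assms(1)])

lemma vecs_closed:
  assumes "subring_on C" "u \<in> vecs C n" "v \<in> vecs C n" "r \<in> C"
  shows "(\<lambda>j. u j + v j) \<in> vecs C n" "(\<lambda>j. u j - v j) \<in> vecs C n" "(\<lambda>j. - u j) \<in> vecs C n"
    "(\<lambda>j. r * u j) \<in> vecs C n" "(\<lambda>j. 0) \<in> vecs C n"
  using assms by (auto simp: vecs_def subring_onD)

lemma vecs_in: "subring_on C \<Longrightarrow> u \<in> vecs C n \<Longrightarrow> u j \<in> C"
  by (cases "j < n") (auto simp: vecs_def subring_onD)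

lemma linear_form_add:
  "linear_form C n act h \<Longrightarrow> u \<in> vecs C n \<Longrightarrow> v \<in> vecs C n \<Longrightarrow> h (\<lambda>j. u j + v j) = h u + h v"
  and linear_form_scale:
  "linear_form C n act h \<Longrightarrow> r \<in> C \<Longrightarrow> u \<in> vecs C n \<Longrightarrow> h (\<lambda>j. r * u j) = act r (h u)"
  unfolding linear_form_def by blast+

lemma linear_form_zero:
  assumes "subring_on C" "linear_form C n act h" shows "h (\<lambda>j. 0) = 0"
proof -
  have "(\<lambda>j. 0) \<in> vecs C n" by (simp add: vecs_def subring_onD[OF assms(1)])
  from linear_form_add[OF assms(2) this this] show ?thesis by simp
qed

lemma linear_form_uminus:
  assumes "subring_on C" "linear_form C n act h" "u \<in> vecs C n" shows "h (\<lambda>j. - u j) = - h u"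
  using linear_form_add[OF assms(2,3) vecs_closed(3)[OF assms(1,3,3) subring_onD(2)[OF assms(1)]]]
    linear_form_zero[OF assms(1,2)] by (simp add: minus_unique)

lemma linear_form_diff:
  assumes "subring_on C" "linear_form C n act h" "u \<in> vecs C n" "v \<in> vecs C n"
  shows "h (\<lambda>j. u j - v j) = h u - h v"
proof -
  have "(\<lambda>j. - v j) \<in> vecs C n" using vecs_closed[OF assms(1,4,4) subring_onD(2)[OF assms(1)]] by blast
  from linear_form_add[OF assms(2,3) this] linear_form_uminus[OF assms(1,2,4)] show ?thesis by simp
qed

lemma linear_form_sum:
  assumes C: "subring_on C" and h: "linear_form C n act h" and "\<And>i. i \<in> I \<Longrightarrow> u i \<in> vecs C n"
  shows "(\<lambda>j. \<Sum>i\<in>I. u i j) \<in> vecs C n \<and> h (\<lambda>j. \<Sum>i\<in>I. u i j) = (\<Sum>i\<in>I. h (u i))"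
  using assms(3)
proof (induction I rule: infinite_finite_induct)
  case (insert x F)
  then show ?case
    using linear_form_add[OF h, of "u x" "\<lambda>j. \<Sum>i\<in>F. u i j"]
      vecs_closed(1)[OF C, of "u x" n "\<lambda>j. \<Sum>i\<in>F. u i j" 1]
    by (simp add: subring_onD[OF C])
qed (use linear_form_zero[OF C h] in \<open>auto simp: vecs_def subring_onD[OF C]\<close>)

text \<open>Series in a new variable y, polynomials if \<open>fin\<close> holds. \<open>X\<close>
  may be a ring of scalars or a module, so the same notion covers C[[y]], C[y], M[[y]] and M[y]. The
  extensionality rule for series bears the same name as this constant.\<close>

definition fps_ext :: "bool \<Rightarrow> 'a::zero set \<Rightarrow> 'a fps set" where
  "fps_ext fin X = {F. (\<forall>k. F $ k \<in> X) \<and> (fin \<longrightarrow> finite {k. F $ k \<noteq> 0})}"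

lemma subring_on_fps_ext:
  assumes C: "subring_on C" shows "subring_on (fps_ext fin C)"
  unfolding subring_on_def
proof (intro conjI ballI)
  show "1 \<in> fps_ext fin C"
    by (auto simp: fps_ext_def subring_onD[OF C] intro: finite_subset[of _ "{0}"])
next
  fix F G assume F: "F \<in> fps_ext fin C" and G: "G \<in> fps_ext fin C"
  have "{k. (F + G) $ k \<noteq> 0} \<subseteq> {k. F $ k \<noteq> 0} \<union> {k. G $ k \<noteq> 0}" by auto
  then show "F + G \<in> fps_ext fin C"
    using F G by (auto simp: fps_ext_def subring_onD[OF C] dest: finite_subset)
  have "{k. (F * G) $ k \<noteq> 0} \<subseteq> (\<lambda>(i, j). i + j) ` ({k. F $ k \<noteq> 0} \<times> {k. G $ k \<noteq> 0})"
  proof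
    fix k assume "k \<in> {k. (F * G) $ k \<noteq> 0}"
    then obtain i where "i \<in> {0..k}" "F $ i * G $ (k - i) \<noteq> 0"
      unfolding mem_Collect_eq fps_mult_nth by (meson sum.not_neutral_contains_not_neutral)
    then show "k \<in> (\<lambda>(i, j). i + j) ` ({k. F $ k \<noteq> 0} \<times> {k. G $ k \<noteq> 0})"
      by (intro image_eqI[of _ _ "(i, k - i)"]) auto
  qed
  moreover have "(F * G) $ k \<in> C" for k
    unfolding fps_mult_nth using F G
    by (intro subring_on_sum[OF C] subring_onD(4)[OF C]) (auto simp: fps_ext_def)
  ultimately show "F * G \<in> fps_ext fin C"
    using F G by (auto simp: fps_ext_def dest: finite_subset)
next
  fix F assume "F \<in> fps_ext fin C"
  then show "- F \<in> fps_ext fin C" by (auto simp: fps_ext_def subring_onD[OF C])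
qed

definition fps_act :: "('r \<Rightarrow> 'm \<Rightarrow> 'm) \<Rightarrow> 'r fps \<Rightarrow> 'm fps \<Rightarrow> 'm::ab_group_add fps" where
  "fps_act act r s = Abs_fps (\<lambda>n. \<Sum>i=0..n. act (r $ i) (s $ (n - i)))"

lemma fps_act_mult [simp]: "fps_act (*) = (*)"
  by (intro ext fps_ext) (simp add: fps_act_def fps_mult_nth)

definition coeff_vec :: "(nat \<Rightarrow> 'r fps) \<Rightarrow> nat \<Rightarrow> nat \<Rightarrow> 'r" where
  "coeff_vec U k = (\<lambda>j. U j $ k)"

text \<open>The base change of \<open>h\<close> along the inclusion of the scalars into series in y:
  it acts on each power of y separately.\<close>

definition lift_form :: "((nat \<Rightarrow> 'r) \<Rightarrow> 'm) \<Rightarrow> (nat \<Rightarrow> 'r fps) \<Rightarrow> 'm fps" where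
  "lift_form h U = Abs_fps (\<lambda>k. h (coeff_vec U k))"

lemma coeff_vec_in: "U \<in> vecs (fps_ext fin C) n \<Longrightarrow> coeff_vec U k \<in> vecs C n"
  by (auto simp: vecs_def coeff_vec_def fps_ext_def)

lemma linear_form_lift:
  assumes C: "subring_on C" and h: "linear_form C n act h"
  shows "linear_form (fps_ext fin C) n (fps_act act) (lift_form h)"
  unfolding linear_form_def
proof (intro conjI ballI)
  fix U V assume U: "U \<in> vecs (fps_ext fin C) n" and V: "V \<in> vecs (fps_ext fin C) n"
  show "lift_form h (\<lambda>j. U j + V j) = lift_form h U + lift_form h V"
    using linear_form_add[OF h coeff_vec_in[OF U] coeff_vec_in[OF V]]
    by (intro fps_ext) (simp add: lift_form_def coeff_vec_def)
next
  fix r U assume r: "r \<in> fps_ext fin C" and U: "U \<in> vecs (fps_ext fin C) n"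
  have r': "r $ i \<in> C" for i using r by (simp add: fps_ext_def)
  show "lift_form h (\<lambda>j. r * U j) = fps_act act r (lift_form h U)"
  proof (rule fps_ext)
    fix k
    have "(\<lambda>j. r $ i * coeff_vec U l j) \<in> vecs C n" for i l
      using vecs_closed(4)[OF C coeff_vec_in[OF U] coeff_vec_in[OF U] r'] .
    then have "h (\<lambda>j. \<Sum>i=0..k. r $ i * coeff_vec U (k - i) j) = (\<Sum>i=0..k. h (\<lambda>j. r $ i * coeff_vec U (k - i) j))"
      by (intro conjunct2[OF linear_form_sum[OF C h]])
    also have "\<dots> = (\<Sum>i=0..k. act (r $ i) (h (coeff_vec U (k - i))))"
      by (intro sum.cong refl linear_form_scale[OF h] r' coeff_vec_in[OF U])
    finally show "lift_form h (\<lambda>j. r * U j) $ k = fps_act act r (lift_form h U) $ k"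
      by (simp add: lift_form_def fps_act_def coeff_vec_def fps_mult_nth)
  qed
qed

text \<open>Lets equations over series in y be solved one power of y at a time; in the polynomial
  case almost all of the partial solutions have to be 0.\<close>

lemma glue_vecs:
  assumes u: "\<And>k. u k \<in> vecs C n" and fin: "fin \<Longrightarrow> finite {k. u k \<noteq> (\<lambda>_. 0)}" and 0: "0 \<in> C"
  shows "\<exists>U\<in>vecs (fps_ext fin C) n. \<forall>k. coeff_vec U k = u k"
proof (intro bexI allI)
  let ?U = "\<lambda>j. Abs_fps (\<lambda>k. u k j)"
  show "coeff_vec ?U k = u k" for k by (simp add: coeff_vec_def)
  have "finite {k. u k j \<noteq> 0}" if fin for j
    by (rule finite_subset[OF _ fin[OF that]]) auto
  then show "?U \<in> vecs (fps_ext fin C) n"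
    using u by (auto simp: vecs_def fps_ext_def intro!: fps_ext)
qed

lemma finite_coeff_vec:
  assumes "U \<in> vecs (fps_ext True C) n" shows "finite {k. coeff_vec U k \<noteq> (\<lambda>_. 0)}"
proof (rule finite_subset)
  show "{k. coeff_vec U k \<noteq> (\<lambda>_. 0)} \<subseteq> (\<Union>j<n. {k. U j $ k \<noteq> 0})"
    using assms by (force simp: coeff_vec_def vecs_def not_le[symmetric])
qed (use assms in \<open>auto simp: vecs_def fps_ext_def\<close>)

text \<open>Exactness survives the base change because an equation over series in y is one equation
  for each power of y. \<open>Z\<close> is the cycle condition, tested on every coefficient
  vector.\<close>

lemma lift_exact:
  assumes ex: "\<And>v. v \<in> vecs C m \<Longrightarrow> Z v \<Longrightarrow> v \<in> d ` vecs C n"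
    and d0: "d (\<lambda>_. 0) = (\<lambda>_. 0)" and C: "subring_on C"
    and V: "V \<in> vecs (fps_ext fin C) m" "\<And>k. Z (coeff_vec V k)"
  shows "\<exists>U\<in>vecs (fps_ext fin C) n. V = (\<lambda>j. lift_form (\<lambda>u. d u j) U)"
proof -
  have z: "(\<lambda>_. 0) \<in> vecs C n" by (simp add: vecs_def subring_onD[OF C])
  \<comment> \<open>A vanishing coefficient receives the preimage 0, which keeps the solution
    polynomial if \<open>V\<close> is.\<close>
  have "\<exists>u\<in>vecs C n. d u = coeff_vec V k \<and> (coeff_vec V k = (\<lambda>_. 0) \<longrightarrow> u = (\<lambda>_. 0))" for k
    using ex[OF coeff_vec_in[OF V(1)] V(2), of k] d0 z by (cases "coeff_vec V k = (\<lambda>_. 0)") auto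
  then obtain u where u: "\<And>k. u k \<in> vecs C n" "\<And>k. d (u k) = coeff_vec V k"
    "\<And>k. coeff_vec V k = (\<lambda>_. 0) \<Longrightarrow> u k = (\<lambda>_. 0)" by metis
  have finu: "finite {k. u k \<noteq> (\<lambda>_. 0)}" if fin
    using finite_coeff_vec[of V C m] V(1) that u(3) by (auto intro: finite_subset[rotated])
  have "\<exists>U\<in>vecs (fps_ext fin C) n. \<forall>k. coeff_vec U k = u k"
    using glue_vecs[of u C n fin, OF u(1) _ subring_onD(1)[OF C]] finu by blast
  then obtain U where U: "U \<in> vecs (fps_ext fin C) n" "\<And>k. coeff_vec U k = u k"
    by blast
  show ?thesis
  proof (intro bexI ext fps_ext)
    show "V j $ k = lift_form (\<lambda>u. d u j) U $ k" for j k
      using fun_cong[OF u(2)[of k], of j] U(2)[of k] by (simp add: lift_form_def coeff_vec_def)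
  qed (rule U(1))
qed

section \<open>Vectors of length n + l as pairs\<close>

definition fst_vec :: "nat \<Rightarrow> (nat \<Rightarrow> 'r::zero) \<Rightarrow> nat \<Rightarrow> 'r" where
  "fst_vec n U = (\<lambda>j. if j < n then U j else 0)"

definition snd_vec :: "nat \<Rightarrow> (nat \<Rightarrow> 'r) \<Rightarrow> nat \<Rightarrow> 'r" where
  "snd_vec n U = (\<lambda>j. U (n + j))"

definition join_vec :: "nat \<Rightarrow> (nat \<Rightarrow> 'r) \<Rightarrow> (nat \<Rightarrow> 'r) \<Rightarrow> nat \<Rightarrow> 'r" where
  "join_vec n u v = (\<lambda>j. if j < n then u j else v (j - n))"

lemma join_vec_in: "u \<in> vecs C n \<Longrightarrow> v \<in> vecs C l \<Longrightarrow> join_vec n u v \<in> vecs C (n + l)"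
  and fst_vec_in: "U \<in> vecs C (n + l) \<Longrightarrow> fst_vec n U \<in> vecs C n"
  and snd_vec_in: "U \<in> vecs C (n + l) \<Longrightarrow> snd_vec n U \<in> vecs C l"
  and fst_join [simp]: "u \<in> vecs C n \<Longrightarrow> fst_vec n (join_vec n u v) = u"
  and snd_join [simp]: "snd_vec n (join_vec n u v) = v"
  by (auto simp: vecs_def join_vec_def fst_vec_def snd_vec_def)

lemma join_fst_snd: "join_vec n (fst_vec n U) (snd_vec n U) = U"
  by (auto simp: join_vec_def fst_vec_def snd_vec_def fun_eq_iff)

lemma join_vec_zero: "u \<in> vecs C n \<Longrightarrow> join_vec n u v = (\<lambda>_. 0) \<longleftrightarrow> u = (\<lambda>_. 0) \<and> v = (\<lambda>_. 0)"
proof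
  assume u: "u \<in> vecs C n" and j: "join_vec n u v = (\<lambda>_. 0)"
  show "u = (\<lambda>_. 0) \<and> v = (\<lambda>_. 0)"
    using fst_join[OF u, of v] snd_join[of n u v] unfolding j by (auto simp: fst_vec_def snd_vec_def)
qed (auto simp: join_vec_def)

primrec cone_betti :: "(nat \<Rightarrow> nat) \<Rightarrow> nat \<Rightarrow> nat" where
  "cone_betti \<beta> 0 = \<beta> 0"
| "cone_betti \<beta> (Suc i) = \<beta> (Suc i) + \<beta> i"

text \<open>The assumptions present M' as the quotient of M[[y]] or M[y] by multiplication with
  \<open>w\<close>, which is injective there: \<open>proj_ker\<close> gives one inclusion between
  the kernel of \<open>proj\<close> and the multiples of \<open>w\<close>, and \<open>act'_w\<close>
  with \<open>proj_act\<close> gives the other. In the applications M is the ring of S and M' that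
  of D.\<close>

locale cone =
  fixes C :: "'r::comm_ring_1 set" and act :: "'r \<Rightarrow> 'm::ab_group_add \<Rightarrow> 'm" and M :: "'m set"
    and fin :: bool and act' :: "'r fps \<Rightarrow> 'n::ab_group_add \<Rightarrow> 'n" and M' :: "'n set"
    and proj :: "'m fps \<Rightarrow> 'n" and w :: "'r fps"
    and \<beta> :: "nat \<Rightarrow> nat" and \<epsilon> :: "(nat \<Rightarrow> 'r) \<Rightarrow> 'm" and d :: "nat \<Rightarrow> (nat \<Rightarrow> 'r) \<Rightarrow> nat \<Rightarrow> 'r"
  assumes C: "subring_on C"
    and w: "w \<in> fps_ext fin C"
    and proj_add: "\<And>s t. s \<in> fps_ext fin M \<Longrightarrow> t \<in> fps_ext fin M \<Longrightarrow> proj (s + t) = proj s + proj t"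
    and proj_act: "\<And>r s. r \<in> fps_ext fin C \<Longrightarrow> s \<in> fps_ext fin M \<Longrightarrow> proj (fps_act act r s) = act' r (proj s)"
    and proj_onto: "proj ` fps_ext fin M = M'"
    and proj_ker: "\<And>s. s \<in> fps_ext fin M \<Longrightarrow> proj s = 0 \<Longrightarrow> \<exists>q\<in>fps_ext fin M. s = fps_act act w q"
    and w_inj: "\<And>q. q \<in> fps_ext fin M \<Longrightarrow> fps_act act w q = 0 \<Longrightarrow> q = 0"
    and act'_w: "\<And>s. s \<in> fps_ext fin M \<Longrightarrow> act' w (proj s) = 0"
    and res: "resolution C act M \<beta> \<epsilon> d"
begin

abbreviation "C' \<equiv> fps_ext fin C"

definition "dd i U = (\<lambda>j. lift_form (\<lambda>u. d i u j) U)"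

definition "cone_aug U = proj (lift_form \<epsilon> U)"

definition "top_part i U = (\<lambda>j. dd i (fst_vec (\<beta> (Suc i)) U) j + w * snd_vec (\<beta> (Suc i)) U j)"

text \<open>The differential of the mapping cone sends (u, v) in F(i+1) + F(i) to (d u + w v, - d
  v); the sign cancels the two terms w d v in the square of the differential. For i = 0 the target
  is F(0) alone, and only the first entry remains.\<close>

primrec cone_diff :: "nat \<Rightarrow> (nat \<Rightarrow> 'r fps) \<Rightarrow> nat \<Rightarrow> 'r fps" where
  "cone_diff 0 U = top_part 0 U"
| "cone_diff (Suc i) U =
    join_vec (\<beta> (Suc i)) (top_part (Suc i) U) (\<lambda>j. - dd i (snd_vec (\<beta> (Suc (Suc i))) U) j)"

lemma C': "subring_on C'"
  using subring_on_fps_ext[OF C] .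

lemma eps_lin: "linear_form C (\<beta> 0) act \<epsilon>"
  and d_in: "\<And>u. u \<in> vecs C (\<beta> (Suc i)) \<Longrightarrow> d i u \<in> vecs C (\<beta> i)"
  and d_lin: "linear_form C (\<beta> (Suc i)) (*) (\<lambda>u. d i u j)"
  and eps_onto: "\<epsilon> ` vecs C (\<beta> 0) = M"
  and exact0: "d 0 ` vecs C (\<beta> (Suc 0)) = {v \<in> vecs C (\<beta> 0). \<epsilon> v = 0}"
  and exact: "d (Suc i) ` vecs C (\<beta> (Suc (Suc i))) = {v \<in> vecs C (\<beta> (Suc i)). d i v = (\<lambda>_. 0)}"
  using res unfolding resolution_def by blast+

lemma d_zero: "d i (\<lambda>_. 0) = (\<lambda>_. 0)"
  using linear_form_zero[OF C d_lin] by (simp add: fun_eq_iff)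

lemma aug_lin: "linear_form C' (\<beta> 0) (fps_act act) (lift_form \<epsilon>)"
  by (rule linear_form_lift[OF C eps_lin])

lemma dd_lin: "linear_form C' (\<beta> (Suc i)) (*) (\<lambda>U. dd i U j)"
  using linear_form_lift[OF C d_lin] unfolding dd_def fps_act_mult .

lemma dd_in:
  assumes U: "U \<in> vecs C' (\<beta> (Suc i))" shows "dd i U \<in> vecs C' (\<beta> i)"
proof -
  have u: "d i (coeff_vec U k) \<in> vecs C (\<beta> i)" for k by (rule d_in[OF coeff_vec_in[OF U]])
  have finu: "finite {k. d i (coeff_vec U k) \<noteq> (\<lambda>_. 0)}" if fin
    by (rule finite_subset[OF _ finite_coeff_vec[of U C "\<beta> (Suc i)"]]) (use d_zero U that in auto)
  have "\<exists>V\<in>vecs C' (\<beta> i). \<forall>k. coeff_vec V k = d i (coeff_vec U k)"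
    using glue_vecs[of "\<lambda>k. d i (coeff_vec U k)" C "\<beta> i" fin, OF u _ subring_onD(1)[OF C]] finu by blast
  then obtain V where V: "V \<in> vecs C' (\<beta> i)" "\<And>k. coeff_vec V k = d i (coeff_vec U k)"
    by blast
  have "dd i U = V"
    using V(2) by (intro ext fps_ext) (simp add: dd_def lift_form_def coeff_vec_def fun_eq_iff)
  with V(1) show ?thesis by simp
qed

lemma aug_in:
  assumes U: "U \<in> vecs C' (\<beta> 0)" shows "lift_form \<epsilon> U \<in> fps_ext fin M"
proof -
  have "finite {k. \<epsilon> (coeff_vec U k) \<noteq> 0}" if fin
    by (rule finite_subset[OF _ finite_coeff_vec[of U C "\<beta> 0"]])
      (use linear_form_zero[OF C eps_lin] U that in auto)
  then show ?thesis using eps_onto coeff_vec_in[OF U] by (auto simp: fps_ext_def lift_form_def)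
qed

lemma aug_onto:
  assumes s: "s \<in> fps_ext fin M" shows "\<exists>U\<in>vecs C' (\<beta> 0). lift_form \<epsilon> U = s"
proof -
  have z: "(\<lambda>_. 0) \<in> vecs C (\<beta> 0)" by (simp add: vecs_def subring_onD[OF C])
  have "\<exists>u\<in>vecs C (\<beta> 0). \<epsilon> u = s $ k \<and> (s $ k = 0 \<longrightarrow> u = (\<lambda>_. 0))" for k
  proof (cases "s $ k = 0")
    case True then show ?thesis using linear_form_zero[OF C eps_lin] z by auto
  next
    case False
    have "s $ k \<in> \<epsilon> ` vecs C (\<beta> 0)" using s eps_onto by (simp add: fps_ext_def)
    with False show ?thesis by auto
  qed
  then obtain u where u: "\<And>k. u k \<in> vecs C (\<beta> 0)" "\<And>k. \<epsilon> (u k) = s $ k" "\<And>k. s $ k = 0 \<Longrightarrow> u k = (\<lambda>_. 0)"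
    by metis
  have finu: "finite {k. u k \<noteq> (\<lambda>_. 0)}" if fin
    using s that u(3) by (auto simp: fps_ext_def intro: finite_subset[rotated])
  have "\<exists>U\<in>vecs C' (\<beta> 0). \<forall>k. coeff_vec U k = u k"
    using glue_vecs[of u C "\<beta> 0" fin, OF u(1) _ subring_onD(1)[OF C]] finu by blast
  then obtain U where U: "U \<in> vecs C' (\<beta> 0)" "\<And>k. coeff_vec U k = u k"
    by blast
  then show ?thesis by (intro bexI[of _ U] fps_ext) (simp_all add: lift_form_def u(2))
qed

lemma dd_exact0:
  assumes "V \<in> vecs C' (\<beta> 0)"
  shows "lift_form \<epsilon> V = 0 \<longleftrightarrow> V \<in> dd 0 ` vecs C' (\<beta> (Suc 0))"
proof
  assume "lift_form \<epsilon> V = 0"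
  then have "\<epsilon> (coeff_vec V k) = 0" for k
    by (metis fps_nth_Abs_fps fps_zero_nth lift_form_def)
  then show "V \<in> dd 0 ` vecs C' (\<beta> (Suc 0))"
    using lift_exact[of C "\<beta> 0" "\<lambda>v. \<epsilon> v = 0" "d 0" "\<beta> (Suc 0)" V fin] exact0 d_zero C assms
    by (auto simp: dd_def image_iff)
next
  assume "V \<in> dd 0 ` vecs C' (\<beta> (Suc 0))"
  then obtain U where U: "U \<in> vecs C' (\<beta> (Suc 0))" "V = dd 0 U" by blast
  have "\<epsilon> (d 0 (coeff_vec U k)) = 0" for k
    using coeff_vec_in[OF U(1), of k] exact0 by blast
  moreover have "coeff_vec V k = d 0 (coeff_vec U k)" for k
    by (simp add: U(2) dd_def lift_form_def coeff_vec_def)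
  ultimately show "lift_form \<epsilon> V = 0" by (intro fps_ext) (simp add: lift_form_def)
qed

lemma dd_exact:
  assumes "V \<in> vecs C' (\<beta> (Suc i))"
  shows "dd i V = (\<lambda>_. 0) \<longleftrightarrow> V \<in> dd (Suc i) ` vecs C' (\<beta> (Suc (Suc i)))"
proof
  assume "dd i V = (\<lambda>_. 0)"
  then have "lift_form (\<lambda>u. d i u j) V $ k = 0" for j k by (simp add: dd_def fun_eq_iff)
  then have "d i (coeff_vec V k) = (\<lambda>_. 0)" for k by (simp add: lift_form_def fun_eq_iff)
  then show "V \<in> dd (Suc i) ` vecs C' (\<beta> (Suc (Suc i)))"
    using lift_exact[of C "\<beta> (Suc i)" "\<lambda>v. d i v = (\<lambda>_. 0)" "d (Suc i)" "\<beta> (Suc (Suc i))" V fin]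
      exact[of i] d_zero C assms
    by (auto simp: dd_def image_iff)
next
  assume "V \<in> dd (Suc i) ` vecs C' (\<beta> (Suc (Suc i)))"
  then obtain U where U: "U \<in> vecs C' (\<beta> (Suc (Suc i)))" "V = dd (Suc i) U" by blast
  have "d i (d (Suc i) (coeff_vec U k)) = (\<lambda>_. 0)" for k
    using coeff_vec_in[OF U(1), of k] exact[of i] by blast
  moreover have "coeff_vec V k = d (Suc i) (coeff_vec U k)" for k
    by (simp add: U(2) dd_def lift_form_def coeff_vec_def)
  ultimately show "dd i V = (\<lambda>_. 0)" by (intro ext fps_ext) (simp add: dd_def lift_form_def)
qed

lemma dd_ops:
  assumes "u \<in> vecs C' (\<beta> (Suc i))" "v \<in> vecs C' (\<beta> (Suc i))" "r \<in> C'"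
  shows "dd i (\<lambda>j. u j + v j) = (\<lambda>j. dd i u j + dd i v j)"
    "dd i (\<lambda>j. r * u j) = (\<lambda>j. r * dd i u j)"
    "dd i (\<lambda>j. - u j) = (\<lambda>j. - dd i u j)"
  using linear_form_add[OF dd_lin assms(1,2)] linear_form_scale[OF dd_lin assms(3,1)]
    linear_form_uminus[OF C' dd_lin assms(1)] by (auto simp: fun_eq_iff)

lemma top_part_in:
  assumes "U \<in> vecs C' (\<beta> (Suc i) + \<beta> i)" shows "top_part i U \<in> vecs C' (\<beta> i)"
  unfolding top_part_def
  using vecs_closed[OF C' snd_vec_in[OF assms] snd_vec_in[OF assms] w]
    vecs_closed(1)[OF C' dd_in[OF fst_vec_in[OF assms]] _ w] by blast

lemma top_part_linear: "linear_form C' (\<beta> (Suc i) + \<beta> i) (*) (\<lambda>U. top_part i U j)"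
  unfolding linear_form_def
proof (intro conjI ballI)
  fix U V assume U: "U \<in> vecs C' (\<beta> (Suc i) + \<beta> i)" and V: "V \<in> vecs C' (\<beta> (Suc i) + \<beta> i)"
  have "fst_vec (\<beta> (Suc i)) (\<lambda>j. U j + V j) = (\<lambda>j. fst_vec (\<beta> (Suc i)) U j + fst_vec (\<beta> (Suc i)) V j)"
    by (auto simp: fst_vec_def)
  then show "top_part i (\<lambda>j. U j + V j) j = top_part i U j + top_part i V j"
    using dd_ops(1)[OF fst_vec_in[OF U] fst_vec_in[OF V] w]
    by (simp add: top_part_def snd_vec_def algebra_simps)
next
  fix r U assume r: "r \<in> C'" and U: "U \<in> vecs C' (\<beta> (Suc i) + \<beta> i)"
  have "fst_vec (\<beta> (Suc i)) (\<lambda>j. r * U j) = (\<lambda>j. r * fst_vec (\<beta> (Suc i)) U j)"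
    by (auto simp: fst_vec_def)
  then show "top_part i (\<lambda>j. r * U j) j = r * top_part i U j"
    using dd_ops(2)[OF fst_vec_in[OF U] fst_vec_in[OF U] r]
    by (simp add: top_part_def snd_vec_def algebra_simps)
qed

lemma cone_diff_in:
  assumes U: "U \<in> vecs C' (cone_betti \<beta> (Suc i))" shows "cone_diff i U \<in> vecs C' (cone_betti \<beta> i)"
proof (cases i)
  case 0 then show ?thesis using top_part_in U by simp
next
  case (Suc k)
  have "snd_vec (\<beta> (Suc i)) U \<in> vecs C' (\<beta> (Suc k))" using snd_vec_in U Suc by auto
  then show ?thesis
    using U top_part_in[of U i] dd_in[of _ k] vecs_closed(3)[OF C' _ _ w] Suc
    by (auto intro!: join_vec_in)
qed

lemma cone_diff_linear: "linear_form C' (cone_betti \<beta> (Suc i)) (*) (\<lambda>U. cone_diff i U j)"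
proof (cases "i = 0 \<or> j < \<beta> i")
  case True
  then have "(\<lambda>U. cone_diff i U j) = (\<lambda>U. top_part i U j)"
    by (cases i) (auto simp: join_vec_def)
  then show ?thesis using top_part_linear by simp
next
  case False
  then obtain k where i: "i = Suc k" by (cases i) auto
  let ?s = "snd_vec (\<beta> (Suc i))"
  have e: "cone_diff i U j = - dd k (?s U) (j - \<beta> i)" for U using False i by (auto simp: join_vec_def)
  have s: "?s U \<in> vecs C' (\<beta> (Suc k))" if "U \<in> vecs C' (cone_betti \<beta> (Suc i))" for U
    using snd_vec_in that i by auto
  show ?thesis
    unfolding linear_form_def e
  proof (intro conjI ballI)
    fix U V assume "U \<in> vecs C' (cone_betti \<beta> (Suc i))" "V \<in> vecs C' (cone_betti \<beta> (Suc i))"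
    from dd_ops(1)[OF s[OF this(1)] s[OF this(2)] w]
    show "- dd k (?s (\<lambda>j. U j + V j)) (j - \<beta> i) = - dd k (?s U) (j - \<beta> i) + - dd k (?s V) (j - \<beta> i)"
      by (simp add: snd_vec_def)
  next
    fix r U assume "r \<in> C'" "U \<in> vecs C' (cone_betti \<beta> (Suc i))"
    from dd_ops(2)[OF s[OF this(2)] s[OF this(2)] this(1)]
    show "- dd k (?s (\<lambda>j. r * U j)) (j - \<beta> i) = r * - dd k (?s U) (j - \<beta> i)"
      by (simp add: snd_vec_def)
  qed
qed

text \<open>For \<open>i = 0\<close> the missing condition on the second component follows from the injectivity of
  \<open>w\<close> on \<open>M[[y]]\<close>.\<close>

lemma cone_diff_zero_iff:
  assumes U: "U \<in> vecs C' (cone_betti \<beta> (Suc i))"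
  shows "cone_diff i U = (\<lambda>_. 0) \<longleftrightarrow>
    top_part i U = (\<lambda>_. 0) \<and> snd_vec (\<beta> (Suc i)) U \<in> dd i ` vecs C' (\<beta> (Suc i))"
proof (cases i)
  case 0
  let ?u = "fst_vec (\<beta> (Suc 0)) U" and ?v = "snd_vec (\<beta> (Suc 0)) U"
  have u: "?u \<in> vecs C' (\<beta> (Suc 0))" and v: "?v \<in> vecs C' (\<beta> 0)"
    using U 0 fst_vec_in snd_vec_in by auto
  have "?v \<in> dd 0 ` vecs C' (\<beta> (Suc 0))" if "top_part 0 U = (\<lambda>_. 0)"
  proof -
    have "lift_form \<epsilon> (\<lambda>j. 0) = 0" by (rule linear_form_zero[OF C' aug_lin])
    then have "0 = lift_form \<epsilon> (\<lambda>j. dd 0 ?u j + w * ?v j)" using that by (simp add: top_part_def)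
    also have "\<dots> = lift_form \<epsilon> (dd 0 ?u) + lift_form \<epsilon> (\<lambda>j. w * ?v j)"
      by (rule linear_form_add[OF aug_lin dd_in[OF u] vecs_closed(4)[OF C' v v w]])
    also have "lift_form \<epsilon> (dd 0 ?u) = 0" using dd_exact0[OF dd_in[OF u]] u by blast
    also have "lift_form \<epsilon> (\<lambda>j. w * ?v j) = fps_act act w (lift_form \<epsilon> ?v)"
      by (rule linear_form_scale[OF aug_lin w v])
    finally show ?thesis using w_inj[OF aug_in[OF v]] dd_exact0[OF v] by simp
  qed
  then show ?thesis using 0 by auto
next
  case (Suc k)
  have v: "snd_vec (\<beta> (Suc i)) U \<in> vecs C' (\<beta> (Suc k))"
    using U Suc snd_vec_in by auto
  have "cone_diff i U = (\<lambda>_. 0) \<longleftrightarrow>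
    top_part i U = (\<lambda>_. 0) \<and> dd k (snd_vec (\<beta> (Suc i)) U) = (\<lambda>_. 0)"
    using join_vec_zero[OF top_part_in[of U i]] U Suc by (auto simp: fun_eq_iff)
  then show ?thesis using dd_exact[OF v] Suc by simp
qed

lemma cone_exact:
  "cone_diff (Suc i) ` vecs C' (cone_betti \<beta> (Suc (Suc i))) =
    {U \<in> vecs C' (cone_betti \<beta> (Suc i)). cone_diff i U = (\<lambda>_. 0)}"
proof (intro equalityI subsetI)
  fix V assume "V \<in> cone_diff (Suc i) ` vecs C' (cone_betti \<beta> (Suc (Suc i)))"
  then obtain U where U: "U \<in> vecs C' (cone_betti \<beta> (Suc (Suc i)))" and V: "V = cone_diff (Suc i) U" by blast
  define u where "u = fst_vec (\<beta> (Suc (Suc i))) U"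
  define v where "v = snd_vec (\<beta> (Suc (Suc i))) U"
  have u: "u \<in> vecs C' (\<beta> (Suc (Suc i)))" and v: "v \<in> vecs C' (\<beta> (Suc i))"
    unfolding u_def v_def using U fst_vec_in snd_vec_in by auto
  have Vin: "V \<in> vecs C' (cone_betti \<beta> (Suc i))" unfolding V by (rule cone_diff_in[OF U])
  have tp: "top_part (Suc i) U \<in> vecs C' (\<beta> (Suc i))" using top_part_in U by simp
  have wv: "(\<lambda>j. w * v j) \<in> vecs C' (\<beta> (Suc i))" using vecs_closed[OF C' v v w] by blast
  have mv: "(\<lambda>j. - v j) \<in> vecs C' (\<beta> (Suc i))" using vecs_closed[OF C' v v w] by blast
  have fV: "fst_vec (\<beta> (Suc i)) V = top_part (Suc i) U" "snd_vec (\<beta> (Suc i)) V = (\<lambda>j. - dd i v j)"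
    using tp unfolding V v_def by simp_all
  have "dd i (top_part (Suc i) U) = (\<lambda>j. dd i (dd (Suc i) u) j + dd i (\<lambda>j. w * v j) j)"
    unfolding top_part_def u_def[symmetric] v_def[symmetric] using dd_ops(1)[OF dd_in[OF u] wv w] .
  also have "\<dots> = (\<lambda>j. w * dd i v j)"
    using iffD2[OF dd_exact[OF dd_in[OF u]] imageI[OF u]] dd_ops(2)[OF v v w] by (simp add: fun_eq_iff)
  finally have "top_part i V = (\<lambda>_. 0)" by (simp add: top_part_def[of i V] fV)
  moreover have "snd_vec (\<beta> (Suc i)) V \<in> dd i ` vecs C' (\<beta> (Suc i))"
    using dd_ops(3)[OF v v w] mv fV(2) by (metis imageI)
  ultimately show "V \<in> {U \<in> vecs C' (cone_betti \<beta> (Suc i)). cone_diff i U = (\<lambda>_. 0)}"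
    using cone_diff_zero_iff[OF Vin] Vin by simp
next
  fix V assume "V \<in> {U \<in> vecs C' (cone_betti \<beta> (Suc i)). cone_diff i U = (\<lambda>_. 0)}"
  then have V: "V \<in> vecs C' (cone_betti \<beta> (Suc i))" and tp: "top_part i V = (\<lambda>_. 0)"
    and "snd_vec (\<beta> (Suc i)) V \<in> dd i ` vecs C' (\<beta> (Suc i))" using cone_diff_zero_iff by auto
  then obtain x where x: "x \<in> vecs C' (\<beta> (Suc i))" and v: "snd_vec (\<beta> (Suc i)) V = dd i x" by blast
  let ?u = "fst_vec (\<beta> (Suc i)) V"
  have u: "?u \<in> vecs C' (\<beta> (Suc i))" using fst_vec_in V by auto
  have wx: "(\<lambda>j. w * x j) \<in> vecs C' (\<beta> (Suc i))" and mx: "(\<lambda>j. - x j) \<in> vecs C' (\<beta> (Suc i))"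
    using vecs_closed[OF C' x x w] by blast+
  have s: "(\<lambda>j. ?u j + w * x j) \<in> vecs C' (\<beta> (Suc i))" using vecs_closed[OF C' u wx w] by blast
  \<comment> \<open>The second entry of the cycle is d x and the first satisfies d u + w d x = 0, so
    u + w x is a cycle and equals some d u'. Then (u', - x) is a preimage, as d u' - w x = u and - d
    (- x) = d x.\<close>
  have "dd i (\<lambda>j. ?u j + w * x j) = (\<lambda>_. 0)"
    using dd_ops(1)[OF u wx w] dd_ops(2)[OF x x w] tp v by (simp add: top_part_def fun_eq_iff)
  then obtain u' where u': "u' \<in> vecs C' (\<beta> (Suc (Suc i)))" and e: "(\<lambda>j. ?u j + w * x j) = dd (Suc i) u'"
    using dd_exact[OF s] by blast
  let ?U = "join_vec (\<beta> (Suc (Suc i))) u' (\<lambda>j. - x j)"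
  have U: "?U \<in> vecs C' (cone_betti \<beta> (Suc (Suc i)))" using join_vec_in[OF u' mx] by simp
  have "top_part (Suc i) ?U = ?u"
    unfolding top_part_def using u' e by (auto simp: fun_eq_iff algebra_simps)
  moreover have "(\<lambda>j. - dd i (snd_vec (\<beta> (Suc (Suc i))) ?U) j) = snd_vec (\<beta> (Suc i)) V"
    using v dd_ops(3)[OF x x w] by simp
  ultimately have "cone_diff (Suc i) ?U = V" using join_fst_snd by simp
  then show "V \<in> cone_diff (Suc i) ` vecs C' (cone_betti \<beta> (Suc (Suc i)))" using U by blast
qed

lemma cone_exact0:
  "cone_diff 0 ` vecs C' (cone_betti \<beta> (Suc 0)) = {V \<in> vecs C' (cone_betti \<beta> 0). cone_aug V = 0}"
proof (intro equalityI subsetI)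
  fix V assume "V \<in> cone_diff 0 ` vecs C' (cone_betti \<beta> (Suc 0))"
  then obtain U where U: "U \<in> vecs C' (cone_betti \<beta> (Suc 0))" and V: "V = cone_diff 0 U" by blast
  define u where "u = fst_vec (\<beta> (Suc 0)) U"
  define v where "v = snd_vec (\<beta> (Suc 0)) U"
  have u: "u \<in> vecs C' (\<beta> (Suc 0))" and v: "v \<in> vecs C' (\<beta> 0)"
    unfolding u_def v_def using U fst_vec_in snd_vec_in by auto
  have "lift_form \<epsilon> V = lift_form \<epsilon> (dd 0 u) + lift_form \<epsilon> (\<lambda>j. w * v j)"
    unfolding V cone_diff.simps top_part_def u_def[symmetric] v_def[symmetric]
    by (rule linear_form_add[OF aug_lin dd_in[OF u] vecs_closed(4)[OF C' v v w]])
  also have "lift_form \<epsilon> (dd 0 u) = 0" using dd_exact0[OF dd_in[OF u]] u by blast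
  also have "lift_form \<epsilon> (\<lambda>j. w * v j) = fps_act act w (lift_form \<epsilon> v)"
    by (rule linear_form_scale[OF aug_lin w v])
  finally have "cone_aug V = 0" unfolding cone_aug_def
    using proj_act[OF w aug_in[OF v]] act'_w[OF aug_in[OF v]] by simp
  then show "V \<in> {V \<in> vecs C' (cone_betti \<beta> 0). cone_aug V = 0}" using cone_diff_in[OF U] V by simp
next
  fix V assume "V \<in> {V \<in> vecs C' (cone_betti \<beta> 0). cone_aug V = 0}"
  then have V: "V \<in> vecs C' (\<beta> 0)" and "proj (lift_form \<epsilon> V) = 0" by (auto simp: cone_aug_def)
  then obtain q where q: "q \<in> fps_ext fin M" "lift_form \<epsilon> V = fps_act act w q"
    using proj_ker[OF aug_in[OF V]] by blast
  \<comment> \<open>The augmentation of V in M[[y]] or M[y] is w q. Subtracting w times a lift v of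
    q from V leaves a boundary d u, and (u, v) is the preimage of V.\<close>
  obtain v where v: "v \<in> vecs C' (\<beta> 0)" "lift_form \<epsilon> v = q" using aug_onto[OF q(1)] by blast
  have wv: "(\<lambda>j. w * v j) \<in> vecs C' (\<beta> 0)" using vecs_closed[OF C' v(1) v(1) w] by blast
  have s: "(\<lambda>j. V j - w * v j) \<in> vecs C' (\<beta> 0)" using vecs_closed[OF C' V wv w] by blast
  have "lift_form \<epsilon> (\<lambda>j. V j - w * v j) = 0"
    using linear_form_diff[OF C' aug_lin V wv] linear_form_scale[OF aug_lin w v(1)] q v(2) by simp
  then obtain u where u: "u \<in> vecs C' (\<beta> (Suc 0))" "(\<lambda>j. V j - w * v j) = dd 0 u"
    using dd_exact0[OF s] by blast
  let ?U = "join_vec (\<beta> (Suc 0)) u v"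
  have "?U \<in> vecs C' (cone_betti \<beta> (Suc 0))" using join_vec_in[OF u(1) v(1)] by simp
  moreover have "cone_diff 0 ?U = V"
    using u by (auto simp: top_part_def fun_eq_iff algebra_simps)
  ultimately show "V \<in> cone_diff 0 ` vecs C' (cone_betti \<beta> (Suc 0))" by blast
qed

theorem cone_resolution: "resolution C' act' M' (cone_betti \<beta>) cone_aug cone_diff"
  unfolding resolution_def
proof (intro conjI allI)
  show "linear_form C' (cone_betti \<beta> 0) act' cone_aug"
    unfolding linear_form_def
  proof (intro conjI ballI)
    fix U V assume "U \<in> vecs C' (cone_betti \<beta> 0)" "V \<in> vecs C' (cone_betti \<beta> 0)"
    then have *: "U \<in> vecs C' (\<beta> 0)" "V \<in> vecs C' (\<beta> 0)" by auto
    show "cone_aug (\<lambda>j. U j + V j) = cone_aug U + cone_aug V"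
      unfolding cone_aug_def linear_form_add[OF aug_lin *] by (rule proj_add[OF aug_in aug_in]) fact+
  next
    fix r U assume "r \<in> C'" "U \<in> vecs C' (cone_betti \<beta> 0)"
    then have *: "r \<in> C'" "U \<in> vecs C' (\<beta> 0)" by auto
    show "cone_aug (\<lambda>j. r * U j) = act' r (cone_aug U)"
      unfolding cone_aug_def linear_form_scale[OF aug_lin *] by (rule proj_act[OF *(1) aug_in[OF *(2)]])
  qed
  have "lift_form \<epsilon> ` vecs C' (\<beta> 0) = fps_ext fin M" using aug_in aug_onto by blast
  then show "cone_aug ` vecs C' (cone_betti \<beta> 0) = M'"
    unfolding cone_aug_def using proj_onto by (metis cone_betti.simps(1) image_image)
qed (use cone_diff_in cone_diff_linear cone_exact0 cone_exact in blast)+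

text \<open>The ideal generated by the old variables and y consists of the series whose constant
  coefficient in y lies in \<open>\<mm>\<close>, so minimality concerns the coefficient of y^0 only.
  There the new entries are, up to sign, those of \<open>d\<close> plus multiples of the constant
  coefficient of \<open>w\<close>.\<close>

lemma cone_minimal:
  assumes min: "\<And>i v j. v \<in> vecs C (\<beta> (Suc i)) \<Longrightarrow> j < \<beta> i \<Longrightarrow> d i v j \<in> \<mm>"
    and \<mm>: "\<And>x y. x \<in> \<mm> \<Longrightarrow> y \<in> \<mm> \<Longrightarrow> x + y \<in> \<mm>" "\<And>x. x \<in> \<mm> \<Longrightarrow> - x \<in> \<mm>"
      "\<And>x r. x \<in> \<mm> \<Longrightarrow> r \<in> C \<Longrightarrow> x * r \<in> \<mm>" and w0: "w $ 0 \<in> \<mm>"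
    and V: "V \<in> vecs C' (cone_betti \<beta> (Suc i))" and j: "j < cone_betti \<beta> i"
  shows "cone_diff i V j $ 0 \<in> \<mm>"
proof -
  have dd: "dd k U l $ 0 \<in> \<mm>" if "U \<in> vecs C' (\<beta> (Suc k))" "l < \<beta> k" for k U l
    using min[OF coeff_vec_in[OF that(1)] that(2)] by (simp add: dd_def lift_form_def)
  have tp: "top_part i V l $ 0 \<in> \<mm>" if "l < \<beta> i" for l
  proof -
    have "snd_vec (\<beta> (Suc i)) V \<in> vecs C' (\<beta> i)" using snd_vec_in V by auto
    then have "snd_vec (\<beta> (Suc i)) V l $ 0 \<in> C" using vecs_in[OF C'] by (auto simp: fps_ext_def)
    moreover have "fst_vec (\<beta> (Suc i)) V \<in> vecs C' (\<beta> (Suc i))" using fst_vec_in V by auto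
    ultimately show ?thesis using dd that \<mm> w0 by (simp add: top_part_def)
  qed
  show ?thesis
  proof (cases i)
    case 0 then show ?thesis using tp j by simp
  next
    case (Suc k)
    then have "snd_vec (\<beta> (Suc i)) V \<in> vecs C' (\<beta> (Suc k))" using snd_vec_in V by auto
    then show ?thesis using tp[of j] j dd[of _ k "j - \<beta> i"] \<mm>(2) Suc by (auto simp: join_vec_def)
  qed
qed

text \<open>Homogeneity of degree \<open>e\<close> where y has degree 1.\<close>

definition "ext_hom H e = {F \<in> C'. \<forall>k. F $ k \<in> H (e - int k)}" for H :: "int \<Rightarrow> 'r set"

text \<open>Multiplication by \<open>w\<close> raises degrees by 2 in the graded case, so the second
  block of basis vectors is moved up by 2 to make the differential of the cone homogeneous of degree
  0.\<close>

primrec cone_shift :: "(nat \<Rightarrow> nat \<Rightarrow> int) \<Rightarrow> nat \<Rightarrow> nat \<Rightarrow> int" where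
  "cone_shift a 0 = a 0"
| "cone_shift a (Suc i) = join_vec (\<beta> (Suc i)) (a (Suc i)) (\<lambda>j. a i j + 2)"

lemma cone_hom:
  fixes a :: "nat \<Rightarrow> nat \<Rightarrow> int" and H :: "int \<Rightarrow> 'r set"
  assumes hom: "\<And>i e v. v \<in> vecs C (\<beta> (Suc i)) \<Longrightarrow> (\<And>j. j < \<beta> (Suc i) \<Longrightarrow> v j \<in> H (e - a (Suc i) j)) \<Longrightarrow>
      (\<And>j. j < \<beta> i \<Longrightarrow> d i v j \<in> H (e - a i j))"
    and H: "\<And>e x y. x \<in> H e \<Longrightarrow> y \<in> H e \<Longrightarrow> x + y \<in> H e" "\<And>e x. x \<in> H e \<Longrightarrow> - x \<in> H e"
    and wH: "\<And>e F. F \<in> ext_hom H e \<Longrightarrow> w * F \<in> ext_hom H (e + 2)"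
    and V: "V \<in> vecs C' (cone_betti \<beta> (Suc i))"
    and Vh: "\<And>j. j < cone_betti \<beta> (Suc i) \<Longrightarrow> V j \<in> ext_hom H (e - cone_shift a (Suc i) j)"
    and j: "j < cone_betti \<beta> i"
  shows "cone_diff i V j \<in> ext_hom H (e - cone_shift a i j)"
proof -
  have dd: "dd k U l $ n \<in> H (e' - a k l - int n)"
    if U: "U \<in> vecs C' (\<beta> (Suc k))" and h: "\<And>j. j < \<beta> (Suc k) \<Longrightarrow> U j \<in> ext_hom H (e' - a (Suc k) j)"
      and "l < \<beta> k" for k U l n e'
  proof -
    have "coeff_vec U n j \<in> H (e' - int n - a (Suc k) j)" if "j < \<beta> (Suc k)" for j
      using h[OF that] by (simp add: ext_hom_def coeff_vec_def algebra_simps)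
    from hom[OF coeff_vec_in[OF U] this \<open>l < \<beta> k\<close>] show ?thesis
      by (simp add: dd_def lift_form_def algebra_simps)
  qed
  let ?u = "fst_vec (\<beta> (Suc i)) V" and ?v = "snd_vec (\<beta> (Suc i)) V"
  have u: "?u \<in> vecs C' (\<beta> (Suc i))" and v: "?v \<in> vecs C' (\<beta> i)"
    using fst_vec_in snd_vec_in V by auto
  have uh: "?u l \<in> ext_hom H (e - a (Suc i) l)" if "l < \<beta> (Suc i)" for l
    using Vh[of l] that by (simp add: fst_vec_def join_vec_def)
  have vh: "?v l \<in> ext_hom H (e - 2 - a i l)" if "l < \<beta> i" for l
    using Vh[of "\<beta> (Suc i) + l"] that by (simp add: snd_vec_def join_vec_def algebra_simps)
  have tp: "top_part i V l $ n \<in> H (e - a i l - int n)" if "l < \<beta> i" for l n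
  proof -
    have "w * ?v l \<in> ext_hom H (e - 2 - a i l + 2)" by (rule wH[OF vh[OF that]])
    then have "(w * ?v l) $ n \<in> H (e - a i l - int n)" by (simp add: ext_hom_def)
    then show ?thesis using dd[OF u uh that] H(1) by (simp add: top_part_def)
  qed
  have "cone_diff i V j \<in> C'" using cone_diff_in[OF V] vecs_in[OF C'] by blast
  moreover have "cone_diff i V j $ n \<in> H (e - cone_shift a i j - int n)" for n
  proof (cases i)
    case 0 then show ?thesis using tp j by simp
  next
    case (Suc k)
    show ?thesis
    proof (cases "j < \<beta> i")
      case True then show ?thesis using tp[OF True] Suc by (simp add: join_vec_def)
    next
      case False
      have "?v l \<in> ext_hom H (e - 2 - a (Suc k) l)" if "l < \<beta> (Suc k)" for l using vh that Suc by simp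
      then have "dd k ?v (j - \<beta> i) $ n \<in> H (e - 2 - a k (j - \<beta> i) - int n)"
        using v j False Suc by (intro dd) auto
      then show ?thesis using False Suc H(2) by (simp add: join_vec_def algebra_simps)
    qed
  qed
  ultimately show ?thesis by (simp add: ext_hom_def)
qed

end

section \<open>Homogeneous regular sequences\<close>

definition ideal_on :: "'r::comm_ring_1 set \<Rightarrow> 'r set \<Rightarrow> bool" where
  "ideal_on C J \<longleftrightarrow> J \<subseteq> C \<and> 0 \<in> J \<and> (\<forall>x\<in>J. \<forall>y\<in>J. x + y \<in> J) \<and> (\<forall>r\<in>C. \<forall>x\<in>J. r * x \<in> J)"

definition adjoin :: "'r::comm_ring_1 set \<Rightarrow> 'r set \<Rightarrow> 'r \<Rightarrow> 'r set" where
  "adjoin C J f = {x + a * f | x a. x \<in> J \<and> a \<in> C}"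

abbreviation "adjoins C \<equiv> foldl (adjoin C)"

definition regular_mod :: "'r::comm_ring_1 set \<Rightarrow> 'r set \<Rightarrow> 'r \<Rightarrow> bool" where
  "regular_mod C J f \<longleftrightarrow> (\<forall>r\<in>C. r * f \<in> J \<longrightarrow> r \<in> J)"

text \<open>The base ideal is a parameter, which allows induction on the list from its front. That
  the sequence generates a proper ideal is kept apart, in \<open>regular_seq_on\<close>.\<close>

primrec regular_list :: "'r::comm_ring_1 set \<Rightarrow> 'r set \<Rightarrow> 'r list \<Rightarrow> bool" where
  "regular_list C J [] = True"
| "regular_list C J (f # fs) = (regular_mod C J f \<and> regular_list C (adjoin C J f) fs)"

lemma regular_list_append:
  "regular_list C J (fs @ gs) \<longleftrightarrow> regular_list C J fs \<and> regular_list C (adjoins C J fs) gs"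
  by (induction fs arbitrary: J) auto

lemma regular_list_iff:
  "regular_list C J fs \<longleftrightarrow> (\<forall>i<length fs. regular_mod C (adjoins C J (take i fs)) (fs ! i))"
proof (induction fs rule: rev_induct)
  case (snoc f fs)
  then show ?case
    by (auto simp: regular_list_append less_Suc_eq nth_append)
qed simp

lemma ideal_onD:
  assumes "ideal_on C J"
  shows "x \<in> J \<Longrightarrow> x \<in> C" "0 \<in> J" "x \<in> J \<Longrightarrow> y \<in> J \<Longrightarrow> x + y \<in> J"
    "r \<in> C \<Longrightarrow> x \<in> J \<Longrightarrow> r * x \<in> J" "r \<in> C \<Longrightarrow> x \<in> J \<Longrightarrow> x * r \<in> J"
  using assms by (auto simp: ideal_on_def mult.commute)

lemma ideal_on_diff:
  assumes "subring_on C" "ideal_on C J" "x \<in> J" "y \<in> J" shows "- x \<in> J" "x - y \<in> J"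
proof -
  have m: "- z \<in> J" if "z \<in> J" for z
    using ideal_onD(4)[OF assms(2) subring_onD(5)[OF assms(1) subring_onD(2)[OF assms(1)]] that] by simp
  show "- x \<in> J" by (rule m[OF assms(3)])
  show "x - y \<in> J" using ideal_onD(3)[OF assms(2) assms(3) m[OF assms(4)]] by simp
qed

lemma ideal_on_sum:
  assumes "ideal_on C J" "\<And>i. i \<in> I \<Longrightarrow> f i \<in> J" shows "sum f I \<in> J"
  using assms(2) by (induction I rule: infinite_finite_induct) (auto simp: ideal_onD[OF assms(1)])

lemma ideal_on_zero: "subring_on C \<Longrightarrow> ideal_on C {0}"
  by (auto simp: ideal_on_def subring_onD)

lemma ideal_on_adjoin:
  assumes C: "subring_on C" and J: "ideal_on C J" and f: "f \<in> C"
  shows "ideal_on C (adjoin C J f)"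
  unfolding ideal_on_def
proof (intro conjI ballI subsetI)
  fix x assume "x \<in> adjoin C J f"
  then obtain j a where x: "x = j + a * f" "j \<in> J" "a \<in> C" by (auto simp: adjoin_def)
  then show "x \<in> C" by (auto simp: subring_onD[OF C] ideal_onD(1)[OF J] f)
next
  show "0 \<in> adjoin C J f" unfolding adjoin_def
    using ideal_onD(2)[OF J] subring_onD(1)[OF C] by (auto intro!: exI[of _ 0])
next
  fix x y assume "x \<in> adjoin C J f" "y \<in> adjoin C J f"
  then obtain j a j' a' where "x = j + a * f" "j \<in> J" "a \<in> C" "y = j' + a' * f" "j' \<in> J" "a' \<in> C"
    by (auto simp: adjoin_def)
  then have "x + y = (j + j') + (a + a') * f" "j + j' \<in> J" "a + a' \<in> C"
    by (auto simp: ideal_onD[OF J] subring_onD[OF C] algebra_simps)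
  then show "x + y \<in> adjoin C J f" unfolding adjoin_def by blast
next
  fix r x assume r: "r \<in> C" and "x \<in> adjoin C J f"
  then obtain j a where "x = j + a * f" "j \<in> J" "a \<in> C" by (auto simp: adjoin_def)
  then have "r * x = r * j + (r * a) * f" "r * j \<in> J" "r * a \<in> C"
    using r by (auto simp: ideal_onD[OF J] subring_onD[OF C] algebra_simps)
  then show "r * x \<in> adjoin C J f" unfolding adjoin_def by blast
qed

lemma adjoin_least:
  assumes "ideal_on C K" "J \<subseteq> K" "f \<in> K" shows "adjoin C J f \<subseteq> K"
  using assms(2,3) ideal_onD(3,4)[OF assms(1)] by (auto simp: adjoin_def)

lemma adjoin_superset:
  assumes "subring_on C" "ideal_on C J" "f \<in> C"
  shows "J \<subseteq> adjoin C J f" "f \<in> adjoin C J f"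
proof -
  show "J \<subseteq> adjoin C J f" unfolding adjoin_def using subring_onD(1)[OF assms(1)] by force
  show "f \<in> adjoin C J f" unfolding adjoin_def
    using subring_onD(2)[OF assms(1)] ideal_onD(2)[OF assms(2)] by force
qed

lemma ideal_on_adjoins:
  "subring_on C \<Longrightarrow> ideal_on C J \<Longrightarrow> set fs \<subseteq> C \<Longrightarrow> ideal_on C (adjoins C J fs)"
  by (induction fs arbitrary: J) (auto simp: ideal_on_adjoin)

lemma adjoins_superset:
  "subring_on C \<Longrightarrow> ideal_on C J \<Longrightarrow> set fs \<subseteq> C \<Longrightarrow> J \<subseteq> adjoins C J fs \<and> set fs \<subseteq> adjoins C J fs"
proof (induction fs arbitrary: J)
  case (Cons f fs)
  then show ?case
    using Cons.IH[of "adjoin C J f"] adjoin_superset[of C J f] ideal_on_adjoin[of C J f] by auto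
qed auto

lemma adjoins_least:
  "ideal_on C K \<Longrightarrow> J \<subseteq> K \<Longrightarrow> set fs \<subseteq> K \<Longrightarrow> adjoins C J fs \<subseteq> K"
  by (induction fs arbitrary: J) (auto simp: adjoin_least)

lemma adjoins_iff:
  assumes C: "subring_on C"
  shows "x \<in> adjoins C J fs \<longleftrightarrow>
    (\<exists>j a. j \<in> J \<and> (\<forall>i<length fs. a i \<in> C) \<and> x = j + (\<Sum>i<length fs. a i * fs ! i))"
proof (induction fs arbitrary: x rule: rev_induct)
  case (snoc f fs)
  show ?case (is "_ = ?R")
  proof
    assume "x \<in> adjoins C J (fs @ [f])"
    then obtain y b where "x = y + b * f" "y \<in> adjoins C J fs" "b \<in> C" by (auto simp: adjoin_def)
    moreover then obtain j a where "j \<in> J" "\<forall>i<length fs. a i \<in> C" "y = j + (\<Sum>i<length fs. a i * fs ! i)"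
      using snoc by blast
    ultimately have "j \<in> J \<and> (\<forall>i<length (fs @ [f]). (a(length fs := b)) i \<in> C) \<and>
        x = j + (\<Sum>i<length (fs @ [f]). (a(length fs := b)) i * (fs @ [f]) ! i)"
      by (auto simp: nth_append algebra_simps)
    then show ?R by blast
  next
    assume ?R
    then obtain j a where "j \<in> J" and a: "\<forall>i<length (fs @ [f]). a i \<in> C"
      and x: "x = j + (\<Sum>i<length (fs @ [f]). a i * (fs @ [f]) ! i)" by blast
    have "j + (\<Sum>i<length fs. a i * fs ! i) \<in> adjoins C J fs"
      unfolding snoc using \<open>j \<in> J\<close> a by (intro exI[of _ j] exI[of _ a]) auto
    moreover have "x = j + (\<Sum>i<length fs. a i * fs ! i) + a (length fs) * f"
      unfolding x by (simp add: nth_append)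
    ultimately show "x \<in> adjoins C J (fs @ [f])" using a by (auto simp: adjoin_def)
  qed
qed auto

text \<open>A grading by natural numbers, given by its projections: f is homogeneous of degree k iff
  \<open>comp k f = f\<close>, so 0 has every degree. \<open>comp_mult\<close> describes products
  with one homogeneous factor, the generators of the ideals in question being homogeneous.\<close>

locale graded_ring =
  fixes C :: "'r::comm_ring_1 set" and comp :: "nat \<Rightarrow> 'r \<Rightarrow> 'r"
  assumes C: "subring_on C"
    and comp_in: "x \<in> C \<Longrightarrow> comp e x \<in> C"
    and comp_add: "comp e (x + y) = comp e x + comp e y"
    and comp_comp: "comp e (comp e' x) = (if e = e' then comp e x else 0)"
    and comp_mult: "x \<in> C \<Longrightarrow> f \<in> C \<Longrightarrow> comp k f = f \<Longrightarrow>
      comp e (x * f) = (if k \<le> e then comp (e - k) x * f else 0)"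
    and comp_sum: "x \<in> C \<Longrightarrow> \<exists>N. x = (\<Sum>e<N. comp e x)"
    and comp_one: "comp 0 1 = 1"
begin

lemma comp_zero [simp]: "comp e 0 = 0"
  using comp_add[of e 0 0] by simp

lemma comp_sums: "comp e (\<Sum>i\<in>I. f i) = (\<Sum>i\<in>I. comp e (f i))"
  by (induction I rule: infinite_finite_induct) (auto simp: comp_add)

definition "hom_ideal J \<longleftrightarrow> ideal_on C J \<and> (\<forall>x\<in>J. \<forall>e. comp e x \<in> J)"

definition "hom_pos f \<longleftrightarrow> f \<in> C \<and> (\<exists>k>0. comp k f = f)"

lemma in_hom_ideal:
  assumes "hom_ideal J" "x \<in> C" "\<And>e. comp e x \<in> J" shows "x \<in> J"
proof -
  obtain N where "x = (\<Sum>e<N. comp e x)" using comp_sum[OF assms(2)] by blast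
  moreover have "(\<Sum>e<N. comp e x) \<in> J" by (rule ideal_on_sum) (use assms in \<open>auto simp: hom_ideal_def\<close>)
  ultimately show ?thesis by simp
qed

lemma hom_ideal_zero: "hom_ideal {0}"
  by (simp add: hom_ideal_def ideal_on_zero[OF C])

lemma hom_ideal_adjoin:
  assumes J: "hom_ideal J" and f: "hom_pos f" shows "hom_ideal (adjoin C J f)"
proof -
  obtain k where k: "f \<in> C" "comp k f = f" using f by (auto simp: hom_pos_def)
  have "comp e x \<in> adjoin C J f" if adj: "x \<in> adjoin C J f" for x e
  proof -
    obtain j a where x: "x = j + a * f" "j \<in> J" "a \<in> C" using adj by (auto simp: adjoin_def)
    have "comp e x = comp e j + (if k \<le> e then comp (e - k) a else 0) * f"
      using comp_mult[OF x(3) k] x(1) by (simp add: comp_add)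
    moreover have "comp e j \<in> J" using J x by (simp add: hom_ideal_def)
    moreover have "(if k \<le> e then comp (e - k) a else 0) \<in> C" using comp_in x subring_onD(1)[OF C] by auto
    ultimately show ?thesis unfolding adjoin_def by blast
  qed
  then show ?thesis using ideal_on_adjoin[OF C _ k(1)] J by (simp add: hom_ideal_def)
qed

text \<open>Homogeneity replaces Nakayama's lemma: an element killed by \<open>g\<close> modulo \<open>J\<close> is a multiple of
  \<open>f\<close> modulo \<open>J\<close>, and the cofactor is again killed by \<open>g\<close> but has smaller degree.\<close>

lemma regular_mod_swap:
  assumes J: "hom_ideal J" and f: "hom_pos f" and g: "hom_pos g"
    and rf: "regular_mod C J f" and rg: "regular_mod C (adjoin C J f) g"
  shows "regular_mod C J g" "regular_mod C (adjoin C J g) f"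
proof -
  obtain k where k: "k > 0" "comp k f = f" and fC: "f \<in> C" using f by (auto simp: hom_pos_def)
  obtain l where l: "comp l g = g" and gC: "g \<in> C" using g by (auto simp: hom_pos_def)
  have JI: "ideal_on C J" using J by (simp add: hom_ideal_def)
  note JD = ideal_onD[OF JI] ideal_on_diff[OF C JI] and CD = subring_onD[OF C]
  have sup: "J \<subseteq> adjoin C J f" by (rule adjoin_superset[OF C JI fC])
  have hom: "r \<in> J" if "r \<in> C" "comp e r = r" "r * g \<in> J" for r e
    using that
  proof (induction e arbitrary: r rule: less_induct)
    case (less e)
    have "r \<in> adjoin C J f" using less.prems rg sup by (auto simp: regular_mod_def)
    then obtain j a where x: "r = j + a * f" "j \<in> J" "a \<in> C" by (auto simp: adjoin_def)
    have cj: "comp e j \<in> J" using J x by (simp add: hom_ideal_def)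
    show ?case
    proof (cases "k \<le> e")
      case True
      let ?a = "comp (e - k) a"
      have r: "r = comp e j + ?a * f"
        using less.prems(2) x comp_mult[OF x(3) fC k(2), of e] True by (simp add: comp_add)
      have aC: "?a \<in> C" using comp_in x by blast
      have "r * g - comp e j * g \<in> J" using JD(7)[OF less.prems(3) JD(5)[OF gC cj]] .
      then have "?a * g * f \<in> J" by (subst (asm) r) (simp add: algebra_simps)
      then have "?a * g \<in> J" using rf CD(4)[OF aC gC] by (simp add: regular_mod_def)
      then have "?a \<in> J" using less.IH[of "e - k" ?a] True k(1) aC by (simp add: comp_comp)
      then have "comp e j + ?a * f \<in> J" by (intro JD(3)[OF cj] JD(5)[OF fC])
      then show ?thesis using r by simp
    next
      case False
      then have "r = comp e j"
        using less.prems(2) x comp_mult[OF x(3) fC k(2), of e] by (simp add: comp_add)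
      then show ?thesis using cj by simp
    qed
  qed
  show "regular_mod C J g"
    unfolding regular_mod_def
  proof (intro ballI impI)
    fix r assume r: "r \<in> C" "r * g \<in> J"
    show "r \<in> J"
    proof (rule in_hom_ideal[OF J r(1)])
      fix e
      have "comp (e + l) (r * g) \<in> J" using J r by (simp add: hom_ideal_def)
      then show "comp e r \<in> J"
        using comp_mult[OF r(1) gC l, of "e + l"] hom[of "comp e r" e] comp_in[OF r(1)]
        by (simp add: comp_comp)
    qed
  qed
  show "regular_mod C (adjoin C J g) f"
    unfolding regular_mod_def
  proof (intro ballI impI)
    fix r assume r: "r \<in> C" "r * f \<in> adjoin C J g"
    then obtain j a where x: "r * f = j + a * g" "j \<in> J" "a \<in> C" by (auto simp: adjoin_def)
    \<comment> \<open>Regularity of g modulo J + (f) turns r f = j + a g into a = j' + b f.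
      Cancelling f in (r - b g) f = j + j' g then shows that r - b g lies in J.\<close>
    then have "a * g = - j + r * f" by (simp add: algebra_simps)
    then have "a * g \<in> adjoin C J f" unfolding adjoin_def using JD(6)[OF x(2) x(2)] r(1) by blast
    then have "a \<in> adjoin C J f" using rg x(3) by (simp add: regular_mod_def)
    then obtain j' b where y: "a = j' + b * f" "j' \<in> J" "b \<in> C" by (auto simp: adjoin_def)
    have "(r - b * g) * f = j + j' * g" using x(1) by (simp add: y(1) algebra_simps)
    then have "(r - b * g) * f \<in> J" using JD(3)[OF x(2) JD(5)[OF gC y(2)]] by simp
    then have "r - b * g \<in> J" using rf CD r(1) y(3) gC by (simp add: regular_mod_def)
    moreover have "r = (r - b * g) + b * g" by simp
    ultimately show "r \<in> adjoin C J g" unfolding adjoin_def using y(3) by blast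
  qed
qed

lemma adjoin_commute: "adjoin C (adjoin C J f) g = adjoin C (adjoin C J g) f"
  unfolding adjoin_def
  by (auto; metis (no_types, opaque_lifting) add.assoc add.commute)

lemma regular_list_swap:
  assumes "hom_ideal J" "hom_pos f" "hom_pos g" "regular_list C J (f # g # fs)"
  shows "regular_list C J (g # f # fs)"
  using assms regular_mod_swap[OF assms(1-3)] by (simp add: adjoin_commute)

lemma regular_list_move_front:
  assumes "hom_ideal J" "\<forall>f\<in>set (xs @ a # ys). hom_pos f" "regular_list C J (xs @ a # ys)"
  shows "regular_list C J (a # xs @ ys)"
  using assms
proof (induction xs arbitrary: J)
  case (Cons x xs)
  then have "regular_list C (adjoin C J x) (a # xs @ ys)"
    using hom_ideal_adjoin[of J x] Cons.IH[of "adjoin C J x"] by auto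
  then have "regular_list C J (x # a # xs @ ys)" using Cons.prems(3) by simp
  then show ?case using regular_list_swap[of J x a "xs @ ys"] Cons.prems by simp
qed simp

text \<open>The descent below uses this to move the form that is exchanged to the end, and
  afterwards to bring y^2 to the front and to sort the other forms by degree.\<close>

lemma regular_list_perm:
  assumes "hom_ideal J" "\<forall>f\<in>set fs. hom_pos f" "regular_list C J fs" "mset gs = mset fs"
  shows "regular_list C J gs"
  using assms
proof (induction gs arbitrary: J fs)
  case (Cons g gs)
  then have "g \<in> set fs" by (metis list.set_intros(1) set_mset_mset)
  then obtain xs ys where fs: "fs = xs @ g # ys" by (meson split_list)
  have r: "regular_list C J (g # xs @ ys)" using regular_list_move_front Cons.prems fs by blast
  have "regular_list C (adjoin C J g) gs"
    by (rule Cons.IH[of _ "xs @ ys"]) (use r Cons.prems fs in \<open>auto intro: hom_ideal_adjoin\<close>)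
  then show ?case using r by simp
qed simp

text \<open>The grading of C[y] in which y has degree 1.\<close>

definition "comp_ext e F = Abs_fps (\<lambda>k. if k \<le> e then comp (e - k) (F $ k) else 0)"

lemma graded_ring_ext: "graded_ring (fps_ext True C) comp_ext"
proof
  show "subring_on (fps_ext True C)" by (rule subring_on_fps_ext[OF C])
  fix x e assume x: "x \<in> fps_ext True C"
  have "{k. comp_ext e x $ k \<noteq> 0} \<subseteq> {k. x $ k \<noteq> 0}" by (auto simp: comp_ext_def)
  then show "comp_ext e x \<in> fps_ext True C"
    using x comp_in subring_onD(1)[OF C] by (auto simp: fps_ext_def comp_ext_def dest: finite_subset)
next
  fix e x y show "comp_ext e (x + y) = comp_ext e x + comp_ext e y"
    by (rule fps_ext) (simp add: comp_ext_def comp_add)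
next
  fix e e' x show "comp_ext e (comp_ext e' x) = (if e = e' then comp_ext e x else 0)"
    by (rule fps_ext) (auto simp: comp_ext_def comp_comp)
next
  fix x f k e
  assume x: "x \<in> fps_ext True C" and f: "f \<in> fps_ext True C" and k: "comp_ext k f = f"
  have xC: "x $ i \<in> C" and fC: "f $ i \<in> C" for i using x f by (auto simp: fps_ext_def)
  have f0: "f $ i = 0" if "i > k" for i
    using arg_cong[OF k, of "\<lambda>F. F $ i"] that by (simp add: comp_ext_def)
  have fk: "comp (k - i) (f $ i) = f $ i" if "i \<le> k" for i
    using arg_cong[OF k, of "\<lambda>F. F $ i"] that by (simp add: comp_ext_def)
  show "comp_ext e (x * f) = (if k \<le> e then comp_ext (e - k) x * f else 0)"
  proof (rule fps_ext)
    fix n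
    have summand: "(if n \<le> e then comp (e - n) (x $ i * f $ (n - i)) else 0) =
        (if k \<le> e then comp_ext (e - k) x $ i * f $ (n - i) else 0)" if "i \<le> n" for i
    proof (cases "n - i \<le> k")
      case True
      have e: "e - n - (k - (n - i)) = e - k - i" using True that by linarith
      have iff: "n \<le> e \<and> k - (n - i) \<le> e - n \<longleftrightarrow> k \<le> e \<and> i \<le> e - k" using True that by linarith
      have "(if n \<le> e then comp (e - n) (x $ i * f $ (n - i)) else 0) =
          (if n \<le> e \<and> k - (n - i) \<le> e - n then comp (e - k - i) (x $ i) * f $ (n - i) else 0)"
        using comp_mult[OF xC fC fk[OF True], of "e - n" i] by (simp only: e) simp
      also have "\<dots> = (if k \<le> e then comp_ext (e - k) x $ i * f $ (n - i) else 0)"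
        unfolding iff by (simp add: comp_ext_def)
      finally show ?thesis .
    next
      case False then show ?thesis using f0 by simp
    qed
    have "comp_ext e (x * f) $ n = (\<Sum>i=0..n. if n \<le> e then comp (e - n) (x $ i * f $ (n - i)) else 0)"
      by (simp add: comp_ext_def fps_mult_nth comp_sums)
    also have "\<dots> = (\<Sum>i=0..n. if k \<le> e then comp_ext (e - k) x $ i * f $ (n - i) else 0)"
      by (intro sum.cong refl summand) simp
    also have "\<dots> = (if k \<le> e then comp_ext (e - k) x * f else 0) $ n"
      by (simp add: fps_mult_nth)
    finally show "comp_ext e (x * f) $ n = (if k \<le> e then comp_ext (e - k) x * f else 0) $ n" .
  qed
next
  fix x assume x: "x \<in> fps_ext True C"
  then have fin: "finite {k. x $ k \<noteq> 0}" and xC: "x $ k \<in> C" for k by (auto simp: fps_ext_def)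
  have "\<exists>N. y = (\<Sum>e<N. comp e y) \<and> (\<forall>e\<ge>N. comp e y = 0)" if "y \<in> C" for y
  proof -
    obtain N where N: "y = (\<Sum>e<N. comp e y)" using comp_sum[OF \<open>y \<in> C\<close>] by blast
    have "comp e y = 0" if "e \<ge> N" for e
      by (subst N) (use that in \<open>simp add: comp_sums comp_comp\<close>)
    with N show ?thesis by blast
  qed
  then have "\<forall>k. \<exists>N. x $ k = (\<Sum>e<N. comp e (x $ k)) \<and> (\<forall>e\<ge>N. comp e (x $ k) = 0)"
    using xC by blast
  from choice[OF this] obtain N where N: "\<And>k. x $ k = (\<Sum>e<N k. comp e (x $ k))"
    "\<And>k e. e \<ge> N k \<Longrightarrow> comp e (x $ k) = 0" by blast
  \<comment> \<open>\<open>N k + k\<close> bounds the total degrees in the term with y^k. Only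
    finitely many of these terms are non-zero, so one bound \<open>K\<close> serves for all.\<close>
  obtain K where K: "\<And>k. x $ k \<noteq> 0 \<Longrightarrow> N k + k < K"
    using fin finite_nat_set_iff_bounded[of "(\<lambda>k. N k + k) ` {k. x $ k \<noteq> 0}"] by auto
  have "x $ k = (\<Sum>e<K. comp_ext e x) $ k" for k
  proof (cases "x $ k = 0")
    case True then show ?thesis by (simp add: fps_sum_nth comp_ext_def cong: if_cong)
  next
    case False
    have "(\<Sum>e<K. comp_ext e x) $ k = (\<Sum>e<K. if k \<le> e then comp (e - k) (x $ k) else 0)"
      by (simp add: fps_sum_nth comp_ext_def)
    also have "\<dots> = (\<Sum>e\<in>{k..<K}. comp (e - k) (x $ k))"
      by (rule sum.mono_neutral_cong_right) auto
    also have "\<dots> = (\<Sum>e<K - k. comp e (x $ k))"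
      by (rule sum.reindex_bij_witness[of _ "\<lambda>e. e + k" "\<lambda>e. e - k"]) auto
    also have "\<dots> = (\<Sum>e<N k. comp e (x $ k))"
      by (rule sum.mono_neutral_right) (use K[OF False] N(2) in auto)
    finally show ?thesis using N(1) by simp
  qed
  then show "\<exists>N. x = (\<Sum>e<N. comp_ext e x)" using fps_ext by blast
next
  show "comp_ext 0 1 = 1" by (rule fps_ext) (simp add: comp_ext_def comp_one)
qed

end

section \<open>Descent of a regular sequence from C[y] to C\<close>

definition regular_seq_on :: "'r::comm_ring_1 set \<Rightarrow> 'r list \<Rightarrow> bool" where
  "regular_seq_on C fs \<longleftrightarrow> set fs \<subseteq> C \<and> regular_list C {0} fs \<and> adjoins C {0} fs \<noteq> C"

text \<open>The ideal generated by \<open>fs\<close> is the one generated by I and y^2 in C[y]. As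
  y^2 has the least possible degree, it can replace a generator of degree 2, and from then on only
  the coefficients of y^0 and y^1 of the other forms matter. With the forms sorted by degree, the
  y-coefficient of each lies in the ideal of the constant coefficients of its predecessors, so the
  constant coefficients alone govern the successive quotients.\<close>

theorem (in graded_ring) regular_seq_descend:
  assumes units: "\<And>x. x \<in> C \<Longrightarrow> comp 0 x = x \<Longrightarrow> x \<noteq> 0 \<Longrightarrow> \<exists>y\<in>C. x * y = 1"
    and I: "ideal_on C I" and I01: "\<And>x. x \<in> I \<Longrightarrow> comp 0 x = 0 \<and> comp 1 x = 0"
    and reg: "regular_seq_on (fps_ext True C) fs" and hom: "\<forall>f\<in>set fs. \<exists>k. comp_ext k f = f"
    and gen: "adjoins (fps_ext True C) {0} fs = {F \<in> fps_ext True C. F $ 0 \<in> I \<and> F $ 1 \<in> I}"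
  shows "\<exists>gs. regular_seq_on C gs \<and> (\<forall>g\<in>set gs. \<exists>k. comp k g = g) \<and> adjoins C {0} gs = I"
proof -
  define C' where "C' = fps_ext True C"
  define I' where "I' = {F \<in> C'. F $ 0 \<in> I \<and> F $ 1 \<in> I}"
  interpret E: graded_ring C' comp_ext unfolding C'_def by (rule graded_ring_ext)
  note CD = subring_onD[OF C] and ED = subring_onD[OF E.C] and ID = ideal_onD[OF I] ideal_on_diff[OF C I]
  have regl: "regular_list C' {0} fs" and fsC: "set fs \<subseteq> C'" and fsI: "adjoins C' {0} fs = I'"
    using reg gen by (auto simp: regular_seq_on_def C'_def I'_def)
  have one: "1 \<notin> I" using I01[of 1] comp_one by auto
  have fI: "set fs \<subseteq> I'" using adjoins_superset[OF E.C ideal_on_zero[OF E.C] fsC] fsI by simp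
  have fps_const_C': "fps_const x \<in> C'" if "x \<in> C" for x
    using that CD(1) by (auto simp: C'_def fps_ext_def intro: finite_subset[of _ "{0}"])
  have X_C': "fps_X \<in> C'"
    using CD(1,2) by (auto simp: C'_def fps_ext_def fps_X_def intro: finite_subset[of _ "{1}"])
  have nth_C: "F $ k \<in> C" if "F \<in> C'" for F k using that by (simp add: C'_def fps_ext_def)
  \<comment> \<open>A generator of degree 0 or 1 would be 0, because I has no components in these
    degrees; but regularity of 0 modulo an ideal puts 1 into that ideal.\<close>
  have deg2: "k \<ge> 2" if f: "f \<in> set fs" and k: "comp_ext k f = f" for f k
  proof (rule ccontr)
    assume "\<not> k \<ge> 2"
    have "f $ 0 \<in> I" "f $ 1 \<in> I" using fI f by (auto simp: I'_def)
    have e: "f $ n = (if n \<le> k then comp (k - n) (f $ n) else 0)" for n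
      using arg_cong[OF k, of "\<lambda>F. F $ n"] by (simp add: comp_ext_def)
    have "f $ n = 0" for n
    proof -
      consider "n = 0" "k = 0" | "n = 0" "k = 1" | "n = 1" "k = 1" | "n > k"
        using \<open>\<not> k \<ge> 2\<close> by linarith
      then show ?thesis using e[of n] I01[OF \<open>f $ 0 \<in> I\<close>] I01[OF \<open>f $ 1 \<in> I\<close>] by cases auto
    qed
    then have f0: "f = 0" by (intro fps_ext) simp
    obtain i where i: "i < length fs" "fs ! i = f" using f by (meson in_set_conv_nth)
    have "regular_mod C' (adjoins C' {0} (take i fs)) 0"
      using regl i f0 unfolding regular_list_iff by auto
    moreover have t: "set (take i fs) \<subseteq> C'" using fsC set_take_subset by fast
    ultimately have "1 \<in> adjoins C' {0} (take i fs)"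
      using ideal_onD(2)[OF ideal_on_adjoins[OF E.C ideal_on_zero[OF E.C] t]] ED(2)
      by (simp add: regular_mod_def)
    moreover have "adjoins C' {0} (take i fs) \<subseteq> adjoins C' {0} fs"
      using adjoins_superset[OF E.C ideal_on_zero[OF E.C] fsC] set_take_subset[of i fs]
      by (intro adjoins_least[OF ideal_on_adjoins[OF E.C ideal_on_zero[OF E.C] fsC]]) auto
    ultimately show False using fsI one by (auto simp: I'_def)
  qed
  obtain dg where dg: "\<And>f. f \<in> set fs \<Longrightarrow> comp_ext (dg f) f = f" using hom by metis
  have hp: "E.hom_pos f" if "f \<in> set fs" for f
    using dg[OF that] deg2[OF that dg[OF that]] fsC that by (auto simp: E.hom_pos_def intro!: exI[of _ "dg f"])
  let ?Y = "fps_X\<^sup>2 :: 'r fps"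
  have Ynth: "?Y $ n = (if n = 2 then 1 else 0)" for n by (simp add: fps_X_power_nth)
  have YC: "?Y \<in> C'" unfolding power2_eq_square by (rule ED(4)[OF X_C' X_C'])
  have YI: "?Y \<in> I'" using YC ID(2) by (simp add: I'_def Ynth)
  have Yhom: "comp_ext 2 ?Y = ?Y"
    by (rule fps_ext) (auto simp: comp_ext_def Ynth comp_one)
  obtain a where a: "\<forall>i<length fs. a i \<in> C'" and Ya: "?Y = (\<Sum>i<length fs. a i * fs ! i)"
    using YI unfolding fsI[symmetric] adjoins_iff[OF E.C] by auto
  \<comment> \<open>Compare the parts of degree 2 in y^2 = sum of a_i f_i. Every f_i has degree at
    least 2, so only those of degree 2 contribute, each with the degree 0 part of its
    cofactor.\<close>
  define b where "b i = (if dg (fs ! i) = 2 then comp_ext 0 (a i) else 0)" for i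
  have bC: "b i \<in> C'" if "i < length fs" for i using a that E.comp_in ED(1) by (simp add: b_def)
  have "?Y = (\<Sum>i<length fs. comp_ext 2 (a i * fs ! i))"
    using Yhom by (subst Ya) (metis E.comp_sums Ya)
  also have "\<dots> = (\<Sum>i<length fs. b i * fs ! i)"
  proof (rule sum.cong[OF refl])
    fix i assume i: "i \<in> {..<length fs}"
    then have f: "fs ! i \<in> set fs" by simp
    have "dg (fs ! i) \<ge> 2" by (rule deg2[OF f dg[OF f]])
    then show "comp_ext 2 (a i * fs ! i) = b i * fs ! i"
      using E.comp_mult[OF _ subsetD[OF fsC f] dg[OF f], of "a i" 2] a i by (auto simp: b_def)
  qed
  finally have Yb: "?Y = (\<Sum>i<length fs. b i * fs ! i)" .
  obtain i where i: "i < length fs" "b i \<noteq> 0"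
  proof -
    have "?Y \<noteq> 0" by (metis Ynth fps_zero_nth zero_neq_one)
    then show ?thesis using that Yb by (metis (no_types, lifting) lessThan_iff mult_zero_left sum.neutral)
  qed
  let ?f = "fs ! i"
  define rest where "rest = take i fs @ drop (Suc i) fs"
  have fs_split: "fs = take i fs @ ?f # drop (Suc i) fs" using i(1) by (rule id_take_nth_drop)
  have restsub: "set rest \<subseteq> set fs" unfolding rest_def using set_take_subset set_drop_subset by fastforce
  have restC: "set rest \<subseteq> C'" using restsub fsC by blast
  have fi: "?f \<in> set fs" "?f \<in> C'" using i(1) fsC by auto
  define Q where "Q = adjoins C' {0} rest"
  have Q: "ideal_on C' Q" unfolding Q_def by (rule ideal_on_adjoins[OF E.C ideal_on_zero[OF E.C] restC])
  have restQ: "set rest \<subseteq> Q" using adjoins_superset[OF E.C ideal_on_zero[OF E.C] restC] by (simp add: Q_def)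
  have rl: "regular_list C' {0} (rest @ [?f])"
  proof (rule E.regular_list_perm[OF E.hom_ideal_zero _ regl])
    show "mset (rest @ [?f]) = mset fs" by (subst (2) fs_split) (simp add: rest_def)
  qed (use hp in blast)
  \<comment> \<open>A non-zero element of degree 0 in C[y] is constant in y and of degree 0 in C,
    hence invertible by \<open>units\<close>.\<close>
  obtain v where v: "v \<in> C'" "b i * v = 1"
  proof -
    have b0: "b i = fps_const (b i $ 0)" and c0: "comp 0 (b i $ 0) = b i $ 0"
      using i(2) by (auto simp: b_def comp_ext_def comp_comp fps_eq_iff split: if_splits)
    moreover have "b i $ 0 \<noteq> 0" using i(2) b0 by auto
    ultimately obtain y where y: "y \<in> C" "b i $ 0 * y = 1" using units nth_C[OF bC[OF i(1)]] by blast
    then have "b i * fps_const y = 1" by (subst b0) simp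
    then show ?thesis using that fps_const_C'[OF y(1)] by blast
  qed
  \<comment> \<open>Modulo the other generators, y^2 and the chosen one are unit multiples of each
    other, hence interchangeable both in the regular sequence and among the generators.\<close>
  have Yf: "?Y - b i * ?f \<in> Q"
  proof -
    have "?Y = b i * ?f + (\<Sum>l\<in>{..<length fs} - {i}. b l * fs ! l)"
      unfolding Yb using i(1) by (intro sum.remove) auto
    moreover have "(\<Sum>l\<in>{..<length fs} - {i}. b l * fs ! l) \<in> Q"
    proof (rule ideal_on_sum[OF Q])
      fix l assume l: "l \<in> {..<length fs} - {i}"
      then have "fs ! l \<in> set rest"
      proof (cases "l < i")
        case True
        then have "fs ! l = take i fs ! l" "l < length (take i fs)" using l by auto
        then show ?thesis unfolding rest_def by (metis UnI1 nth_mem set_append)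
      next
        case False
        then have "fs ! l = drop (Suc i) fs ! (l - Suc i)" "l - Suc i < length (drop (Suc i) fs)"
          using l by auto
        then show ?thesis unfolding rest_def by (metis UnI2 nth_mem set_append)
      qed
      then show "b l * fs ! l \<in> Q" using ideal_onD(4)[OF Q bC, of l] l restQ by auto
    qed
    ultimately show ?thesis by simp
  qed
  have fY: "?f - v * ?Y \<in> Q"
  proof -
    have "- v * (?Y - b i * ?f) \<in> Q" by (rule ideal_onD(4)[OF Q ED(5)[OF v(1)] Yf])
    moreover have "- v * (?Y - b i * ?f) = (b i * v) * ?f - v * ?Y" by (simp add: algebra_simps)
    ultimately show ?thesis using v(2) by simp
  qed
  have regY: "regular_mod C' Q ?Y"
    unfolding regular_mod_def
  proof (intro ballI impI)
    fix r assume r: "r \<in> C'" "r * ?Y \<in> Q"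
    have "r * ?Y - r * (?Y - b i * ?f) \<in> Q"
      using ideal_on_diff(2)[OF E.C Q r(2) ideal_onD(4)[OF Q r(1) Yf]] .
    then have "(r * b i) * ?f \<in> Q" by (simp add: algebra_simps)
    moreover have "regular_mod C' Q ?f" using rl by (simp add: regular_list_append Q_def)
    ultimately have "r * b i \<in> Q" using ED(4)[OF r(1) bC[OF i(1)]] by (simp add: regular_mod_def)
    then have "r * b i * v \<in> Q" using ideal_onD(5)[OF Q v(1)] by blast
    then show "r \<in> Q" using v(2) by (simp add: mult.assoc)
  qed
  \<comment> \<open>The order by degree is what \<open>low\<close> below relies on.\<close>
  define L where "L = sort_key dg rest"
  have Lset: "set L = set rest" by (simp add: L_def)
  have hpY: "E.hom_pos ?Y" using YC Yhom by (auto simp: E.hom_pos_def intro!: exI[of _ 2])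
  have regL: "regular_list C' {0} (?Y # L)"
  proof (rule E.regular_list_perm[OF E.hom_ideal_zero])
    show "regular_list C' {0} (rest @ [?Y])" using rl regY by (simp add: regular_list_append Q_def)
    show "\<forall>f\<in>set (rest @ [?Y]). E.hom_pos f" using restsub hp hpY by auto
    show "mset (?Y # L) = mset (rest @ [?Y])" by (simp add: L_def)
  qed
  have I': "ideal_on C' I'" using ideal_on_adjoins[OF E.C ideal_on_zero[OF E.C] fsC] fsI by simp
  have LI: "set L \<subseteq> I'" and LC: "set (?Y # L) \<subseteq> C'" using Lset restsub fI fsC YC by auto
  have genL: "adjoins C' {0} (?Y # L) = I'"
  proof
    show "adjoins C' {0} (?Y # L) \<subseteq> I'"
      by (rule adjoins_least[OF I']) (use LI YI ideal_onD(2)[OF I'] in auto)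
    let ?A = "adjoins C' {0} (?Y # L)"
    have A: "ideal_on C' ?A" by (rule ideal_on_adjoins[OF E.C ideal_on_zero[OF E.C] LC])
    have sA: "set (?Y # L) \<subseteq> ?A" using adjoins_superset[OF E.C ideal_on_zero[OF E.C] LC] by blast
    have "Q \<subseteq> ?A" unfolding Q_def by (rule adjoins_least[OF A]) (use ideal_onD(2)[OF A] sA Lset in auto)
    then have "(?f - v * ?Y) + v * ?Y \<in> ?A"
      using fY sA by (intro ideal_onD(3)[OF A] ideal_onD(4)[OF A v(1)]) auto
    then have "?f \<in> ?A" by simp
    moreover have "set fs = insert ?f (set rest)" by (subst fs_split) (auto simp: rest_def)
    ultimately have "set fs \<subseteq> ?A" using sA Lset by auto
    then show "I' \<subseteq> ?A" unfolding fsI[symmetric] using ideal_onD(2)[OF A] by (intro adjoins_least[OF A]) auto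
  qed
  define L0 where "L0 = map (\<lambda>F. F $ 0) L"
  have L0C: "set L0 \<subseteq> C" using LC nth_C by (auto simp: L0_def)
  have L0I: "set L0 \<subseteq> I" using LI by (auto simp: L0_def I'_def)
  have Lhom: "comp_ext (dg f) f = f" if "f \<in> set L" for f using that Lset restsub dg by auto
  have L0hom: "comp (dg f) (f $ 0) = f $ 0" if "f \<in> set L" for f
    using arg_cong[OF Lhom[OF that], of "\<lambda>F. F $ 0"] by (simp add: comp_ext_def)
  have genL0: "adjoins C {0} L0 = I"
  proof
    show "adjoins C {0} L0 \<subseteq> I" by (rule adjoins_least[OF I]) (use ID(2) L0I in auto)
    show "I \<subseteq> adjoins C {0} L0"
    proof
      fix x assume x: "x \<in> I"
      then have "fps_const x \<in> I'" using fps_const_C'[OF ID(1)[OF x]] ID(2) by (simp add: I'_def)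
      then have "fps_const x \<in> adjoins C' (adjoin C' {0} ?Y) L" using genL by simp
      then obtain j c where j: "j \<in> adjoin C' {0} ?Y" and c: "\<forall>i<length L. c i \<in> C'"
        and e: "fps_const x = j + (\<Sum>i<length L. c i * L ! i)" unfolding adjoins_iff[OF E.C] by blast
      from j have "j $ 0 = 0" by (auto simp: adjoin_def)
      then have "x = (\<Sum>i<length L. c i $ 0 * L ! i $ 0)"
        using arg_cong[OF e, of "\<lambda>F. F $ 0"] by (simp add: fps_sum_nth)
      also have "\<dots> = (\<Sum>i<length L0. c i $ 0 * L0 ! i)" by (simp add: L0_def)
      finally show "x \<in> adjoins C {0} L0" unfolding adjoins_iff[OF C] using c nth_C
        by (intro exI[of _ 0] exI[of _ "\<lambda>i. c i $ 0"]) (auto simp: L0_def)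
    qed
  qed
  define S where "S j = adjoins C {0} (take j L0)" for j
  have take_sub: "set (take j L0) \<subseteq> C" for j using L0C set_take_subset by fast
  have S: "ideal_on C (S j)" for j unfolding S_def by (rule ideal_on_adjoins[OF C ideal_on_zero[OF C] take_sub])
  have S_Suc: "S (Suc j) = adjoin C (S j) (L ! j $ 0)" if "j < length L" for j
    using that by (simp add: S_def L0_def take_Suc_conv_app_nth)
  \<comment> \<open>The y-coefficient of L_j lies in I and has degree one less than L_j. It is
    therefore a combination of constant terms of degree smaller than that of L_j, and in the sorted
    list these come before position j. If L_j has degree 0, its y-coefficient is 0.\<close>
  have low: "L ! j $ 1 \<in> S j" if j: "j < length L" for j
  proof -
    let ?l = "L ! j"
    have l: "?l \<in> set L" using j by simp
    have l1: "?l $ 1 \<in> I" using LI l by (auto simp: I'_def)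
    show ?thesis
    proof (cases "dg ?l = 0")
      case True
      then show ?thesis using arg_cong[OF Lhom[OF l], of "\<lambda>F. F $ 1"] ideal_onD(2)[OF S]
        by (simp add: comp_ext_def)
    next
      case False
      obtain c where c: "\<forall>i<length L0. c i \<in> C" and e: "?l $ 1 = (\<Sum>i<length L0. c i * L0 ! i)"
        using l1 unfolding genL0[symmetric] adjoins_iff[OF C] by auto
      let ?e = "dg ?l - 1"
      have "?l $ 1 = comp ?e (?l $ 1)"
        using arg_cong[OF Lhom[OF l], of "\<lambda>F. F $ 1"] False by (simp add: comp_ext_def split: if_splits)
      also have "\<dots> = (\<Sum>i<length L0. comp ?e (c i * L0 ! i))" by (subst e) (rule comp_sums)
      also have "\<dots> \<in> S j"
      proof (rule ideal_on_sum[OF S])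
        fix i assume i: "i \<in> {..<length L0}"
        then have iL: "i < length L" "L ! i \<in> set L" by (auto simp: L0_def)
        have L0i: "L0 ! i = L ! i $ 0" using iL by (simp add: L0_def)
        have m: "comp ?e (c i * L0 ! i) = (if dg (L ! i) \<le> ?e then comp (?e - dg (L ! i)) (c i) * L0 ! i else 0)"
          using c i L0C L0hom[OF iL(2)] by (intro comp_mult) (auto simp: L0i[symmetric])
        show "comp ?e (c i * L0 ! i) \<in> S j"
        proof (cases "dg (L ! i) \<le> ?e")
          case True
          have "i < j"
          proof (rule ccontr)
            assume "\<not> i < j"
            then have "dg ?l \<le> dg (L ! i)"
              using sorted_nth_mono[of "map dg L" j i] iL(1) by (simp add: L_def)
            then show False using True False by linarith
          qed
          then have "L0 ! i \<in> set (take j L0)" using iL(1) by (auto simp: in_set_conv_nth L0_def intro!: exI[of _ i])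
          then have "L0 ! i \<in> S j" using adjoins_superset[OF C ideal_on_zero[OF C] take_sub] by (auto simp: S_def)
          then show ?thesis using m True ideal_onD(4)[OF S comp_in] c i by simp
        qed (use m ideal_onD(2)[OF S] in auto)
      qed
      finally show ?thesis .
    qed
  qed
  \<comment> \<open>Modulo y^2 an element is a pair of coefficients. The y-coefficient of L_j is
    already in S_j, so adjoining L_j adds multiples of its constant term to the two coefficients
    independently.\<close>
  have key: "adjoins C' (adjoin C' {0} ?Y) (take j L) = {F \<in> C'. F $ 0 \<in> S j \<and> F $ 1 \<in> S j}"
    if "j \<le> length L" for j
    using that
  proof (induction j)
    case 0
    have "\<exists>q\<in>C'. F = q * ?Y" if F: "F \<in> C'" "F $ 0 = 0" "F $ 1 = 0" for F
    proof
      let ?q = "Abs_fps (\<lambda>n. F $ (n + 2))"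
      show "F = ?q * ?Y"
      proof (rule fps_ext)
        fix n show "F $ n = (?q * ?Y) $ n"
        proof (cases "n < 2")
          case True
          then show ?thesis using F(2,3) by (auto simp: fps_X_power_mult_right_nth less_2_cases_iff)
        next
          case False
          then obtain k where "n = k + 2" by (metis add.commute le_Suc_ex not_le)
          then show ?thesis by (simp add: fps_X_power_mult_right_nth)
        qed
      qed
      have "finite ((\<lambda>n. n + 2) -` {k. F $ k \<noteq> 0})"
        using F(1) by (intro finite_vimageI) (auto simp: C'_def fps_ext_def inj_def)
      then show "?q \<in> C'" using nth_C[OF F(1)] by (simp add: C'_def fps_ext_def vimage_def)
    qed
    then show ?case using YC ED by (auto simp: S_def adjoin_def)
  next
    case (Suc j)
    then have j: "j < length L" by simp
    let ?l = "L ! j"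
    have lC: "?l \<in> C'" using LC j by auto
    have l0C: "?l $ 0 \<in> C" by (rule nth_C[OF lC])
    have "adjoins C' (adjoin C' {0} ?Y) (take (Suc j) L) =
        adjoin C' {F \<in> C'. F $ 0 \<in> S j \<and> F $ 1 \<in> S j} ?l"
      using Suc j by (simp add: take_Suc_conv_app_nth)
    also have "\<dots> = {F \<in> C'. F $ 0 \<in> S (Suc j) \<and> F $ 1 \<in> S (Suc j)}"
    proof (intro equalityI subsetI)
      fix F assume "F \<in> adjoin C' {F \<in> C'. F $ 0 \<in> S j \<and> F $ 1 \<in> S j} ?l"
      then obtain G q where F: "F = G + q * ?l" and G: "G \<in> C'" "G $ 0 \<in> S j" "G $ 1 \<in> S j" and q: "q \<in> C'"
        by (auto simp: adjoin_def)
      have "F $ 0 = G $ 0 + q $ 0 * ?l $ 0" by (simp add: F)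
      moreover have "F $ 1 = (G $ 1 + q $ 0 * ?l $ 1) + q $ 1 * ?l $ 0"
        by (simp add: F fps_mult_nth_1 algebra_simps)
      moreover have "G $ 1 + q $ 0 * ?l $ 1 \<in> S j"
        using ideal_onD(3,4)[OF S] G(3) nth_C[OF q] low[OF j] by blast
      ultimately show "F \<in> {F \<in> C'. F $ 0 \<in> S (Suc j) \<and> F $ 1 \<in> S (Suc j)}"
        unfolding S_Suc[OF j] adjoin_def using G(2) nth_C[OF q, of 0] nth_C[OF q, of 1]
          ED(3)[OF G(1) ED(4)[OF q lC]] unfolding F[symmetric] by blast
    next
      fix F assume "F \<in> {F \<in> C'. F $ 0 \<in> S (Suc j) \<and> F $ 1 \<in> S (Suc j)}"
      then obtain x0 a0 x1 a1 where F: "F \<in> C'" and F0: "F $ 0 = x0 + a0 * ?l $ 0" "x0 \<in> S j" "a0 \<in> C"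
        and F1: "F $ 1 = x1 + a1 * ?l $ 0" "x1 \<in> S j" "a1 \<in> C"
        unfolding S_Suc[OF j] adjoin_def by blast
      \<comment> \<open>The cofactor a0 + a1 y removes the multiples of the constant term of L_j
        from both coefficients; the error, a0 times the y-coefficient of L_j, stays in S_j.\<close>
      define q where "q = fps_const a0 + fps_const a1 * fps_X"
      have q: "q \<in> C'" unfolding q_def
        by (rule ED(3)[OF fps_const_C'[OF F0(3)] ED(4)[OF fps_const_C'[OF F1(3)] X_C']])
      have q0: "q $ 0 = a0" "q $ 1 = a1" by (simp_all add: q_def)
      have "(F - q * ?l) $ 0 = x0" using F0(1) q0 by simp
      moreover have "(F - q * ?l) $ 1 = x1 - a0 * ?l $ 1"
        using F1(1) q0 by (simp add: fps_mult_nth_1)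
      moreover have "x1 - a0 * ?l $ 1 \<in> S j"
        using ideal_on_diff(2)[OF C S F1(2) ideal_onD(4)[OF S F0(3) low[OF j]]] .
      moreover have "F - q * ?l \<in> C'" by (rule ED(6)[OF F ED(4)[OF q lC]])
      moreover have "F = (F - q * ?l) + q * ?l" by simp
      ultimately show "F \<in> adjoin C' {F \<in> C'. F $ 0 \<in> S j \<and> F $ 1 \<in> S j} ?l"
        unfolding adjoin_def using q F0(2) by (intro CollectI exI[of _ "F - q * ?l"] exI[of _ q]) simp
    qed
    finally show ?case .
  qed
  have "regular_list C {0} L0"
    unfolding regular_list_iff
  proof (intro allI impI)
    fix j assume "j < length L0"
    then have j: "j < length L" by (simp add: L0_def)
    let ?l = "L ! j"
    have rj: "regular_mod C' {F \<in> C'. F $ 0 \<in> S j \<and> F $ 1 \<in> S j} ?l"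
      using regL j key[of j] unfolding regular_list.simps regular_list_iff by auto
    show "regular_mod C (adjoins C {0} (take j L0)) (L0 ! j)"
      unfolding S_def[symmetric] regular_mod_def
    proof (intro ballI impI)
      fix r assume r: "r \<in> C" "r * L0 ! j \<in> S j"
      \<comment> \<open>Regularity in C[y] is tested on the constant series r: the y-coefficient of
        r L_j is in S_j by \<open>low\<close>, so the hypothesis on the constant coefficient
        decides.\<close>
      have "fps_const r * ?l \<in> {F \<in> C'. F $ 0 \<in> S j \<and> F $ 1 \<in> S j}"
        using r j ED(4)[OF fps_const_C'[OF r(1)] subsetD[OF LC, of ?l]] ideal_onD(4)[OF S r(1) low[OF j]]
        by (auto simp: L0_def)
      then have "fps_const r \<in> {F \<in> C'. F $ 0 \<in> S j \<and> F $ 1 \<in> S j}"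
        using rj fps_const_C'[OF r(1)] unfolding regular_mod_def by blast
      then show "r \<in> S j" by simp
    qed
  qed
  moreover have "\<forall>g\<in>set L0. \<exists>k. comp k g = g" using L0hom by (auto simp: L0_def)
  moreover have "I \<noteq> C" using one CD(2) by blast
  ultimately show ?thesis using genL0 L0C by (auto simp: regular_seq_on_def)
qed

section \<open>Orders in numerical semigroups\<close>

definition reps :: "nat set \<Rightarrow> nat \<Rightarrow> nat multiset set" where
  "reps U z = {c. set_mset c \<subseteq> min_gens U \<and> \<Sum>\<^sub># c = z}"

text \<open>The order of t^z in the filtration by powers of the maximal ideal, see
  \<open>ideal_power_eq\<close>. The value is meaningful for z in U, where \<open>reps U z\<close>
  is finite and non-empty.\<close>

definition sg_ord :: "nat set \<Rightarrow> nat \<Rightarrow> nat" where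
  "sg_ord U z = Max (size ` reps U z)"

lemma size_le_sum_mset: "0 \<notin># c \<Longrightarrow> size c \<le> \<Sum>\<^sub># (c :: nat multiset)"
  by (induction c) (auto simp: Suc_le_eq intro: add_less_le_mono)

context
  fixes U :: "nat set" assumes U: "numerical_semigroup U"
begin

lemma min_gens_sub: "min_gens U \<subseteq> U - {0}"
  using min_gens_eq[OF U] by auto

lemma sg_closed: "0 \<in> U" "x \<in> U \<Longrightarrow> y \<in> U \<Longrightarrow> x + y \<in> U"
  using U by (auto simp: numerical_semigroup_def)

lemma generated_min_gens: "generated (min_gens U) = U"
  using minimally_generates_iff[OF U, of "min_gens U"] min_gens_eq[OF U]
  by (simp add: minimally_generates_def)

lemma sum_mset_in: "set_mset c \<subseteq> min_gens U \<Longrightarrow> \<Sum>\<^sub># c \<in> U"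
  using generated_min_gens by (auto simp: generated_def)

lemma reps_nonempty: "z \<in> U \<Longrightarrow> reps U z \<noteq> {}"
proof -
  assume "z \<in> U"
  then have "z \<in> generated (min_gens U)" by (simp add: generated_min_gens)
  then show ?thesis by (auto simp: generated_def reps_def)
qed

lemma finite_reps: "finite (reps U z)"
proof (rule finite_subset)
  show "reps U z \<subseteq> {c. set_mset c \<subseteq> {..z} \<and> size c \<le> z}"
  proof
    fix c assume c: "c \<in> reps U z"
    then have "0 \<notin># c" using min_gens_sub by (auto simp: reps_def)
    then have "size c \<le> z" using size_le_sum_mset c by (auto simp: reps_def)
    moreover have "x \<le> z" if "x \<in># c" for x
      using c that by (auto simp: reps_def dest: multi_member_split)
    ultimately show "c \<in> {c. set_mset c \<subseteq> {..z} \<and> size c \<le> z}" by auto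
  qed
qed (simp add: finite_msets_bounded_size)

lemma size_le_ord: "set_mset c \<subseteq> min_gens U \<Longrightarrow> size c \<le> sg_ord U (\<Sum>\<^sub># c)"
  unfolding sg_ord_def using finite_reps by (intro Max_ge) (auto simp: reps_def)

lemma ord_attained: "z \<in> U \<Longrightarrow> \<exists>c. set_mset c \<subseteq> min_gens U \<and> \<Sum>\<^sub># c = z \<and> size c = sg_ord U z"
proof -
  assume "z \<in> U"
  then have "sg_ord U z \<in> size ` reps U z"
    unfolding sg_ord_def using finite_reps[of z] reps_nonempty by (intro Max_in) auto
  then obtain c where "c \<in> reps U z" "sg_ord U z = size c" by (rule imageE) simp
  then show ?thesis by (auto simp: reps_def)
qed

lemma ord_le: "z \<in> U \<Longrightarrow> (\<And>c. set_mset c \<subseteq> min_gens U \<Longrightarrow> \<Sum>\<^sub># c = z \<Longrightarrow> size c \<le> n) \<Longrightarrow> sg_ord U z \<le> n"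
  using ord_attained by metis

lemma superadd_ord: "superadd_on U (sg_ord U)"
  unfolding superadd_on_def
proof (intro ballI conjI)
  fix u v assume "u \<in> U" "v \<in> U"
  then show "u + v \<in> U" by (rule sg_closed)
  obtain c c' where "set_mset c \<subseteq> min_gens U" "\<Sum>\<^sub># c = u" "size c = sg_ord U u"
    "set_mset c' \<subseteq> min_gens U" "\<Sum>\<^sub># c' = v" "size c' = sg_ord U v"
    using ord_attained \<open>u \<in> U\<close> \<open>v \<in> U\<close> by metis
  then show "sg_ord U u + sg_ord U v \<le> sg_ord U (u + v)" using size_le_ord[of "c + c'"] by auto
qed

lemma ord_add_le: "u \<in> U \<Longrightarrow> v \<in> U \<Longrightarrow> sg_ord U u + sg_ord U v \<le> sg_ord U (u + v)"
  using superadd_ord by (auto simp: superadd_on_def)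

lemma ord_0: "sg_ord U 0 = 0"
  using ord_add_le[of 0 0] sg_closed by simp

lemma ord_pos: "z \<in> U \<Longrightarrow> z \<noteq> 0 \<Longrightarrow> 0 < sg_ord U z"
  using ord_attained[of z] by (metis neq0_conv size_eq_0_iff_empty sum_mset.empty)

lemma mset_sum_gen:
  assumes "set_mset c \<subseteq> min_gens U" "\<Sum>\<^sub># c = g" "g \<in> min_gens U" shows "c = {#g#}"
proof -
  have g: "g \<noteq> 0" "\<And>x y. x \<in> U - {0} \<Longrightarrow> y \<in> U - {0} \<Longrightarrow> g \<noteq> x + y"
    using assms(3) min_gens_eq[OF U] by auto
  then obtain x c' where c: "c = add_mset x c'" using assms(2) by (cases c) auto
  have x: "x \<in> U - {0}" using assms(1) min_gens_sub c by auto
  have "\<Sum>\<^sub># c' \<notin> U - {0}"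
  proof
    assume "\<Sum>\<^sub># c' \<in> U - {0}"
    from g(2)[OF x this] show False using assms(2) c by simp
  qed
  moreover have "\<Sum>\<^sub># c' \<in> U" by (rule sum_mset_in) (use assms(1) c in auto)
  ultimately have "\<Sum>\<^sub># c' = 0" by blast
  moreover have "0 \<notin># c'" using assms(1) c min_gens_sub by auto
  ultimately have "size c' \<le> 0" using size_le_sum_mset[of c'] by metis
  then show ?thesis using c assms(2) by simp
qed

lemma ord_gen: "g \<in> min_gens U \<Longrightarrow> sg_ord U g = 1"
proof -
  assume g: "g \<in> min_gens U"
  then have "g \<in> U" using min_gens_sub by blast
  then obtain c where c: "set_mset c \<subseteq> min_gens U" "\<Sum>\<^sub># c = g" "size c = sg_ord U g"
    using ord_attained by blast
  from mset_sum_gen[OF c(1,2) g] c(3) show ?thesis by simp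
qed

text \<open>Drop one generator from a longest factorization. This is the reason why series of order
  n + 1 lie in the product of the ideal of order n with the maximal ideal.\<close>

lemma ord_split:
  assumes "z \<in> U" "Suc n \<le> sg_ord U z"
  shows "\<exists>g z'. g \<in> min_gens U \<and> z' \<in> U \<and> z = g + z' \<and> n \<le> sg_ord U z'"
proof -
  obtain c where c: "set_mset c \<subseteq> min_gens U" "\<Sum>\<^sub># c = z" "size c = sg_ord U z"
    using ord_attained[OF assms(1)] by blast
  then obtain g c' where "c = add_mset g c'" using assms(2) by (cases c) auto
  then show ?thesis using c assms(2) size_le_ord[of c'] sum_mset_in[of c']
    by (intro exI[of _ g] exI[of _ "\<Sum>\<^sub># c'"]) auto
qed

lemma finite_min_gens: "finite (min_gens U)"
proof -
  have "finite (UNIV - U)" using U by (simp add: numerical_semigroup_def)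
  then obtain N where N: "\<And>x. x \<notin> U \<Longrightarrow> x < N"
    using finite_nat_set_iff_bounded[of "UNIV - U"] by auto
  \<comment> \<open>All gaps of U are below N, so a number from 2 N + 2 on is the sum of Suc N and a
    remainder larger than N, both in U.\<close>
  have "g < 2 * N + 2" if g: "g \<in> min_gens U" for g
  proof (rule ccontr)
    assume "\<not> g < 2 * N + 2"
    then have "\<not> Suc N < N" "\<not> g - Suc N < N" "g - Suc N \<noteq> 0" and e: "g = Suc N + (g - Suc N)" by auto
    then have "Suc N \<in> U - {0}" "g - Suc N \<in> U - {0}" using N by blast+
    then show False using g e unfolding min_gens_eq[OF U] by blast
  qed
  then show ?thesis using finite_nat_set_iff_bounded by blast
qed

lemma ns_multiplicity_props:
  "ns_multiplicity U \<in> U - {0}" "x \<in> U \<Longrightarrow> x \<noteq> 0 \<Longrightarrow> ns_multiplicity U \<le> x"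
proof -
  have "\<not> UNIV - U \<supseteq> {0<..}"
    using U finite_subset infinite_Ioi by (auto simp: numerical_semigroup_def)
  then have "\<exists>x. x \<in> U \<and> x \<noteq> 0" by auto
  then show "ns_multiplicity U \<in> U - {0}"
    unfolding ns_multiplicity_def using LeastI_ex[of "\<lambda>x. x \<in> U \<and> x \<noteq> 0"] by simp
  show "x \<in> U \<Longrightarrow> x \<noteq> 0 \<Longrightarrow> ns_multiplicity U \<le> x"
    unfolding ns_multiplicity_def by (simp add: Least_le)
qed

end

section \<open>The duplication with respect to a principal ideal\<close>

text \<open>With \<open>c = 2 s + b\<close> the semigroup \<open>D\<close> below is the duplication of \<open>S\<close> with respect to \<open>s + S\<close>.\<close>

locale semigroup_double =
  fixes S :: "nat set" and c :: nat and D :: "nat set"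
  assumes S: "numerical_semigroup S" and c: "c \<in> S" "odd c" "3 \<le> sg_ord S c"
    and D_def: "D = {2 * x | x. x \<in> S} \<union> {2 * x + c | x. x \<in> S}"
    and D: "numerical_semigroup D"
begin

abbreviation "G \<equiv> min_gens S"

text \<open>The monomial in the generators of D that stands for x^m y^k, where (m, k) is the
  argument: a generator g of S becomes 2 g, and y becomes c.\<close>

definition "dmon p = image_mset ((*) 2) (fst p) + replicate_mset (snd p) c"
  for p :: "nat multiset \<times> nat"

text \<open>Odd elements of D are at least c, so c is irreducible, and every other odd element is c
  plus a non-zero even one. Apart from splittings of g in S, a double 2 g could only split into two
  odd elements, which would give g = c + u + v of order at least 3.\<close>

lemma min_gens_D: "min_gens D = (*) 2 ` G \<union> {c}"
proof -
  have gen: "g \<in> min_gens D \<longleftrightarrow> g \<in> D - {0} \<and> \<not> (\<exists>x\<in>D - {0}. \<exists>y\<in>D - {0}. g = x + y)" for g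
    using min_gens_eq[OF D] by simp
  have genS: "g \<in> G \<longleftrightarrow> g \<in> S - {0} \<and> \<not> (\<exists>x\<in>S - {0}. \<exists>y\<in>S - {0}. g = x + y)" for g
    using min_gens_eq[OF S] by simp
  have c0: "c \<noteq> 0" using c(2) by (intro notI) simp
  note clS = sg_closed[OF S]
  have ev: "2 * x \<in> D \<longleftrightarrow> x \<in> S" for x
    unfolding D_def using c(2) by (auto, presburger)
  have od: "2 * x + c \<in> D" if "x \<in> S" for x using that by (auto simp: D_def)
  have odE: "\<exists>x\<in>S. y = 2 * x + c" if "y \<in> D" "odd y" for y using that by (auto simp: D_def)
  have cD: "c \<in> D" using od[OF clS(1)] by simp
  have "c \<noteq> x + y" if "x \<in> D - {0}" "y \<in> D - {0}" for x y
  proof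
    assume e: "c = x + y"
    then have "odd x \<or> odd y" using c(2) by presburger
    then show False
    proof
      assume "odd x"
      then obtain u where "x = 2 * u + c" using odE[of x] \<open>x \<in> D - {0}\<close> by blast
      then show False using e \<open>y \<in> D - {0}\<close> by simp
    next
      assume "odd y"
      then obtain u where "y = 2 * u + c" using odE[of y] \<open>y \<in> D - {0}\<close> by blast
      then show False using e \<open>x \<in> D - {0}\<close> by simp
    qed
  qed
  then have 1: "c \<in> min_gens D" unfolding gen using cD c0 by blast
  have 2: "2 * g \<in> min_gens D" if g: "g \<in> G" for g
  proof -
    have "2 * g \<noteq> x + y" if "x \<in> D - {0}" "y \<in> D - {0}" for x y
    proof
      assume e: "2 * g = x + y"
      show False
      proof (cases "even x")
        case True
        then have "even y" using e by presburger
        with True obtain u v where uv: "x = 2 * u" "y = 2 * v" by (auto elim!: evenE)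
        then have "u \<in> S - {0}" "v \<in> S - {0}" "g = u + v" using that e ev by auto
        then show False using g genS by blast
      next
        case False
        then have "odd y" using e by presburger
        with False obtain u v where uv: "u \<in> S" "v \<in> S" "x = 2 * u + c" "y = 2 * v + c"
          using odE[of x] odE[of y] \<open>x \<in> D - {0}\<close> \<open>y \<in> D - {0}\<close> by auto
        then have g': "g = c + (u + v)" using e by simp
        have "3 \<le> sg_ord S g" using ord_add_le[OF S c(1) clS(2)[OF uv(1,2)]] c(3) g' by simp
        then show False using ord_gen[OF S g] by simp
      qed
    qed
    then show ?thesis using g genS ev by (auto simp: gen)
  qed
  have 3: "g \<in> (*) 2 ` G \<union> {c}" if g: "g \<in> min_gens D" for g
  proof (cases "even g")
    case True
    then obtain x where x: "g = 2 * x" by blast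
    then have xS: "x \<in> S - {0}" using g gen ev by auto
    have "x \<noteq> u + v" if "u \<in> S - {0}" "v \<in> S - {0}" for u v
    proof
      assume "x = u + v"
      moreover have "2 * u \<in> D - {0}" "2 * v \<in> D - {0}" using that ev by auto
      ultimately show False using g gen x by (metis distrib_left)
    qed
    then show ?thesis using xS x genS by blast
  next
    case False
    then obtain x where x: "x \<in> S" "g = 2 * x + c" using odE g gen by blast
    have "x = 0"
    proof (rule ccontr)
      assume "x \<noteq> 0"
      then have "2 * x \<in> D - {0}" "c \<in> D - {0}" using x ev cD c0 by auto
      then show False using g gen x(2) by blast
    qed
    then show ?thesis using x by simp
  qed
  show ?thesis using 1 2 3 by blast
qed

lemma dmon_sum: "\<Sum>\<^sub># (dmon p) = 2 * \<Sum>\<^sub># (fst p) + c * snd p"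
  by (simp add: dmon_def sum_mset_distrib_left[symmetric])

lemma dmon_size: "size (dmon p) = size (fst p) + snd p"
  by (simp add: dmon_def)

lemma dmon_add: "dmon (p + q) = dmon p + dmon q"
  by (rule multiset_eqI) (simp add: dmon_def)

lemma dmon_0: "dmon ({#}, 0) = {#}"
  by (simp add: dmon_def)

lemma dmon_inj: "inj dmon"
proof (rule injI)
  fix p q assume e: "dmon p = dmon q"
  have n: "count (image_mset ((*) 2) m) c = 0" for m :: "nat multiset"
    using c(2) by (auto simp: count_eq_zero_iff)
  have "snd p = snd q" using arg_cong[OF e, of "\<lambda>m. count m c"] n by (simp add: dmon_def)
  then have "image_mset ((*) 2) (fst p) = image_mset ((*) 2) (fst q)" using e by (simp add: dmon_def)
  from arg_cong[OF this, of "image_mset (\<lambda>x. x div 2)"] have "fst p = fst q"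
    by (simp add: multiset.map_comp comp_def)
  with \<open>snd p = snd q\<close> show "p = q" by (simp add: prod_eq_iff)
qed

lemma dmon_set: "set_mset (dmon p) \<subseteq> min_gens D \<longleftrightarrow> set_mset (fst p) \<subseteq> G"
proof -
  have "2 * x \<in> min_gens D \<longleftrightarrow> x \<in> G" for x
    unfolding min_gens_D using c(2) by auto
  moreover have "c \<in> min_gens D" by (simp add: min_gens_D)
  ultimately show ?thesis unfolding dmon_def by (auto split: if_splits)
qed

lemma dmon_surj:
  assumes "set_mset m \<subseteq> min_gens D" shows "\<exists>p. set_mset (fst p) \<subseteq> G \<and> dmon p = m"
  using assms
proof (induction m)
  case empty show ?case by (intro exI[of _ "({#}, 0)"]) (simp add: dmon_0)
next
  case (add x m)
  then obtain p where p: "set_mset (fst p) \<subseteq> G" "dmon p = m" by auto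
  consider g where "g \<in> G" "x = 2 * g" | "x = c" using add.prems min_gens_D by auto
  then show ?case
  proof cases
    case 1
    then have "set_mset (fst (add_mset g (fst p), snd p)) \<subseteq> G \<and> dmon (add_mset g (fst p), snd p) = add_mset x m"
      using p by (auto simp: dmon_def)
    then show ?thesis by blast
  next
    case 2
    then have "set_mset (fst (fst p, Suc (snd p))) \<subseteq> G \<and> dmon (fst p, Suc (snd p)) = add_mset x m"
      using p by (auto simp: dmon_def)
    then show ?thesis by blast
  qed
qed

lemma double_in: "x \<in> S \<Longrightarrow> 2 * x + c * k \<in> D"
proof (induction k arbitrary: x rule: less_induct)
  case (less k)
  consider "k = 0" | "k = 1" | j where "k = j + 2" by (metis One_nat_def add_2_eq_Suc' not0_implies_Suc)
  then show ?case
  proof cases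
    case 3
    then show ?thesis using less.IH[of j "x + c"] sg_closed(2)[OF S less.prems c(1)] by (simp add: algebra_simps)
  qed (use less.prems in \<open>auto simp: D_def\<close>)
qed

lemma ord_double_ge:
  assumes "x \<in> S" shows "sg_ord S x + k \<le> sg_ord D (2 * x + c * k)"
proof -
  obtain m where m: "set_mset m \<subseteq> G" "\<Sum>\<^sub># m = x" "size m = sg_ord S x" using ord_attained[OF S assms] by blast
  have "set_mset (dmon (m, k)) \<subseteq> min_gens D" using dmon_set m(1) by simp
  from size_le_ord[OF D this] show ?thesis using m by (simp add: dmon_size dmon_sum)
qed

lemma ord_mult_c: "x \<in> S \<Longrightarrow> sg_ord S x + 3 * i \<le> sg_ord S (x + c * i) \<and> x + c * i \<in> S"
proof (induction i)
  case (Suc i)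
  then have "x + c * i \<in> S" by blast
  from ord_add_le[OF S this c(1)] sg_closed(2)[OF S this c(1)] Suc c(3) show ?case
    by (simp add: algebra_simps)
qed simp

text \<open>This is the source of y^2 = 0 in the graded ring. A pair of c's has the sum 2 c, the
  double of an element of S, and can be traded for at least three even generators, so from k = 2 on
  the order exceeds the expected one. For k <= 1 any factorization uses k + 2 i copies of c; trading
  the i pairs lengthens it, so the bound by the order in S holds for it as well.\<close>

lemma ord_double:
  assumes x: "x \<in> S" shows "sg_ord D (2 * x + c * k) = sg_ord S x + k \<longleftrightarrow> k \<le> 1"
proof -
  have small: "sg_ord D (2 * x + c * k) = sg_ord S x + k" if x: "x \<in> S" and k: "k \<le> 1" for x k
  proof (rule antisym[OF ord_le[OF D double_in[OF x]] ord_double_ge[OF x]])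
    fix m assume m: "set_mset m \<subseteq> min_gens D" "\<Sum>\<^sub># m = 2 * x + c * k"
    then obtain p where p: "set_mset (fst p) \<subseteq> G" "dmon p = m" using dmon_surj by blast
    let ?y = "\<Sum>\<^sub># (fst p)" and ?j = "snd p"
    have e: "2 * ?y + c * ?j = 2 * x + c * k" using m(2) unfolding p(2)[symmetric] dmon_sum .
    have y: "?y \<in> S" "size (fst p) \<le> sg_ord S ?y" using p(1) sum_mset_in[OF S] size_le_ord[OF S] by auto
    have "even (c * ?j) = even (c * k)" using e by presburger
    then have par: "even ?j = even k" using c(2) by simp
    have "k \<le> ?j"
    proof (rule ccontr)
      assume "\<not> k \<le> ?j"
      then have "k = 1" "?j = 0" using k by auto
      then show False using par by simp
    qed
    then obtain i where i: "?j = k + 2 * i"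
      using par by (metis dvd_def even_add le_Suc_ex)
    then have "?y + c * i = x" using e by (simp add: algebra_simps)
    then have "sg_ord S ?y + 3 * i \<le> sg_ord S x" using ord_mult_c[OF y(1), of i] by simp
    then show "size m \<le> sg_ord S x + k" using y(2) p(2) dmon_size[of p] i by simp
  qed
  show ?thesis
  proof (cases "k \<le> 1")
    case True then show ?thesis using small x by simp
  next
    case False
    obtain i r where k: "k = 2 * i + r" "r \<le> 1"
      using that[of "k div 2" "k mod 2"] by simp
    have e: "2 * x + c * k = 2 * (x + c * i) + c * r" by (simp add: k(1) algebra_simps)
    have "sg_ord D (2 * x + c * k) = sg_ord S (x + c * i) + r"
      unfolding e by (rule small) (use ord_mult_c[OF x] k(2) in auto)
    then have "sg_ord D (2 * x + c * k) \<ge> sg_ord S x + 3 * i + r" using ord_mult_c[OF x, of i] by simp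
    then show ?thesis using k False by linarith
  qed
qed

lemma not_homogeneous:
  assumes ap: "c \<in> apery (ns_multiplicity S) S" and le: "2 * ns_multiplicity S \<le> c"
  shows "\<not> homogeneous D"
proof -
  let ?m = "ns_multiplicity S"
  have m: "?m \<in> S - {0}" using ns_multiplicity_props(1)[OF S] .
  have m2: "ns_multiplicity D = 2 * ?m"
  proof (rule antisym)
    show "ns_multiplicity D \<le> 2 * ?m" by (rule ns_multiplicity_props(2)[OF D]) (use m D_def in auto)
    have "ns_multiplicity D \<in> D - {0}" by (rule ns_multiplicity_props(1)[OF D])
    \<comment> \<open>Non-zero even elements of D are doubles of non-zero elements of S, and odd
      ones are at least c, which is at least 2 m by \<open>le\<close>.\<close>
    then show "2 * ?m \<le> ns_multiplicity D"
      using ns_multiplicity_props(2)[OF S] le unfolding D_def by fastforce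
  qed
  have "2 * c \<in> apery (2 * ?m) D"
    unfolding apery_def
  proof (intro CollectI conjI notI)
    show "2 * c \<in> D" using c(1) D_def by auto
    assume "int (2 * c) - int (2 * ?m) \<in> int ` D"
    then obtain y where y: "y \<in> D" "int (2 * c) - int (2 * ?m) = int y" by blast
    then have "even y" by presburger
    then obtain x where x: "x \<in> S" "y = 2 * x" using y(1) c(2) D_def by auto
    then have "int c - int ?m = int x" using y by simp
    then show False using ap x by (auto simp: apery_def)
  qed
  moreover obtain r where r: "set_mset r \<subseteq> G" "\<Sum>\<^sub># r = c" "size r = sg_ord S c"
    using ord_attained[OF S c(1)] by blast
  then have "set_mset (dmon (r, 0)) \<subseteq> min_gens D" "\<Sum>\<^sub># (dmon (r, 0)) = 2 * c"
    and "size (dmon (r, 0)) \<ge> 3"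
    using dmon_set[of "(r, 0)"] dmon_sum[of "(r, 0)"] dmon_size[of "(r, 0)"] c(3) by auto
  moreover have "set_mset {#c, c#} \<subseteq> min_gens D" "\<Sum>\<^sub># {#c, c#} = 2 * c"
    using min_gens_D by auto
  ultimately have "homogeneous D \<Longrightarrow> size (dmon (r, 0)) = size {#c, c#}"
    unfolding homogeneous_def m2 by blast
  then show ?thesis using \<open>size (dmon (r, 0)) \<ge> 3\<close> by auto
qed

end

section \<open>Transfer to the record-based structures\<close>

lemma image_eq_by_inverse:
  assumes "\<And>x. x \<in> A \<Longrightarrow> f x \<in> B" "\<And>y. y \<in> B \<Longrightarrow> g y \<in> A" "\<And>y. y \<in> B \<Longrightarrow> f (g y) = y"
  shows "f ` A = B"
  using assms by (metis imageI image_subsetI subsetI subset_antisym)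

lemma image_Collect_by_inverse:
  assumes "\<And>x. x \<in> A \<Longrightarrow> f x \<in> B" "\<And>y. y \<in> B \<Longrightarrow> g y \<in> A" "\<And>y. y \<in> B \<Longrightarrow> f (g y) = y"
    "\<And>x. x \<in> A \<Longrightarrow> g (f x) = x" "\<And>x. x \<in> A \<Longrightarrow> P x \<longleftrightarrow> Q x"
  shows "f ` {x \<in> A. P x} = {y \<in> B. Q (g y)}"
proof (rule image_eq_by_inverse[of _ _ _ g])
  fix x assume "x \<in> {x \<in> A. P x}"
  then have x: "x \<in> A" "Q x" using assms(5) by blast+
  then show "f x \<in> {y \<in> B. Q (g y)}" using assms(1,4) by simp
next
  fix y assume "y \<in> {y \<in> B. Q (g y)}"
  then have y: "y \<in> B" "Q (g y)" by blast+
  show "g y \<in> {x \<in> A. P x}" using assms(2,5) y by simp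
  show "f (g y) = y" by (rule assms(3)[OF y(1)])
qed

lemma free_module_simps [simp]:
  "carrier (free_module R n) = {..<n} \<rightarrow>\<^sub>E carrier R"
  "zero (free_module R n) = (\<lambda>j\<in>{..<n}. \<zero>\<^bsub>R\<^esub>)"
  "add (free_module R n) = (\<lambda>u v. \<lambda>j\<in>{..<n}. u j \<oplus>\<^bsub>R\<^esub> v j)"
  "smult (free_module R n) = (\<lambda>r v. \<lambda>j\<in>{..<n}. r \<otimes>\<^bsub>R\<^esub> v j)"
  by (simp_all add: free_module_def)

text \<open>Carries a record-based ring over to a subset \<open>C\<close> of a commutative ring
  type, where class-based algebra is at hand. The choice of \<open>\<rho>\<close> matters: the ring
  over the generators of D is modelled by series in y over the model for S, see
  \<open>dcoeff\<close>.\<close>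

locale ring_model =
  fixes R :: "('q, 'x) ring_scheme" (structure) and \<rho> :: "'q \<Rightarrow> 'r::comm_ring_1" and C :: "'r set"
  assumes R: "cring R" and bij: "bij_betw \<rho> (carrier R) C"
    and \<rho>_add: "x \<in> carrier R \<Longrightarrow> y \<in> carrier R \<Longrightarrow> \<rho> (x \<oplus> y) = \<rho> x + \<rho> y"
    and \<rho>_mult: "x \<in> carrier R \<Longrightarrow> y \<in> carrier R \<Longrightarrow> \<rho> (x \<otimes> y) = \<rho> x * \<rho> y"
    and \<rho>_one: "\<rho> \<one> = 1"
begin

interpretation cring R by (rule R)

definition "\<rho>' = inv_into (carrier R) \<rho>"

lemma \<rho>_in: "x \<in> carrier R \<Longrightarrow> \<rho> x \<in> C"
  and \<rho>'_in: "y \<in> C \<Longrightarrow> \<rho>' y \<in> carrier R"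
  and \<rho>_\<rho>': "y \<in> C \<Longrightarrow> \<rho> (\<rho>' y) = y"
  and \<rho>'_\<rho>: "x \<in> carrier R \<Longrightarrow> \<rho>' (\<rho> x) = x"
  using bij unfolding \<rho>'_def bij_betw_def
  by (auto simp: inv_into_f_f f_inv_into_f intro: inv_into_into)

lemma image_\<rho>: "\<rho> ` carrier R = C"
  using bij by (simp add: bij_betw_def)

lemma \<rho>_zero: "\<rho> \<zero> = 0"
  using \<rho>_add[of \<zero> \<zero>] by simp

lemma \<rho>_minus: "x \<in> carrier R \<Longrightarrow> \<rho> (\<ominus> x) = - \<rho> x"
  using \<rho>_add[of x "\<ominus> x"] \<rho>_zero by (simp add: r_neg add_eq_0_iff)

lemma subring_C: "subring_on C"
  unfolding subring_on_def
proof (intro conjI ballI)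
  show "1 \<in> C" using \<rho>_in[OF one_closed] \<rho>_one by simp
  fix x assume x: "x \<in> C"
  show "- x \<in> C" using \<rho>_in[OF a_inv_closed[OF \<rho>'_in[OF x]]] \<rho>_minus[OF \<rho>'_in[OF x]] \<rho>_\<rho>'[OF x] by simp
  fix y assume y: "y \<in> C"
  show "x + y \<in> C" "x * y \<in> C"
    using \<rho>_in[OF a_closed[OF \<rho>'_in[OF x] \<rho>'_in[OF y]]] \<rho>_add[OF \<rho>'_in[OF x] \<rho>'_in[OF y]]
      \<rho>_in[OF m_closed[OF \<rho>'_in[OF x] \<rho>'_in[OF y]]] \<rho>_mult[OF \<rho>'_in[OF x] \<rho>'_in[OF y]]
      \<rho>_\<rho>'[OF x] \<rho>_\<rho>'[OF y] by simp_all
qed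

lemma ideal_vimage:
  assumes J: "ideal_on C J" shows "ideal {x \<in> carrier R. \<rho> x \<in> J} R"
proof (rule idealI)
  show "ring R" by (rule ring_axioms)
  show "subgroup {x \<in> carrier R. \<rho> x \<in> J} (add_monoid R)"
  proof (rule subgroup.intro)
    fix x assume "x \<in> {x \<in> carrier R. \<rho> x \<in> J}"
    then have "x \<in> carrier R" "\<rho> (\<ominus> x) \<in> J"
      using \<rho>_minus ideal_on_diff(1)[OF subring_C J] by auto
    then show "inv\<^bsub>add_monoid R\<^esub> x \<in> {x \<in> carrier R. \<rho> x \<in> J}"
      by (simp add: a_inv_def[symmetric])
  qed (use \<rho>_zero \<rho>_add ideal_onD[OF J] in auto)
qed (auto simp: \<rho>_mult ideal_onD[OF J] \<rho>_in)

lemma ideal_image: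
  assumes "ideal I R" shows "ideal_on C (\<rho> ` I)"
proof -
  interpret I: ideal I R by fact
  have IC: "x \<in> carrier R" if "x \<in> I" for x using that by (rule I.Icarr)
  show ?thesis
    unfolding ideal_on_def
  proof (intro conjI ballI)
    show "\<rho> ` I \<subseteq> C" using IC \<rho>_in by auto
    show "0 \<in> \<rho> ` I" using \<rho>_zero I.zero_closed by (metis imageI)
    fix y assume "y \<in> \<rho> ` I"
    then obtain x where x: "x \<in> I" "y = \<rho> x" by blast
    { fix y' assume "y' \<in> \<rho> ` I"
      then obtain x' where x': "x' \<in> I" "y' = \<rho> x'" by blast
      have "y + y' = \<rho> (x \<oplus> x')" using x x' IC \<rho>_add by simp
      then show "y + y' \<in> \<rho> ` I" using x x' by blast }
    fix r assume r: "r \<in> C"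
    have "r * y = \<rho> (\<rho>' r \<otimes> x)" using x IC r \<rho>'_in \<rho>_\<rho>' \<rho>_mult by simp
    then show "r * y \<in> \<rho> ` I" using x r \<rho>'_in I.I_l_closed by blast
  qed
qed

text \<open>Translates generated ideals of the record into \<open>adjoins\<close>, the form in which
  regular sequences are studied above.\<close>

lemma genideal_image:
  assumes fs: "set fs \<subseteq> carrier R" shows "\<rho> ` (Idl (set fs)) = adjoins C {0} (map \<rho> fs)"
proof
  let ?A = "adjoins C {0} (map \<rho> fs)"
  have C: "set (map \<rho> fs) \<subseteq> C" using fs \<rho>_in by auto
  have A: "ideal_on C ?A" by (rule ideal_on_adjoins[OF subring_C ideal_on_zero[OF subring_C] C])
  have "set (map \<rho> fs) \<subseteq> ?A" using adjoins_superset[OF subring_C ideal_on_zero[OF subring_C] C] by blast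
  then have "Idl (set fs) \<subseteq> {x \<in> carrier R. \<rho> x \<in> ?A}"
    using fs by (intro genideal_minimal ideal_vimage A) auto
  then show "\<rho> ` (Idl (set fs)) \<subseteq> ?A" by auto
  show "?A \<subseteq> \<rho> ` (Idl (set fs))"
  proof (rule adjoins_least[OF ideal_image[OF genideal_ideal[OF fs]]])
    show "{0} \<subseteq> \<rho> ` (Idl (set fs))"
      using ideal_onD(2)[OF ideal_image[OF genideal_ideal[OF fs]]] by simp
    show "set (map \<rho> fs) \<subseteq> \<rho> ` (Idl (set fs))" unfolding set_map by (rule image_mono[OF genideal_self[OF fs]])
  qed
qed

lemma genideal_mem:
  assumes fs: "set fs \<subseteq> carrier R" and x: "x \<in> carrier R"
  shows "x \<in> Idl (set fs) \<longleftrightarrow> \<rho> x \<in> adjoins C {0} (map \<rho> fs)"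
proof -
  have "Idl (set fs) \<subseteq> carrier R" using ideal.Icarr[OF genideal_ideal[OF fs]] by (rule subsetI)
  then show ?thesis unfolding genideal_image[OF fs, symmetric] using inj_on_image_mem_iff[OF bij_betw_imp_inj_on[OF bij] x] by simp
qed

lemma regular_sequence_iff:
  assumes fs: "set fs \<subseteq> carrier R"
  shows "regular_sequence R fs \<longleftrightarrow> regular_seq_on C (map \<rho> fs)"
proof -
  have t: "set (take i fs) \<subseteq> carrier R" for i using fs set_take_subset by fast
  have mem: "r \<in> Idl (set (take i fs)) \<longleftrightarrow> \<rho> r \<in> adjoins C {0} (take i (map \<rho> fs))"
    if "r \<in> carrier R" for r i using genideal_mem[OF t that] by (simp add: take_map)
  have "(\<forall>r\<in>carrier R. r \<otimes> fs ! i \<in> Idl (set (take i fs)) \<longrightarrow> r \<in> Idl (set (take i fs))) \<longleftrightarrow>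
      regular_mod C (adjoins C {0} (take i (map \<rho> fs))) (map \<rho> fs ! i)" if i: "i < length fs" for i
  proof -
    have f: "fs ! i \<in> carrier R" using fs i by auto
    have "(\<forall>r\<in>carrier R. r \<otimes> fs ! i \<in> Idl (set (take i fs)) \<longrightarrow> r \<in> Idl (set (take i fs))) \<longleftrightarrow>
      (\<forall>r\<in>carrier R. \<rho> r * \<rho> (fs ! i) \<in> adjoins C {0} (take i (map \<rho> fs)) \<longrightarrow>
        \<rho> r \<in> adjoins C {0} (take i (map \<rho> fs)))"
      using mem m_closed[OF _ f] \<rho>_mult[OF _ f] by simp
    also have "\<dots> \<longleftrightarrow> regular_mod C (adjoins C {0} (take i (map \<rho> fs))) (map \<rho> fs ! i)"
      unfolding regular_mod_def image_\<rho>[symmetric] using i by simp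
    finally show ?thesis .
  qed
  moreover have "Idl (set fs) \<noteq> carrier R \<longleftrightarrow> adjoins C {0} (map \<rho> fs) \<noteq> C"
  proof -
    have "Idl (set fs) = carrier R \<longleftrightarrow> \<one> \<in> Idl (set fs)"
      using ideal.one_imp_carrier[OF genideal_ideal[OF fs]] by auto
    also have "\<dots> \<longleftrightarrow> 1 \<in> adjoins C {0} (map \<rho> fs)" using genideal_mem[OF fs one_closed] \<rho>_one by simp
    also have "\<dots> \<longleftrightarrow> adjoins C {0} (map \<rho> fs) = C"
    proof
      have A: "ideal_on C (adjoins C {0} (map \<rho> fs))"
        by (rule ideal_on_adjoins[OF subring_C ideal_on_zero[OF subring_C]]) (use fs \<rho>_in in auto)
      assume "1 \<in> adjoins C {0} (map \<rho> fs)"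
      then have "x \<in> adjoins C {0} (map \<rho> fs)" if "x \<in> C" for x
        using ideal_onD(4)[OF A \<open>x \<in> C\<close>, of 1] by simp
      then show "adjoins C {0} (map \<rho> fs) = C" using ideal_onD(1)[OF A] by blast
    qed (use subring_onD(2)[OF subring_C] in simp)
    finally show ?thesis by simp
  qed
  moreover have "set (map \<rho> fs) \<subseteq> C" using fs \<rho>_in by auto
  ultimately show ?thesis
    unfolding regular_sequence_def regular_seq_on_def regular_list_iff using fs by simp
qed

text \<open>Vectors of \<open>free_module\<close> are undefined beyond their length, those of
  \<open>vecs\<close> vanish there; \<open>to_vec\<close> and \<open>of_vec\<close> translate
  between the two, entrywise along \<open>\<rho>\<close> and its inverse.\<close>

definition "to_vec n u = (\<lambda>j. if j < n then \<rho> (u j) else 0)"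

definition "of_vec n v = (\<lambda>j\<in>{..<n}. \<rho>' (v j))"

lemma to_vec_in: "u \<in> {..<n} \<rightarrow>\<^sub>E carrier R \<Longrightarrow> to_vec n u \<in> vecs C n"
  by (auto simp: vecs_def to_vec_def intro!: \<rho>_in)

lemma of_vec_in: "v \<in> vecs C n \<Longrightarrow> of_vec n v \<in> {..<n} \<rightarrow>\<^sub>E carrier R"
  by (auto simp: vecs_def of_vec_def intro!: \<rho>'_in)

lemma to_of: "v \<in> vecs C n \<Longrightarrow> to_vec n (of_vec n v) = v"
  by (auto simp: vecs_def of_vec_def to_vec_def \<rho>_\<rho>' fun_eq_iff)

lemma of_to: "u \<in> {..<n} \<rightarrow>\<^sub>E carrier R \<Longrightarrow> of_vec n (to_vec n u) = u"
proof (rule ext)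
  fix j assume u: "u \<in> {..<n} \<rightarrow>\<^sub>E carrier R"
  show "of_vec n (to_vec n u) j = u j"
  proof (cases "j < n")
    case True
    then show ?thesis using PiE_mem[OF u, of j] by (simp add: of_vec_def to_vec_def \<rho>'_\<rho>)
  next
    case False
    then show ?thesis using PiE_arb[OF u, of j] by (simp add: of_vec_def)
  qed
qed

lemma to_vec_ops:
  assumes "u \<in> {..<n} \<rightarrow>\<^sub>E carrier R" "v \<in> {..<n} \<rightarrow>\<^sub>E carrier R" "r \<in> carrier R"
  shows "to_vec n (\<lambda>j\<in>{..<n}. u j \<oplus> v j) = (\<lambda>j. to_vec n u j + to_vec n v j)"
    "to_vec n (\<lambda>j\<in>{..<n}. r \<otimes> u j) = (\<lambda>j. \<rho> r * to_vec n u j)"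
proof -
  have "u j \<in> carrier R" "v j \<in> carrier R" if "j < n" for j
    using PiE_mem[OF assms(1)] PiE_mem[OF assms(2)] that by auto
  then show "to_vec n (\<lambda>j\<in>{..<n}. u j \<oplus> v j) = (\<lambda>j. to_vec n u j + to_vec n v j)"
    "to_vec n (\<lambda>j\<in>{..<n}. r \<otimes> u j) = (\<lambda>j. \<rho> r * to_vec n u j)"
    using assms(3) by (auto simp: to_vec_def \<rho>_add \<rho>_mult)
qed

lemma of_vec_ops:
  assumes u: "u \<in> vecs C n" and v: "v \<in> vecs C n" and r: "r \<in> C"
  shows "of_vec n (\<lambda>j. u j + v j) = (\<lambda>j\<in>{..<n}. of_vec n u j \<oplus> of_vec n v j)"
    "of_vec n (\<lambda>j. r * u j) = (\<lambda>j\<in>{..<n}. \<rho>' r \<otimes> of_vec n u j)"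
proof -
  note iu = of_vec_in[OF u] and iv = of_vec_in[OF v] and ir = \<rho>'_in[OF r]
  have a: "(\<lambda>j\<in>{..<n}. of_vec n u j \<oplus> of_vec n v j) \<in> {..<n} \<rightarrow>\<^sub>E carrier R"
    and b: "(\<lambda>j\<in>{..<n}. \<rho>' r \<otimes> of_vec n u j) \<in> {..<n} \<rightarrow>\<^sub>E carrier R"
    using iu iv ir by (auto simp: PiE_mem)
  show "of_vec n (\<lambda>j. u j + v j) = (\<lambda>j\<in>{..<n}. of_vec n u j \<oplus> of_vec n v j)"
    using of_to[OF a] to_vec_ops(1)[OF iu iv ir] to_of[OF u] to_of[OF v] by simp
  show "of_vec n (\<lambda>j. r * u j) = (\<lambda>j\<in>{..<n}. \<rho>' r \<otimes> of_vec n u j)"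
    using of_to[OF b] to_vec_ops(2)[OF iu iv ir] to_of[OF u] \<rho>_\<rho>'[OF r] by simp
qed

lemma to_vec_zero: "to_vec n (\<lambda>j\<in>{..<n}. \<zero>) = (\<lambda>_. 0)"
  by (auto simp: to_vec_def \<rho>_zero)

lemma to_vec_image: "to_vec n ` ({..<n} \<rightarrow>\<^sub>E carrier R) = vecs C n"
  by (rule image_eq_by_inverse[of _ _ _ "of_vec n"]) (simp_all add: to_vec_in of_vec_in to_of)

lemma of_vec_image: "of_vec n ` vecs C n = {..<n} \<rightarrow>\<^sub>E carrier R"
  by (rule image_eq_by_inverse[of _ _ _ "to_vec n"]) (simp_all add: to_vec_in of_vec_in of_to)

lemma to_vec_eq_zero: "u \<in> {..<n} \<rightarrow>\<^sub>E carrier R \<Longrightarrow> to_vec n u = (\<lambda>_. 0) \<longleftrightarrow> u = (\<lambda>j\<in>{..<n}. \<zero>)"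
proof -
  assume u: "u \<in> {..<n} \<rightarrow>\<^sub>E carrier R"
  have z: "(\<lambda>j\<in>{..<n}. \<zero>) \<in> {..<n} \<rightarrow>\<^sub>E carrier R" by simp
  show ?thesis using of_to[OF u] of_to[OF z] to_vec_zero[of n] by metis
qed

end

text \<open>\<open>\<psi>\<close> runs from the model to the record, opposite to
  \<open>\<rho>\<close>, because elements of the associated graded ring are reached from series by
  \<open>to_gr\<close>.\<close>

locale module_model = ring_model R \<rho> C
  for R :: "('q, 'x) ring_scheme" (structure) and \<rho> :: "'q \<Rightarrow> 'r::comm_ring_1" and C +
  fixes N :: "('q, 'a) module" and \<psi> :: "'m::ab_group_add \<Rightarrow> 'a" and M and act :: "'r \<Rightarrow> 'm \<Rightarrow> 'm"
  assumes \<psi>_bij: "bij_betw \<psi> M (carrier N)"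
    and \<psi>_add: "x \<in> M \<Longrightarrow> y \<in> M \<Longrightarrow> x + y \<in> M \<and> \<psi> (x + y) = \<psi> x \<oplus>\<^bsub>N\<^esub> \<psi> y"
    and \<psi>_zero: "0 \<in> M" "\<psi> 0 = \<zero>\<^bsub>N\<^esub>"
    and \<psi>_act: "r \<in> carrier R \<Longrightarrow> x \<in> M \<Longrightarrow> act (\<rho> r) x \<in> M \<and> \<psi> (act (\<rho> r) x) = r \<odot>\<^bsub>N\<^esub> \<psi> x"
begin

definition "\<psi>' = inv_into M \<psi>"

lemma \<psi>_in: "x \<in> M \<Longrightarrow> \<psi> x \<in> carrier N"
  and \<psi>'_in: "y \<in> carrier N \<Longrightarrow> \<psi>' y \<in> M"
  and \<psi>_\<psi>': "y \<in> carrier N \<Longrightarrow> \<psi> (\<psi>' y) = y"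
  and \<psi>'_\<psi>: "x \<in> M \<Longrightarrow> \<psi>' (\<psi> x) = x"
  using \<psi>_bij unfolding \<psi>'_def bij_betw_def
  by (auto simp: inv_into_f_f f_inv_into_f intro: inv_into_into)

lemma \<psi>'_add: "x \<in> carrier N \<Longrightarrow> y \<in> carrier N \<Longrightarrow> \<psi>' (x \<oplus>\<^bsub>N\<^esub> y) = \<psi>' x + \<psi>' y"
  using \<psi>_add[of "\<psi>' x" "\<psi>' y"] \<psi>'_\<psi>[of "\<psi>' x + \<psi>' y"] \<psi>'_in \<psi>_\<psi>' by metis

lemma \<psi>'_smult: "r \<in> carrier R \<Longrightarrow> x \<in> carrier N \<Longrightarrow> \<psi>' (r \<odot>\<^bsub>N\<^esub> x) = act (\<rho> r) (\<psi>' x)"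
  using \<psi>_act[of r "\<psi>' x"] \<psi>'_\<psi>[of "act (\<rho> r) (\<psi>' x)"] \<psi>'_in \<psi>_\<psi>' by metis

lemma \<psi>'_eq_zero: "x \<in> carrier N \<Longrightarrow> \<psi>' x = 0 \<longleftrightarrow> x = \<zero>\<^bsub>N\<^esub>"
  using \<psi>_zero \<psi>_\<psi>' \<psi>'_\<psi> by metis

lemma \<psi>_eq_zero: "x \<in> M \<Longrightarrow> \<psi> x = \<zero>\<^bsub>N\<^esub> \<longleftrightarrow> x = 0"
  using \<psi>_zero \<psi>'_\<psi> by metis

lemma resolution_of_free:
  assumes "free_resolution R N \<beta> \<epsilon> d"
  shows "resolution C act M \<beta> (\<lambda>v. \<psi>' (\<epsilon> (of_vec (\<beta> 0) v))) (\<lambda>i v. to_vec (\<beta> i) (d i (of_vec (\<beta> (Suc i)) v)))"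
proof -
  let ?F = "\<lambda>n. {..<n} \<rightarrow>\<^sub>E carrier R"
  have eps: "\<epsilon> \<in> ?F (\<beta> 0) \<rightarrow> carrier N"
    "\<And>x y. x \<in> ?F (\<beta> 0) \<Longrightarrow> y \<in> ?F (\<beta> 0) \<Longrightarrow> \<epsilon> (\<lambda>j\<in>{..<\<beta> 0}. x j \<oplus> y j) = \<epsilon> x \<oplus>\<^bsub>N\<^esub> \<epsilon> y"
    "\<And>r x. r \<in> carrier R \<Longrightarrow> x \<in> ?F (\<beta> 0) \<Longrightarrow> \<epsilon> (\<lambda>j\<in>{..<\<beta> 0}. r \<otimes> x j) = r \<odot>\<^bsub>N\<^esub> \<epsilon> x"
    "\<epsilon> ` ?F (\<beta> 0) = carrier N"
    and d: "\<And>i. d i \<in> ?F (\<beta> (Suc i)) \<rightarrow> ?F (\<beta> i)"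
    "\<And>i x y. x \<in> ?F (\<beta> (Suc i)) \<Longrightarrow> y \<in> ?F (\<beta> (Suc i)) \<Longrightarrow>
       d i (\<lambda>j\<in>{..<\<beta> (Suc i)}. x j \<oplus> y j) = (\<lambda>j\<in>{..<\<beta> i}. d i x j \<oplus> d i y j)"
    "\<And>i r x. r \<in> carrier R \<Longrightarrow> x \<in> ?F (\<beta> (Suc i)) \<Longrightarrow>
       d i (\<lambda>j\<in>{..<\<beta> (Suc i)}. r \<otimes> x j) = (\<lambda>j\<in>{..<\<beta> i}. r \<otimes> d i x j)"
    and ex0: "d 0 ` ?F (\<beta> (Suc 0)) = {v \<in> ?F (\<beta> 0). \<epsilon> v = \<zero>\<^bsub>N\<^esub>}"
    and ex: "\<And>i. d (Suc i) ` ?F (\<beta> (Suc (Suc i))) = {v \<in> ?F (\<beta> (Suc i)). d i v = (\<lambda>j\<in>{..<\<beta> i}. \<zero>)}"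
    using assms unfolding free_resolution_def linear_maps_def Let_def by (simp_all add: numeral_2_eq_2)
  have dF: "d i x \<in> ?F (\<beta> i)" if "x \<in> ?F (\<beta> (Suc i))" for i x using d(1)[of i] that by blast
  have eN: "\<epsilon> x \<in> carrier N" if "x \<in> ?F (\<beta> 0)" for x using eps(1) that by blast
  show ?thesis
    unfolding resolution_def
  proof (intro conjI allI ballI)
    show "linear_form C (\<beta> 0) act (\<lambda>v. \<psi>' (\<epsilon> (of_vec (\<beta> 0) v)))"
      unfolding linear_form_def
    proof (intro conjI ballI)
      fix u v assume u: "u \<in> vecs C (\<beta> 0)" and v: "v \<in> vecs C (\<beta> 0)"
      show "\<psi>' (\<epsilon> (of_vec (\<beta> 0) (\<lambda>j. u j + v j))) = \<psi>' (\<epsilon> (of_vec (\<beta> 0) u)) + \<psi>' (\<epsilon> (of_vec (\<beta> 0) v))"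
        unfolding of_vec_ops(1)[OF u v subring_onD(1)[OF subring_C]]
        using eps(2) of_vec_in[OF u] of_vec_in[OF v] eN \<psi>'_add by simp
    next
      fix r u assume r: "r \<in> C" and u: "u \<in> vecs C (\<beta> 0)"
      show "\<psi>' (\<epsilon> (of_vec (\<beta> 0) (\<lambda>j. r * u j))) = act r (\<psi>' (\<epsilon> (of_vec (\<beta> 0) u)))"
        unfolding of_vec_ops(2)[OF u u r]
        using eps(3) of_vec_in[OF u] eN \<psi>'_smult \<rho>'_in[OF r] \<rho>_\<rho>'[OF r] by simp
    qed
  next
    fix i u assume "u \<in> vecs C (\<beta> (Suc i))"
    then show "to_vec (\<beta> i) (d i (of_vec (\<beta> (Suc i)) u)) \<in> vecs C (\<beta> i)"
      by (intro to_vec_in dF of_vec_in)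
  next
    fix i j
    show "linear_form C (\<beta> (Suc i)) (*) (\<lambda>u. to_vec (\<beta> i) (d i (of_vec (\<beta> (Suc i)) u)) j)"
      unfolding linear_form_def
    proof (intro conjI ballI)
      fix u v assume u: "u \<in> vecs C (\<beta> (Suc i))" and v: "v \<in> vecs C (\<beta> (Suc i))"
      show "to_vec (\<beta> i) (d i (of_vec (\<beta> (Suc i)) (\<lambda>j. u j + v j))) j =
          to_vec (\<beta> i) (d i (of_vec (\<beta> (Suc i)) u)) j + to_vec (\<beta> i) (d i (of_vec (\<beta> (Suc i)) v)) j"
        unfolding of_vec_ops(1)[OF u v subring_onD(1)[OF subring_C]] d(2)[OF of_vec_in[OF u] of_vec_in[OF v]]
          to_vec_ops(1)[OF dF[OF of_vec_in[OF u]] dF[OF of_vec_in[OF v]] \<rho>'_in[OF subring_onD(1)[OF subring_C]]] ..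
    next
      fix r u assume r: "r \<in> C" and u: "u \<in> vecs C (\<beta> (Suc i))"
      show "to_vec (\<beta> i) (d i (of_vec (\<beta> (Suc i)) (\<lambda>j. r * u j))) j =
          r * to_vec (\<beta> i) (d i (of_vec (\<beta> (Suc i)) u)) j"
        unfolding of_vec_ops(2)[OF u u r] d(3)[OF \<rho>'_in[OF r] of_vec_in[OF u]]
          to_vec_ops(2)[OF dF[OF of_vec_in[OF u]] dF[OF of_vec_in[OF u]] \<rho>'_in[OF r]] \<rho>_\<rho>'[OF r] ..
    qed
  next
    have "(\<lambda>v. \<psi>' (\<epsilon> (of_vec (\<beta> 0) v))) ` vecs C (\<beta> 0) = \<psi>' ` \<epsilon> ` of_vec (\<beta> 0) ` vecs C (\<beta> 0)"
      by (simp add: image_image)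
    also have "\<dots> = \<psi>' ` carrier N" unfolding of_vec_image eps(4) ..
    also have "\<dots> = M" 
      by (rule image_eq_by_inverse[of _ _ _ \<psi>]) (simp_all add: \<psi>'_in \<psi>_in \<psi>'_\<psi>)
    finally show "(\<lambda>v. \<psi>' (\<epsilon> (of_vec (\<beta> 0) v))) ` vecs C (\<beta> 0) = M" .
  next
    have "(\<lambda>v. to_vec (\<beta> 0) (d 0 (of_vec (\<beta> (Suc 0)) v))) ` vecs C (\<beta> (Suc 0)) =
        to_vec (\<beta> 0) ` d 0 ` of_vec (\<beta> (Suc 0)) ` vecs C (\<beta> (Suc 0))" by (simp add: image_image)
    also have "\<dots> = to_vec (\<beta> 0) ` {v \<in> ?F (\<beta> 0). \<epsilon> v = \<zero>\<^bsub>N\<^esub>}" unfolding of_vec_image ex0 ..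
    also have "\<dots> = {v \<in> vecs C (\<beta> 0). \<psi>' (\<epsilon> (of_vec (\<beta> 0) v)) = 0}"
      by (rule image_Collect_by_inverse[where g = "of_vec (\<beta> 0)"
          and Q = "\<lambda>x. \<psi>' (\<epsilon> x) = 0"])
        (simp_all add: of_to to_of to_vec_in of_vec_in eN \<psi>'_eq_zero)
    finally show "(\<lambda>v. to_vec (\<beta> 0) (d 0 (of_vec (\<beta> (Suc 0)) v))) ` vecs C (\<beta> (Suc 0)) =
        {v \<in> vecs C (\<beta> 0). \<psi>' (\<epsilon> (of_vec (\<beta> 0) v)) = 0}" .
  next
    fix i
    have "(\<lambda>v. to_vec (\<beta> (Suc i)) (d (Suc i) (of_vec (\<beta> (Suc (Suc i))) v))) ` vecs C (\<beta> (Suc (Suc i))) =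
        to_vec (\<beta> (Suc i)) ` d (Suc i) ` of_vec (\<beta> (Suc (Suc i))) ` vecs C (\<beta> (Suc (Suc i)))"
      by (simp add: image_image)
    also have "\<dots> = to_vec (\<beta> (Suc i)) ` {v \<in> ?F (\<beta> (Suc i)). d i v = (\<lambda>j\<in>{..<\<beta> i}. \<zero>)}"
      unfolding of_vec_image ex ..
    also have "\<dots> = {v \<in> vecs C (\<beta> (Suc i)). to_vec (\<beta> i) (d i (of_vec (\<beta> (Suc i)) v)) = (\<lambda>_. 0)}"
      by (rule image_Collect_by_inverse[where g = "of_vec (\<beta> (Suc i))"
          and Q = "\<lambda>x. to_vec (\<beta> i) (d i x) = (\<lambda>_. 0)"])
        (simp_all add: of_to to_of to_vec_in of_vec_in to_vec_eq_zero[OF dF])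
    finally show "(\<lambda>v. to_vec (\<beta> (Suc i)) (d (Suc i) (of_vec (\<beta> (Suc (Suc i))) v))) ` vecs C (\<beta> (Suc (Suc i))) =
        {v \<in> vecs C (\<beta> (Suc i)). to_vec (\<beta> i) (d i (of_vec (\<beta> (Suc i)) v)) = (\<lambda>_. 0)}" .
  qed
qed

lemma free_of_resolution:
  assumes res: "resolution C act M \<beta> \<epsilon> d"
  shows "free_resolution R N \<beta> (\<lambda>u. \<psi> (\<epsilon> (to_vec (\<beta> 0) u))) (\<lambda>i u. of_vec (\<beta> i) (d i (to_vec (\<beta> (Suc i)) u)))"
proof -
  let ?F = "\<lambda>n. {..<n} \<rightarrow>\<^sub>E carrier R"
  have eps: "linear_form C (\<beta> 0) act \<epsilon>" "\<epsilon> ` vecs C (\<beta> 0) = M"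
    and dV: "\<And>i u. u \<in> vecs C (\<beta> (Suc i)) \<Longrightarrow> d i u \<in> vecs C (\<beta> i)"
    and d_lin: "\<And>i j. linear_form C (\<beta> (Suc i)) (*) (\<lambda>u. d i u j)"
    and ex0: "d 0 ` vecs C (\<beta> (Suc 0)) = {v \<in> vecs C (\<beta> 0). \<epsilon> v = 0}"
    and ex: "\<And>i. d (Suc i) ` vecs C (\<beta> (Suc (Suc i))) = {v \<in> vecs C (\<beta> (Suc i)). d i v = (\<lambda>_. 0)}"
    using res unfolding resolution_def by blast+
  have eM: "\<epsilon> v \<in> M" if "v \<in> vecs C (\<beta> 0)" for v using eps(2) that by blast
  have z: "\<zero> \<in> carrier R" using R by (simp add: cring.cring_simprules)
  have of_zero: "of_vec n v = (\<lambda>j\<in>{..<n}. \<zero>) \<longleftrightarrow> v = (\<lambda>_. 0)" if "v \<in> vecs C n" for n v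
    using to_vec_eq_zero[OF of_vec_in[OF that]] to_of[OF that] by simp
  show ?thesis
    unfolding free_resolution_def Let_def linear_maps_def free_module_simps numeral_2_eq_2 Suc_eq_plus1[symmetric] add_Suc_right add_0_right One_nat_def
  proof (intro conjI allI CollectI ballI)
    show "(\<lambda>u. \<psi> (\<epsilon> (to_vec (\<beta> 0) u))) \<in> ?F (\<beta> 0) \<rightarrow> carrier N"
      using eM \<psi>_in to_vec_in by auto
    fix x assume x: "x \<in> ?F (\<beta> 0)"
    { fix y assume y: "y \<in> ?F (\<beta> 0)"
      show "\<psi> (\<epsilon> (to_vec (\<beta> 0) (\<lambda>j\<in>{..<\<beta> 0}. x j \<oplus> y j))) =
          \<psi> (\<epsilon> (to_vec (\<beta> 0) x)) \<oplus>\<^bsub>N\<^esub> \<psi> (\<epsilon> (to_vec (\<beta> 0) y))"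
        unfolding to_vec_ops(1)[OF x y z] linear_form_add[OF eps(1) to_vec_in[OF x] to_vec_in[OF y]]
        using \<psi>_add eM to_vec_in[OF x] to_vec_in[OF y] by blast }
    fix r assume r: "r \<in> carrier R"
    show "\<psi> (\<epsilon> (to_vec (\<beta> 0) (\<lambda>j\<in>{..<\<beta> 0}. r \<otimes> x j))) = r \<odot>\<^bsub>N\<^esub> \<psi> (\<epsilon> (to_vec (\<beta> 0) x))"
      unfolding to_vec_ops(2)[OF x x r] linear_form_scale[OF eps(1) \<rho>_in[OF r] to_vec_in[OF x]]
      using \<psi>_act[OF r eM[OF to_vec_in[OF x]]] by blast
  next
    fix i
    show "(\<lambda>u. of_vec (\<beta> i) (d i (to_vec (\<beta> (Suc i)) u))) \<in> ?F (\<beta> (Suc i)) \<rightarrow> ?F (\<beta> i)"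
      using dV of_vec_in to_vec_in by blast
    fix x assume x: "x \<in> ?F (\<beta> (Suc i))"
    { fix y assume y: "y \<in> ?F (\<beta> (Suc i))"
      have "d i (\<lambda>j. to_vec (\<beta> (Suc i)) x j + to_vec (\<beta> (Suc i)) y j) =
          (\<lambda>j. d i (to_vec (\<beta> (Suc i)) x) j + d i (to_vec (\<beta> (Suc i)) y) j)"
        by (rule ext) (rule linear_form_add[OF d_lin to_vec_in[OF x] to_vec_in[OF y]])
      then show "of_vec (\<beta> i) (d i (to_vec (\<beta> (Suc i)) (\<lambda>j\<in>{..<\<beta> (Suc i)}. x j \<oplus> y j))) =
          (\<lambda>j\<in>{..<\<beta> i}. of_vec (\<beta> i) (d i (to_vec (\<beta> (Suc i)) x)) j \<oplus> of_vec (\<beta> i) (d i (to_vec (\<beta> (Suc i)) y)) j)"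
        unfolding to_vec_ops(1)[OF x y z]
        using of_vec_ops(1)[OF dV[OF to_vec_in[OF x]] dV[OF to_vec_in[OF y]] subring_onD(1)[OF subring_C]] by simp }
    fix r assume r: "r \<in> carrier R"
    have "d i (\<lambda>j. \<rho> r * to_vec (\<beta> (Suc i)) x j) = (\<lambda>j. \<rho> r * d i (to_vec (\<beta> (Suc i)) x) j)"
      by (rule ext) (rule linear_form_scale[OF d_lin \<rho>_in[OF r] to_vec_in[OF x]])
    then show "of_vec (\<beta> i) (d i (to_vec (\<beta> (Suc i)) (\<lambda>j\<in>{..<\<beta> (Suc i)}. r \<otimes> x j))) =
        (\<lambda>j\<in>{..<\<beta> i}. r \<otimes> of_vec (\<beta> i) (d i (to_vec (\<beta> (Suc i)) x)) j)"
      unfolding to_vec_ops(2)[OF x x r]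
      using of_vec_ops(2)[OF dV[OF to_vec_in[OF x]] dV[OF to_vec_in[OF x]] \<rho>_in[OF r]] \<rho>'_\<rho>[OF r] by simp
  next
    have "(\<lambda>u. \<psi> (\<epsilon> (to_vec (\<beta> 0) u))) ` ?F (\<beta> 0) = \<psi> ` \<epsilon> ` to_vec (\<beta> 0) ` ?F (\<beta> 0)" by (simp add: image_image)
    also have "\<dots> = carrier N" unfolding to_vec_image eps(2) using \<psi>_bij by (simp add: bij_betw_def)
    finally show "(\<lambda>u. \<psi> (\<epsilon> (to_vec (\<beta> 0) u))) ` ?F (\<beta> 0) = carrier N" .
  next
    have "(\<lambda>u. of_vec (\<beta> 0) (d 0 (to_vec (\<beta> (Suc 0)) u))) ` ?F (\<beta> (Suc 0)) =
        of_vec (\<beta> 0) ` d 0 ` to_vec (\<beta> (Suc 0)) ` ?F (\<beta> (Suc 0))" by (simp add: image_image)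
    also have "\<dots> = of_vec (\<beta> 0) ` {v \<in> vecs C (\<beta> 0). \<epsilon> v = 0}" unfolding to_vec_image ex0 ..
    also have "\<dots> = {v \<in> ?F (\<beta> 0). \<psi> (\<epsilon> (to_vec (\<beta> 0) v)) = \<zero>\<^bsub>N\<^esub>}"
      by (rule image_Collect_by_inverse[where g = "to_vec (\<beta> 0)"
          and Q = "\<lambda>x. \<psi> (\<epsilon> x) = \<zero>\<^bsub>N\<^esub>"])
        (simp_all add: of_to to_of to_vec_in of_vec_in eM \<psi>_eq_zero)
    finally show "(\<lambda>u. of_vec (\<beta> 0) (d 0 (to_vec (\<beta> (Suc 0)) u))) ` ?F (\<beta> (Suc 0)) =
        {v \<in> ?F (\<beta> 0). \<psi> (\<epsilon> (to_vec (\<beta> 0) v)) = \<zero>\<^bsub>N\<^esub>}" .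
  next
    fix i
    have "(\<lambda>u. of_vec (\<beta> (Suc i)) (d (Suc i) (to_vec (\<beta> (Suc (Suc i))) u))) ` ?F (\<beta> (Suc (Suc i))) =
        of_vec (\<beta> (Suc i)) ` d (Suc i) ` to_vec (\<beta> (Suc (Suc i))) ` ?F (\<beta> (Suc (Suc i)))"
      by (simp add: image_image)
    also have "\<dots> = of_vec (\<beta> (Suc i)) ` {v \<in> vecs C (\<beta> (Suc i)). d i v = (\<lambda>_. 0)}"
      unfolding to_vec_image ex ..
    also have "\<dots> = {v \<in> ?F (\<beta> (Suc i)). of_vec (\<beta> i) (d i (to_vec (\<beta> (Suc i)) v)) = (\<lambda>j\<in>{..<\<beta> i}. \<zero>)}"
      by (rule image_Collect_by_inverse[where g = "to_vec (\<beta> (Suc i))"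
          and Q = "\<lambda>x. of_vec (\<beta> i) (d i x) = (\<lambda>j\<in>{..<\<beta> i}. \<zero>)"])
        (simp_all add: of_to to_of to_vec_in of_vec_in of_zero[OF dV])
    finally show "(\<lambda>u. of_vec (\<beta> (Suc i)) (d (Suc i) (to_vec (\<beta> (Suc (Suc i))) u))) ` ?F (\<beta> (Suc (Suc i))) =
        {v \<in> ?F (\<beta> (Suc i)). of_vec (\<beta> i) (d i (to_vec (\<beta> (Suc i)) v)) = (\<lambda>j\<in>{..<\<beta> i}. \<zero>)}" .
  qed
qed

definition "minimal_resolution \<mm> \<beta> \<epsilon> d \<longleftrightarrow> resolution C act M \<beta> \<epsilon> d \<and>
  (\<forall>i. \<forall>v\<in>vecs C (\<beta> (Suc i)). \<forall>j<\<beta> i. d i v j \<in> \<mm>)"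

definition "graded_resolution H MH (\<beta> :: nat \<Rightarrow> nat) \<epsilon> d (a :: nat \<Rightarrow> nat \<Rightarrow> int) \<longleftrightarrow>
  (\<forall>e. \<forall>v\<in>vecs C (\<beta> 0). (\<forall>j<\<beta> 0. v j \<in> H (e - a 0 j)) \<longrightarrow> \<epsilon> v \<in> MH e) \<and>
  (\<forall>i e. \<forall>v\<in>vecs C (\<beta> (Suc i)). (\<forall>j<\<beta> (Suc i). v j \<in> H (e - a (Suc i) j)) \<longrightarrow>
    (\<forall>j<\<beta> i. d i v j \<in> H (e - a i j)))"

lemma has_betti_numbers_iff:
  assumes mm: "\<And>x. x \<in> carrier R \<Longrightarrow> x \<in> I \<longleftrightarrow> \<rho> x \<in> \<mm>"
  shows "has_betti_numbers R I N \<beta> \<longleftrightarrow> (\<exists>\<epsilon> d. minimal_resolution \<mm> \<beta> \<epsilon> d)"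
proof
  assume "has_betti_numbers R I N \<beta>"
  then obtain \<epsilon> d where fr: "free_resolution R N \<beta> \<epsilon> d" and min: "minimal_differentials R I \<beta> d"
    unfolding has_betti_numbers_def by blast
  have "to_vec (\<beta> i) (d i (of_vec (\<beta> (Suc i)) v)) j \<in> \<mm>" if v: "v \<in> vecs C (\<beta> (Suc i))" and j: "j < \<beta> i" for i v j
  proof -
    have "d i \<in> ({..<\<beta> (Suc i)} \<rightarrow>\<^sub>E carrier R) \<rightarrow> ({..<\<beta> i} \<rightarrow>\<^sub>E carrier R)"
      using fr by (simp add: free_resolution_def Let_def linear_maps_def)
    then have "d i (of_vec (\<beta> (Suc i)) v) j \<in> carrier R" using of_vec_in[OF v] j by (blast intro: PiE_mem)
    moreover have "d i (of_vec (\<beta> (Suc i)) v) j \<in> I"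
      using min of_vec_in[OF v] j unfolding minimal_differentials_def by simp
    ultimately show ?thesis using mm j by (simp add: to_vec_def)
  qed
  then show "\<exists>\<epsilon> d. minimal_resolution \<mm> \<beta> \<epsilon> d"
    unfolding minimal_resolution_def using resolution_of_free[OF fr] by blast
next
  assume "\<exists>\<epsilon> d. minimal_resolution \<mm> \<beta> \<epsilon> d"
  then obtain \<epsilon> d where res: "resolution C act M \<beta> \<epsilon> d"
    and min: "\<And>i v j. v \<in> vecs C (\<beta> (Suc i)) \<Longrightarrow> j < \<beta> i \<Longrightarrow> d i v j \<in> \<mm>" unfolding minimal_resolution_def by blast
  have "minimal_differentials R I \<beta> (\<lambda>i u. of_vec (\<beta> i) (d i (to_vec (\<beta> (Suc i)) u)))"
    unfolding minimal_differentials_def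
  proof (intro allI ballI impI)
    fix i v j assume "v \<in> carrier (free_module R (\<beta> (i + 1)))" and j: "j < \<beta> i"
    then have v: "to_vec (\<beta> (Suc i)) v \<in> vecs C (\<beta> (Suc i))" by (simp add: to_vec_in)
    have "d i (to_vec (\<beta> (Suc i)) v) j \<in> C" using res v j by (auto simp: resolution_def vecs_def)
    then show "of_vec (\<beta> i) (d i (to_vec (\<beta> (Suc i)) v)) j \<in> I"
      using min[OF v j] mm \<rho>'_in \<rho>_\<rho>' j by (simp add: of_vec_def)
  qed
  then show "has_betti_numbers R I N \<beta>"
    unfolding has_betti_numbers_def using free_of_resolution[OF res] by blast
qed

lemma has_graded_betti_numbers_iff:
  assumes mm: "\<And>x. x \<in> carrier R \<Longrightarrow> x \<in> I \<longleftrightarrow> \<rho> x \<in> \<mm>"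
    and H: "\<And>x e. x \<in> carrier R \<Longrightarrow> x \<in> RH e \<longleftrightarrow> \<rho> x \<in> H e"
    and MH: "\<And>x e. x \<in> M \<Longrightarrow> \<psi> x \<in> NH e \<longleftrightarrow> x \<in> MH e"
  shows "has_graded_betti_numbers R RH I N NH \<beta> \<longleftrightarrow>
    (\<exists>\<epsilon> d a. minimal_resolution \<mm> \<beta> \<epsilon> d \<and> graded_resolution H MH \<beta> \<epsilon> d a)"
proof
  assume "has_graded_betti_numbers R RH I N NH \<beta>"
  then obtain \<epsilon> d a where fr: "free_resolution R N \<beta> \<epsilon> d" and min: "minimal_differentials R I \<beta> d"
    and g0: "\<And>e. \<epsilon> ` free_hom R RH (\<beta> 0) (a 0) e \<subseteq> NH e"
    and gd: "\<And>i e. d i ` free_hom R RH (\<beta> (i + 1)) (a (i + 1)) e \<subseteq> free_hom R RH (\<beta> i) (a i) e"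
    unfolding has_graded_betti_numbers_def by blast
  let ?\<epsilon> = "\<lambda>v. \<psi>' (\<epsilon> (of_vec (\<beta> 0) v))" and ?d = "\<lambda>i v. to_vec (\<beta> i) (d i (of_vec (\<beta> (Suc i)) v))"
  have eN: "\<epsilon> \<in> ({..<\<beta> 0} \<rightarrow>\<^sub>E carrier R) \<rightarrow> carrier N"
    and dF: "d i \<in> ({..<\<beta> (Suc i)} \<rightarrow>\<^sub>E carrier R) \<rightarrow> ({..<\<beta> i} \<rightarrow>\<^sub>E carrier R)" for i
    using fr by (simp_all add: free_resolution_def Let_def linear_maps_def)
  have dc: "d i (of_vec (\<beta> (Suc i)) v) j \<in> carrier R" if v: "v \<in> vecs C (\<beta> (Suc i))" and j: "j < \<beta> i" for i v j
    using dF[of i] of_vec_in[OF v] j by (blast intro: PiE_mem)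
  have "?d i v j \<in> \<mm>" if v: "v \<in> vecs C (\<beta> (Suc i))" and j: "j < \<beta> i" for i v j
  proof -
    have "d i (of_vec (\<beta> (Suc i)) v) j \<in> I"
      using min of_vec_in[OF v] j unfolding minimal_differentials_def by simp
    then show ?thesis using mm dc[OF v j] j by (simp add: to_vec_def)
  qed
  then have "minimal_resolution \<mm> \<beta> ?\<epsilon> ?d"
    unfolding minimal_resolution_def using resolution_of_free[OF fr] by blast
  moreover have hom: "of_vec n v \<in> free_hom R RH n b e"
    if "v \<in> vecs C n" "\<forall>j<n. v j \<in> H (e - b j)" for n v b e
    using that of_vec_in[OF that(1)] H \<rho>'_in \<rho>_\<rho>'
    by (auto simp: free_hom_def of_vec_def vecs_def)
  have "graded_resolution H MH \<beta> ?\<epsilon> ?d a"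
    unfolding graded_resolution_def
  proof (intro conjI allI ballI impI)
    fix e v assume v: "v \<in> vecs C (\<beta> 0)" "\<forall>j<\<beta> 0. v j \<in> H (e - a 0 j)"
    have "\<epsilon> (of_vec (\<beta> 0) v) \<in> NH e" using g0 hom[OF v] by blast
    moreover have "\<epsilon> (of_vec (\<beta> 0) v) \<in> carrier N" using eN of_vec_in[OF v(1)] by blast
    ultimately show "?\<epsilon> v \<in> MH e" using MH[OF \<psi>'_in] \<psi>_\<psi>' by simp
  next
    fix i e v j assume v: "v \<in> vecs C (\<beta> (Suc i))" "\<forall>j<\<beta> (Suc i). v j \<in> H (e - a (Suc i) j)" and j: "j < \<beta> i"
    have "d i (of_vec (\<beta> (Suc i)) v) \<in> free_hom R RH (\<beta> i) (a i) e" using gd[of i e] hom[OF v] by auto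
    then show "?d i v j \<in> H (e - a i j)" using j H[OF dc[OF v(1) j]]
      by (auto simp: free_hom_def to_vec_def)
  qed
  ultimately show "\<exists>\<epsilon> d a. minimal_resolution \<mm> \<beta> \<epsilon> d \<and> graded_resolution H MH \<beta> \<epsilon> d a" by blast
next
  assume "\<exists>\<epsilon> d a. minimal_resolution \<mm> \<beta> \<epsilon> d \<and> graded_resolution H MH \<beta> \<epsilon> d a"
  then obtain \<epsilon> d a where m: "minimal_resolution \<mm> \<beta> \<epsilon> d" and g: "graded_resolution H MH \<beta> \<epsilon> d a"
    by blast
  have res: "resolution C act M \<beta> \<epsilon> d" using m unfolding minimal_resolution_def ..
  have min: "d i v j \<in> \<mm>" if "v \<in> vecs C (\<beta> (Suc i))" "j < \<beta> i" for i v j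
    using m that unfolding minimal_resolution_def by blast
  have g0: "\<epsilon> v \<in> MH e" if "v \<in> vecs C (\<beta> 0)" "\<forall>j<\<beta> 0. v j \<in> H (e - a 0 j)" for e v
    using g that unfolding graded_resolution_def by blast
  have gd: "d i v j \<in> H (e - a i j)"
    if "v \<in> vecs C (\<beta> (Suc i))" "\<forall>j<\<beta> (Suc i). v j \<in> H (e - a (Suc i) j)" "j < \<beta> i" for i e v j
    using g that unfolding graded_resolution_def by blast
  let ?d = "\<lambda>i u. of_vec (\<beta> i) (d i (to_vec (\<beta> (Suc i)) u))"
  have dV: "d i v \<in> vecs C (\<beta> i)" if "v \<in> vecs C (\<beta> (Suc i))" for i v
    using res that by (simp add: resolution_def)
  have dC: "d i v j \<in> C" if "v \<in> vecs C (\<beta> (Suc i))" "j < \<beta> i" for i v j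
    using dV[OF that(1)] that(2) by (simp add: vecs_def)
  have "minimal_differentials R I \<beta> ?d"
    unfolding minimal_differentials_def
  proof (intro allI ballI impI)
    fix i v j assume "v \<in> carrier (free_module R (\<beta> (i + 1)))" and j: "j < \<beta> i"
    then have v: "to_vec (\<beta> (Suc i)) v \<in> vecs C (\<beta> (Suc i))" by (simp add: to_vec_in)
    show "?d i v j \<in> I"
      using min[OF v j] dC[OF v j] mm \<rho>'_in \<rho>_\<rho>' j by (simp add: of_vec_def)
  qed
  moreover have tv: "to_vec n u \<in> vecs C n" "\<forall>j<n. to_vec n u j \<in> H (e - b j)"
    if "u \<in> free_hom R RH n b e" for n u b e
  proof -
    have uF: "u \<in> {..<n} \<rightarrow>\<^sub>E carrier R" and uh: "\<forall>j<n. u j \<in> RH (e - b j)"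
      using that by (simp_all add: free_hom_def)
    show "to_vec n u \<in> vecs C n" by (rule to_vec_in[OF uF])
    show "\<forall>j<n. to_vec n u j \<in> H (e - b j)" using uh H[OF PiE_mem[OF uF]] by (simp add: to_vec_def)
  qed
  have "\<psi> (\<epsilon> (to_vec (\<beta> 0) u)) \<in> NH e" if "u \<in> free_hom R RH (\<beta> 0) (a 0) e" for u e
  proof -
    have "\<epsilon> (to_vec (\<beta> 0) u) \<in> M" using res tv(1)[OF that] unfolding resolution_def by blast
    then show ?thesis using MH g0[OF tv[OF that]] by simp
  qed
  then have "(\<lambda>u. \<psi> (\<epsilon> (to_vec (\<beta> 0) u))) ` free_hom R RH (\<beta> 0) (a 0) e \<subseteq> NH e" for e by blast
  moreover have "?d i u \<in> free_hom R RH (\<beta> i) (a i) e"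
    if "u \<in> free_hom R RH (\<beta> (i + 1)) (a (i + 1)) e" for u i e
  proof -
    have u: "u \<in> free_hom R RH (\<beta> (Suc i)) (a (Suc i)) e" using that by simp
    show ?thesis
      using of_vec_in[OF dV[OF tv(1)[OF u]]] gd[OF tv[OF u]] H[OF \<rho>'_in[OF dC[OF tv(1)[OF u]]]]
        \<rho>_\<rho>'[OF dC[OF tv(1)[OF u]]]
      by (simp add: free_hom_def of_vec_def)
  qed
  ultimately show "has_graded_betti_numbers R RH I N NH \<beta>"
    unfolding has_graded_betti_numbers_def using free_of_resolution[OF res] by (blast intro: exI[of _ a])
qed

end

section \<open>Power series and polynomial rings\<close>

text \<open>All ring laws are pulled back along the injective \<open>\<rho>\<close>; closure of
  \<open>C\<close> under negation supplies the additive inverses of the record.\<close>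

lemma cring_by_embedding:
  fixes R :: "('q, 'x) ring_scheme" and \<rho> :: "'q \<Rightarrow> 'r::comm_ring_1"
  assumes bij: "bij_betw \<rho> (carrier R) C" and C: "subring_on C"
    and add: "\<And>x y. x \<in> carrier R \<Longrightarrow> y \<in> carrier R \<Longrightarrow> x \<oplus>\<^bsub>R\<^esub> y \<in> carrier R \<and> \<rho> (x \<oplus>\<^bsub>R\<^esub> y) = \<rho> x + \<rho> y"
    and mult: "\<And>x y. x \<in> carrier R \<Longrightarrow> y \<in> carrier R \<Longrightarrow> x \<otimes>\<^bsub>R\<^esub> y \<in> carrier R \<and> \<rho> (x \<otimes>\<^bsub>R\<^esub> y) = \<rho> x * \<rho> y"
    and one: "\<one>\<^bsub>R\<^esub> \<in> carrier R \<and> \<rho> \<one>\<^bsub>R\<^esub> = 1" and zero: "\<zero>\<^bsub>R\<^esub> \<in> carrier R \<and> \<rho> \<zero>\<^bsub>R\<^esub> = 0"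
  shows "cring R"
proof -
  have eq: "x = y" if "x \<in> carrier R" "y \<in> carrier R" "\<rho> x = \<rho> y" for x y
    using bij that by (auto simp: bij_betw_def inj_on_def)
  have neg: "\<exists>y\<in>carrier R. y \<oplus>\<^bsub>R\<^esub> x = \<zero>\<^bsub>R\<^esub>" if x: "x \<in> carrier R" for x
  proof -
    have "\<rho> x \<in> C" using bij x by (auto simp: bij_betw_def)
    then have "- \<rho> x \<in> \<rho> ` carrier R" using bij subring_onD(5)[OF C] by (simp add: bij_betw_def)
    then obtain y where y: "y \<in> carrier R" "\<rho> y = - \<rho> x" by force
    have "y \<oplus>\<^bsub>R\<^esub> x = \<zero>\<^bsub>R\<^esub>" by (rule eq) (use x y add zero in auto)
    with y show ?thesis by blast
  qed
  show ?thesis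
  proof (rule cringI)
    show "abelian_group R"
      by (rule abelian_groupI) (use add zero neg in \<open>auto intro!: eq simp: algebra_simps\<close>)
    show "comm_monoid R"
      by (rule comm_monoidI) (use mult one in \<open>auto intro!: eq simp: algebra_simps\<close>)
    show "(x \<oplus>\<^bsub>R\<^esub> y) \<otimes>\<^bsub>R\<^esub> z = x \<otimes>\<^bsub>R\<^esub> z \<oplus>\<^bsub>R\<^esub> y \<otimes>\<^bsub>R\<^esub> z"
      if "x \<in> carrier R" "y \<in> carrier R" "z \<in> carrier R" for x y z
      by (rule eq) (use that add mult in \<open>auto simp: algebra_simps\<close>)
  qed
qed

text \<open>The flag distinguishes polynomials (true) from power series (false).\<close>

definition mring :: "bool \<Rightarrow> 'g set \<Rightarrow> ('g multiset \<Rightarrow> 'k::field) ring" where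
  "mring fin G = (if fin then mpoly_ring G else mpower_series_ring G)"

definition mps_on :: "bool \<Rightarrow> 'g set \<Rightarrow> ('g, 'k::field) mps set" where
  "mps_on fin G = {f. (\<forall>m. mcoeff f m \<noteq> 0 \<longrightarrow> set_mset m \<subseteq> G) \<and> (fin \<longrightarrow> finite {m. mcoeff f m \<noteq> 0})}"

lemma mring_simps:
  "carrier (mring fin G) = {f. Abs_mps f \<in> mps_on fin G}"
  "f \<oplus>\<^bsub>mring fin G\<^esub> g = (\<lambda>m. f m + g m)"
  "\<zero>\<^bsub>mring fin G\<^esub> = (\<lambda>m. 0)"
  "\<one>\<^bsub>mring fin G\<^esub> = (\<lambda>m. if m = {#} then 1 else 0)"
  by (auto simp: mring_def mpoly_ring_def mpower_series_ring_def mps_on_def)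

lemma mring_mult: "f \<otimes>\<^bsub>mring fin G\<^esub> g = mcoeff (Abs_mps f * Abs_mps g)"
proof
  fix m
  have "(f \<otimes>\<^bsub>mring fin G\<^esub> g) m = (\<Sum>u | u \<subseteq># m. f u * g (m - u))"
    by (simp add: mring_def mpoly_ring_def mpower_series_ring_def)
  also have "\<dots> = (\<Sum>(u, v) \<in> {(u, v). u + v = m}. f u * g v)"
    by (rule sum.reindex_bij_witness[of _ fst "\<lambda>u. (u, m - u)"]) auto
  finally show "(f \<otimes>\<^bsub>mring fin G\<^esub> g) m = mcoeff (Abs_mps f * Abs_mps g) m"
    by (simp add: mcoeff_mult)
qed

lemma subring_mps_on: "subring_on (mps_on fin G)"
  unfolding subring_on_def
proof (intro conjI ballI)
  show "(1 :: ('a, 'b) mps) \<in> mps_on fin G"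
    by (auto simp: mps_on_def intro: finite_subset[of _ "{{#}}"])
next
  fix f g :: "('a, 'b) mps" assume f: "f \<in> mps_on fin G" and g: "g \<in> mps_on fin G"
  have "{m. mcoeff (f + g) m \<noteq> 0} \<subseteq> {m. mcoeff f m \<noteq> 0} \<union> {m. mcoeff g m \<noteq> 0}" by auto
  then show "f + g \<in> mps_on fin G"
    using f g unfolding mps_on_def by (auto dest: finite_subset)
  have ex: "\<exists>u v. m = u + v \<and> mcoeff f u \<noteq> 0 \<and> mcoeff g v \<noteq> 0" if "mcoeff (f * g) m \<noteq> 0" for m
  proof -
    obtain p where "p \<in> {(u, v). u + v = m}" "(case p of (u, v) \<Rightarrow> mcoeff f u * mcoeff g v) \<noteq> 0"
      using \<open>mcoeff (f * g) m \<noteq> 0\<close> unfolding mcoeff_mult by (meson sum.not_neutral_contains_not_neutral)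
    then show ?thesis by (cases p) auto
  qed
  have "{m. mcoeff (f * g) m \<noteq> 0} \<subseteq> (\<lambda>(u, v). u + v) ` ({m. mcoeff f m \<noteq> 0} \<times> {m. mcoeff g m \<noteq> 0})"
    using ex by fastforce
  then have "finite {m. mcoeff (f * g) m \<noteq> 0}" if fin
    by (rule finite_subset) (use f g that in \<open>auto simp: mps_on_def\<close>)
  moreover have "set_mset m \<subseteq> G" if "mcoeff (f * g) m \<noteq> 0" for m
  proof -
    obtain u v where "m = u + v" "mcoeff f u \<noteq> 0" "mcoeff g v \<noteq> 0"
      using ex[OF \<open>mcoeff (f * g) m \<noteq> 0\<close>] by blast
    then show ?thesis using f g by (simp add: mps_on_def)
  qed
  ultimately show "f * g \<in> mps_on fin G" by (simp add: mps_on_def)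
next
  fix f :: "('a, 'b) mps" assume "f \<in> mps_on fin G"
  then show "- f \<in> mps_on fin G" by (simp add: mps_on_def)
qed

lemma bij_Abs_mps: "bij_betw Abs_mps (carrier (mring fin G)) (mps_on fin G)"
  by (rule bij_betw_byWitness[where f' = mcoeff]) (auto simp: mring_simps mcoeff_inverse)

lemma Abs_mps_add: "Abs_mps (\<lambda>m. f m + g m) = Abs_mps f + Abs_mps g"
  by (rule mps_eqI) simp

lemma cring_mring: "cring (mring fin G)"
proof (rule cring_by_embedding[OF bij_Abs_mps subring_mps_on])
  fix x y :: "'a multiset \<Rightarrow> 'b" assume "x \<in> carrier (mring fin G)" "y \<in> carrier (mring fin G)"
  then have *: "Abs_mps x \<in> mps_on fin G" "Abs_mps y \<in> mps_on fin G" by (auto simp: mring_simps)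
  show "x \<oplus>\<^bsub>mring fin G\<^esub> y \<in> carrier (mring fin G) \<and>
      Abs_mps (x \<oplus>\<^bsub>mring fin G\<^esub> y) = Abs_mps x + Abs_mps y"
    using subring_onD(3)[OF subring_mps_on *] by (simp add: mring_simps Abs_mps_add)
  show "x \<otimes>\<^bsub>mring fin G\<^esub> y \<in> carrier (mring fin G) \<and>
      Abs_mps (x \<otimes>\<^bsub>mring fin G\<^esub> y) = Abs_mps x * Abs_mps y"
    using subring_onD(4)[OF subring_mps_on *] by (simp add: mring_simps mring_mult mcoeff_inverse)
next
  show "\<one>\<^bsub>mring fin G\<^esub> \<in> carrier (mring fin G) \<and> Abs_mps \<one>\<^bsub>mring fin G\<^esub> = (1 :: ('a, 'b) mps)"
    using subring_onD(2)[OF subring_mps_on] by (simp add: mring_simps one_mps_def[symmetric])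
  show "\<zero>\<^bsub>mring fin G\<^esub> \<in> carrier (mring fin G) \<and> Abs_mps \<zero>\<^bsub>mring fin G\<^esub> = (0 :: ('a, 'b) mps)"
    using subring_onD(1)[OF subring_mps_on] by (simp add: mring_simps zero_mps_def[symmetric])
qed

lemma ring_model_mring: "ring_model (mring fin G) Abs_mps (mps_on fin G)"
proof (rule ring_model.intro[OF cring_mring bij_Abs_mps])
  fix x y :: "'a multiset \<Rightarrow> 'b"
  show "Abs_mps (x \<oplus>\<^bsub>mring fin G\<^esub> y) = Abs_mps x + Abs_mps y" by (simp add: mring_simps Abs_mps_add)
  show "Abs_mps (x \<otimes>\<^bsub>mring fin G\<^esub> y) = Abs_mps x * Abs_mps y" by (simp add: mring_mult mcoeff_inverse)
  show "Abs_mps \<one>\<^bsub>mring fin G\<^esub> = (1 :: ('a, 'b) mps)" by (simp add: mring_simps one_mps_def)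
qed

lemma mvar_mult: "(mvar g \<otimes>\<^bsub>mring fin G\<^esub> f) m = (if g \<in># m then f (m - {#g#}) else 0)"
proof -
  have "(mvar g \<otimes>\<^bsub>mring fin G\<^esub> f) m = (\<Sum>(u, v) \<in> {(u, v). u + v = m}. mvar g u * f v)"
    by (simp add: mring_mult mcoeff_mult)
  also have "\<dots> = (\<Sum>(u, v) \<in> (if g \<in># m then {({#g#}, m - {#g#})} else {}). mvar g u * f v)"
    by (rule sum.mono_neutral_right[OF finite_decomp_mset])
      (auto simp: mvar_def dest: multi_member_split split: if_splits)
  finally show ?thesis by (simp add: mvar_def)
qed

text \<open>A power series without constant term has infinitely many monomials to divide by
  variables, but an ideal admits finite sums only. Grouping the monomials by their least variable g
  writes the series as a sum, over the finitely many variables, of g times a single series.\<close>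

lemma mring_var_ideal:
  fixes G :: "nat set"
  assumes G: "finite G"
  shows "Idl\<^bsub>mring fin G\<^esub> (mvar ` G) = {f \<in> carrier (mring fin G). f {#} = (0 :: 'k::field)}"
proof -
  let ?R = "mring fin G :: (nat multiset \<Rightarrow> 'k) ring"
  interpret R: cring ?R by (rule cring_mring)
  interpret T: ring_model ?R Abs_mps "mps_on fin G" by (rule ring_model_mring)
  have varC: "mvar ` G \<subseteq> carrier ?R"
    by (auto simp: mring_simps mps_on_def mvar_def intro: finite_subset[of _ "{{#_#}}"] split: if_splits)
  have K: "ideal_on (mps_on fin G) {f \<in> mps_on fin G. mcoeff f {#} = (0 :: 'k)}"
    using subring_onD[OF subring_mps_on[of fin G]] by (auto simp: ideal_on_def)
  have "{x \<in> carrier ?R. Abs_mps x \<in> {f \<in> mps_on fin G. mcoeff f {#} = 0}} = {f \<in> carrier ?R. f {#} = 0}"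
    by (auto simp: mring_simps)
  then have "ideal {f \<in> carrier ?R. f {#} = 0} ?R" using T.ideal_vimage[OF K] by simp
  then have "Idl\<^bsub>?R\<^esub> (mvar ` G) \<subseteq> {f \<in> carrier ?R. f {#} = 0}"
    using varC by (intro R.genideal_minimal) (auto simp: mvar_def)
  moreover have "f \<in> Idl\<^bsub>?R\<^esub> (mvar ` G)" if f: "f \<in> carrier ?R" "f {#} = 0" for f
  proof -
    interpret I: ideal "Idl\<^bsub>?R\<^esub> (mvar ` G)" ?R by (rule R.genideal_ideal[OF varC])
    have fG: "set_mset m \<subseteq> G" if "f m \<noteq> 0" for m
      using f(1) that by (simp add: mring_simps mps_on_def)
    define part where "part A = (\<lambda>m. if m \<noteq> {#} \<and> Min (set_mset m) \<in> A then f m else 0)" for A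
    have "part A \<in> Idl\<^bsub>?R\<^esub> (mvar ` G)" if A: "finite A" "A \<subseteq> G" for A
      using A
    proof (induction A)
      case empty
      have "part {} = \<zero>\<^bsub>?R\<^esub>" by (auto simp: part_def mring_simps)
      then show ?case by (simp only: I.zero_closed)
    next
      case (insert g A)
      \<comment> \<open>The quotient by the variable g of the terms whose least variable is
        g.\<close>
      define q where "q = (\<lambda>m. if Min (set_mset (add_mset g m)) = g then f (add_mset g m) else 0)"
      have "finite (add_mset g -` {m. f m \<noteq> 0})" if fin
        using f that by (intro finite_vimageI) (auto simp: mring_simps mps_on_def inj_def)
      then have "finite {m. q m \<noteq> 0}" if fin
        by (rule finite_subset[rotated]) (use that in \<open>auto simp: q_def\<close>)
      moreover have "set_mset m \<subseteq> G" if "q m \<noteq> 0" for m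
      proof -
        have "f (add_mset g m) \<noteq> 0" using \<open>q m \<noteq> 0\<close> by (auto simp: q_def split: if_splits)
        then have "set_mset (add_mset g m) \<subseteq> G" by (rule fG)
        then show ?thesis by simp
      qed
      ultimately have q: "q \<in> carrier ?R" by (simp add: mring_simps mps_on_def)
      have "mvar g \<in> Idl\<^bsub>?R\<^esub> (mvar ` G)" using R.genideal_self[OF varC] insert.prems by blast
      then have "mvar g \<otimes>\<^bsub>?R\<^esub> q \<in> Idl\<^bsub>?R\<^esub> (mvar ` G)" using I.I_r_closed q by blast
      moreover have "part A \<in> Idl\<^bsub>?R\<^esub> (mvar ` G)" using insert by blast
      moreover have "part (insert g A) = part A \<oplus>\<^bsub>?R\<^esub> (mvar g \<otimes>\<^bsub>?R\<^esub> q)"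
      proof
        fix m
        have gm: "g \<in># m" if "m \<noteq> {#}" "Min (set_mset m) = g"
          using that Min_in[of "set_mset m"] by simp
        show "part (insert g A) m = (part A \<oplus>\<^bsub>?R\<^esub> (mvar g \<otimes>\<^bsub>?R\<^esub> q)) m"
        proof (cases "g \<in># m")
          case True
          then have "add_mset g (m - {#g#}) = m" by simp
          then have "q (m - {#g#}) = (if Min (set_mset m) = g then f m else 0)" unfolding q_def by (simp only:)
          then show ?thesis using True insert.hyps(2) by (auto simp: mring_simps(2) mvar_mult part_def)
        next
          case False
          then show ?thesis using gm by (auto simp: mring_simps(2) mvar_mult part_def)
        qed
      qed
      ultimately show ?case by (simp only: I.a_closed)
    qed
    from this[OF G subset_refl] have "part G \<in> Idl\<^bsub>?R\<^esub> (mvar ` G)" .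
    moreover have "part G = f"
    proof
      fix m
      show "part G m = f m"
      proof (cases "m = {#} \<or> f m = 0")
        case False
        then have "set_mset m \<subseteq> G" using f(1) by (simp add: mring_simps mps_on_def)
        then show ?thesis using False Min_in[of "set_mset m"] by (auto simp: part_def)
      qed (use f(2) in \<open>auto simp: part_def\<close>)
    qed
    ultimately show ?thesis by simp
  qed
  ultimately show ?thesis by blast
qed

section \<open>Series over the generators of D as series in y\<close>

context semigroup_double
begin

definition dcoeff :: "(nat multiset \<Rightarrow> 'k::field) \<Rightarrow> (nat, 'k) mps fps" where
  "dcoeff f = Abs_fps (\<lambda>k. Abs_mps (\<lambda>m. f (dmon (m, k))))"

lemma mcoeff_dcoeff [simp]: "mcoeff (fps_nth (dcoeff f) k) m = f (dmon (m, k))"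
  by (simp add: dcoeff_def)

text \<open>In contrast to \<open>dmon_surj\<close>, the variables are not confined to generators.
  Products in \<open>mps\<close> run over all decompositions of a monomial, and the factors of a
  monomial in the range of \<open>dmon\<close> have to be in this range again.\<close>

lemma dmon_surj_even: "(\<forall>x\<in>#m. even x \<or> x = c) \<Longrightarrow> \<exists>p. dmon p = m"
proof (induction m)
  case empty show ?case by (intro exI[of _ "({#}, 0)"]) (simp add: dmon_0)
next
  case (add x m)
  then obtain p where p: "dmon p = m" by auto
  consider g where "x = 2 * g" | "x = c" using add.prems by auto
  then show ?case
  proof cases
    case 1
    then have "dmon (add_mset g (fst p), snd p) = add_mset x m" using p by (auto simp: dmon_def)
    then show ?thesis by blast
  next
    case 2
    then have "dmon (fst p, Suc (snd p)) = add_mset x m" using p by (auto simp: dmon_def)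
    then show ?thesis by blast
  qed
qed

lemma dmon_decomp:
  assumes "u + v = dmon q" shows "\<exists>p p'. u = dmon p \<and> v = dmon p' \<and> p + p' = q"
proof -
  have "\<forall>x\<in>#dmon q. even x \<or> x = c" by (auto simp: dmon_def split: if_splits)
  then have u: "\<forall>x\<in>#u. even x \<or> x = c" and v: "\<forall>x\<in>#v. even x \<or> x = c"
    unfolding assms[symmetric] by auto
  obtain p where p: "dmon p = u" using dmon_surj_even[OF u] ..
  obtain p' where p': "dmon p' = v" using dmon_surj_even[OF v] ..
  have "dmon (p + p') = dmon q" unfolding dmon_add p p' by (rule assms)
  then have "p + p' = q" using dmon_inj by (simp add: inj_eq)
  then show ?thesis using p p' by blast
qed

lemma sum_decomp_dmon:
  "(\<Sum>(u, v) \<in> {(u, v). u + v = dmon q}. F u v) = (\<Sum>(p, p') \<in> {(p, p'). p + p' = q}. F (dmon p) (dmon p'))"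
proof -
  have "{(u, v). u + v = dmon q} = (\<lambda>(p, p'). (dmon p, dmon p')) ` {(p, p'). p + p' = q}"
  proof (intro equalityI subsetI)
    fix a assume "a \<in> {(u, v). u + v = dmon q}"
    then obtain u v where a: "a = (u, v)" "u + v = dmon q" by blast
    from dmon_decomp[OF a(2)] obtain p p' where "u = dmon p" "v = dmon p'" "p + p' = q" by blast
    then show "a \<in> (\<lambda>(p, p'). (dmon p, dmon p')) ` {(p, p'). p + p' = q}"
      by (intro image_eqI[of _ _ "(p, p')"]) (simp_all add: a(1))
  qed (auto simp: dmon_add[symmetric])
  moreover have "inj_on (\<lambda>(p, p'). (dmon p, dmon p')) {(p, p'). p + p' = q}"
    by (auto intro!: inj_onI dest: injD[OF dmon_inj])
  ultimately show ?thesis by (simp add: sum.reindex case_prod_unfold)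
qed

lemma sum_decomp_pair:
  "(\<Sum>(p, p') \<in> {(p, p'). p + p' = (m :: 'a::plus, k :: nat)}. F p p') =
    (\<Sum>i=0..k. \<Sum>(u, v) \<in> {(u, v). u + v = m}. F (u, i) (v, k - i))"
proof -
  have "(\<Sum>(p, p') \<in> {(p, p'). p + p' = (m, k)}. F p p') =
      (\<Sum>(i, u, v) \<in> {0..k} \<times> {(u, v). u + v = m}. F (u, i) (v, k - i))"
    by (rule sum.reindex_bij_witness[of _ "\<lambda>(i, u, v). ((u, i), (v, k - i))" "\<lambda>(p, p'). (snd p, fst p, fst p')"])
      auto
  then show ?thesis by (simp add: sum.cartesian_product)
qed

lemma dcoeff_mult:
  "dcoeff (f \<otimes>\<^bsub>mring fin (min_gens D)\<^esub> g) = dcoeff f * dcoeff g"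
proof (intro fps_ext mps_eqI)
  fix k m
  have "mcoeff (fps_nth (dcoeff (f \<otimes>\<^bsub>mring fin (min_gens D)\<^esub> g)) k) m =
      (\<Sum>(p, p') \<in> {(p, p'). p + p' = (m, k)}. f (dmon p) * g (dmon p'))"
    by (simp add: mring_mult mcoeff_mult sum_decomp_dmon)
  also have "\<dots> = mcoeff (fps_nth (dcoeff f * dcoeff g) k) m"
    unfolding sum_decomp_pair by (simp add: fps_mult_nth mcoeff_sum mcoeff_mult)
  finally show "mcoeff (fps_nth (dcoeff (f \<otimes>\<^bsub>mring fin (min_gens D)\<^esub> g)) k) m =
    mcoeff (fps_nth (dcoeff f * dcoeff g) k) m" .
qed

lemma dcoeff_bij:
  "bij_betw (dcoeff :: _ \<Rightarrow> (nat, 'k::field) mps fps) (carrier (mring fin (min_gens D))) (fps_ext fin (mps_on fin G))"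
proof (rule bij_betw_imageI)
  show "inj_on (dcoeff :: _ \<Rightarrow> (nat, 'k) mps fps) (carrier (mring fin (min_gens D)))"
  proof (rule inj_onI, rule ext)
    fix f g :: "nat multiset \<Rightarrow> 'k" and m
    assume f: "f \<in> carrier (mring fin (min_gens D))" and g: "g \<in> carrier (mring fin (min_gens D))"
      and e: "dcoeff f = dcoeff g"
    show "f m = g m"
    proof (cases "set_mset m \<subseteq> min_gens D")
      case True
      then obtain p where "dmon p = m" using dmon_surj by blast
      then show ?thesis using arg_cong[OF e, of "\<lambda>F. mcoeff (fps_nth F (snd p)) (fst p)"] by simp
    next
      case False
      then have "f m = 0" "g m = 0" using f g by (auto simp: mring_simps mps_on_def)
      then show ?thesis by simp
    qed
  qed
  show "dcoeff ` carrier (mring fin (min_gens D)) = (fps_ext fin (mps_on fin G) :: (nat, 'k) mps fps set)"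
  proof (intro equalityI subsetI)
    fix F :: "(nat, 'k) mps fps" assume "F \<in> dcoeff ` carrier (mring fin (min_gens D))"
    then obtain f where F: "F = dcoeff f" and f: "\<And>m. f m \<noteq> 0 \<Longrightarrow> set_mset m \<subseteq> min_gens D"
      "fin \<Longrightarrow> finite {m. f m \<noteq> 0}" by (auto simp: mring_simps mps_on_def)
    have fin': "finite (dmon -` {m. f m \<noteq> 0})" if fin
      by (rule finite_vimageI[OF f(2)[OF that] dmon_inj])
    have "finite {m. f (dmon (m, k)) \<noteq> 0}" if fin for k
      by (rule finite_subset[OF _ finite_imageI[OF fin'[OF that], of fst]]) (force simp: image_iff)
    moreover have "finite {k. fps_nth F k \<noteq> 0}" if fin
    proof (rule finite_subset[OF _ finite_imageI[OF fin'[OF that], of snd]])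
      show "{k. fps_nth F k \<noteq> 0} \<subseteq> snd ` (dmon -` {m. f m \<noteq> 0})"
      proof
        fix k assume "k \<in> {k. fps_nth F k \<noteq> 0}"
        then obtain m where "mcoeff (fps_nth F k) m \<noteq> 0" using mps_eqI[of "fps_nth F k" 0] by auto
        then show "k \<in> snd ` (dmon -` {m. f m \<noteq> 0})" by (intro image_eqI[of _ _ "(m, k)"]) (auto simp: F)
      qed
    qed
    moreover have "set_mset m \<subseteq> G" if "f (dmon (m, k)) \<noteq> 0" for m k
      using f(1)[OF that] dmon_set[of "(m, k)"] by simp
    ultimately show "F \<in> fps_ext fin (mps_on fin G)"
      by (auto simp: fps_ext_def mps_on_def F)
  next
    fix F :: "(nat, 'k) mps fps" assume F: "F \<in> fps_ext fin (mps_on fin G)"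
    define f where "f m = (if m \<in> range dmon then mcoeff (fps_nth F (snd (inv_into UNIV dmon m))) (fst (inv_into UNIV dmon m)) else 0)" for m
    have f: "f (dmon p) = mcoeff (fps_nth F (snd p)) (fst p)" for p
      using dmon_inj by (simp add: f_def inv_f_f)
    have FG: "mcoeff (fps_nth F k) m \<noteq> 0 \<Longrightarrow> set_mset m \<subseteq> G" for k m
      using F by (simp add: fps_ext_def mps_on_def)
    have "set_mset m \<subseteq> min_gens D" if "f m \<noteq> 0" for m
    proof -
      have "m \<in> range dmon" using \<open>f m \<noteq> 0\<close> by (auto simp: f_def split: if_splits)
      then obtain p where p: "m = dmon p" by blast
      then have "set_mset (fst p) \<subseteq> G" using FG \<open>f m \<noteq> 0\<close> f by metis
      then show ?thesis using dmon_set p by simp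
    qed
    moreover have "finite {m. f m \<noteq> 0}" if fin
    proof (rule finite_subset)
      show "{m. f m \<noteq> 0} \<subseteq> dmon ` (SIGMA k:{k. fps_nth F k \<noteq> 0}. {m. mcoeff (fps_nth F k) m \<noteq> 0})\<inverse>"
      proof
        fix m assume m: "m \<in> {m. f m \<noteq> 0}"
        then obtain p where p: "m = dmon p" by (auto simp: f_def split: if_splits)
        then have *: "mcoeff (fps_nth F (snd p)) (fst p) \<noteq> 0" using m f by simp
        then have "fps_nth F (snd p) \<noteq> 0" by auto
        with * have "p \<in> (SIGMA k:{k. fps_nth F k \<noteq> 0}. {m. mcoeff (fps_nth F k) m \<noteq> 0})\<inverse>"
          by (cases p) auto
        then show "m \<in> dmon ` (SIGMA k:{k. fps_nth F k \<noteq> 0}. {m. mcoeff (fps_nth F k) m \<noteq> 0})\<inverse>" using p by blast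
      qed
      show "finite (dmon ` (SIGMA k:{k. fps_nth F k \<noteq> 0}. {m. mcoeff (fps_nth F k) m \<noteq> 0})\<inverse>)"
        using F that by (auto simp: fps_ext_def mps_on_def)
    qed
    ultimately have "f \<in> carrier (mring fin (min_gens D))" by (simp add: mring_simps mps_on_def)
    moreover have "dcoeff f = F" by (intro fps_ext mps_eqI) (simp add: f)
    ultimately show "F \<in> dcoeff ` carrier (mring fin (min_gens D))" by blast
  qed
qed

lemma ring_model_dcoeff:
  "ring_model (mring fin (min_gens D)) (dcoeff :: _ \<Rightarrow> (nat, 'k::field) mps fps) (fps_ext fin (mps_on fin G))"
proof (rule ring_model.intro[OF cring_mring dcoeff_bij])
  fix x y :: "nat multiset \<Rightarrow> 'k"
  show "dcoeff (x \<oplus>\<^bsub>mring fin (min_gens D)\<^esub> y) = dcoeff x + dcoeff y"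
    by (intro fps_ext mps_eqI) (simp add: mring_simps)
  show "dcoeff (x \<otimes>\<^bsub>mring fin (min_gens D)\<^esub> y) = dcoeff x * dcoeff y" by (rule dcoeff_mult)
  show "dcoeff \<one>\<^bsub>mring fin (min_gens D)\<^esub> = (1 :: (nat, 'k) mps fps)"
  proof (intro fps_ext mps_eqI)
    fix k m
    have "dmon (m, k) = {#} \<longleftrightarrow> m = {#} \<and> k = 0" by (simp add: dmon_def)
    then show "mcoeff (fps_nth (dcoeff \<one>\<^bsub>mring fin (min_gens D)\<^esub>) k) m = mcoeff (fps_nth (1 :: (nat, 'k) mps fps) k) m"
      by (auto simp: mring_simps)
  qed
qed

end

section \<open>Semigroup rings and their associated graded rings\<close>

definition sg_deg :: "bool \<Rightarrow> nat set \<Rightarrow> nat \<Rightarrow> nat" where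
  "sg_deg gr U z = (if gr then sg_ord U z else 0)"

text \<open>The graded ring is a direct sum with finite-dimensional components, so its model
  consists of the series with finite support.\<close>

definition sg_on :: "bool \<Rightarrow> nat set \<Rightarrow> 'k::field fps set" where
  "sg_on gr U = {x. (\<forall>n. x $ n \<noteq> 0 \<longrightarrow> n \<in> U) \<and> (gr \<longrightarrow> finite {n. x $ n \<noteq> 0})}"

text \<open>Multiplication in the semigroup ring (false) and in its associated graded ring (true), the latter
  being identified with the span of the \<open>t\<^bsup>z\<^esup>\<close>, where \<open>t\<^bsup>u\<^esup> t\<^bsup>v\<^esup> = 0\<close> unless the orders add up.\<close>

definition sg_mul :: "bool \<Rightarrow> nat set \<Rightarrow> 'k::field fps \<Rightarrow> 'k fps \<Rightarrow> 'k fps" where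
  "sg_mul gr U x y = Abs_fps (tconv (sg_deg gr U) (fps_nth x) (fps_nth y))"

text \<open>The substitution of t^g for the variable of g. In the graded case a monomial whose
  length falls short of the order of its value is sent to 0, since the value then lies in a higher
  power of the maximal ideal.\<close>

definition sg_eval :: "bool \<Rightarrow> nat set \<Rightarrow> (nat, 'k::field) mps \<Rightarrow> 'k fps" where
  "sg_eval gr U f = Abs_fps (push (\<lambda>m. if gr then size m else 0) (sg_deg gr U) sum_mset
     {m. set_mset m \<subseteq> min_gens U} (mcoeff f))"

lemma fps_nth_Abs_fun: "fps_nth (Abs_fps f) = f"
  by (rule ext) simp

lemma fps_mult_pairs: "(x * y) $ z = (\<Sum>(u, v) \<in> {(u, v). u + v = z}. x $ u * y $ v)"
  for x y :: "'k::comm_ring_1 fps"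
  unfolding fps_mult_nth
  by (rule sum.reindex_bij_witness[of _ fst "\<lambda>i. (i, z - i)"]) auto

lemma sg_mul_False: "sg_mul False U x y = x * y"
  by (rule fps_ext) (simp add: sg_mul_def tconv_def sg_deg_def fps_mult_pairs)

lemma sg_mul_nth: "sg_mul gr U x y $ z = tconv (sg_deg gr U) (fps_nth x) (fps_nth y) z"
  by (simp add: sg_mul_def)

lemma sg_mul_commute: "sg_mul gr U x y = sg_mul gr U y x"
  by (rule fps_ext) (simp add: sg_mul_nth tconv_commute[of _ "fps_nth x"])

lemma sg_on_supp: "x \<in> sg_on gr U \<Longrightarrow> supp_on U (fps_nth x)"
  by (auto simp: sg_on_def supp_on_def)

lemma sg_on_add: "x \<in> sg_on gr U \<Longrightarrow> y \<in> sg_on gr U \<Longrightarrow> x + y \<in> sg_on gr U"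
proof -
  assume x: "x \<in> sg_on gr U" and y: "y \<in> sg_on gr U"
  have "{n. (x + y) $ n \<noteq> 0} \<subseteq> {n. x $ n \<noteq> 0} \<union> {n. y $ n \<noteq> 0}" by auto
  then have "finite {n. (x + y) $ n \<noteq> 0}" if gr
    by (rule finite_subset) (use x y that in \<open>auto simp: sg_on_def\<close>)
  moreover have "n \<in> U" if "(x + y) $ n \<noteq> 0" for n
  proof -
    have "x $ n \<noteq> 0 \<or> y $ n \<noteq> 0" using \<open>(x + y) $ n \<noteq> 0\<close> by auto
    then show ?thesis using x y by (auto simp: sg_on_def)
  qed
  ultimately show ?thesis by (simp add: sg_on_def)
qed

lemma sg_on_zero: "0 \<in> sg_on gr U"
  by (simp add: sg_on_def)

context
  fixes U :: "nat set" assumes U: "numerical_semigroup U"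
begin

lemma superadd_sg_deg: "superadd_on U (sg_deg gr U)"
  using superadd_ord[OF U] by (simp add: superadd_on_def sg_deg_def)

lemma sg_mul_in:
  assumes x: "x \<in> sg_on gr U" and y: "y \<in> sg_on gr U" shows "sg_mul gr U x y \<in> sg_on gr U"
proof -
  have "supp_on U (fps_nth (sg_mul gr U x y))"
    using supp_on_tconv[OF superadd_sg_deg sg_on_supp[OF x] sg_on_supp[OF y]]
    by (simp add: sg_mul_def fps_nth_Abs_fun)
  then have 1: "z \<in> U" if "sg_mul gr U x y $ z \<noteq> 0" for z using that by (simp add: supp_on_def)
  have "{z. sg_mul gr U x y $ z \<noteq> 0} \<subseteq> (\<lambda>(u, v). u + v) ` ({n. x $ n \<noteq> 0} \<times> {n. y $ n \<noteq> 0})"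
  proof
    fix z assume "z \<in> {z. sg_mul gr U x y $ z \<noteq> 0}"
    then have "tconv (sg_deg gr U) (fps_nth x) (fps_nth y) z \<noteq> 0" by (simp add: sg_mul_nth)
    then obtain p where p: "p \<in> {(u, v). u + v = z \<and> sg_deg gr U u + sg_deg gr U v = sg_deg gr U z}"
      "(case p of (u, v) \<Rightarrow> x $ u * y $ v) \<noteq> 0"
      unfolding tconv_def by (meson sum.not_neutral_contains_not_neutral)
    then show "z \<in> (\<lambda>(u, v). u + v) ` ({n. x $ n \<noteq> 0} \<times> {n. y $ n \<noteq> 0})"
      by (intro image_eqI[of _ _ p]) auto
  qed
  then have "finite {z. sg_mul gr U x y $ z \<noteq> 0}" if gr
    by (rule finite_subset) (use x y that in \<open>auto simp: sg_on_def\<close>)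
  with 1 show ?thesis by (simp add: sg_on_def)
qed

lemma sg_mul_assoc:
  assumes "x \<in> sg_on gr U" "y \<in> sg_on gr U" "z \<in> sg_on gr U"
  shows "sg_mul gr U (sg_mul gr U x y) z = sg_mul gr U x (sg_mul gr U y z)"
  using tconv_assoc[OF finite_decomp_nat superadd_sg_deg sg_on_supp[OF assms(1)] sg_on_supp[OF assms(2)]
      sg_on_supp[OF assms(3)]]
  by (intro fps_ext) (simp add: sg_mul_def fps_nth_Abs_fun)

lemma sg_mul_const: "sg_mul gr U (fps_const k) x = fps_const k * x"
proof (rule fps_ext)
  fix z
  have "sg_mul gr U (fps_const k) x $ z = (\<Sum>(u, v) \<in> {(0, z)}. fps_const k $ u * x $ v)"
    unfolding sg_mul_nth tconv_def using ord_0[OF U]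
    by (intro sum.mono_neutral_right finite_subset[OF _ finite_decomp_nat[of z]])
      (auto simp: sg_deg_def split: if_splits)
  then show "sg_mul gr U (fps_const k) x $ z = (fps_const k * x) $ z" by simp
qed

lemma fps_const_in: "fps_const k \<in> sg_on gr U"
  using sg_closed(1)[OF U] by (auto simp: sg_on_def intro: finite_subset[of _ "{0}"] split: if_splits)

lemma sg_eval_in:
  assumes f: "f \<in> mps_on gr (min_gens U)" shows "sg_eval gr U f \<in> sg_on gr U"
proof -
  have ex: "\<exists>m. set_mset m \<subseteq> min_gens U \<and> \<Sum>\<^sub># m = z \<and> mcoeff f m \<noteq> 0" if "sg_eval gr U f $ z \<noteq> 0" for z
  proof -
    from that obtain m where "m \<in> {m \<in> {m. set_mset m \<subseteq> min_gens U}. \<Sum>\<^sub># m = z \<and>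
        (if gr then size m else 0) = sg_deg gr U z}" "mcoeff f m \<noteq> 0"
      unfolding sg_eval_def push_def fps_nth_Abs_fps by (meson sum.not_neutral_contains_not_neutral)
    then show ?thesis by blast
  qed
  have "{z. sg_eval gr U f $ z \<noteq> 0} \<subseteq> sum_mset ` {m. mcoeff f m \<noteq> 0}" using ex by blast
  then have "finite {z. sg_eval gr U f $ z \<noteq> 0}" if gr
    by (rule finite_subset) (use f that in \<open>auto simp: mps_on_def\<close>)
  moreover have "z \<in> U" if "sg_eval gr U f $ z \<noteq> 0" for z
    using ex[OF that] sum_mset_in[OF U] by blast
  ultimately show ?thesis by (simp add: sg_on_def)
qed

lemma fiber_finite: "finite {m \<in> {m. set_mset m \<subseteq> min_gens U}. \<Sum>\<^sub># m = z}"
  using finite_reps[OF U, of z] by (simp add: reps_def)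

subsection \<open>The semigroup ring\<close>

lemma sg_ring_simps [simp]:
  "carrier (sg_ring U) = sg_on False U" "x \<otimes>\<^bsub>sg_ring U\<^esub> y = x * y" "\<one>\<^bsub>sg_ring U\<^esub> = 1"
  "\<zero>\<^bsub>sg_ring U\<^esub> = 0" "x \<oplus>\<^bsub>sg_ring U\<^esub> y = x + y"
  by (simp_all add: sg_ring_def sg_on_def)

lemma subring_sg_on: "subring_on (sg_on False U :: 'k::field fps set)"
  unfolding subring_on_def
proof (intro conjI ballI)
  show "1 \<in> (sg_on False U :: 'k fps set)" using fps_const_in[of 1 False] by simp
  fix x :: "'k fps" assume x: "x \<in> sg_on False U"
  then show "- x \<in> sg_on False U" by (simp add: sg_on_def)
  fix y :: "'k fps" assume y: "y \<in> sg_on False U"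
  show "x + y \<in> sg_on False U" by (rule sg_on_add[OF x y])
  show "x * y \<in> sg_on False U" using sg_mul_in[OF x y] by (simp add: sg_mul_False)
qed

lemma cring_sg_ring: "cring (sg_ring U :: 'k::field fps ring)"
  by (rule cring_by_embedding[where \<rho> = "\<lambda>x. x" and C = "sg_on False U"])
    (use subring_onD[OF subring_sg_on] subring_sg_on in \<open>auto simp: bij_betw_def\<close>)

lemma sg_ring_minus: "x \<in> sg_on False U \<Longrightarrow> \<ominus>\<^bsub>sg_ring U\<^esub> x = - (x :: 'k::field fps)"
proof -
  interpret cring "sg_ring U :: 'k fps ring" by (rule cring_sg_ring)
  assume x: "x \<in> sg_on False U"
  have "\<ominus>\<^bsub>sg_ring U\<^esub> x + x = 0" using l_neg[of x] x by simp
  then show ?thesis by (simp add: eq_neg_iff_add_eq_0)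
qed

text \<open>This turns out to be the n-th power of the maximal ideal
  (\<open>ideal_power_eq\<close>), described by exponents alone.\<close>

definition ord_ideal :: "nat \<Rightarrow> 'k::field fps set" where
  "ord_ideal n = {x \<in> sg_on False U. \<forall>z. x $ z \<noteq> 0 \<longrightarrow> n \<le> sg_ord U z}"

lemma ord_ideal_sub: "x \<in> ord_ideal n \<Longrightarrow> x \<in> sg_on False U"
  by (simp add: ord_ideal_def)

lemma ord_ideal_0: "ord_ideal 0 = sg_on False U"
  by (auto simp: ord_ideal_def)

lemma ord_ideal_antimono: "i \<le> j \<Longrightarrow> x \<in> ord_ideal j \<Longrightarrow> x \<in> ord_ideal i"
  by (auto simp: ord_ideal_def)

lemma ord_ideal_mult:
  assumes x: "x \<in> ord_ideal i" and y: "y \<in> ord_ideal j" shows "x * y \<in> (ord_ideal (i + j) :: 'k::field fps set)"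
proof -
  have "i + j \<le> sg_ord U z" if nz: "(x * y) $ z \<noteq> 0" for z
  proof -
    obtain p where p: "p \<in> {(u, v). u + v = z}" "(case p of (u, v) \<Rightarrow> x $ u * y $ v) \<noteq> 0"
      using nz unfolding fps_mult_pairs by (meson sum.not_neutral_contains_not_neutral)
    then obtain u v where uv: "u + v = z" "x $ u \<noteq> 0" "y $ v \<noteq> 0" by (cases p) auto
    then have "u \<in> U" "v \<in> U" "i \<le> sg_ord U u" "j \<le> sg_ord U v"
      using x y by (auto simp: ord_ideal_def sg_on_def)
    then show ?thesis using ord_add_le[OF U, of u v] uv(1) by simp
  qed
  then show ?thesis
    using subring_onD(4)[OF subring_sg_on ord_ideal_sub[OF x] ord_ideal_sub[OF y]] by (simp add: ord_ideal_def)
qed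

lemma ord_ideal_on: "ideal_on (sg_on False U) (ord_ideal n :: 'k::field fps set)"
  unfolding ideal_on_def
proof (intro conjI ballI)
  show "ord_ideal n \<subseteq> (sg_on False U :: 'k fps set)" "0 \<in> (ord_ideal n :: 'k fps set)"
    by (auto simp: ord_ideal_def sg_on_zero)
  fix x :: "'k fps" assume x: "x \<in> ord_ideal n"
  { fix y :: "'k fps" assume y: "y \<in> ord_ideal n"
    have "n \<le> sg_ord U z" if "(x + y) $ z \<noteq> 0" for z
    proof -
      have "x $ z \<noteq> 0 \<or> y $ z \<noteq> 0" using \<open>(x + y) $ z \<noteq> 0\<close> by auto
      then show ?thesis using x y by (auto simp: ord_ideal_def)
    qed
    then show "x + y \<in> ord_ideal n"
      using sg_on_add[OF ord_ideal_sub[OF x] ord_ideal_sub[OF y]] by (simp add: ord_ideal_def) }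
  fix r :: "'k fps" assume "r \<in> sg_on False U"
  then have "r \<in> ord_ideal 0" by (simp add: ord_ideal_0)
  from ord_ideal_mult[OF this x] show "r * x \<in> ord_ideal n" by simp
qed

lemma ring_model_sg_ring: "ring_model (sg_ring U) (\<lambda>x. x) (sg_on False U :: 'k::field fps set)"
  by (rule ring_model.intro[OF cring_sg_ring]) (auto simp: bij_betw_def)

lemma ideal_ord_ideal: "ideal (ord_ideal n) (sg_ring U :: 'k::field fps ring)"
proof -
  interpret T: ring_model "sg_ring U :: 'k fps ring" "\<lambda>x. x" "sg_on False U" by (rule ring_model_sg_ring)
  have "{x \<in> carrier (sg_ring U). x \<in> ord_ideal n} = (ord_ideal n :: 'k fps set)"
    using ord_ideal_sub by auto
  then show ?thesis using T.ideal_vimage[OF ord_ideal_on] by metis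
qed

lemma X_power_in: "z \<in> U \<Longrightarrow> fps_X ^ z \<in> (ord_ideal (sg_ord U z) :: 'k::field fps set)"
  by (auto simp: ord_ideal_def sg_on_def fps_X_power_nth)

text \<open>Series of order greater than \<open>n\<close> are sums of products of a generator \<open>t\<^bsup>g\<^esup>\<close> and a series of
  order at least \<open>n\<close>, since \<open>U\<close> is finitely generated.\<close>

lemma ord_ideal_Suc_subset:
  fixes T :: "'k::field fps set"
  assumes T: "0 \<in> T" "\<And>x y. x \<in> T \<Longrightarrow> y \<in> T \<Longrightarrow> x + y \<in> T"
    and gen: "\<And>g q. g \<in> min_gens U \<Longrightarrow> q \<in> ord_ideal n \<Longrightarrow> q * fps_X ^ g \<in> T"
  shows "ord_ideal (Suc n) \<subseteq> T"
proof
  fix f :: "'k fps" assume f: "f \<in> ord_ideal (Suc n)"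
  have "\<forall>z. \<exists>g. z \<in> U \<and> Suc n \<le> sg_ord U z \<longrightarrow>
      g \<in> min_gens U \<and> (\<exists>z'. z' \<in> U \<and> z = g + z' \<and> n \<le> sg_ord U z')"
    using ord_split[OF U] by blast
  from choice[OF this] obtain pick where pick: "\<And>z. z \<in> U \<Longrightarrow> Suc n \<le> sg_ord U z \<Longrightarrow>
      pick z \<in> min_gens U \<and> (\<exists>z'. z' \<in> U \<and> z = pick z + z' \<and> n \<le> sg_ord U z')" by blast
  have fz: "pick z \<in> min_gens U \<and> (\<exists>z'. z' \<in> U \<and> z = pick z + z' \<and> n \<le> sg_ord U z')" if "f $ z \<noteq> 0" for z
    using pick f that by (simp add: ord_ideal_def sg_on_def)
  \<comment> \<open>Each exponent in the support has a chosen generator \<open>pick z\<close> to be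
    split off. Cutting f according to this choice writes a possibly infinite series as a finite sum
    of terms q t^g.\<close>
  define part where "part A = Abs_fps (\<lambda>z. if pick z \<in> A then f $ z else 0)" for A
  have "part A \<in> T" if "finite A" "A \<subseteq> min_gens U" for A
    using that
  proof (induction A)
    case empty
    have "part {} = 0" by (rule fps_ext) (simp add: part_def)
    then show ?case using T by simp
  next
    case (insert g A)
    define q where "q = Abs_fps (\<lambda>z. if pick (z + g) = g then f $ (z + g) else 0)"
    have "z \<in> U \<and> n \<le> sg_ord U z" if "q $ z \<noteq> 0" for z
    proof -
      have "f $ (z + g) \<noteq> 0" "pick (z + g) = g" using that by (auto simp: q_def split: if_splits)
      then show ?thesis using fz[of "z + g"] by auto
    qed
    then have "q \<in> ord_ideal n" by (simp add: ord_ideal_def sg_on_def)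
    then have "q * fps_X ^ g \<in> T" using gen insert.prems by blast
    moreover have "part (insert g A) = part A + q * fps_X ^ g"
    proof (rule fps_ext)
      fix z
      show "part (insert g A) $ z = (part A + q * fps_X ^ g) $ z"
      proof (cases "pick z = g \<and> f $ z \<noteq> 0")
        case True
        then have "g \<le> z" using fz[of z] by auto
        then show ?thesis using True insert.hyps(2)
          by (simp add: part_def q_def fps_X_power_mult_right_nth)
      next
        case False
        then show ?thesis by (auto simp: part_def q_def fps_X_power_mult_right_nth)
      qed
    qed
    ultimately show ?case using T insert by simp
  qed
  from this[OF finite_min_gens[OF U] subset_refl] have "part (min_gens U) \<in> T" .
  moreover have "part (min_gens U) = f" using fz by (intro fps_ext) (auto simp: part_def)
  ultimately show "f \<in> T" by simp
qed

lemma sg_max_ideal_eq: "sg_max_ideal U = (ord_ideal 1 :: 'k::field fps set)"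
proof -
  interpret cring "sg_ring U :: 'k fps ring" by (rule cring_sg_ring)
  have X: "(\<lambda>x. fps_X ^ x) ` (U - {0}) \<subseteq> (ord_ideal 1 :: 'k fps set)"
  proof
    fix y :: "'k fps" assume "y \<in> (\<lambda>x. fps_X ^ x) ` (U - {0})"
    then obtain x where x: "x \<in> U" "x \<noteq> 0" "y = fps_X ^ x" by blast
    have "1 \<le> sg_ord U x" using ord_pos[OF U x(1,2)] by simp
    then show "y \<in> ord_ideal 1" using ord_ideal_antimono X_power_in[OF x(1)] x(3) by blast
  qed
  then have XC: "(\<lambda>x. fps_X ^ x) ` (U - {0}) \<subseteq> carrier (sg_ring U :: 'k fps ring)"
    using ord_ideal_sub by auto
  show ?thesis
    unfolding sg_max_ideal_def
  proof
    show "Idl\<^bsub>sg_ring U\<^esub> ((\<lambda>x. fps_X ^ x) ` (U - {0})) \<subseteq> (ord_ideal 1 :: 'k fps set)"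
      by (rule genideal_minimal[OF ideal_ord_ideal X])
    define J where "J = Idl\<^bsub>sg_ring U :: 'k fps ring\<^esub> ((\<lambda>x. fps_X ^ x) ` (U - {0}))"
    have J: "ideal J (sg_ring U)" unfolding J_def by (rule genideal_ideal[OF XC])
    have J0: "0 \<in> J"
      using additive_subgroup.zero_closed[OF ideal.axioms(1)[OF J]] by simp
    have J_add: "x + y \<in> J" if "x \<in> J" "y \<in> J" for x y
      using additive_subgroup.a_closed[OF ideal.axioms(1)[OF J] that] by simp
    have J_gen: "q * fps_X ^ g \<in> J" if g: "g \<in> min_gens U" and q: "q \<in> ord_ideal 0" for g q
    proof -
      have "g \<in> U - {0}" using g min_gens_sub[OF U] by blast
      then have "fps_X ^ g \<in> J" unfolding J_def by (intro subsetD[OF genideal_self[OF XC]] imageI)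
      from ideal.I_l_closed[OF J this, of q] show ?thesis using q by (simp add: ord_ideal_0)
    qed
    show "ord_ideal 1 \<subseteq> Idl\<^bsub>sg_ring U :: 'k fps ring\<^esub> ((\<lambda>x. fps_X ^ x) ` (U - {0}))"
      unfolding One_nat_def J_def[symmetric] by (rule ord_ideal_Suc_subset[OF J0 J_add J_gen])
  qed
qed

text \<open>One inclusion is superadditivity of the order, the other splits a generator off a
  longest factorization.\<close>

lemma ideal_power_eq: "ideal_power (sg_ring U) (sg_max_ideal U) n = (ord_ideal n :: 'k::field fps set)"
proof (induction n)
  case 0 show ?case by (simp add: ord_ideal_0)
next
  case (Suc n)
  have "ideal_prod (sg_ring U) (ord_ideal n) (ord_ideal 1) = (ord_ideal (Suc n) :: 'k fps set)"
  proof
    show "ideal_prod (sg_ring U) (ord_ideal n) (ord_ideal 1) \<subseteq> (ord_ideal (Suc n) :: 'k fps set)"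
    proof
      fix x :: "'k fps" assume "x \<in> ideal_prod (sg_ring U) (ord_ideal n) (ord_ideal 1)"
      then show "x \<in> ord_ideal (Suc n)"
      proof (induction rule: ideal_prod.induct)
        case (prod i j) then show ?case using ord_ideal_mult[of i n j 1] by simp
      next
        case (sum s1 s2) then show ?case using ideal_onD(3)[OF ord_ideal_on] by simp
      qed
    qed
    show "ord_ideal (Suc n) \<subseteq> ideal_prod (sg_ring U) (ord_ideal n) (ord_ideal 1 :: 'k fps set)"
    proof (rule ord_ideal_Suc_subset)
      have zero: "(0 :: 'k fps) \<in> ord_ideal k" for k using ideal_onD(2)[OF ord_ideal_on] .
      show "0 \<in> ideal_prod (sg_ring U) (ord_ideal n) (ord_ideal 1 :: 'k fps set)"
        using ideal_prod.prod[OF zero zero, of "sg_ring U" n 1] by simp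
      fix x y :: "'k fps"
      assume "x \<in> ideal_prod (sg_ring U) (ord_ideal n) (ord_ideal 1)" "y \<in> ideal_prod (sg_ring U) (ord_ideal n) (ord_ideal 1)"
      then show "x + y \<in> ideal_prod (sg_ring U) (ord_ideal n) (ord_ideal 1)"
        using ideal_prod.sum[of x "sg_ring U" _ _ y] by simp
    next
      fix g and q :: "'k fps" assume g: "g \<in> min_gens U" and q: "q \<in> ord_ideal n"
      have "(fps_X ^ g :: 'k fps) \<in> ord_ideal 1"
        using X_power_in[of g] ord_gen[OF U g] g min_gens_sub[OF U] by auto
      from ideal_prod.prod[OF q this, of "sg_ring U"]
      show "q * fps_X ^ g \<in> ideal_prod (sg_ring U) (ord_ideal n) (ord_ideal 1)" by simp
    qed
  qed
  then show ?case using Suc by (simp add: sg_max_ideal_eq)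
qed

subsection \<open>The associated graded ring\<close>

definition ord_coset :: "nat \<Rightarrow> 'k::field fps \<Rightarrow> 'k fps set" where
  "ord_coset n x = ord_ideal (Suc n) +>\<^bsub>sg_ring U\<^esub> x"

definition ord_slice :: "nat \<Rightarrow> 'k::field fps \<Rightarrow> 'k fps" where
  "ord_slice n x = Abs_fps (\<lambda>z. if sg_ord U z = n then x $ z else 0)"

text \<open>The t^z with z of order n represent a basis of the n-th graded component, so a finitely
  supported series corresponds to the sequence of classes of its slices by order.\<close>

definition to_gr :: "'k::field fps \<Rightarrow> nat \<Rightarrow> 'k fps set" where
  "to_gr x = (\<lambda>n. ord_coset n (ord_slice n x))"

lemma ord_coset_eq_iff:
  fixes x y :: "'k::field fps"
  assumes x: "x \<in> sg_on False U" and y: "y \<in> sg_on False U"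
  shows "ord_coset n x = ord_coset n y \<longleftrightarrow> (\<forall>z. sg_ord U z \<le> n \<longrightarrow> x $ z = y $ z)"
proof -
  interpret cring "sg_ring U :: 'k fps ring" by (rule cring_sg_ring)
  interpret I: ideal "ord_ideal (Suc n)" "sg_ring U :: 'k fps ring" by (rule ideal_ord_ideal)
  have "ord_coset n x = ord_coset n y \<longleftrightarrow> x \<ominus>\<^bsub>sg_ring U\<^esub> y \<in> ord_ideal (Suc n)"
    unfolding ord_coset_def using quotient_eq_iff_same_a_r_cos[OF ideal_ord_ideal, of x y] x y by simp
  also have "x \<ominus>\<^bsub>sg_ring U\<^esub> y = x - y" by (simp add: a_minus_def sg_ring_minus[OF y])
  also have "x - y \<in> ord_ideal (Suc n) \<longleftrightarrow> (\<forall>z. sg_ord U z \<le> n \<longrightarrow> x $ z = y $ z)"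
    using subring_onD(6)[OF subring_sg_on x y] by (auto simp: ord_ideal_def not_le[symmetric] Suc_le_eq)
  finally show ?thesis .
qed

lemma ord_coset_mem:
  assumes "x \<in> sg_on False U" "a \<in> ord_coset n x" shows "a \<in> sg_on False U \<and> a - x \<in> ord_ideal (Suc n)"
proof -
  obtain h where h: "h \<in> ord_ideal (Suc n)" "a = h + x"
    using assms(2) unfolding ord_coset_def a_r_coset_def' by auto
  then show ?thesis using sg_on_add[OF ord_ideal_sub[OF h(1)] assms(1)] by simp
qed

lemma ord_coset_self: "x \<in> sg_on False U \<Longrightarrow> x \<in> ord_coset n (x :: 'k::field fps)"
  unfolding ord_coset_def a_r_coset_def' using ideal_onD(2)[OF ord_ideal_on] by force

lemma ord_coset_zero: "ord_coset n 0 = (ord_ideal (Suc n) :: 'k::field fps set)"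
  unfolding ord_coset_def a_r_coset_def' by auto

lemma ord_slice_nth: "ord_slice n x $ z = (if sg_ord U z = n then x $ z else 0)"
  by (simp add: ord_slice_def)

lemma ord_slice_in: "x \<in> sg_on gr U \<Longrightarrow> ord_slice n x \<in> ord_ideal n"
  by (auto simp: ord_slice_def ord_ideal_def sg_on_def)

lemma ord_slice_in': "x \<in> sg_on gr U \<Longrightarrow> ord_slice n x \<in> sg_on False U"
  by (rule ord_ideal_sub[OF ord_slice_in])

lemma ord_slice_zero: "ord_slice n 0 = 0"
  by (rule fps_ext) (simp add: ord_slice_def)

lemma ord_slice_add: "ord_slice n (x + y) = ord_slice n x + ord_slice n y"
  by (rule fps_ext) (simp add: ord_slice_def)

lemma sg_gr_simps:
  fixes f g :: "nat \<Rightarrow> 'k::field fps set"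
  shows "carrier (sg_gr U) = {f :: nat \<Rightarrow> 'k fps set. (\<forall>n. f n \<in> ord_coset n ` ord_ideal n) \<and>
      finite {n. f n \<noteq> ord_ideal (Suc n)}}"
    "\<zero>\<^bsub>sg_gr U\<^esub> = (\<lambda>n. ord_ideal (Suc n) :: 'k fps set)"
    "\<one>\<^bsub>sg_gr U\<^esub> = (\<lambda>n. if n = 0 then ord_coset 0 1 else ord_ideal (Suc n) :: 'k fps set)"
    "f \<oplus>\<^bsub>sg_gr U\<^esub> g = (\<lambda>n. f n <+>\<^bsub>sg_ring U\<^esub> g n)"
    "f \<otimes>\<^bsub>sg_gr U\<^esub> g = (\<lambda>n. finsum (sg_ring U Quot ord_ideal (Suc n))
       (\<lambda>i. rcoset_mult (sg_ring U) (ord_ideal (Suc n)) (f i) (g (n - i))) {..n})"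
  unfolding sg_gr_def assoc_graded_ring_def ideal_power_eq ord_coset_def
  by (simp_all add: fun_eq_iff)

lemma to_gr_zero: "to_gr 0 = \<zero>\<^bsub>sg_gr U :: (nat \<Rightarrow> 'k::field fps set) ring\<^esub>"
  by (simp add: to_gr_def ord_slice_zero ord_coset_zero sg_gr_simps)

lemma to_gr_one: "to_gr 1 = \<one>\<^bsub>sg_gr U :: (nat \<Rightarrow> 'k::field fps set) ring\<^esub>"
proof -
  have "ord_slice n (1 :: 'k fps) = (if n = 0 then 1 else 0)" for n
    using ord_0[OF U] by (intro fps_ext) (auto simp: ord_slice_def)
  then show ?thesis by (auto simp: to_gr_def ord_coset_zero sg_gr_simps fun_eq_iff)
qed

lemma to_gr_eq_zero_iff:
  assumes "x \<in> sg_on gr U"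
  shows "to_gr x n = (ord_ideal (Suc n) :: 'k::field fps set) \<longleftrightarrow> (\<forall>z. sg_ord U z = n \<longrightarrow> x $ z = 0)"
  unfolding to_gr_def ord_coset_zero[symmetric]
    ord_coset_eq_iff[OF ord_slice_in'[OF assms] sg_on_zero] by (auto simp: ord_slice_def)

text \<open>With this, an element of the graded ring, having finitely many non-zero components,
  comes from a series with finite support.\<close>

lemma finite_ord_fiber: "finite {z \<in> U. sg_ord U z = n}"
proof (rule finite_subset)
  show "{z \<in> U. sg_ord U z = n} \<subseteq> sum_mset ` {c. set_mset c \<subseteq> min_gens U \<and> size c \<le> n}"
    using ord_attained[OF U] by fastforce
qed (simp add: finite_msets_bounded_size finite_min_gens[OF U])

lemma to_gr_bij: "bij_betw to_gr (sg_on True U) (carrier (sg_gr U :: (nat \<Rightarrow> 'k::field fps set) ring))"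
proof (rule bij_betw_imageI)
  show "inj_on to_gr (sg_on True U :: 'k fps set)"
  proof (rule inj_onI, rule fps_ext)
    fix x y :: "'k fps" and z
    assume x: "x \<in> sg_on True U" and y: "y \<in> sg_on True U" and e: "to_gr x = to_gr y"
    have "to_gr x (sg_ord U z) = to_gr y (sg_ord U z)" using e by simp
    then show "x $ z = y $ z"
      unfolding to_gr_def ord_coset_eq_iff[OF ord_slice_in'[OF x] ord_slice_in'[OF y]]
      by (auto simp: ord_slice_def)
  qed
  show "to_gr ` sg_on True U = carrier (sg_gr U :: (nat \<Rightarrow> 'k fps set) ring)"
  proof (intro equalityI subsetI)
    fix f :: "nat \<Rightarrow> 'k fps set" assume "f \<in> to_gr ` sg_on True U"
    then obtain x where x: "x \<in> sg_on True U" "f = to_gr x" by blast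
    have "{n. f n \<noteq> ord_ideal (Suc n)} \<subseteq> sg_ord U ` {z. x $ z \<noteq> 0}"
      using to_gr_eq_zero_iff[OF x(1)] x(2) by auto
    then have "finite {n. f n \<noteq> ord_ideal (Suc n)}"
      by (rule finite_subset) (use x(1) in \<open>simp add: sg_on_def\<close>)
    moreover have "f n \<in> ord_coset n ` ord_ideal n" for n
      using ord_slice_in[OF x(1)] x(2) by (simp add: to_gr_def)
    ultimately show "f \<in> carrier (sg_gr U)" by (simp add: sg_gr_simps)
  next
    fix f :: "nat \<Rightarrow> 'k fps set" assume f: "f \<in> carrier (sg_gr U)"
    then have "\<forall>n. \<exists>x. x \<in> ord_ideal n \<and> f n = ord_coset n x" by (auto simp: sg_gr_simps)
    from choice[OF this] obtain x where x: "\<And>n. x n \<in> ord_ideal n" "\<And>n. f n = ord_coset n (x n)" by blast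
    \<comment> \<open>The preimage takes its coefficient at z from the representative of the
      component whose degree is the order of z.\<close>
    define a where "a = Abs_fps (\<lambda>z. x (sg_ord U z) $ z)"
    have sup: "z \<in> U" if "a $ z \<noteq> 0" for z
      using x(1)[of "sg_ord U z"] that by (simp add: a_def ord_ideal_def sg_on_def)
    have sl: "f n = ord_coset n (ord_slice n a)" for n
    proof -
      have "ord_slice n a \<in> sg_on False U" using sup by (auto simp: sg_on_def ord_slice_def split: if_splits)
      moreover have "x n $ z = 0" if "sg_ord U z < n" for z
        using x(1)[of n] that by (auto simp: ord_ideal_def)
      ultimately show ?thesis
        unfolding x(2) by (subst ord_coset_eq_iff[OF ord_ideal_sub[OF x(1)]]) (auto simp: ord_slice_def a_def)
    qed
    have zero: "a $ z = 0" if "f (sg_ord U z) = ord_ideal (Suc (sg_ord U z))" for z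
    proof -
      have "ord_coset (sg_ord U z) (x (sg_ord U z)) = ord_coset (sg_ord U z) 0"
        using that unfolding x(2) by (simp add: ord_coset_zero)
      then show ?thesis
        unfolding ord_coset_eq_iff[OF ord_ideal_sub[OF x(1)] sg_on_zero] by (simp add: a_def)
    qed
    have "{z. a $ z \<noteq> 0} \<subseteq> (\<Union>n\<in>{n. f n \<noteq> ord_ideal (Suc n)}. {z \<in> U. sg_ord U z = n})"
      using zero sup by auto
    then have "finite {z. a $ z \<noteq> 0}"
      by (rule finite_subset) (use f finite_ord_fiber in \<open>auto simp: sg_gr_simps\<close>)
    then have "a \<in> sg_on True U" using sup by (simp add: sg_on_def)
    moreover have "f = to_gr a" using sl by (simp add: to_gr_def fun_eq_iff)
    ultimately show "f \<in> to_gr ` sg_on True U" by blast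
  qed
qed

lemma to_gr_add:
  fixes x y :: "'k::field fps"
  assumes x: "x \<in> sg_on True U" and y: "y \<in> sg_on True U"
  shows "to_gr (x + y) = to_gr x \<oplus>\<^bsub>sg_gr U\<^esub> to_gr y"
proof -
  have "ord_coset n (ord_slice n x) <+>\<^bsub>sg_ring U\<^esub> ord_coset n (ord_slice n y) =
      ord_coset n (ord_slice n x + ord_slice n y)" for n
    using ideal.a_rcos_sum[OF ideal_ord_ideal, of "ord_slice n x" "ord_slice n y" "Suc n"]
      ord_slice_in'[OF x] ord_slice_in'[OF y] by (simp add: ord_coset_def)
  then show ?thesis by (simp add: sg_gr_simps to_gr_def ord_slice_add)
qed

lemma finsum_sg_ring:
  fixes f :: "'i \<Rightarrow> 'k::field fps"
  assumes "finite A" "\<And>i. i \<in> A \<Longrightarrow> f i \<in> sg_on False U"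
  shows "finsum (sg_ring U) f A = sum f A"
proof -
  interpret cring "sg_ring U :: 'k fps ring" by (rule cring_sg_ring)
  show ?thesis using assms by (induction A) (auto simp: finsum_insert)
qed

lemma rcoset_mult_ord:
  fixes x y :: "'k::field fps"
  assumes x: "x \<in> ord_ideal i" and y: "y \<in> ord_ideal j"
  shows "rcoset_mult (sg_ring U) (ord_ideal (Suc (i + j))) (ord_coset i x) (ord_coset j y) = ord_coset (i + j) (x * y)"
proof -
  have key: "ord_coset (i + j) (a * b) = ord_coset (i + j) (x * y)"
    if a: "a \<in> ord_coset i x" and b: "b \<in> ord_coset j y" for a b
  proof -
    have a': "a \<in> sg_on False U" "a - x \<in> ord_ideal (Suc i)" using ord_coset_mem[OF ord_ideal_sub[OF x] a] by auto
    have b': "b \<in> sg_on False U" "b - y \<in> ord_ideal (Suc j)" using ord_coset_mem[OF ord_ideal_sub[OF y] b] by auto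
    have "b = (b - y) + y" by simp
    then have bj: "b \<in> ord_ideal j"
      using ideal_onD(3)[OF ord_ideal_on ord_ideal_antimono[OF _ b'(2), of j] y] by simp
    \<comment> \<open>The identity a b - x y = (a - x) b + x (b - y) shows that the class of the
      product does not depend on the representatives.\<close>
    have "(a - x) * b + x * (b - y) \<in> ord_ideal (Suc (i + j))"
      using ideal_onD(3)[OF ord_ideal_on] ord_ideal_mult[OF a'(2) bj] ord_ideal_mult[OF x b'(2)] by simp
    then have "a * b - x * y \<in> ord_ideal (Suc (i + j))" by (simp add: algebra_simps)
    then have "\<forall>z. sg_ord U z \<le> i + j \<longrightarrow> (a * b) $ z = (x * y) $ z"
      by (auto simp: ord_ideal_def not_le[symmetric] Suc_le_eq)
    then show ?thesis
      unfolding ord_coset_eq_iff[OF subring_onD(4)[OF subring_sg_on a'(1) b'(1)]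
          subring_onD(4)[OF subring_sg_on ord_ideal_sub[OF x] ord_ideal_sub[OF y]]] .
  qed
  have ne: "ord_coset i x \<noteq> {}" "ord_coset j y \<noteq> {}"
    using ord_coset_self[OF ord_ideal_sub[OF x]] ord_coset_self[OF ord_ideal_sub[OF y]] by blast+
  have "rcoset_mult (sg_ring U) (ord_ideal (Suc (i + j))) (ord_coset i x) (ord_coset j y) =
      (\<Union>a\<in>ord_coset i x. \<Union>b\<in>ord_coset j y. ord_coset (i + j) (a * b))"
    by (simp add: rcoset_mult_def ord_coset_def)
  also have "\<dots> = (\<Union>a\<in>ord_coset i x. \<Union>b\<in>ord_coset j y. ord_coset (i + j) (x * y))"
    by (intro SUP_cong refl key)
  also have "\<dots> = ord_coset (i + j) (x * y)" using ne by simp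
  finally show ?thesis .
qed

text \<open>In degree n the product collects the pairs (u, v) whose orders add up to n. If u + v has
  order n, these are the pairs of the twisted convolution; if it has larger order, the term vanishes
  in the quotient; smaller order is excluded by superadditivity.\<close>

lemma to_gr_mult:
  fixes x y :: "'k::field fps"
  assumes x: "x \<in> sg_on True U" and y: "y \<in> sg_on True U"
  shows "to_gr (sg_mul True U x y) = to_gr x \<otimes>\<^bsub>sg_gr U\<^esub> to_gr y"
proof
  fix n
  let ?p = "\<lambda>i. ord_slice i x * ord_slice (n - i) y"
  have p: "?p i \<in> sg_on False U" for i
    using subring_onD(4)[OF subring_sg_on ord_slice_in'[OF x] ord_slice_in'[OF y]] .
  interpret cring "sg_ring U :: 'k fps ring" by (rule cring_sg_ring)
  interpret I: ideal "ord_ideal (Suc n)" "sg_ring U :: 'k fps ring" by (rule ideal_ord_ideal)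
  interpret h: ring_hom_cring "sg_ring U :: 'k fps ring" "sg_ring U Quot ord_ideal (Suc n)" "(+>\<^bsub>sg_ring U\<^esub>) (ord_ideal (Suc n))"
    by (rule I.rcos_ring_hom_cring) (rule cring_sg_ring)
  have "(to_gr x \<otimes>\<^bsub>sg_gr U\<^esub> to_gr y) n =
      finsum (sg_ring U Quot ord_ideal (Suc n)) (\<lambda>i. ord_ideal (Suc n) +>\<^bsub>sg_ring U\<^esub> ?p i) {..n}"
    unfolding sg_gr_simps to_gr_def
  proof (rule h.S.finsum_cong')
    fix i assume "i \<in> {..n}"
    then show "rcoset_mult (sg_ring U) (ord_ideal (Suc n)) (ord_coset i (ord_slice i x)) (ord_coset (n - i) (ord_slice (n - i) y)) =
        ord_ideal (Suc n) +>\<^bsub>sg_ring U\<^esub> ?p i"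
      using rcoset_mult_ord[OF ord_slice_in[OF x, of i] ord_slice_in[OF y, of "n - i"]] by (simp add: ord_coset_def)
  qed (use p h.hom_closed in auto)
  also have "\<dots> = ord_ideal (Suc n) +>\<^bsub>sg_ring U\<^esub> (finsum (sg_ring U) ?p {..n})"
    using h.hom_finsum[of ?p "{..n}"] p by (simp add: comp_def)
  also have "\<dots> = ord_coset n (\<Sum>i\<le>n. ?p i)"
    using finsum_sg_ring[of "{..n}" ?p] p by (simp add: ord_coset_def)
  also have "\<dots> = ord_coset n (ord_slice n (sg_mul True U x y))"
  proof (subst ord_coset_eq_iff)
    show "(\<Sum>i\<le>n. ?p i) \<in> sg_on False U" by (rule subring_on_sum[OF subring_sg_on p])
    show "ord_slice n (sg_mul True U x y) \<in> sg_on False U" by (rule ord_slice_in'[OF sg_mul_in[OF x y]])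
    have fin: "finite {(u, v). u + v = z}" for z :: nat by (rule finite_decomp_nat)
    have e: "(\<Sum>i\<le>n. ?p i) $ z = (\<Sum>(u, v) \<in> {(u, v). u + v = z}. if sg_ord U u + sg_ord U v = n then x $ u * y $ v else 0)" for z
    proof -
      have "(\<Sum>i\<le>n. ?p i) $ z = (\<Sum>i\<le>n. \<Sum>p \<in> {(u, v). u + v = z}. ord_slice i x $ fst p * ord_slice (n - i) y $ snd p)"
        by (simp add: fps_sum_nth fps_mult_pairs case_prod_unfold)
      also have "\<dots> = (\<Sum>p \<in> {(u, v). u + v = z}. \<Sum>i\<le>n. ord_slice i x $ fst p * ord_slice (n - i) y $ snd p)"
        by (rule sum.swap)
      also have "\<dots> = (\<Sum>p \<in> {(u, v). u + v = z}.
          if sg_ord U (fst p) + sg_ord U (snd p) = n then x $ fst p * y $ snd p else 0)"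
      proof (rule sum.cong[OF refl])
        fix p
        have "(\<Sum>i\<le>n. ord_slice i x $ fst p * ord_slice (n - i) y $ snd p) =
            (\<Sum>i\<le>n. if i = sg_ord U (fst p) then (if sg_ord U (snd p) = n - i then x $ fst p * y $ snd p else 0) else 0)"
          by (rule sum.cong) (auto simp: ord_slice_nth)
        also have "\<dots> = (if sg_ord U (fst p) \<le> n then (if sg_ord U (snd p) = n - sg_ord U (fst p) then x $ fst p * y $ snd p else 0) else 0)"
          by (subst sum.delta) auto
        also have "\<dots> = (if sg_ord U (fst p) + sg_ord U (snd p) = n then x $ fst p * y $ snd p else 0)" by auto
        finally show "(\<Sum>i\<le>n. ord_slice i x $ fst p * ord_slice (n - i) y $ snd p) =
          (if sg_ord U (fst p) + sg_ord U (snd p) = n then x $ fst p * y $ snd p else 0)" .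
      qed
      finally show ?thesis by (simp add: case_prod_unfold)
    qed
    show "\<forall>z. sg_ord U z \<le> n \<longrightarrow> (\<Sum>i\<le>n. ?p i) $ z = ord_slice n (sg_mul True U x y) $ z"
    proof (intro allI impI)
      fix z assume z: "sg_ord U z \<le> n"
      show "(\<Sum>i\<le>n. ?p i) $ z = ord_slice n (sg_mul True U x y) $ z"
      proof (cases "sg_ord U z = n")
        case True
        have "(\<Sum>i\<le>n. ?p i) $ z = (\<Sum>(u, v) \<in> {(u, v). u + v = z \<and> sg_ord U u + sg_ord U v = sg_ord U z}. x $ u * y $ v)"
          unfolding e True by (rule sum.mono_neutral_cong_right[OF fin]) (auto split: if_splits)
        then show ?thesis using True by (simp add: ord_slice_nth sg_mul_nth tconv_def sg_deg_def)
      next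
        case False
        have "(if sg_ord U u + sg_ord U v = n then x $ u * y $ v else 0) = 0" if uv: "u + v = z" for u v
        proof (cases "u \<in> U \<and> v \<in> U")
          case True
          then have "sg_ord U u + sg_ord U v \<le> sg_ord U z" using ord_add_le[OF U] uv by blast
          then show ?thesis using z False by simp
        next
          case False
          then have "x $ u = 0 \<or> y $ v = 0" using x y by (auto simp: sg_on_def)
          then show ?thesis by auto
        qed
        then have "(\<Sum>i\<le>n. ?p i) $ z = 0" unfolding e by (intro sum.neutral) auto
        then show ?thesis using False by (simp add: ord_slice_nth)
      qed
    qed
  qed
  finally show "to_gr (sg_mul True U x y) n = (to_gr x \<otimes>\<^bsub>sg_gr U\<^esub> to_gr y) n" by (simp add: to_gr_def)
qed

end

subsection \<open>Evaluation in the associated graded ring\<close>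

context
  fixes U :: "nat set" assumes U [simp]: "numerical_semigroup U"
begin

lemma sg_gr_elem:
  assumes "f \<in> carrier (sg_gr U :: (nat \<Rightarrow> 'k::field fps set) ring)"
  obtains x where "x \<in> sg_on True U" "f = to_gr U x"
  using assms to_gr_bij[OF U, where 'k = 'k] unfolding bij_betw_def by blast

lemma to_gr_in: "x \<in> sg_on True U \<Longrightarrow> to_gr U x \<in> carrier (sg_gr U :: (nat \<Rightarrow> 'k::field fps set) ring)"
  using to_gr_bij[OF U, where 'k = 'k] unfolding bij_betw_def by blast

lemma sg_mul_one: "sg_mul gr U 1 x = x"
  using sg_mul_const[OF U, of gr 1 x] by simp

lemma one_in: "1 \<in> sg_on gr U"
  using fps_const_in[OF U, of 1 gr] by simp

lemma comm_monoid_sg_gr: "comm_monoid (sg_gr U :: (nat \<Rightarrow> 'k::field fps set) ring)"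
proof (rule comm_monoidI)
  let ?A = "sg_gr U :: (nat \<Rightarrow> 'k fps set) ring"
  show "\<one>\<^bsub>?A\<^esub> \<in> carrier ?A" using to_gr_in[OF one_in] to_gr_one[OF U] by metis
  fix f g assume "f \<in> carrier ?A" "g \<in> carrier ?A"
  then obtain x y where x: "x \<in> sg_on True U" "f = to_gr U x" and y: "y \<in> sg_on True U" "g = to_gr U y"
    by (elim sg_gr_elem) blast
  show "f \<otimes>\<^bsub>?A\<^esub> g \<in> carrier ?A"
    unfolding x(2) y(2) to_gr_mult[OF U x(1) y(1), symmetric] by (rule to_gr_in[OF sg_mul_in[OF U x(1) y(1)]])
  show "f \<otimes>\<^bsub>?A\<^esub> g = g \<otimes>\<^bsub>?A\<^esub> f"
    unfolding x(2) y(2) to_gr_mult[OF U x(1) y(1), symmetric] to_gr_mult[OF U y(1) x(1), symmetric]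
    by (simp add: sg_mul_commute[of _ _ x])
  show "\<one>\<^bsub>?A\<^esub> \<otimes>\<^bsub>?A\<^esub> f = f"
    unfolding x(2) to_gr_one[OF U, symmetric] to_gr_mult[OF U one_in x(1), symmetric] by (simp add: sg_mul_one)
  fix h assume "h \<in> carrier ?A"
  then obtain z where z: "z \<in> sg_on True U" "h = to_gr U z" by (elim sg_gr_elem) blast
  show "f \<otimes>\<^bsub>?A\<^esub> g \<otimes>\<^bsub>?A\<^esub> h = f \<otimes>\<^bsub>?A\<^esub> (g \<otimes>\<^bsub>?A\<^esub> h)"
    unfolding x(2) y(2) z(2) to_gr_mult[OF U x(1) y(1), symmetric] to_gr_mult[OF U y(1) z(1), symmetric]
      to_gr_mult[OF U sg_mul_in[OF U x(1) y(1)] z(1), symmetric]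
      to_gr_mult[OF U x(1) sg_mul_in[OF U y(1) z(1)], symmetric]
    by (simp add: sg_mul_assoc[OF U x(1) y(1) z(1)])
qed

lemma abelian_monoid_sg_gr: "abelian_monoid (sg_gr U :: (nat \<Rightarrow> 'k::field fps set) ring)"
proof (rule abelian_monoidI)
  let ?A = "sg_gr U :: (nat \<Rightarrow> 'k fps set) ring"
  show "\<zero>\<^bsub>?A\<^esub> \<in> carrier ?A" using to_gr_in[OF sg_on_zero] to_gr_zero[OF U] by metis
  fix f g assume "f \<in> carrier ?A" "g \<in> carrier ?A"
  then obtain x y where x: "x \<in> sg_on True U" "f = to_gr U x" and y: "y \<in> sg_on True U" "g = to_gr U y"
    by (elim sg_gr_elem) blast
  show "f \<oplus>\<^bsub>?A\<^esub> g \<in> carrier ?A"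
    unfolding x(2) y(2) to_gr_add[OF U x(1) y(1), symmetric] by (rule to_gr_in[OF sg_on_add[OF x(1) y(1)]])
  show "f \<oplus>\<^bsub>?A\<^esub> g = g \<oplus>\<^bsub>?A\<^esub> f"
    unfolding x(2) y(2) to_gr_add[OF U x(1) y(1), symmetric] to_gr_add[OF U y(1) x(1), symmetric]
    by (simp add: add.commute)
  show "\<zero>\<^bsub>?A\<^esub> \<oplus>\<^bsub>?A\<^esub> f = f"
    unfolding x(2) to_gr_zero[OF U, symmetric] to_gr_add[OF U sg_on_zero x(1), symmetric] by simp
  fix h assume "h \<in> carrier ?A"
  then obtain z where z: "z \<in> sg_on True U" "h = to_gr U z" by (elim sg_gr_elem) blast
  show "f \<oplus>\<^bsub>?A\<^esub> g \<oplus>\<^bsub>?A\<^esub> h = f \<oplus>\<^bsub>?A\<^esub> (g \<oplus>\<^bsub>?A\<^esub> h)"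
    unfolding x(2) y(2) z(2) to_gr_add[OF U x(1) y(1), symmetric] to_gr_add[OF U y(1) z(1), symmetric]
      to_gr_add[OF U sg_on_add[OF x(1) y(1)] z(1), symmetric]
      to_gr_add[OF U x(1) sg_on_add[OF y(1) z(1)], symmetric]
    by (simp add: add.assoc)
qed

text \<open>The product of the classes of t^g over the members g of \<open>c\<close>, in the model:
  it survives in degree \<open>size c\<close> only if \<open>c\<close> is a longest factorization of
  its sum.\<close>

definition gr_mono :: "nat multiset \<Rightarrow> 'k::field fps" where
  "gr_mono c = Abs_fps (\<lambda>z. if z = \<Sum>\<^sub># c \<and> size c = sg_ord U z then 1 else 0)"

lemma gr_mono_in: "set_mset c \<subseteq> min_gens U \<Longrightarrow> gr_mono c \<in> sg_on True U"
  using sum_mset_in[OF U, of c]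
  by (auto simp: sg_on_def gr_mono_def intro: finite_subset[of _ "{\<Sum>\<^sub># c}"] split: if_splits)

lemma gr_mono_empty: "gr_mono {#} = 1"
  by (rule fps_ext) (auto simp: gr_mono_def ord_0[OF U])

lemma gr_mono_gen: "g \<in> min_gens U \<Longrightarrow> gr_mono {#g#} = fps_X ^ g"
  by (rule fps_ext) (auto simp: gr_mono_def ord_gen[OF U] fps_X_power_nth)

lemma gr_mono_mult:
  assumes c: "set_mset c \<subseteq> min_gens U" and c': "set_mset c' \<subseteq> min_gens U"
  shows "sg_mul True U (gr_mono c) (gr_mono c') = gr_mono (c + c')"
proof (rule fps_ext)
  fix z
  let ?u = "\<Sum>\<^sub># c" and ?v = "\<Sum>\<^sub># c'"
  have le: "size c \<le> sg_ord U ?u" "size c' \<le> sg_ord U ?v" "sg_ord U ?u + sg_ord U ?v \<le> sg_ord U (?u + ?v)"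
    using size_le_ord[OF U] c c' ord_add_le[OF U] sum_mset_in[OF U] by auto
  have "sg_mul True U (gr_mono c) (gr_mono c') $ z =
      (\<Sum>(u, v) \<in> (if ?u + ?v = z \<and> sg_ord U ?u + sg_ord U ?v = sg_ord U z then {(?u, ?v)} else {}).
        gr_mono c $ u * gr_mono c' $ v)"
    unfolding sg_mul_nth tconv_def
    by (intro sum.mono_neutral_right finite_subset[OF _ finite_decomp_nat[of z]])
      (auto simp: sg_deg_def gr_mono_def split: if_splits)
  also have "\<dots> = gr_mono (c + c') $ z"
    using le by (auto simp: gr_mono_def)
  finally show "sg_mul True U (gr_mono c) (gr_mono c') $ z = gr_mono (c + c') $ z" .
qed

lemma graded_class_eq:
  fixes x :: "'k::field fps"
  assumes "\<And>z. x $ z \<noteq> 0 \<Longrightarrow> sg_ord U z = n"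
  shows "graded_class (sg_ring U) (sg_max_ideal U) n x = to_gr U x"
proof -
  have "ord_slice U i x = (if i = n then x else 0)" for i
    using assms by (intro fps_ext) (auto simp: ord_slice_nth)
  then show ?thesis
    unfolding graded_class_def to_gr_def[OF U] ideal_power_eq[OF U]
    by (auto simp: fun_eq_iff ord_coset_zero[OF U, unfolded ord_coset_def[OF U]] ord_coset_def[OF U])
qed

text \<open>The sums and products over the record are computed by induction: powers of a generator
  first, then products over its distinct generators with \<open>gr_mono_mult\<close>, then the sum
  over the support of f.\<close>

lemma gr_subst_eq:
  fixes f :: "nat multiset \<Rightarrow> 'k::field"
  assumes f: "f \<in> carrier (mring True (min_gens U))"
  shows "gr_subst U f = to_gr U (sg_eval True U (Abs_mps f))"
proof -
  let ?A = "sg_gr U :: (nat \<Rightarrow> 'k fps set) ring"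
  interpret M: comm_monoid ?A by (rule comm_monoid_sg_gr)
  interpret A: abelian_monoid ?A by (rule abelian_monoid_sg_gr)
  have fin: "finite {m. f m \<noteq> 0}" and supp: "\<And>m. f m \<noteq> 0 \<Longrightarrow> set_mset m \<subseteq> min_gens U"
    using f by (auto simp: mring_simps mps_on_def)
  have pow: "graded_class (sg_ring U) (sg_max_ideal U) 1 (fps_X ^ g) [^]\<^bsub>?A\<^esub> n = to_gr U (gr_mono (replicate_mset n g))"
    if g: "g \<in> min_gens U" for g n
  proof (induction n)
    case 0 show ?case by (simp add: gr_mono_empty to_gr_one[OF U])
  next
    case (Suc n)
    have "graded_class (sg_ring U) (sg_max_ideal U) 1 (fps_X ^ g) = to_gr U (gr_mono {#g#} :: 'k fps)"
      unfolding gr_mono_gen[OF g]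
      by (rule graded_class_eq) (auto simp: fps_X_power_nth ord_gen[OF U g] split: if_splits)
    then have "graded_class (sg_ring U) (sg_max_ideal U) 1 (fps_X ^ g) [^]\<^bsub>?A\<^esub> Suc n =
        to_gr U (gr_mono (replicate_mset n g)) \<otimes>\<^bsub>?A\<^esub> to_gr U (gr_mono {#g#})"
      using Suc by simp
    also have "\<dots> = to_gr U (gr_mono (replicate_mset n g + {#g#}))"
      using g by (subst to_gr_mult[OF U, symmetric]) (auto intro!: gr_mono_in simp: gr_mono_mult split: if_splits)
    finally show ?case by simp
  qed
  have prod: "(\<Otimes>\<^bsub>?A\<^esub> g \<in> B. graded_class (sg_ring U) (sg_max_ideal U) 1 (fps_X ^ g) [^]\<^bsub>?A\<^esub> count m g) =
      to_gr U (gr_mono (filter_mset (\<lambda>x. x \<in> B) m))" if "finite B" "B \<subseteq> min_gens U" for B m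
    using that
  proof (induction B)
    case empty show ?case by (simp add: gr_mono_empty to_gr_one[OF U])
  next
    case (insert g B)
    have in1: "gr_mono (replicate_mset n h) \<in> (sg_on True U :: 'k fps set)" if "h \<in> insert g B" for n h
      using that insert.prems by (intro gr_mono_in) (auto split: if_splits)
    have in2: "gr_mono (filter_mset (\<lambda>x. x \<in> B) m) \<in> (sg_on True U :: 'k fps set)"
      using insert.prems by (intro gr_mono_in) auto
    have split: "filter_mset (\<lambda>x. x \<in> insert g B) m = replicate_mset (count m g) g + filter_mset (\<lambda>x. x \<in> B) m"
      using insert.hyps(2) by (intro multiset_eqI) auto
    have "(\<Otimes>\<^bsub>?A\<^esub> h \<in> insert g B. graded_class (sg_ring U) (sg_max_ideal U) 1 (fps_X ^ h) [^]\<^bsub>?A\<^esub> count m h) =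
        to_gr U (gr_mono (replicate_mset (count m g) g)) \<otimes>\<^bsub>?A\<^esub> to_gr U (gr_mono (filter_mset (\<lambda>x. x \<in> B) m))"
      using insert pow in1 by (subst M.finprod_insert) (auto simp: subset_iff to_gr_in)
    also have "\<dots> = to_gr U (gr_mono (filter_mset (\<lambda>x. x \<in> insert g B) m))"
      unfolding split using in1 in2 insert.prems
      by (subst to_gr_mult[OF U, symmetric], simp, simp, subst gr_mono_mult) (auto split: if_splits)
    finally show ?case .
  qed
  have summand: "graded_class (sg_ring U) (sg_max_ideal U) 0 (fps_const (f m)) \<otimes>\<^bsub>?A\<^esub>
      (\<Otimes>\<^bsub>?A\<^esub> g \<in> set_mset m. graded_class (sg_ring U) (sg_max_ideal U) 1 (fps_X ^ g) [^]\<^bsub>?A\<^esub> count m g) =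
      to_gr U (fps_const (f m) * gr_mono m) \<and> fps_const (f m) * gr_mono m \<in> sg_on True U"
    if m: "set_mset m \<subseteq> min_gens U" for m
  proof -
    have c: "graded_class (sg_ring U) (sg_max_ideal U) 0 (fps_const (f m)) = to_gr U (fps_const (f m))"
      by (rule graded_class_eq) (auto simp: ord_0[OF U] split: if_splits)
    have "filter_mset (\<lambda>x. x \<in> set_mset m) m = m" by (rule multiset_eqI) (simp add: not_in_iff)
    then show ?thesis
      using prod[of "set_mset m" m] m gr_mono_in[OF m] sg_mul_in[OF U fps_const_in[OF U] gr_mono_in[OF m], of "f m"]
      by (simp add: c to_gr_mult[OF U fps_const_in[OF U] gr_mono_in[OF m], symmetric] sg_mul_const[OF U])
  qed
  have sum: "(\<Oplus>\<^bsub>?A\<^esub> m \<in> B. graded_class (sg_ring U) (sg_max_ideal U) 0 (fps_const (f m)) \<otimes>\<^bsub>?A\<^esub>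
      (\<Otimes>\<^bsub>?A\<^esub> g \<in> set_mset m. graded_class (sg_ring U) (sg_max_ideal U) 1 (fps_X ^ g) [^]\<^bsub>?A\<^esub> count m g)) =
      to_gr U (\<Sum>m\<in>B. fps_const (f m) * gr_mono m) \<and> (\<Sum>m\<in>B. fps_const (f m) * gr_mono m) \<in> sg_on True U"
    if "finite B" "\<And>m. m \<in> B \<Longrightarrow> set_mset m \<subseteq> min_gens U" for B
    using that
  proof (induction B)
    case empty show ?case by (simp add: to_gr_zero[OF U] sg_on_zero)
  next
    case (insert m B)
    have s: "set_mset m' \<subseteq> min_gens U" if "m' \<in> insert m B" for m' using insert.prems that by blast
    have "(\<lambda>m. graded_class (sg_ring U) (sg_max_ideal U) 0 (fps_const (f m)) \<otimes>\<^bsub>?A\<^esub>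
      (\<Otimes>\<^bsub>?A\<^esub> g \<in> set_mset m. graded_class (sg_ring U) (sg_max_ideal U) 1 (fps_X ^ g) [^]\<^bsub>?A\<^esub> count m g)) \<in> B \<rightarrow> carrier ?A"
      using summand[OF s] by (auto simp: to_gr_in)
    then show ?case
      using insert summand[OF s] by (subst A.finsum_insert) (auto simp: to_gr_in to_gr_add[OF U] sg_on_add)
  qed
  have "(\<Sum>m | f m \<noteq> 0. fps_const (f m) * gr_mono m) = sg_eval True U (Abs_mps f)"
  proof (rule fps_ext)
    fix z
    have fib: "finite {m. set_mset m \<subseteq> min_gens U \<and> \<Sum>\<^sub># m = z \<and> size m = sg_ord U z}"
      by (rule finite_subset[OF _ fiber_finite[OF U, of z]]) auto
    have "(\<Sum>m | f m \<noteq> 0. fps_const (f m) * gr_mono m) $ z =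
        (\<Sum>m | f m \<noteq> 0. if z = \<Sum>\<^sub># m \<and> size m = sg_ord U z then f m else 0)"
      by (simp add: fps_sum_nth gr_mono_def if_distrib cong: if_cong)
    also have "\<dots> = (\<Sum>m | m \<in> {m. set_mset m \<subseteq> min_gens U} \<and> \<Sum>\<^sub># m = z \<and> size m = sg_ord U z. f m)"
      by (rule sum.mono_neutral_cong)
        (use fin supp fib in auto)
    finally show "(\<Sum>m | f m \<noteq> 0. fps_const (f m) * gr_mono m) $ z = sg_eval True U (Abs_mps f) $ z"
      by (simp add: sg_eval_def push_def sg_deg_def)
  qed
  then show ?thesis
    unfolding gr_subst_def Let_def using sum[OF fin] supp by simp
qed

lemma sg_subst_eq: "sg_subst U f = sg_eval False U (Abs_mps f)"
  by (rule fps_ext) (simp add: sg_subst_def sg_eval_def push_def sg_deg_def)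

lemma module_model_ring:
  assumes "ring_model (mring False (min_gens U)) \<rho> C"
    and act: "\<And>r x. r \<in> carrier (mring False (min_gens U)) \<Longrightarrow> act (\<rho> r) x = sg_mul False U (sg_eval False U (Abs_mps r)) x"
  shows "module_model (mring False (min_gens U)) \<rho> C
    (module_via (sg_subst U) (sg_ring U :: 'k::field fps ring)) (\<lambda>x. x) (sg_on False U) act"
proof (rule module_model.intro[OF assms(1)], unfold_locales)
  let ?N = "module_via (sg_subst U) (sg_ring U :: 'k fps ring)"
  show "bij_betw (\<lambda>x. x) (sg_on False U) (carrier ?N)" by (simp add: module_via_def bij_betw_def)
  fix x y :: "'k fps" assume x: "x \<in> sg_on False U"
  { assume y: "y \<in> sg_on False U"
    show "x + y \<in> sg_on False U \<and> x + y = x \<oplus>\<^bsub>?N\<^esub> y" using sg_on_add[OF x y] by (simp add: module_via_def) }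
  fix r :: "nat multiset \<Rightarrow> 'k" assume r: "r \<in> carrier (mring False (min_gens U))"
  then have "sg_eval False U (Abs_mps r) \<in> sg_on False U" by (intro sg_eval_in[OF U]) (simp add: mring_simps)
  then show "act (\<rho> r) x \<in> sg_on False U \<and> act (\<rho> r) x = r \<odot>\<^bsub>?N\<^esub> x"
    using sg_mul_in[OF U _ x] act[OF r] by (simp add: module_via_def sg_subst_eq sg_mul_False)
qed (simp_all add: sg_on_zero module_via_def)

lemma module_model_gr:
  assumes "ring_model (mring True (min_gens U)) \<rho> C"
    and act: "\<And>r x. r \<in> carrier (mring True (min_gens U)) \<Longrightarrow> act (\<rho> r) x = sg_mul True U (sg_eval True U (Abs_mps r)) x"
  shows "module_model (mring True (min_gens U)) \<rho> C
    (module_via (gr_subst U) (sg_gr U :: (nat \<Rightarrow> 'k::field fps set) ring)) (to_gr U) (sg_on True U) act"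
proof (rule module_model.intro[OF assms(1)], unfold_locales)
  let ?N = "module_via (gr_subst U) (sg_gr U :: (nat \<Rightarrow> 'k fps set) ring)"
  show "bij_betw (to_gr U) (sg_on True U) (carrier ?N)" using to_gr_bij[OF U] by (simp add: module_via_def)
  fix x y :: "'k fps" assume x: "x \<in> sg_on True U"
  { assume y: "y \<in> sg_on True U"
    show "x + y \<in> sg_on True U \<and> to_gr U (x + y) = to_gr U x \<oplus>\<^bsub>?N\<^esub> to_gr U y"
      using sg_on_add[OF x y] to_gr_add[OF U x y] by (simp add: module_via_def) }
  fix r :: "nat multiset \<Rightarrow> 'k" assume r: "r \<in> carrier (mring True (min_gens U))"
  then have e: "sg_eval True U (Abs_mps r) \<in> sg_on True U" by (intro sg_eval_in[OF U]) (simp add: mring_simps)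
  show "act (\<rho> r) x \<in> sg_on True U \<and> to_gr U (act (\<rho> r) x) = r \<odot>\<^bsub>?N\<^esub> to_gr U x"
    using sg_mul_in[OF U e x] act[OF r] to_gr_mult[OF U e x] by (simp add: module_via_def gr_subst_eq[OF r])
qed (simp_all add: sg_on_zero module_via_def to_gr_zero[OF U])

lemma assoc_graded_hom_iff:
  fixes x :: "'k::field fps"
  assumes x: "x \<in> sg_on True U"
  shows "to_gr U x \<in> assoc_graded_hom (sg_ring U) (sg_max_ideal U) e \<longleftrightarrow> (\<forall>z. x $ z \<noteq> 0 \<longrightarrow> int (sg_ord U z) = e)"
  using to_gr_in[OF x] to_gr_eq_zero_iff[OF U x]
  unfolding assoc_graded_hom_def sg_gr_def[symmetric] ideal_power_eq[OF U] by auto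

lemma kernel_gr_subst:
  "a_kernel (mring True (min_gens U)) (sg_gr U) (gr_subst U) =
    {f \<in> carrier (mring True (min_gens U)). sg_eval True U (Abs_mps f) = (0 :: 'k::field fps)}"
proof -
  have "gr_subst U f = \<zero>\<^bsub>sg_gr U\<^esub> \<longleftrightarrow> sg_eval True U (Abs_mps f) = 0"
    if f: "f \<in> carrier (mring True (min_gens U))" for f :: "nat multiset \<Rightarrow> 'k"
  proof -
    have e: "sg_eval True U (Abs_mps f) \<in> sg_on True U"
      using f by (intro sg_eval_in[OF U]) (simp add: mring_simps)
    show ?thesis
      unfolding gr_subst_eq[OF f] to_gr_zero[OF U, symmetric]
      using to_gr_bij[OF U, where 'k = 'k] e sg_on_zero by (auto simp: bij_betw_def inj_on_def)
  qed
  then show ?thesis by (auto simp: a_kernel_def')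
qed

end

section \<open>The projection onto the ring of the duplication\<close>

lemma tconv_alt:
  assumes "finite {(u, v). u + v = z}"
  shows "tconv \<delta> f g z = (\<Sum>(u, v) \<in> {(u, v). u + v = z}. if \<delta> u + \<delta> v = \<delta> z then f u * g v else 0)"
  unfolding tconv_def by (rule sum.mono_neutral_cong_left[OF assms]) (auto split: if_splits)

context semigroup_double
begin

text \<open>In the graded case this is the degree of t^x y^k for the argument (x, k): x counts with
  its order in S and y has degree 1.\<close>

definition pair_deg :: "bool \<Rightarrow> nat \<times> nat \<Rightarrow> nat" where
  "pair_deg gr p = (if gr then sg_ord S (fst p) + snd p else 0)"

definition pair_sum :: "nat \<times> nat \<Rightarrow> nat" where
  "pair_sum p = 2 * fst p + c * snd p"

text \<open>The substitution \<open>t \<mapsto> t\<^sup>2\<close>, \<open>y \<mapsto> t\<^bsup>c\<^esup>\<close>, restricted in the graded case to the monomials whose order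
  is preserved.\<close>

definition proj :: "bool \<Rightarrow> 'k::field fps fps \<Rightarrow> 'k fps" where
  "proj gr s = Abs_fps (push (pair_deg gr) (sg_deg gr D) pair_sum (S \<times> UNIV) (\<lambda>p. s $ snd p $ fst p))"

definition act :: "bool \<Rightarrow> (nat, 'k::field) mps \<Rightarrow> 'k fps \<Rightarrow> 'k fps" where
  "act gr r x = sg_mul gr S (sg_eval gr S r) x"

definition eval_fps :: "bool \<Rightarrow> (nat, 'k::field) mps fps \<Rightarrow> 'k fps fps" where
  "eval_fps gr F = Abs_fps (\<lambda>k. sg_eval gr S (F $ k))"

text \<open>An element of the ring in y acts on the ring of D through its value there, computed
  first coefficientwise in S and then by \<open>proj\<close>. By \<open>eval_dcoeff\<close> this is
  the substitution belonging to D.\<close>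

definition act' :: "bool \<Rightarrow> (nat, 'k::field) mps fps \<Rightarrow> 'k fps \<Rightarrow> 'k fps" where
  "act' gr F x = sg_mul gr D (proj gr (eval_fps gr F)) x"

lemma c_pos: "c > 0"
  using c(2) by (cases c) auto

lemma finite_pair_fiber: "finite {p \<in> S \<times> UNIV. pair_sum p = z}"
proof (rule finite_subset)
  show "{p \<in> S \<times> UNIV. pair_sum p = z} \<subseteq> {..z} \<times> {..z}"
  proof
    fix p assume "p \<in> {p \<in> S \<times> UNIV. pair_sum p = z}"
    then have "2 * fst p + c * snd p = z" by (simp add: pair_sum_def)
    moreover have "snd p \<le> c * snd p" using c_pos by simp
    ultimately have "fst p \<le> z \<and> snd p \<le> z" by linarith
    then show "p \<in> {..z} \<times> {..z}" by (cases p) auto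
  qed
qed simp

lemma proj_nth: "proj gr s $ z =
    (\<Sum>p | p \<in> S \<times> UNIV \<and> pair_sum p = z \<and> pair_deg gr p = sg_deg gr D z. s $ snd p $ fst p)"
  by (simp add: proj_def push_def)

lemma proj_add: "proj gr (s + t) = proj gr s + proj gr t"
  by (rule fps_ext) (simp add: proj_nth sum.distrib)

lemma proj_nonzero:
  assumes "proj gr s $ z \<noteq> 0"
  shows "\<exists>x k. x \<in> S \<and> 2 * x + c * k = z \<and> pair_deg gr (x, k) = sg_deg gr D z \<and> s $ k $ x \<noteq> 0"
proof -
  obtain p where "p \<in> {p. p \<in> S \<times> UNIV \<and> pair_sum p = z \<and> pair_deg gr p = sg_deg gr D z}" "s $ snd p $ fst p \<noteq> 0"
    using assms unfolding proj_nth by (meson sum.not_neutral_contains_not_neutral)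
  then show ?thesis by (intro exI[of _ "fst p"] exI[of _ "snd p"]) (auto simp: pair_sum_def)
qed

lemma proj_in:
  assumes s: "s \<in> fps_ext gr (sg_on gr S)" shows "proj gr s \<in> sg_on gr D"
proof -
  have "z \<in> D" if "proj gr s $ z \<noteq> 0" for z using proj_nonzero[OF that] double_in by blast
  moreover have "finite {z. proj gr s $ z \<noteq> 0}" if gr
  proof (rule finite_subset)
    show "{z. proj gr s $ z \<noteq> 0} \<subseteq> (\<lambda>(k, x). 2 * x + c * k) ` (SIGMA k:{k. s $ k \<noteq> 0}. {x. s $ k $ x \<noteq> 0})"
    proof
      fix z assume "z \<in> {z. proj gr s $ z \<noteq> 0}"
      then obtain x k where "2 * x + c * k = z" "s $ k $ x \<noteq> 0" using proj_nonzero[of gr s z] by blast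
      then show "z \<in> (\<lambda>(k, x). 2 * x + c * k) ` (SIGMA k:{k. s $ k \<noteq> 0}. {x. s $ k $ x \<noteq> 0})"
        by (intro image_eqI[of _ _ "(k, x)"]) auto
    qed
    show "finite ((\<lambda>(k, x). 2 * x + c * k) ` (SIGMA k:{k. s $ k \<noteq> 0}. {x. s $ k $ x \<noteq> 0}))"
      using s that by (auto simp: fps_ext_def sg_on_def)
  qed
  ultimately show ?thesis by (simp add: sg_on_def)
qed

text \<open>The product of series in y over the ring of S is a twisted convolution on pairs (x, k),
  and \<open>proj\<close> is a push-forward along \<open>pair_sum\<close>. Multiplicativity is then
  \<open>push_tconv\<close>, whose bound on weights comes from \<open>ord_double_ge\<close>.\<close>

lemma proj_act:
  assumes r: "r \<in> fps_ext gr (mps_on gr G)" and s: "s \<in> fps_ext gr (sg_on gr S)"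
  shows "proj gr (fps_act (act gr) r s) = act' gr r (proj gr s)"
proof (rule fps_ext)
  fix z
  let ?f = "\<lambda>p. eval_fps gr r $ snd p $ fst p" and ?g = "\<lambda>p. s $ snd p $ fst p"
  have rk: "sg_eval gr S (r $ k) \<in> sg_on gr S" for k
    by (rule sg_eval_in[OF S]) (use r in \<open>simp add: fps_ext_def\<close>)
  have suppf: "supp_on (S \<times> UNIV) ?f"
    using rk by (auto simp: supp_on_def eval_fps_def sg_on_def)
  have suppg: "supp_on (S \<times> UNIV) ?g"
    using s by (auto simp: supp_on_def fps_ext_def sg_on_def)
  have fin2: "finite {(u, v). u + v = (q :: nat \<times> nat)}" for q
    by (rule finite_decomp_prod[OF finite_decomp_nat finite_decomp_nat])
  have conv: "fps_act (act gr) r s $ k $ x = tconv (pair_deg gr) ?f ?g (x, k)" for k x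
  proof -
    have "tconv (pair_deg gr) ?f ?g (x, k) = (\<Sum>(p, p') \<in> {(p, p'). p + p' = (x, k)}.
        if pair_deg gr p + pair_deg gr p' = pair_deg gr (x, k) then ?f p * ?g p' else 0)"
      by (rule tconv_alt[OF fin2])
    also have "\<dots> = (\<Sum>i=0..k. \<Sum>(u, v) \<in> {(u, v). u + v = x}.
        if pair_deg gr (u, i) + pair_deg gr (v, k - i) = pair_deg gr (x, k) then ?f (u, i) * ?g (v, k - i) else 0)"
      by (rule sum_decomp_pair)
    also have "\<dots> = (\<Sum>i=0..k. tconv (sg_deg gr S) (fps_nth (sg_eval gr S (r $ i))) (fps_nth (s $ (k - i))) x)"
      unfolding tconv_alt[OF finite_decomp_nat]
      by (intro sum.cong refl) (auto simp: pair_deg_def sg_deg_def eval_fps_def)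
    finally show ?thesis by (simp add: fps_act_def act_def sg_mul_nth fps_sum_nth)
  qed
  have sumadd: "pair_sum (p + q) = pair_sum p + pair_sum q" for p q
    by (simp add: pair_sum_def algebra_simps)
  have A: "superadd_on (S \<times> UNIV) (pair_deg gr)"
    using superadd_ord[OF S] by (auto simp: superadd_on_def pair_deg_def)
  have img: "pair_sum ` (S \<times> UNIV) \<subseteq> D" using double_in by (auto simp: pair_sum_def)
  have B: "superadd_on (pair_sum ` (S \<times> UNIV)) (sg_deg gr D)"
    unfolding superadd_on_def
  proof (intro ballI conjI)
    fix u v assume uv: "u \<in> pair_sum ` (S \<times> UNIV)" "v \<in> pair_sum ` (S \<times> UNIV)"
    then obtain p q where "p \<in> S \<times> UNIV" "u = pair_sum p" "q \<in> S \<times> UNIV" "v = pair_sum q" by blast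
    moreover from this have "p + q \<in> S \<times> UNIV" using sg_closed(2)[OF S] by (cases p; cases q) simp
    ultimately show "u + v \<in> pair_sum ` (S \<times> UNIV)" by (metis imageI sumadd)
    have "u \<in> D" "v \<in> D" using uv img by auto
    then show "sg_deg gr D u + sg_deg gr D v \<le> sg_deg gr D (u + v)"
      using superadd_sg_deg[OF D, of gr] by (simp add: superadd_on_def)
  qed
  have le: "pair_deg gr p \<le> sg_deg gr D (pair_sum p)" if "p \<in> S \<times> UNIV" for p
    using ord_double_ge[of "fst p" "snd p"] that by (cases p) (simp add: pair_deg_def sg_deg_def pair_sum_def)
  have "proj gr (fps_act (act gr) r s) $ z = push (pair_deg gr) (sg_deg gr D) pair_sum (S \<times> UNIV) (tconv (pair_deg gr) ?f ?g) z"
    unfolding proj_def fps_nth_Abs_fps conv by simp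
  also have "\<dots> = tconv (sg_deg gr D) (push (pair_deg gr) (sg_deg gr D) pair_sum (S \<times> UNIV) ?f)
      (push (pair_deg gr) (sg_deg gr D) pair_sum (S \<times> UNIV) ?g) z"
    by (rule push_tconv[OF fin2 finite_decomp_nat finite_pair_fiber A B le sumadd suppf suppg])
  also have "\<dots> = act' gr r (proj gr s) $ z"
    by (simp add: act'_def sg_mul_nth proj_def fps_nth_Abs_fun)
  finally show "proj gr (fps_act (act gr) r s) $ z = act' gr r (proj gr s) $ z" .
qed

text \<open>A monomial of D is given by k and a factorization m of some x in S. In the graded case
  the length of m plus k is at most the order of x plus k, and this is at most the order of z in D;
  so the single condition imposed in D, equality of the outer terms, splits into the condition for S
  and the one for \<open>proj\<close>.\<close>

lemma eval_dcoeff: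
  fixes f :: "nat multiset \<Rightarrow> 'k::field"
  shows "proj gr (eval_fps gr (dcoeff f)) = sg_eval gr D (Abs_mps f)"
proof (rule fps_ext)
  fix z
  let ?P = "{p. p \<in> S \<times> UNIV \<and> pair_sum p = z \<and> pair_deg gr p = sg_deg gr D z}"
  let ?Q = "\<lambda>x. {m. m \<in> {m. set_mset m \<subseteq> G} \<and> \<Sum>\<^sub># m = x \<and> (if gr then size m else 0) = sg_deg gr S x}"
  let ?R = "{m. m \<in> {m. set_mset m \<subseteq> min_gens D} \<and> \<Sum>\<^sub># m = z \<and> (if gr then size m else 0) = sg_deg gr D z}"
  have finP: "finite ?P" by (rule finite_subset[OF _ finite_pair_fiber[of z]]) auto
  have finQ: "finite (?Q x)" for x by (rule finite_subset[OF _ fiber_finite[OF S, of x]]) auto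
  have "proj gr (eval_fps gr (dcoeff f)) $ z = (\<Sum>p\<in>?P. \<Sum>m\<in>?Q (fst p). f (dmon (m, snd p)))"
    by (simp add: proj_nth eval_fps_def sg_eval_def push_def)
  also have "\<dots> = (\<Sum>(p, m)\<in>(SIGMA p:?P. ?Q (fst p)). f (dmon (m, snd p)))"
    by (rule sum.Sigma) (use finP finQ in auto)
  also have "\<dots> = (\<Sum>m'\<in>?R. f m')"
  proof -
    have bij: "bij_betw (\<lambda>(p, m). dmon (m, snd p)) (SIGMA p:?P. ?Q (fst p)) ?R"
    proof (rule bij_betw_imageI)
      show "inj_on (\<lambda>(p, m). dmon (m, snd p)) (SIGMA p:?P. ?Q (fst p))"
        by (auto intro!: inj_onI dest!: injD[OF dmon_inj])
      show "(\<lambda>(p, m). dmon (m, snd p)) ` (SIGMA p:?P. ?Q (fst p)) = ?R"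
      proof (intro equalityI subsetI)
        fix m' assume "m' \<in> (\<lambda>(p, m). dmon (m, snd p)) ` (SIGMA p:?P. ?Q (fst p))"
        then obtain x k m where m': "m' = dmon (m, k)" and "x \<in> S" and z: "2 * x + c * k = z"
          and deg: "pair_deg gr (x, k) = sg_deg gr D z" and m: "set_mset m \<subseteq> G" "\<Sum>\<^sub># m = x"
          "(if gr then size m else 0) = sg_deg gr S x"
          by (auto simp: pair_sum_def)
        have "\<Sum>\<^sub># m' = z" using dmon_sum[of "(m, k)"] m m' z by simp
        moreover have "set_mset m' \<subseteq> min_gens D" using dmon_set[of "(m, k)"] m m' by simp
        moreover have "(if gr then size m' else 0) = sg_deg gr D z"
          using deg m(3) m' dmon_size[of "(m, k)"] by (auto simp: pair_deg_def sg_deg_def)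
        ultimately show "m' \<in> ?R" by simp
      next
        fix m' assume m': "m' \<in> ?R"
        then obtain p where p: "set_mset (fst p) \<subseteq> G" "dmon p = m'" using dmon_surj by blast
        let ?x = "\<Sum>\<^sub># (fst p)" and ?k = "snd p"
        have x: "?x \<in> S" by (rule sum_mset_in[OF S p(1)])
        have z: "2 * ?x + c * ?k = z" using m' dmon_sum[of p] p(2) by simp
        have "size (fst p) \<le> sg_ord S ?x" by (rule size_le_ord[OF S p(1)])
        moreover have "sg_ord S ?x + ?k \<le> sg_ord D z" using ord_double_ge[OF x, of ?k] z by simp
        moreover have "(if gr then size (fst p) + ?k else 0) = sg_deg gr D z"
          using m' dmon_size[of p] p(2) by auto
        ultimately have "(if gr then size (fst p) else 0) = sg_deg gr S ?x" "pair_deg gr (?x, ?k) = sg_deg gr D z"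
          by (auto simp: sg_deg_def pair_deg_def split: if_splits)
        then have "((?x, ?k), fst p) \<in> (SIGMA p:?P. ?Q (fst p))" using x z p(1) by (simp add: pair_sum_def)
        moreover have "m' = (\<lambda>(p, m). dmon (m, snd p)) ((?x, ?k), fst p)" using p(2) by simp
        ultimately show "m' \<in> (\<lambda>(p, m). dmon (m, snd p)) ` (SIGMA p:?P. ?Q (fst p))" by (rule rev_image_eqI)
      qed
    qed
    from sum.reindex_bij_betw[OF bij, of f] show ?thesis by (simp add: case_prod_unfold)
  qed
  also have "\<dots> = sg_eval gr D (Abs_mps f) $ z" by (simp add: sg_eval_def push_def)
  finally show "proj gr (eval_fps gr (dcoeff f)) $ z = sg_eval gr D (Abs_mps f) $ z" .
qed

text \<open>By \<open>ord_double\<close> only pairs with k <= 1 contribute in the graded case, and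
  the parity of the exponent tells k = 0 from k = 1.\<close>

lemma proj_gr_nth:
  assumes x: "x \<in> S" and k: "k \<le> 1"
  shows "proj True s $ (2 * x + c * k) = s $ k $ x"
proof -
  have "{p. p \<in> S \<times> UNIV \<and> pair_sum p = 2 * x + c * k \<and> pair_deg True p = sg_deg True D (2 * x + c * k)} = {(x, k)}"
  proof (intro equalityI subsetI)
    fix p assume "p \<in> {p. p \<in> S \<times> UNIV \<and> pair_sum p = 2 * x + c * k \<and> pair_deg True p = sg_deg True D (2 * x + c * k)}"
    then obtain x' k' where p: "p = (x', k')" "x' \<in> S" and e: "2 * x' + c * k' = 2 * x + c * k"
      and "sg_ord S x' + k' = sg_ord D (2 * x + c * k)"
      by (cases p) (auto simp: pair_sum_def pair_deg_def sg_deg_def)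
    then have "sg_ord D (2 * x' + c * k') = sg_ord S x' + k'" by simp
    then have k': "k' \<le> 1" using ord_double[OF p(2), of k'] by simp
    have "even (c * k') = even (c * k)" using e by presburger
    then have "k' = k" using c(2) k k' by (cases k; cases k') auto
    then show "p \<in> {(x, k)}" using e p by simp
  qed (use x k ord_double[OF x, of k] in \<open>auto simp: pair_sum_def pair_deg_def sg_deg_def\<close>)
  then show ?thesis by (simp add: proj_nth)
qed

lemma proj_gr_eq_zero:
  assumes s: "s \<in> fps_ext True (sg_on True S)"
  shows "proj True s = 0 \<longleftrightarrow> s $ 0 = 0 \<and> s $ 1 = 0"
proof
  assume p: "proj True s = 0"
  have "s $ k = 0" if "k \<le> 1" for k
  proof (rule fps_ext)
    fix x
    show "s $ k $ x = 0 $ x"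
    proof (cases "x \<in> S")
      case True then show ?thesis using proj_gr_nth[OF True that, of s] p by simp
    next
      case False then show ?thesis using s by (auto simp: fps_ext_def sg_on_def)
    qed
  qed
  then show "s $ 0 = 0 \<and> s $ 1 = 0" by simp
next
  assume z: "s $ 0 = 0 \<and> s $ 1 = 0"
  show "proj True s = 0"
  proof (rule fps_ext, rule ccontr)
    fix n assume "proj True s $ n \<noteq> 0 $ n"
    then obtain x k where x: "x \<in> S" "2 * x + c * k = n" "pair_deg True (x, k) = sg_deg True D n" "s $ k $ x \<noteq> 0"
      using proj_nonzero[of True s n] by auto
    then have "k \<le> 1" using ord_double[OF x(1), of k] by (auto simp: pair_deg_def sg_deg_def)
    then have "k = 0 \<or> k = 1" by auto
    then show False using z x(4) by auto
  qed
qed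

text \<open>With s = s_0 + y s' this is the identity proj s = s_0(t^2) + t^c proj s'.\<close>

lemma proj_peel:
  "proj False s $ z = (if even z \<and> z div 2 \<in> S then s $ 0 $ (z div 2) else 0) +
     (if c \<le> z then proj False (Abs_fps (\<lambda>k. s $ Suc k)) $ (z - c) else 0)"
proof -
  let ?P = "\<lambda>z. {p. p \<in> S \<times> UNIV \<and> pair_sum p = z}"
  have fin: "finite (?P z)" for z using finite_pair_fiber[of z] by simp
  let ?A = "{p \<in> ?P z. snd p = 0}" and ?B = "{p \<in> ?P z. snd p \<noteq> 0}"
  have "proj False s $ z = (\<Sum>p\<in>?P z. s $ snd p $ fst p)"
    by (simp add: proj_nth pair_deg_def sg_deg_def)
  also have "?P z = ?A \<union> ?B" by auto
  also have "(\<Sum>p\<in>?A \<union> ?B. s $ snd p $ fst p) = (\<Sum>p\<in>?A. s $ snd p $ fst p) + (\<Sum>p\<in>?B. s $ snd p $ fst p)"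
    by (rule sum.union_disjoint) (auto intro: finite_subset[OF _ fin[of z]])
  also have "?A = (if even z \<and> z div 2 \<in> S then {(z div 2, 0)} else {})"
    by (auto simp: pair_sum_def intro!: gr0I)
  also have "(\<Sum>p\<in>(if even z \<and> z div 2 \<in> S then {(z div 2, 0)} else {}). s $ snd p $ fst p) =
      (if even z \<and> z div 2 \<in> S then s $ 0 $ (z div 2) else 0)" by simp
  also have "(\<Sum>p\<in>?B. s $ snd p $ fst p) = (if c \<le> z then proj False (Abs_fps (\<lambda>k. s $ Suc k)) $ (z - c) else 0)"
  proof (cases "c \<le> z")
    case True
    have "(\<Sum>p\<in>?B. s $ snd p $ fst p) = (\<Sum>p\<in>?P (z - c). s $ Suc (snd p) $ fst p)"
    proof (rule sum.reindex_bij_witness[of _ "\<lambda>p. (fst p, Suc (snd p))" "\<lambda>p. (fst p, snd p - 1)"], goal_cases)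
      case (2 p)
      then obtain x k where p: "p = (x, Suc k)" "x \<in> S" "2 * x + c * Suc k = z"
        by (cases p; cases "snd p") (auto simp: pair_sum_def)
      then show ?case by (auto simp: pair_sum_def)
    next
      case (4 p)
      then show ?case using True by (cases p) (auto simp: pair_sum_def)
    qed auto
    then show ?thesis using True by (simp add: proj_nth pair_deg_def sg_deg_def)
  next
    case False
    have "?B = {}"
    proof (rule ccontr)
      assume "?B \<noteq> {}"
      then obtain x k where "2 * x + c * k = z" "k \<noteq> 0" by (auto simp: pair_sum_def)
      moreover from this have "c \<le> c * k" by simp
      ultimately show False using False by linarith
    qed
    then have "(\<Sum>p\<in>?B. s $ snd p $ fst p) = 0" by (simp only: sum.empty)
    then show ?thesis using False by (simp only: if_False)
  qed
  finally show ?thesis .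
qed

text \<open>The sum over i of t^(c i) s_(n + 2 i), read off from the projection of the n-fold shift
  of s: as c is odd, an exponent 2 x is reached by even powers of y only.\<close>

definition even_part :: "'k::field fps fps \<Rightarrow> nat \<Rightarrow> 'k fps" where
  "even_part s n = Abs_fps (\<lambda>x. if x \<in> S then proj False (Abs_fps (\<lambda>k. s $ (n + k))) $ (2 * x) else 0)"

lemma even_in_D: "2 * x \<in> D \<longleftrightarrow> x \<in> S"
proof
  assume "2 * x \<in> D"
  then consider y where "y \<in> S" "2 * x = 2 * y" | y where "2 * x = 2 * y + c" unfolding D_def by blast
  then show "x \<in> S"
  proof cases
    case 2
    then have "even c" by presburger
    then show ?thesis using c(2) by simp
  qed auto
qed (auto simp: D_def)

lemma shift_in: "s \<in> fps_ext False M \<Longrightarrow> Abs_fps (\<lambda>k. s $ (n + k)) \<in> fps_ext False M"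
  by (simp add: fps_ext_def)

lemma even_part_in: "even_part s n \<in> sg_on False S"
  by (simp add: even_part_def sg_on_def)

text \<open>The even part solves \<open>E\<^sub>n = s\<^sub>n + t\<^bsup>c\<^esup> E\<^bsub>n+2\<^esub>\<close>, so that a series killed by the projection is the
  multiple of \<open>y\<^sup>2 - t\<^bsup>c\<^esup>\<close> by the series with coefficients \<open>E\<^bsub>n+2\<^esub>\<close>.\<close>

lemma even_part_rec:
  assumes s: "s \<in> fps_ext False (sg_on False S)"
  shows "even_part s n = s $ n + fps_X ^ c * even_part s (n + 2)"
proof (rule fps_ext)
  fix x
  define t where "t i = Abs_fps (\<lambda>k. s $ (n + i + k))" for i
  have t: "t i \<in> fps_ext False (sg_on False S)" for i unfolding t_def by (rule shift_in[OF s])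
  have pin: "proj False (t i) \<in> sg_on False D" for i using proj_in[OF t, of i] .
  have shift: "Abs_fps (\<lambda>k. t i $ Suc k) = t (Suc i)" for i by (rule fps_ext) (simp add: t_def)
  have t0: "t i $ 0 = s $ (n + i)" for i by (simp add: t_def)
  note peel = proj_peel[of "t i" for i, unfolded shift t0]
  have ev: "even_part s (n + i) $ x = (if x \<in> S then proj False (t i) $ (2 * x) else 0)" for i x
    by (simp add: even_part_def t_def)
  show "even_part s n $ x = (s $ n + fps_X ^ c * even_part s (n + 2)) $ x"
  proof (cases "x \<in> S")
    case False
    then have "s $ n $ x = 0" using s by (auto simp: fps_ext_def sg_on_def)
    moreover have "(fps_X ^ c * even_part s (n + 2)) $ x = 0"
    proof (rule ccontr)
      assume "(fps_X ^ c * even_part s (n + 2)) $ x \<noteq> 0"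
      then have "c \<le> x" "x - c \<in> S" by (auto simp: fps_X_power_mult_nth ev[of 2, simplified] split: if_splits)
      then show False using sg_closed(2)[OF S \<open>x - c \<in> S\<close> c(1)] False by simp
    qed
    ultimately show ?thesis using False ev[of 0] by simp
  next
    case True
    have "even_part s n $ x = proj False (t 0) $ (2 * x)" using True ev[of 0 x] by simp
    also have "\<dots> = s $ n $ x + (if c \<le> 2 * x then proj False (t 1) $ (2 * x - c) else 0)"
      using True by (subst peel) simp
    \<comment> \<open>The exponent 2 x - c is odd and receives nothing from the coefficient peeled
      off next, so the recursion advances by two steps at once.\<close>
    also have "(if c \<le> 2 * x then proj False (t 1) $ (2 * x - c) else 0) =
        (if c \<le> x then proj False (t 2) $ (2 * (x - c)) else 0)"
    proof (cases "c \<le> 2 * x")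
      case le: True
      then have odd: "odd (2 * x - c)" using c(2) by simp
      have dbl: "2 * x - c - c = 2 * (x - c)" by simp
      have iff: "c \<le> 2 * x - c \<longleftrightarrow> c \<le> x" using le by linarith
      have "proj False (t 1) $ (2 * x - c) = (if c \<le> x then proj False (t (Suc 1)) $ (2 * (x - c)) else 0)"
        unfolding peel[of 1 "2 * x - c"] dbl iff using odd by (simp only: simp_thms if_False add_0)
      then show ?thesis using le by (simp only: Suc_1 if_True)
    next
      case False
      then have "\<not> c \<le> x" by linarith
      then show ?thesis using False by (simp only: if_False)
    qed
    also have "\<dots> = (fps_X ^ c * even_part s (n + 2)) $ x"
    proof (cases "c \<le> x \<and> x - c \<notin> S")
      case True
      then have "2 * (x - c) \<notin> D" using even_in_D by blast
      then have "proj False (t 2) $ (2 * (x - c)) = 0" using pin[of 2] by (auto simp: sg_on_def)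
      then show ?thesis using True by (simp add: fps_X_power_mult_nth ev[of 2, simplified])
    next
      case False
      then show ?thesis by (auto simp: fps_X_power_mult_nth ev[of 2, simplified])
    qed
    finally show ?thesis by simp
  qed
qed

text \<open>Vanishing of the even exponents of the projection gives the case n = 0, vanishing of the
  odd ones the case n = 1.\<close>

lemma even_part_zero:
  assumes s: "s \<in> fps_ext False (sg_on False S)" and p: "proj False s = 0" and n: "n < 2"
  shows "even_part s n = 0"
proof (rule fps_ext)
  fix x
  have e0: "Abs_fps (\<lambda>k. s $ (0 + k)) = s" by (rule fps_ext) simp
  have "proj False (Abs_fps (\<lambda>k. s $ (n + k))) $ (2 * x) = 0" if x: "x \<in> S"
  proof (cases "n = 0")
    case True then show ?thesis using p e0 by simp
  next
    case False
    then have n1: "n = 1" using n by simp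
    have "odd (2 * x + c)" using c(2) by simp
    then have "proj False s $ (2 * x + c) = proj False (Abs_fps (\<lambda>k. s $ Suc k)) $ (2 * x)"
      using proj_peel[of s "2 * x + c"] by simp
    then show ?thesis using p n1 by simp
  qed
  then show "even_part s n $ x = 0 $ x" by (simp add: even_part_def)
qed

end

section \<open>The quadratic relation and the kernel of the projection\<close>

context semigroup_double
begin

text \<open>Any factorization of c in S serves: the relation requires a monomial different from 1
  whose value is t^c.\<close>

definition c_rep :: "nat multiset" where
  "c_rep = (SOME m. set_mset m \<subseteq> G \<and> \<Sum>\<^sub># m = c)"

lemma c_rep: "set_mset c_rep \<subseteq> G" "\<Sum>\<^sub># c_rep = c" "c_rep \<noteq> {#}"
proof -
  have "\<exists>m. set_mset m \<subseteq> G \<and> \<Sum>\<^sub># m = c" using ord_attained[OF S c(1)] by blast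
  from someI_ex[OF this] show "set_mset c_rep \<subseteq> G" "\<Sum>\<^sub># c_rep = c" by (simp_all add: c_rep_def)
  then show "c_rep \<noteq> {#}" using c_pos by auto
qed

text \<open>The relation between \<open>y\<close> and the other variables: \<open>y\<^sup>2 - x\<^bsup>c\<^esup>\<close>, with initial form \<open>y\<^sup>2\<close> as the
  order of \<open>c\<close> exceeds \<open>2\<close>.\<close>

definition quad :: "bool \<Rightarrow> (nat, 'k::field) mps fps" where
  "quad gr = fps_X\<^sup>2 - fps_const (if gr then 0 else Abs_mps (\<lambda>m. if m = c_rep then 1 else 0))"

lemma quad_nth:
  "quad gr $ n = (if n = 2 then 1 else if n = 0 \<and> \<not> gr then - Abs_mps (\<lambda>m. if m = c_rep then 1 else 0) else 0)"
  by (simp add: quad_def fps_X_power_nth)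

lemma quad_in: "(quad gr :: (nat, 'k::field) mps fps) \<in> fps_ext gr (mps_on gr G)"
proof -
  have "(Abs_mps (\<lambda>m. if m = c_rep then 1 else 0) :: (nat, 'k) mps) \<in> mps_on gr G"
    using c_rep(1) by (auto simp: mps_on_def)
  moreover have "(0 :: (nat, 'k) mps) \<in> mps_on gr G" "(1 :: (nat, 'k) mps) \<in> mps_on gr G"
    by (rule subring_onD[OF subring_mps_on])+
  moreover have "(if P then a else b) \<in> X" if "a \<in> X" "b \<in> X" for P and a b :: "(nat, 'k) mps" and X
    using that by simp
  ultimately have "(quad gr $ n :: (nat, 'k) mps) \<in> mps_on gr G" for n
    unfolding quad_nth using subring_onD(5)[OF subring_mps_on] by metis
  moreover have "finite {n. quad gr $ n \<noteq> (0 :: (nat, 'k) mps)}"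
    by (rule finite_subset[of _ "{0, 2}"]) (auto simp: quad_nth split: if_splits)
  ultimately show ?thesis unfolding fps_ext_def by blast
qed

lemma sg_eval_monomial:
  assumes "set_mset r \<subseteq> G"
  shows "sg_eval gr S (Abs_mps (\<lambda>m. if m = r then 1 else 0)) $ z =
    (if \<Sum>\<^sub># r = z \<and> (if gr then size r else 0) = sg_deg gr S z then 1 else 0)"
proof -
  let ?Q = "{m \<in> {m. set_mset m \<subseteq> G}. \<Sum>\<^sub># m = z \<and> (if gr then size m else 0) = sg_deg gr S z}"
  have "finite ?Q" by (rule finite_subset[OF _ fiber_finite[OF S, of z]]) auto
  then have "(\<Sum>m\<in>?Q. if m = r then 1 else 0) = (if r \<in> ?Q then 1 else 0 :: 'a)" by (rule sum.delta)
  then show ?thesis using assms by (simp add: sg_eval_def push_def)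
qed

lemma sg_eval_one: "sg_eval gr S 1 = 1"
proof (rule fps_ext)
  fix z
  have "(1 :: (nat, 'a) mps) = Abs_mps (\<lambda>m. if m = {#} then 1 else 0)" by (simp add: one_mps_def)
  then show "sg_eval gr S 1 $ z = (1 :: 'a fps) $ z"
    using sg_eval_monomial[of "{#}" gr z, where 'a = 'a] ord_0[OF S] by (cases "z = 0") (auto simp: sg_deg_def)
qed

lemma sg_eval_c_rep: "sg_eval False S (Abs_mps (\<lambda>m. if m = c_rep then 1 else 0)) = fps_X ^ c"
  by (rule fps_ext) (simp add: sg_eval_monomial[OF c_rep(1)] c_rep(2) sg_deg_def fps_X_power_nth)

lemma sg_eval_zero: "sg_eval gr S 0 = 0"
  by (rule fps_ext) (simp add: sg_eval_def push_def)

lemma sg_eval_uminus: "sg_eval gr S (- f) = - sg_eval gr S f"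
  by (rule fps_ext) (simp add: sg_eval_def push_def sum_negf)

lemma sg_mul_zero: "sg_mul gr S 0 x = 0"
  by (rule fps_ext) (simp add: sg_mul_nth tconv_def)

lemma eval_quad: "eval_fps gr (quad gr) $ n = (if n = 2 then 1 else if n = 0 \<and> \<not> gr then - (fps_X ^ c) else 0)"
  by (cases gr) (simp_all add: eval_fps_def quad_nth sg_eval_one sg_eval_zero sg_eval_uminus sg_eval_c_rep)

lemma fps_act_quad:
  "fps_act (act gr) (quad gr) q $ n =
    (if gr then 0 else - (fps_X ^ c * q $ n)) + (if 2 \<le> n then q $ (n - 2) else 0)"
proof -
  have a: "act gr (quad gr $ i) x = (if i = 2 then x else if i = 0 \<and> \<not> gr then - (fps_X ^ c * x) else 0)" for i x
  proof -
    have e: "sg_eval gr S (quad gr $ i) = (if i = 2 then 1 else if i = 0 \<and> \<not> gr then - (fps_X ^ c) else 0)"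
      using eval_quad[of gr i] unfolding eval_fps_def fps_nth_Abs_fps .
    show ?thesis unfolding act_def e by (cases gr) (simp_all add: sg_mul_zero sg_mul_one[OF S] sg_mul_False)
  qed
  have "fps_act (act gr) (quad gr) q $ n = (\<Sum>i=0..n. act gr (quad gr $ i) (q $ (n - i)))"
    by (simp add: fps_act_def)
  also have "\<dots> = (\<Sum>i\<in>(if 2 \<le> n then {0, 2} else {0}). act gr (quad gr $ i) (q $ (n - i)))"
    by (rule sum.mono_neutral_right) (auto simp: a)
  also have "\<dots> = (if gr then 0 else - (fps_X ^ c * q $ n)) + (if 2 \<le> n then q $ (n - 2) else 0)"
    by (simp add: a)
  finally show ?thesis .
qed

lemma proj_low:
  assumes low: "\<And>k. k \<ge> 2 \<Longrightarrow> s $ k = 0" and x: "x \<in> S" and k: "k \<le> 1"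
  shows "proj gr s $ (2 * x + c * k) = s $ k $ x"
proof -
  let ?z = "2 * x + c * k"
  let ?P = "{p. p \<in> S \<times> UNIV \<and> pair_sum p = ?z \<and> pair_deg gr p = sg_deg gr D ?z}"
  have "finite ?P" by (rule finite_subset[OF _ finite_pair_fiber[of ?z]]) auto
  moreover have "{(x, k)} \<subseteq> ?P"
    using x ord_double[OF x, of k] k by (simp add: pair_sum_def pair_deg_def sg_deg_def)
  moreover have "\<forall>p\<in>?P - {(x, k)}. s $ snd p $ fst p = 0"
  proof
    fix p assume p: "p \<in> ?P - {(x, k)}"
    then have e: "2 * fst p + c * snd p = 2 * x + c * k" by (simp add: pair_sum_def)
    show "s $ snd p $ fst p = 0"
    proof (cases "snd p \<ge> 2")
      case True then show ?thesis using low by simp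
    next
      case False
      have "even (c * snd p) = even (c * k)" using e by presburger
      then have "even (snd p) = even k" using c(2) by simp
      then have "snd p = k" using False k by presburger
      then have "p = (x, k)" using e by (cases p) simp
      then show ?thesis using p by blast
    qed
  qed
  ultimately have "(\<Sum>p\<in>?P. s $ snd p $ fst p) = (\<Sum>p\<in>{(x, k)}. s $ snd p $ fst p)"
    by (rule sum.mono_neutral_right)
  then show ?thesis by (simp add: proj_nth)
qed

lemma proj_onto: "proj gr ` fps_ext gr (sg_on gr S) = sg_on gr D"
proof (intro equalityI subsetI)
  fix y :: "'a fps" assume "y \<in> proj gr ` fps_ext gr (sg_on gr S)"
  then show "y \<in> sg_on gr D" using proj_in by blast
next
  fix y :: "'a fps" assume y: "y \<in> sg_on gr D"
  \<comment> \<open>A preimage of degree at most 1 in the new variable: its coefficient 0 collects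
    the even exponents of the given element, its coefficient 1 the odd ones.\<close>
  define s where "s = Abs_fps (\<lambda>k. if k \<le> 1 then Abs_fps (\<lambda>x. if x \<in> S then y $ (2 * x + c * k) else 0) else 0)"
  have "s $ k \<in> sg_on gr S" for k
  proof -
    have "finite {x. y $ (2 * x + c * k) \<noteq> 0}" if gr
      using y that finite_vimageI[of "{n. y $ n \<noteq> 0}" "\<lambda>x. 2 * x + c * k"]
      by (simp add: sg_on_def inj_def vimage_def)
    then have "finite {x. s $ k $ x \<noteq> 0}" if gr
      by (rule finite_subset[rotated]) (use that in \<open>auto simp: s_def split: if_splits\<close>)
    moreover have "x \<in> S" if "s $ k $ x \<noteq> 0" for x using that by (auto simp: s_def split: if_splits)
    ultimately show ?thesis by (simp add: sg_on_def)
  qed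
  moreover have "finite {k. s $ k \<noteq> 0}"
    by (rule finite_subset[of _ "{..1}"]) (auto simp: s_def split: if_splits)
  ultimately have s: "s \<in> fps_ext gr (sg_on gr S)" by (simp add: fps_ext_def)
  have low: "s $ k = 0" if "k \<ge> 2" for k using that by (simp add: s_def)
  have "proj gr s = y"
  proof (rule fps_ext)
    fix z
    show "proj gr s $ z = y $ z"
    proof (cases "z \<in> D")
      case False
      then have "y $ z = 0" "proj gr s $ z = 0" using y proj_in[OF s] unfolding sg_on_def by blast+
      then show ?thesis by simp
    next
      case True
      have "\<exists>x k. x \<in> S \<and> k \<le> 1 \<and> z = 2 * x + c * k"
      proof -
        from True consider x where "x \<in> S" "z = 2 * x" | x where "x \<in> S" "z = 2 * x + c"
          unfolding D_def by blast
        then show ?thesis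
        proof cases
          case 1 then show ?thesis by (intro exI[of _ x] exI[of _ 0]) simp
        next
          case 2 then show ?thesis by (intro exI[of _ x] exI[of _ 1]) simp
        qed
      qed
      then obtain x k where xk: "x \<in> S" "k \<le> 1" "z = 2 * x + c * k" by blast
      have "s $ k $ x = y $ (2 * x + c * k)" using xk by (simp add: s_def)
      then show ?thesis using proj_low[OF low xk(1,2), of gr] xk(3) by simp
    qed
  qed
  then show "y \<in> proj gr ` fps_ext gr (sg_on gr S)" using s by blast
qed

lemma proj_ker:
  fixes s :: "'k::field fps fps"
  assumes s: "s \<in> fps_ext gr (sg_on gr S)" and p: "proj gr s = 0"
  shows "\<exists>q\<in>fps_ext gr (sg_on gr S). s = fps_act (act gr) (quad gr) q"
proof (cases gr)
  case True
  let ?q = "Abs_fps (\<lambda>n. s $ (n + 2))"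
  have sT: "s \<in> fps_ext True (sg_on True S)" using s True by simp
  have s01: "s $ 0 = 0" "s $ 1 = 0" using proj_gr_eq_zero[OF sT] p True by simp_all
  have "finite ((\<lambda>n. n + 2) -` {k. s $ k \<noteq> 0})"
    by (rule finite_vimageI) (use sT in \<open>auto simp: fps_ext_def inj_def\<close>)
  then have "?q \<in> fps_ext True (sg_on True S)" using sT by (simp add: fps_ext_def vimage_def)
  moreover have "s = fps_act (act True) (quad True) ?q"
  proof (rule fps_ext)
    fix n :: nat
    consider "n = 0" | "n = 1" | k where "n = k + 2" by (metis One_nat_def add_2_eq_Suc' not0_implies_Suc)
    then show "s $ n = fps_act (act True) (quad True) ?q $ n"
      by cases (use s01 in \<open>simp_all add: fps_act_quad\<close>)
  qed
  moreover have gr: "gr = True" using True by simp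
  ultimately show ?thesis unfolding gr by blast
next
  case False
  let ?q = "Abs_fps (\<lambda>n. even_part s (n + 2))"
  have sF: "s \<in> fps_ext False (sg_on False S)" and pF: "proj False s = 0" using s p False by simp_all
  have "?q \<in> fps_ext False (sg_on False S)" by (simp add: fps_ext_def even_part_in)
  moreover have "s = fps_act (act False) (quad False) ?q"
  proof (rule fps_ext)
    fix n
    have r: "s $ n = even_part s n - fps_X ^ c * even_part s (n + 2)" using even_part_rec[OF sF, of n] by simp
    show "s $ n = fps_act (act False) (quad False) ?q $ n"
    proof (cases "2 \<le> n")
      case True
      then have "n - 2 + 2 = n" by simp
      then show ?thesis unfolding r fps_act_quad using True by simp
    next
      case False
      then have "even_part s n = 0" using even_part_zero[OF sF pF] by simp
      then show ?thesis unfolding r fps_act_quad using False by simp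
    qed
  qed
  moreover have gr: "gr = False" using False by simp
  ultimately show ?thesis unfolding gr by blast
qed

text \<open>In the graded case multiplication by y^2 is a shift. Otherwise coefficient n of the
  product is q_(n-2) - t^c q_n, without the first term for n < 2, so the q_n vanish one after the
  other, power series over a field having no zero divisors.\<close>

lemma quad_inj:
  assumes "fps_act (act gr) (quad gr) q = 0" shows "q = (0 :: 'k::field fps fps)"
proof -
  have e: "(if gr then 0 else - (fps_X ^ c * q $ n)) + (if 2 \<le> n then q $ (n - 2) else 0) = 0" for n
    using arg_cong[OF assms, of "\<lambda>F. F $ n"] unfolding fps_act_quad by simp
  have "q $ n = 0" for n
  proof (cases gr)
    case True
    then show ?thesis using e[of "n + 2"] by simp
  next
    case False
    then show ?thesis
    proof (induction n rule: less_induct)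
      case (less n)
      have "(if 2 \<le> n then q $ (n - 2) else 0) = 0" using less.IH[of "n - 2"] less.prems by simp
      then have "fps_X ^ c * q $ n = 0" using e[of n] less.prems by simp
      then show ?case by simp
    qed
  qed
  then show ?thesis by (intro fps_ext) simp
qed

lemma proj_zero: "proj gr 0 = 0"
  by (rule fps_ext) (simp add: proj_nth)

text \<open>The two terms cancel: y^2 is sent to t^(2 c), and x^c as well, since exponents of S are
  doubled. In the graded case y^2 has no terms in y^0 and y^1.\<close>

lemma proj_quad: "proj gr (eval_fps gr (quad gr)) = (0 :: 'k::field fps)"
proof (cases gr)
  case True
  have "eval_fps True (quad True) \<in> fps_ext True (sg_on True S :: 'k fps set)"
    using one_in[OF S, of True, where 'a = 'k] sg_on_zero[of True S, where 'a = 'k]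
    by (auto simp: fps_ext_def eval_quad intro: finite_subset[of _ "{2}"])
  from proj_gr_eq_zero[OF this] show ?thesis using True by (simp add: eval_quad)
next
  case False
  \<comment> \<open>\<open>e i\<close> is the i-fold shift of y^2 - t^c; peeling off one coefficient
    at a time computes the projection from \<open>e 3 = 0\<close> down to
    \<open>e 0\<close>.\<close>
  define e where "e i = Abs_fps (\<lambda>k. eval_fps False (quad False) $ (i + k) :: 'k fps)" for i
  have e0: "eval_fps False (quad False) = e 0" by (rule fps_ext) (simp add: e_def)
  have eS: "Abs_fps (\<lambda>k. e i $ Suc k) = e (Suc i)" for i by (rule fps_ext) (simp add: e_def)
  have en: "e i $ 0 = (if i = 2 then 1 else if i = 0 then - (fps_X ^ c) else 0)" for i
    by (simp add: e_def eval_quad)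
  note peel = proj_peel[of "e i" for i, unfolded eS en]
  have "e 3 = 0" by (intro fps_ext) (simp add: e_def eval_quad)
  then have p3: "proj False (e 3) = 0" by (simp add: proj_zero)
  have p2: "proj False (e 2) $ z = (if z = 0 then 1 else 0)" for z
  proof -
    have "Suc 2 = 3" by simp
    then have "proj False (e 2) $ z = (if even z \<and> z div 2 \<in> S then (1 :: 'k fps) $ (z div 2) else 0)"
      using peel[of 2 z] p3 by simp
    then show ?thesis using sg_closed(1)[OF S] by (auto elim!: evenE)
  qed
  have p1: "proj False (e (Suc 0)) $ z = (if z = c then 1 else 0)" for z
  proof -
    have "proj False (e (Suc 0)) $ z = (if c \<le> z then proj False (e 2) $ (z - c) else 0)"
      using peel[of "Suc 0" z] by (simp add: numeral_2_eq_2)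
    then show ?thesis by (auto simp: p2)
  qed
  have "proj False (e 0) = 0"
  proof (rule fps_ext)
    fix z
    have h: "(if even z \<and> z div 2 \<in> S then - ((fps_X ^ c :: 'k fps) $ (z div 2)) else 0) = (if z = 2 * c then -1 else 0)"
    proof (cases "z = 2 * c")
      case True then show ?thesis using c(1) by (simp add: fps_X_power_nth)
    next
      case False
      then have "odd z \<or> z div 2 \<noteq> c" by presburger
      then show ?thesis using False by (auto simp: fps_X_power_nth)
    qed
    have "proj False (e 0) $ z = (if even z \<and> z div 2 \<in> S then - ((fps_X ^ c :: 'k fps) $ (z div 2)) else 0) +
        (if c \<le> z then proj False (e (Suc 0)) $ (z - c) else 0)"
      using peel[of 0 z] by simp
    also have "(if c \<le> z then proj False (e (Suc 0)) $ (z - c) else 0) = (if z = 2 * c then 1 else 0)"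
      unfolding p1 by auto
    also note h
    also have "(if z = 2 * c then -1 else 0) + (if z = 2 * c then 1 else 0) = (0 :: 'k)" by simp
    finally show "proj False (e 0) $ z = (0 :: 'k fps) $ z" by simp
  qed
  then show ?thesis using False e0 by simp
qed

lemma cone_double:
  fixes \<epsilon> :: "(nat \<Rightarrow> (nat, 'k::field) mps) \<Rightarrow> 'k fps"
  assumes "resolution (mps_on gr G) (act gr) (sg_on gr S) \<beta> \<epsilon> d"
  shows "cone (mps_on gr G) (act gr) (sg_on gr S) gr (act' gr) (sg_on gr D) (proj gr) (quad gr) \<beta> \<epsilon> d"
proof
  show "subring_on (mps_on gr G :: (nat, 'k) mps set)" by (rule subring_mps_on)
  show "(quad gr :: (nat, 'k) mps fps) \<in> fps_ext gr (mps_on gr G)" by (rule quad_in)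
  show "proj gr ` fps_ext gr (sg_on gr S) = (sg_on gr D :: 'k fps set)" by (rule proj_onto)
  fix s t :: "'k fps fps"
  show "proj gr (s + t) = proj gr s + proj gr t" by (rule proj_add)
  show "act' gr (quad gr) (proj gr s) = 0"
    by (rule fps_ext) (simp add: act'_def proj_quad sg_mul_nth tconv_def)
  show "fps_act (act gr) (quad gr) s = 0 \<Longrightarrow> s = 0" by (rule quad_inj)
  assume s: "s \<in> fps_ext gr (sg_on gr S)"
  show "proj gr s = 0 \<Longrightarrow> \<exists>q\<in>fps_ext gr (sg_on gr S). s = fps_act (act gr) (quad gr) q" by (rule proj_ker[OF s])
  fix r :: "(nat, 'k) mps fps" assume "r \<in> fps_ext gr (mps_on gr G)"
  then show "proj gr (fps_act (act gr) r s) = act' gr r (proj gr s)" by (rule proj_act) (rule s)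
qed (rule assms)

section \<open>Betti numbers\<close>

abbreviation "aug_ideal \<equiv> {f :: (nat, 'k::field) mps. mcoeff f {#} = 0}"

lemma model_S_ring: "module_model (mring False G) Abs_mps (mps_on False G)
    (module_via (sg_subst S) (sg_ring S :: 'k::field fps ring)) (\<lambda>x. x) (sg_on False S) (act False)"
  by (rule module_model_ring[OF S ring_model_mring]) (simp add: act_def)

lemma model_S_gr: "module_model (mring True G) Abs_mps (mps_on True G)
    (module_via (gr_subst S) (sg_gr S :: (nat \<Rightarrow> 'k::field fps set) ring)) (to_gr S) (sg_on True S) (act True)"
  by (rule module_model_gr[OF S ring_model_mring]) (simp add: act_def)

lemma model_D_ring: "module_model (mring False (min_gens D)) dcoeff (fps_ext False (mps_on False G))
    (module_via (sg_subst D) (sg_ring D :: 'k::field fps ring)) (\<lambda>x. x) (sg_on False D) (act' False)"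
  by (rule module_model_ring[OF D ring_model_dcoeff]) (simp add: act'_def eval_dcoeff)

lemma model_D_gr: "module_model (mring True (min_gens D)) dcoeff (fps_ext True (mps_on True G))
    (module_via (gr_subst D) (sg_gr D :: (nat \<Rightarrow> 'k::field fps set) ring)) (to_gr D) (sg_on True D) (act' True)"
  by (rule module_model_gr[OF D ring_model_dcoeff]) (simp add: act'_def eval_dcoeff)

lemma var_ideal_S: "x \<in> carrier (mring fin G) \<Longrightarrow>
    x \<in> Idl\<^bsub>mring fin G\<^esub> (mvar ` G) \<longleftrightarrow> Abs_mps x \<in> (aug_ideal :: (nat, 'k::field) mps set)"
  by (simp add: mring_var_ideal[OF finite_min_gens[OF S]])

lemma var_ideal_D: "x \<in> carrier (mring fin (min_gens D)) \<Longrightarrow>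
    x \<in> Idl\<^bsub>mring fin (min_gens D)\<^esub> (mvar ` min_gens D) \<longleftrightarrow>
    dcoeff x \<in> {F :: (nat, 'k::field) mps fps. F $ 0 \<in> aug_ideal}"
  by (simp add: mring_var_ideal[OF finite_min_gens[OF D]] dmon_0)

text \<open>The constant coefficient in y of the relation is 0 or minus a monomial different from 1,
  hence in the ideal of the variables.\<close>

lemma minimal_cone:
  fixes \<epsilon> :: "(nat \<Rightarrow> (nat, 'k::field) mps) \<Rightarrow> 'k fps"
  assumes res: "resolution (mps_on gr G) (act gr) (sg_on gr S) \<beta> \<epsilon> d"
    and min: "\<And>i v j. v \<in> vecs (mps_on gr G) (\<beta> (Suc i)) \<Longrightarrow> j < \<beta> i \<Longrightarrow> d i v j \<in> aug_ideal"
    and V: "V \<in> vecs (fps_ext gr (mps_on gr G)) (cone_betti \<beta> (Suc i))" and j: "j < cone_betti \<beta> i"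
  shows "cone.cone_diff (quad gr) \<beta> d i V j $ 0 \<in> aug_ideal"
proof -
  interpret X: cone "mps_on gr G" "act gr" "sg_on gr S" gr "act' gr" "sg_on gr D" "proj gr" "quad gr" \<beta> \<epsilon> d
    by (rule cone_double[OF res])
  show ?thesis
    by (rule X.cone_minimal[OF min _ _ _ _ V j]) (use c_rep(3) in \<open>auto simp: quad_nth\<close>)
qed

lemma betti_double_ring:
  assumes "has_betti_numbers (mring False G) (Idl\<^bsub>mring False G\<^esub> (mvar ` G))
      (module_via (sg_subst S) (sg_ring S :: 'k::field fps ring)) \<beta>"
  shows "has_betti_numbers (mring False (min_gens D)) (Idl\<^bsub>mring False (min_gens D)\<^esub> (mvar ` min_gens D))
      (module_via (sg_subst D) (sg_ring D :: 'k fps ring)) (cone_betti \<beta>)"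
proof -
  interpret MS: module_model "mring False G :: (nat multiset \<Rightarrow> 'k) ring" Abs_mps "mps_on False G"
    "module_via (sg_subst S) (sg_ring S :: 'k fps ring)" "\<lambda>x. x" "sg_on False S" "act False"
    by (rule model_S_ring)
  interpret MD: module_model "mring False (min_gens D) :: (nat multiset \<Rightarrow> 'k) ring" dcoeff "fps_ext False (mps_on False G)"
    "module_via (sg_subst D) (sg_ring D :: 'k fps ring)" "\<lambda>x. x" "sg_on False D" "act' False"
    by (rule model_D_ring)
  obtain \<epsilon> d where "MS.minimal_resolution aug_ideal \<beta> \<epsilon> d"
    using assms MS.has_betti_numbers_iff[where \<mm> = aug_ideal, OF var_ideal_S] by blast
  then have res: "resolution (mps_on False G) (act False) (sg_on False S) \<beta> \<epsilon> d"
    and min: "\<And>i v j. v \<in> vecs (mps_on False G) (\<beta> (Suc i)) \<Longrightarrow> j < \<beta> i \<Longrightarrow> d i v j \<in> aug_ideal"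
    unfolding MS.minimal_resolution_def by blast+
  interpret X: cone "mps_on False G" "act False" "sg_on False S" False "act' False" "sg_on False D" "proj False" "quad False" \<beta> \<epsilon> d
    by (rule cone_double[OF res])
  have "MD.minimal_resolution {F. F $ 0 \<in> aug_ideal} (cone_betti \<beta>) X.cone_aug X.cone_diff"
    unfolding MD.minimal_resolution_def
  proof (intro conjI allI ballI impI)
    show "resolution (fps_ext False (mps_on False G)) (act' False) (sg_on False D) (cone_betti \<beta>) X.cone_aug X.cone_diff"
      by (rule X.cone_resolution)
  next
    fix i j and v :: "nat \<Rightarrow> (nat, 'k) mps fps"
    assume "v \<in> vecs (fps_ext False (mps_on False G)) (cone_betti \<beta> (Suc i))" "j < cone_betti \<beta> i"
    from minimal_cone[OF res min this] show "X.cone_diff i v j \<in> {F. F $ 0 \<in> aug_ideal}" by simp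
  qed
  then show ?thesis 
    using MD.has_betti_numbers_iff[where \<mm> = "{F. F $ 0 \<in> aug_ideal}", OF var_ideal_D] by blast
qed

definition hom_part :: "int \<Rightarrow> (nat, 'k::field) mps set" where
  "hom_part e = {f \<in> mps_on True G. \<forall>m. mcoeff f m \<noteq> 0 \<longrightarrow> int (size m) = e}"

definition hom_elems :: "nat set \<Rightarrow> int \<Rightarrow> 'k::field fps set" where
  "hom_elems U e = {x. \<forall>z. x $ z \<noteq> 0 \<longrightarrow> int (sg_ord U z) = e}"

lemma mpoly_hom_eq: "mpoly_hom A e = {f \<in> carrier (mring True A). \<forall>m. f m \<noteq> 0 \<longrightarrow> int (size m) = e}"
  by (simp add: mpoly_hom_def mring_def)

text \<open>The cone is the same as for the semigroup ring; in addition its maps are homogeneous for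
  the shifts \<open>cone_shift\<close>, because \<open>proj\<close> preserves degrees and y^2 has
  degree 2.\<close>

lemma betti_double_gr:
  assumes "has_graded_betti_numbers (mring True G) (mpoly_hom G) (Idl\<^bsub>mring True G\<^esub> (mvar ` G))
      (module_via (gr_subst S) (sg_gr S :: (nat \<Rightarrow> 'k::field fps set) ring))
      (assoc_graded_hom (sg_ring S) (sg_max_ideal S)) \<beta>"
  shows "has_graded_betti_numbers (mring True (min_gens D)) (mpoly_hom (min_gens D))
      (Idl\<^bsub>mring True (min_gens D)\<^esub> (mvar ` min_gens D))
      (module_via (gr_subst D) (sg_gr D :: (nat \<Rightarrow> 'k fps set) ring))
      (assoc_graded_hom (sg_ring D) (sg_max_ideal D)) (cone_betti \<beta>)"
proof -
  interpret MS: module_model "mring True G :: (nat multiset \<Rightarrow> 'k) ring" Abs_mps "mps_on True G"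
    "module_via (gr_subst S) (sg_gr S :: (nat \<Rightarrow> 'k fps set) ring)" "to_gr S" "sg_on True S" "act True"
    by (rule model_S_gr)
  interpret MD: module_model "mring True (min_gens D) :: (nat multiset \<Rightarrow> 'k) ring" dcoeff "fps_ext True (mps_on True G)"
    "module_via (gr_subst D) (sg_gr D :: (nat \<Rightarrow> 'k fps set) ring)" "to_gr D" "sg_on True D" "act' True"
    by (rule model_D_gr)
  have HS: "x \<in> mpoly_hom G e \<longleftrightarrow> Abs_mps x \<in> hom_part e" if "x \<in> carrier (mring True G)"
    for x :: "nat multiset \<Rightarrow> 'k" and e
    using that by (simp add: mpoly_hom_eq hom_part_def mring_simps)
  have MHS: "to_gr S x \<in> assoc_graded_hom (sg_ring S) (sg_max_ideal S) e \<longleftrightarrow> x \<in> hom_elems S e"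
    if "x \<in> sg_on True S" for x :: "'k fps" and e
    using assoc_graded_hom_iff[OF S that] by (simp add: hom_elems_def)
  have MHD: "to_gr D x \<in> assoc_graded_hom (sg_ring D) (sg_max_ideal D) e \<longleftrightarrow> x \<in> hom_elems D e"
    if "x \<in> sg_on True D" for x :: "'k fps" and e
    using assoc_graded_hom_iff[OF D that] by (simp add: hom_elems_def)
  obtain \<epsilon> d a where m: "MS.minimal_resolution aug_ideal \<beta> \<epsilon> d"
    and g: "MS.graded_resolution hom_part (hom_elems S) \<beta> \<epsilon> d a"
    using assms MS.has_graded_betti_numbers_iff[where \<mm> = aug_ideal and RH = "mpoly_hom G" and H = hom_part
        and NH = "assoc_graded_hom (sg_ring S) (sg_max_ideal S)" and MH = "hom_elems S",
        OF var_ideal_S HS MHS] by blast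
  have res: "resolution (mps_on True G) (act True) (sg_on True S) \<beta> \<epsilon> d"
    and min: "\<And>i v j. v \<in> vecs (mps_on True G) (\<beta> (Suc i)) \<Longrightarrow> j < \<beta> i \<Longrightarrow> d i v j \<in> aug_ideal"
    using m unfolding MS.minimal_resolution_def by blast+
  have g0: "\<epsilon> v \<in> hom_elems S e" if "v \<in> vecs (mps_on True G) (\<beta> 0)" "\<forall>j<\<beta> 0. v j \<in> hom_part (e - a 0 j)" for e v
    using g that unfolding MS.graded_resolution_def by blast
  have gd: "d i v j \<in> hom_part (e - a i j)"
    if "v \<in> vecs (mps_on True G) (\<beta> (Suc i))" "\<And>j. j < \<beta> (Suc i) \<Longrightarrow> v j \<in> hom_part (e - a (Suc i) j)" "j < \<beta> i" for i e v j
    using g that unfolding MS.graded_resolution_def by blast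
  interpret X: cone "mps_on True G" "act True" "sg_on True S" True "act' True" "sg_on True D" "proj True" "quad True" \<beta> \<epsilon> d
    by (rule cone_double[OF res])
  have HD: "x \<in> mpoly_hom (min_gens D) e \<longleftrightarrow> dcoeff x \<in> X.ext_hom hom_part e"
    if x: "x \<in> carrier (mring True (min_gens D))" for x :: "nat multiset \<Rightarrow> 'k" and e
  proof
    assume h: "x \<in> mpoly_hom (min_gens D) e"
    have "dcoeff x \<in> fps_ext True (mps_on True G)" by (rule MD.\<rho>_in[OF x])
    moreover have "int (size m) = e - int k" if "x (dmon (m, k)) \<noteq> 0" for m k
      using h that dmon_size[of "(m, k)"] by (auto simp: mpoly_hom_eq)
    ultimately show "dcoeff x \<in> X.ext_hom hom_part e"
      by (simp add: X.ext_hom_def hom_part_def) (simp add: fps_ext_def)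
  next
    assume h: "dcoeff x \<in> X.ext_hom hom_part e"
    have "int (size m) = e" if "x m \<noteq> 0" for m
    proof -
      have "set_mset m \<subseteq> min_gens D" using x that by (simp add: mring_simps mps_on_def)
      then obtain p where p: "dmon p = m" using dmon_surj by blast
      have "dcoeff x $ snd p \<in> hom_part (e - int (snd p))" using h by (simp add: X.ext_hom_def)
      moreover have "mcoeff (dcoeff x $ snd p) (fst p) \<noteq> 0" using p that by simp
      ultimately have "int (size (fst p)) = e - int (snd p)" unfolding hom_part_def by blast
      then show ?thesis using p dmon_size[of p] by simp
    qed
    then show "x \<in> mpoly_hom (min_gens D) e" using x by (simp add: mpoly_hom_eq)
  qed
  have "MD.minimal_resolution {F. F $ 0 \<in> aug_ideal} (cone_betti \<beta>) X.cone_aug X.cone_diff"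
    unfolding MD.minimal_resolution_def
  proof (intro conjI allI ballI impI)
    show "resolution (fps_ext True (mps_on True G)) (act' True) (sg_on True D) (cone_betti \<beta>) X.cone_aug X.cone_diff"
      by (rule X.cone_resolution)
  next
    fix i j and v :: "nat \<Rightarrow> (nat, 'k) mps fps"
    assume "v \<in> vecs (fps_ext True (mps_on True G)) (cone_betti \<beta> (Suc i))" "j < cone_betti \<beta> i"
    from minimal_cone[OF res min this] show "X.cone_diff i v j \<in> {F. F $ 0 \<in> aug_ideal}" by simp
  qed
  moreover have "MD.graded_resolution (X.ext_hom hom_part) (hom_elems D) (cone_betti \<beta>) X.cone_aug X.cone_diff (X.cone_shift a)"
    unfolding MD.graded_resolution_def
  proof (intro conjI allI ballI impI)
    fix e and v :: "nat \<Rightarrow> (nat, 'k) mps fps"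
    assume "v \<in> vecs (fps_ext True (mps_on True G)) (cone_betti \<beta> 0)"
      and "\<forall>j<cone_betti \<beta> 0. v j \<in> X.ext_hom hom_part (e - X.cone_shift a 0 j)"
    then have v: "v \<in> vecs (fps_ext True (mps_on True G)) (\<beta> 0)"
      and vh: "\<And>j. j < \<beta> 0 \<Longrightarrow> v j \<in> X.ext_hom hom_part (e - a 0 j)" by simp_all
    have "\<epsilon> (coeff_vec v k) \<in> hom_elems S (e - int k)" for k
      by (rule g0[OF coeff_vec_in[OF v]])
        (use vh in \<open>simp add: X.ext_hom_def coeff_vec_def algebra_simps\<close>)
    then have lh: "lift_form \<epsilon> v $ k \<in> hom_elems S (e - int k)" for k by (simp add: lift_form_def)
    \<comment> \<open>\<open>proj\<close> keeps a term only if its weight equals the order of its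
      exponent in D, so the degree is not changed.\<close>
    have "int (sg_ord D z) = e" if "proj True (lift_form \<epsilon> v) $ z \<noteq> 0" for z
    proof -
      obtain x k where "pair_deg True (x, k) = sg_deg True D z" "lift_form \<epsilon> v $ k $ x \<noteq> 0"
        using proj_nonzero[OF \<open>proj True (lift_form \<epsilon> v) $ z \<noteq> 0\<close>] by blast
      moreover from this have "int (sg_ord S x) = e - int k" using lh[of k] unfolding hom_elems_def by blast
      ultimately show ?thesis by (simp add: pair_deg_def sg_deg_def)
    qed
    then show "X.cone_aug v \<in> hom_elems D e" by (simp add: X.cone_aug_def hom_elems_def)
  next
    fix i e j and v :: "nat \<Rightarrow> (nat, 'k) mps fps"
    assume v: "v \<in> vecs (fps_ext True (mps_on True G)) (cone_betti \<beta> (Suc i))"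
      and vh: "\<forall>j<cone_betti \<beta> (Suc i). v j \<in> X.ext_hom hom_part (e - X.cone_shift a (Suc i) j)"
      and j: "j < cone_betti \<beta> i"
    have add: "x + y \<in> hom_part e" if "x \<in> hom_part e" "y \<in> hom_part e" for x y :: "(nat, 'k) mps" and e
    proof -
      have "int (size m) = e" if "mcoeff (x + y) m \<noteq> 0" for m
      proof -
        have "mcoeff x m \<noteq> 0 \<or> mcoeff y m \<noteq> 0" using that by auto
        then show ?thesis using \<open>x \<in> hom_part e\<close> \<open>y \<in> hom_part e\<close> unfolding hom_part_def by blast
      qed
      then show ?thesis using subring_onD(3)[OF subring_mps_on, of x True G y] that by (simp add: hom_part_def)
    qed
    have neg: "- x \<in> hom_part e" if "x \<in> hom_part e" for x :: "(nat, 'k) mps" and e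
      using subring_onD(5)[OF subring_mps_on, of x True G] that by (simp add: hom_part_def)
    have zero: "(0 :: (nat, 'k) mps) \<in> hom_part e" for e
      using subring_onD(1)[OF subring_mps_on, of True G] by (simp add: hom_part_def)
    have wH: "quad True * F \<in> X.ext_hom hom_part (e + 2)" if "F \<in> X.ext_hom hom_part e" for F and e
    proof -
      have q: "quad True = (fps_X\<^sup>2 :: (nat, 'k) mps fps)" by (simp add: quad_def)
      have F: "F \<in> fps_ext True (mps_on True G)" "\<And>k. F $ k \<in> hom_part (e - int k)"
        using that by (auto simp: X.ext_hom_def)
      have "quad True * F \<in> fps_ext True (mps_on True G)"
        by (rule subring_onD(4)[OF X.C' quad_in F(1)])
      moreover have "(quad True * F) $ k \<in> hom_part (e + 2 - int k)" for k
      proof (cases "k < 2")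
        case True then show ?thesis by (simp add: q fps_X_power_mult_nth zero)
      next
        case False
        then have e: "e + 2 - int k = e - int (k - 2)" by simp
        show ?thesis unfolding e using False F(2)[of "k - 2"] by (simp add: q fps_X_power_mult_nth)
      qed
      ultimately show ?thesis by (simp add: X.ext_hom_def)
    qed
    show "X.cone_diff i v j \<in> X.ext_hom hom_part (e - X.cone_shift a i j)"
      by (rule X.cone_hom[OF gd add neg wH v _ j]) (use vh in auto)
  qed
  ultimately show ?thesis 
    using MD.has_graded_betti_numbers_iff[where \<mm> = "{F. F $ 0 \<in> aug_ideal}" and RH = "mpoly_hom (min_gens D)"
        and H = "X.ext_hom hom_part" and NH = "assoc_graded_hom (sg_ring D) (sg_max_ideal D)" and MH = "hom_elems D",
        OF var_ideal_D HD MHD] by blast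
qed

text \<open>One sequence \<open>\<beta>\<close> serves the ring and the graded ring of S, and both
  cones then have the ranks \<open>cone_betti \<beta>\<close>.\<close>

lemma homogeneous_type_double:
  assumes "homogeneous_type TYPE('k::field) S" shows "homogeneous_type TYPE('k) D"
proof -
  have m: "mpower_series_ring A = mring False A" "mpoly_ring A = mring True A" for A :: "nat set"
    by (simp_all add: mring_def)
  show ?thesis
    using assms betti_double_ring[where 'k = 'k] betti_double_gr[where 'k = 'k]
    unfolding homogeneous_type_def Let_def m by blast
qed

end

section \<open>Complete intersections\<close>

definition size_part :: "nat \<Rightarrow> ('g, 'k::zero) mps \<Rightarrow> ('g, 'k) mps" where
  "size_part e f = Abs_mps (\<lambda>m. if size m = e then mcoeff f m else 0)"

lemma mcoeff_size_part: "mcoeff (size_part e f) m = (if size m = e then mcoeff f m else 0)"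
  by (simp add: size_part_def)

lemma size_part_id_iff: "size_part e f = f \<longleftrightarrow> (\<forall>m. mcoeff f m \<noteq> 0 \<longrightarrow> size m = e)"
proof
  assume h: "size_part e f = f"
  show "\<forall>m. mcoeff f m \<noteq> 0 \<longrightarrow> size m = e"
    using mcoeff_size_part[of e f] unfolding h by metis
qed (auto intro!: mps_eqI simp: mcoeff_size_part)

lemma graded_ring_mps: "graded_ring (mps_on True A :: ('g, 'k::field) mps set) size_part"
proof
  show "subring_on (mps_on True A :: ('g, 'k) mps set)" by (rule subring_mps_on)
  fix x :: "('g, 'k) mps" and e assume x: "x \<in> mps_on True A"
  have "{m. mcoeff (size_part e x) m \<noteq> 0} \<subseteq> {m. mcoeff x m \<noteq> 0}" by (auto simp: mcoeff_size_part)
  then have "finite {m. mcoeff (size_part e x) m \<noteq> 0}"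
    by (rule finite_subset) (use x in \<open>simp add: mps_on_def\<close>)
  moreover have "set_mset m \<subseteq> A" if "mcoeff (size_part e x) m \<noteq> 0" for m
    using x that unfolding mcoeff_size_part mps_on_def by (simp split: if_splits)
  ultimately show "size_part e x \<in> mps_on True A" by (simp add: mps_on_def)
next
  fix e and x y :: "('g, 'k) mps"
  show "size_part e (x + y) = size_part e x + size_part e y" by (rule mps_eqI) (simp add: mcoeff_size_part)
next
  fix e e' and x :: "('g, 'k) mps"
  show "size_part e (size_part e' x) = (if e = e' then size_part e x else 0)"
    by (rule mps_eqI) (auto simp: mcoeff_size_part)
next
  fix x f :: "('g, 'k) mps" and k e assume f: "size_part k f = f"
  then have fk: "size v = k" if "mcoeff f v \<noteq> 0" for v using that by (simp add: size_part_id_iff)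
  show "size_part e (x * f) = (if k \<le> e then size_part (e - k) x * f else 0)"
  proof (rule mps_eqI)
    fix m
    have "mcoeff (size_part e (x * f)) m = (\<Sum>p \<in> {(u, v). u + v = m}.
        if size m = e then mcoeff x (fst p) * mcoeff f (snd p) else 0)"
      by (simp add: mcoeff_size_part mcoeff_mult case_prod_unfold)
    also have "\<dots> = (\<Sum>p \<in> {(u, v). u + v = m}.
        if k \<le> e then mcoeff (size_part (e - k) x) (fst p) * mcoeff f (snd p) else 0)"
    proof (rule sum.cong[OF refl])
      fix p assume "p \<in> {(u, v). u + v = m}"
      then have m: "size m = size (fst p) + size (snd p)" by (cases p) auto
      show "(if size m = e then mcoeff x (fst p) * mcoeff f (snd p) else 0) =
          (if k \<le> e then mcoeff (size_part (e - k) x) (fst p) * mcoeff f (snd p) else 0)"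
      proof (cases "mcoeff f (snd p) = 0")
        case False
        then have "size (snd p) = k" by (rule fk)
        then have "size m = e \<longleftrightarrow> k \<le> e \<and> size (fst p) = e - k" using m by linarith
        then show ?thesis by (simp add: mcoeff_size_part)
      qed simp
    qed
    also have "\<dots> = mcoeff (if k \<le> e then size_part (e - k) x * f else 0) m"
      by (simp add: mcoeff_mult case_prod_unfold)
    finally show "mcoeff (size_part e (x * f)) m = mcoeff (if k \<le> e then size_part (e - k) x * f else 0) m" .
  qed
next
  fix x :: "('g, 'k) mps" assume "x \<in> mps_on True A"
  then have "finite (size ` {m. mcoeff x m \<noteq> 0})" by (simp add: mps_on_def)
  then obtain N where N: "\<forall>n\<in>size ` {m. mcoeff x m \<noteq> 0}. n < N"
    using finite_nat_set_iff_bounded by blast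
  have "x = (\<Sum>e<N. size_part e x)"
  proof (rule mps_eqI)
    fix m
    have "mcoeff (\<Sum>e<N. size_part e x) m = (if size m < N then mcoeff x m else 0)"
      by (simp add: mcoeff_sum mcoeff_size_part)
    then show "mcoeff x m = mcoeff (\<Sum>e<N. size_part e x) m" using N by auto
  qed
  then show "\<exists>N. x = (\<Sum>e<N. size_part e x)" by blast
next
  show "size_part 0 1 = (1 :: ('g, 'k) mps)" by (rule mps_eqI) (simp add: mcoeff_size_part)
qed

lemma size_part_0_unit:
  fixes x :: "('g, 'k::field) mps"
  assumes "size_part 0 x = x" "x \<noteq> 0" shows "\<exists>y\<in>mps_on True A. x * y = 1"
proof
  let ?y = "Abs_mps (\<lambda>m. if m = {#} then inverse (mcoeff x {#}) else 0)"
  have x0: "mcoeff x m = 0" if "m \<noteq> {#}" for m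
    using assms(1) that unfolding size_part_id_iff by auto
  have nz: "mcoeff x {#} \<noteq> 0"
  proof
    assume "mcoeff x {#} = 0"
    then have "mcoeff x m = 0" for m using x0 by (cases "m = {#}") simp_all
    then have "x = 0" by (intro mps_eqI) simp
    then show False using assms(2) by simp
  qed
  show "?y \<in> mps_on True A" by (auto simp: mps_on_def intro: finite_subset[of _ "{{#}}"])
  show "x * ?y = 1"
  proof (rule mps_eqI)
    fix m
    show "mcoeff (x * ?y) m = mcoeff 1 m"
    proof (cases "m = {#}")
      case True then show ?thesis using nz by simp
    next
      case False
      have "mcoeff (x * ?y) m = (\<Sum>p \<in> {(u, v). u + v = m}. mcoeff x (fst p) * mcoeff ?y (snd p))"
        by (simp add: mcoeff_mult case_prod_unfold)
      also have "\<dots> = 0"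
      proof (rule sum.neutral, rule ballI)
        fix p assume "p \<in> {(u, v). u + v = m}"
        then have "fst p \<noteq> {#} \<or> snd p \<noteq> {#}" using False by auto
        then show "mcoeff x (fst p) * mcoeff ?y (snd p) = 0" using x0 by auto
      qed
      finally show ?thesis using False by simp
    qed
  qed
qed

section \<open>Relations of the graded rings and descent to S\<close>

context semigroup_double
begin

definition gr_relations :: "(nat, 'k::field) mps set" where
  "gr_relations = {f \<in> mps_on True G. sg_eval True S f = 0}"

text \<open>A monomial of length at most 1 is the only factorization of its value, so its
  coefficient appears alone in the evaluation. This supplies the condition \<open>I01\<close> of
  \<open>regular_seq_descend\<close>.\<close>

lemma gr_relations_low:
  assumes f: "f \<in> gr_relations" and m: "size m \<le> 1" shows "mcoeff f m = 0"
proof (rule ccontr)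
  assume nz: "mcoeff f m \<noteq> 0"
  then have mG: "set_mset m \<subseteq> G" using f by (simp add: gr_relations_def mps_on_def)
  let ?z = "\<Sum>\<^sub># m"
  have "{a \<in> {m. set_mset m \<subseteq> G}. \<Sum>\<^sub># a = ?z \<and> size a = sg_ord S ?z} = {m}"
  proof (cases m)
    case empty
    then show ?thesis using ord_0[OF S] by auto
  next
    case (add g m')
    then have mg: "m = {#g#}" using m by simp
    then have g: "g \<in> G" using mG by simp
    have "a = {#g#}" if "set_mset a \<subseteq> G" "\<Sum>\<^sub># a = g" for a by (rule mset_sum_gen[OF S that g])
    then show ?thesis using mg g ord_gen[OF S g] by auto
  qed
  then have "sg_eval True S f $ ?z = mcoeff f m" by (simp add: sg_eval_def push_def sg_deg_def)
  then show False using f nz by (simp add: gr_relations_def)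
qed

text \<open>By \<open>proj_gr_eq_zero\<close> a polynomial in y is a relation of D iff its
  coefficients of y^0 and y^1 are relations of S; this is the shape of ideal that
  \<open>regular_seq_descend\<close> expects.\<close>

lemma dcoeff_kernel:
  "dcoeff ` {f \<in> carrier (mring True (min_gens D)). sg_eval True D (Abs_mps f) = (0 :: 'k::field fps)} =
    {F \<in> fps_ext True (mps_on True G). F $ 0 \<in> gr_relations \<and> F $ 1 \<in> gr_relations}"
proof -
  have mem: "sg_eval True D (Abs_mps f) = 0 \<longleftrightarrow> dcoeff f $ 0 \<in> gr_relations \<and> dcoeff f $ 1 \<in> gr_relations"
    if f: "dcoeff f \<in> fps_ext True (mps_on True G)" for f :: "nat multiset \<Rightarrow> 'k"
  proof -
    have C: "dcoeff f $ k \<in> mps_on True G" for k using f by (simp add: fps_ext_def)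
    have "{k. eval_fps True (dcoeff f) $ k \<noteq> 0} \<subseteq> {k. dcoeff f $ k \<noteq> 0}"
      by (auto simp: eval_fps_def sg_eval_zero)
    moreover have "finite {k. dcoeff f $ k \<noteq> 0}" using f by (simp add: fps_ext_def)
    ultimately have "finite {k. eval_fps True (dcoeff f) $ k \<noteq> 0}" by (rule finite_subset)
    moreover have "eval_fps True (dcoeff f) $ k \<in> sg_on True S" for k
      using sg_eval_in[OF S C] by (simp add: eval_fps_def)
    ultimately have e: "eval_fps True (dcoeff f) \<in> fps_ext True (sg_on True S)" unfolding fps_ext_def by blast
    show ?thesis
      unfolding eval_dcoeff[symmetric] proj_gr_eq_zero[OF e] using C by (simp add: eval_fps_def gr_relations_def)
  qed
  have img: "dcoeff ` carrier (mring True (min_gens D)) = (fps_ext True (mps_on True G) :: (nat, 'k) mps fps set)"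
    using dcoeff_bij[of True, where 'k = 'k] by (simp add: bij_betw_def)
  show ?thesis
  proof (intro equalityI subsetI)
    fix F :: "(nat, 'k) mps fps"
    assume "F \<in> dcoeff ` {f \<in> carrier (mring True (min_gens D)). sg_eval True D (Abs_mps f) = 0}"
    then obtain f where "f \<in> carrier (mring True (min_gens D))" "sg_eval True D (Abs_mps f) = 0" "F = dcoeff f" by blast
    then show "F \<in> {F \<in> fps_ext True (mps_on True G). F $ 0 \<in> gr_relations \<and> F $ 1 \<in> gr_relations}"
      using mem[of f] img by blast
  next
    fix F :: "(nat, 'k) mps fps"
    assume F: "F \<in> {F \<in> fps_ext True (mps_on True G). F $ 0 \<in> gr_relations \<and> F $ 1 \<in> gr_relations}"
    then obtain f where "f \<in> carrier (mring True (min_gens D))" "F = dcoeff f" unfolding img[symmetric] by blast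
    then show "F \<in> dcoeff ` {f \<in> carrier (mring True (min_gens D)). sg_eval True D (Abs_mps f) = 0}"
      using mem[of f] F by blast
  qed
qed

lemma mpoly_hom_imp_size_part:
  assumes "f \<in> mpoly_hom (min_gens D) e"
  shows "\<exists>k. graded_ring.comp_ext size_part k (dcoeff f) = dcoeff (f :: nat multiset \<Rightarrow> 'k::field)"
proof -
  interpret graded_ring "mps_on True G :: (nat, 'k) mps set" size_part by (rule graded_ring_mps)
  have h: "int (size m) = e" if "f m \<noteq> 0" for m using assms that by (simp add: mpoly_hom_eq)
  \<comment> \<open>A negative \<open>e\<close> forces f = 0, so truncating it to a natural number
    does no harm.\<close>
  have "comp_ext (nat e) (dcoeff f) = dcoeff f"
  proof (intro fps_ext mps_eqI)
    fix k m
    show "mcoeff (comp_ext (nat e) (dcoeff f) $ k) m = mcoeff (dcoeff f $ k) m"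
    proof (cases "f (dmon (m, k)) = 0")
      case True then show ?thesis by (simp add: comp_ext_def mcoeff_size_part)
    next
      case False
      then have "nat e = size m + k" using h[OF False] dmon_size[of "(m, k)"] by simp
      then show ?thesis by (simp add: comp_ext_def mcoeff_size_part)
    qed
  qed
  then show ?thesis by blast
qed

lemma gr_complete_intersection_descend:
  assumes "gr_complete_intersection TYPE('k::field) D" shows "gr_complete_intersection TYPE('k) S"
proof -
  let ?P = "mring True G :: (nat multiset \<Rightarrow> 'k) ring" and ?P' = "mring True (min_gens D) :: (nat multiset \<Rightarrow> 'k) ring"
  let ?C = "mps_on True G :: (nat, 'k) mps set"
  let ?I = "gr_relations :: (nat, 'k) mps set"
  interpret RS: ring_model ?P Abs_mps ?C by (rule ring_model_mring)
  interpret RD: ring_model ?P' dcoeff "fps_ext True ?C" by (rule ring_model_dcoeff)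
  interpret graded_ring ?C size_part by (rule graded_ring_mps)
  obtain fs where reg: "regular_sequence ?P' fs" and hom: "\<forall>f\<in>set fs. \<exists>e. f \<in> mpoly_hom (min_gens D) e"
    and ker: "a_kernel ?P' (sg_gr D) (gr_subst D) = Idl\<^bsub>?P'\<^esub> (set fs)"
    using assms unfolding gr_complete_intersection_def Let_def by (auto simp: mring_def)
  have fsC: "set fs \<subseteq> carrier ?P'" using reg by (simp add: regular_sequence_def)
  have fsC': "set (map dcoeff fs) \<subseteq> fps_ext True ?C" using fsC RD.\<rho>_in by auto
  have reg': "regular_seq_on (fps_ext True ?C) (map dcoeff fs)"
    using reg RD.regular_sequence_iff[OF fsC] by simp
  have hom': "\<forall>f\<in>set (map dcoeff fs). \<exists>k. comp_ext k f = f"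
    using hom mpoly_hom_imp_size_part by fastforce
  have gen: "adjoins (fps_ext True ?C) {0} (map dcoeff fs) =
      {F \<in> fps_ext True ?C. F $ 0 \<in> ?I \<and> F $ 1 \<in> ?I}"
    using RD.genideal_image[OF fsC] ker unfolding kernel_gr_subst[OF D]
    by (simp only: dcoeff_kernel[symmetric])
  have I': "ideal_on (fps_ext True ?C) {F \<in> fps_ext True ?C. F $ 0 \<in> ?I \<and> F $ 1 \<in> ?I}"
    unfolding gen[symmetric]
    by (rule ideal_on_adjoins[OF RD.subring_C ideal_on_zero[OF RD.subring_C] fsC'])
  have const: "fps_const x \<in> fps_ext True ?C" if "x \<in> ?C" for x
    using that subring_onD(1)[OF subring_mps_on, of True G]
    by (auto simp: fps_ext_def intro: finite_subset[of _ "{0}"])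
  have zeroI: "0 \<in> ?I" using subring_onD(1)[OF subring_mps_on, of True G] by (simp add: gr_relations_def sg_eval_zero)
  \<comment> \<open>Constant series in y detect the relations of S, which thereby inherit the ideal
    laws from the ideal generated by the images of \<open>fs\<close>.\<close>
  have constI: "x \<in> ?I \<longleftrightarrow> fps_const x \<in> {F \<in> fps_ext True ?C. F $ 0 \<in> ?I \<and> F $ 1 \<in> ?I}" if "x \<in> ?C" for x
    using const[OF that] zeroI by simp
  have IC: "?I \<subseteq> ?C" by (auto simp: gr_relations_def)
  have I: "ideal_on ?C ?I"
    unfolding ideal_on_def
  proof (intro conjI ballI)
    show "?I \<subseteq> ?C" "0 \<in> ?I" by (fact IC, fact zeroI)
    fix x y assume x: "x \<in> ?I" and y: "y \<in> ?I"
    have xy: "x \<in> ?C" "y \<in> ?C" using x y IC by blast+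
    have "fps_const x + fps_const y \<in> {F \<in> fps_ext True ?C. F $ 0 \<in> ?I \<and> F $ 1 \<in> ?I}"
      by (rule ideal_onD(3)[OF I' iffD1[OF constI[OF xy(1)] x] iffD1[OF constI[OF xy(2)] y]])
    then show "x + y \<in> ?I"
      unfolding fps_const_add by (rule iffD2[OF constI[OF subring_onD(3)[OF subring_mps_on xy]]])
  next
    fix r x assume r: "r \<in> ?C" and x: "x \<in> ?I"
    have xC: "x \<in> ?C" using x IC by blast
    have "fps_const r * fps_const x \<in> {F \<in> fps_ext True ?C. F $ 0 \<in> ?I \<and> F $ 1 \<in> ?I}"
      by (rule ideal_onD(4)[OF I' const[OF r] iffD1[OF constI[OF xC] x]])
    then show "r * x \<in> ?I"
      unfolding fps_const_mult by (rule iffD2[OF constI[OF subring_onD(4)[OF subring_mps_on r xC]]])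
  qed
  have I01: "size_part 0 x = 0 \<and> size_part 1 x = 0" if "x \<in> ?I" for x
    using gr_relations_low[OF that] by (auto intro!: mps_eqI simp: mcoeff_size_part)
  obtain gs where gs: "regular_seq_on ?C gs" "\<forall>g\<in>set gs. \<exists>k. size_part k g = g" "adjoins ?C {0} gs = ?I"
    using regular_seq_descend[OF size_part_0_unit I I01 reg' hom' gen] by blast
  let ?fs = "map mcoeff gs"
  have Abs: "map Abs_mps ?fs = gs" by (simp add: comp_def mcoeff_inverse)
  have gsC: "set ?fs \<subseteq> carrier ?P"
    using gs(1) by (auto simp: regular_seq_on_def mring_simps mcoeff_inverse)
  have "regular_sequence ?P ?fs" using RS.regular_sequence_iff[OF gsC] gs(1) Abs by simp
  moreover have "\<exists>e. f \<in> mpoly_hom G e" if "f \<in> set ?fs" for f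
  proof -
    obtain g where g: "g \<in> set gs" "f = mcoeff g" using \<open>f \<in> set ?fs\<close> by auto
    obtain k where "size_part k g = g" using gs(2) g(1) by blast
    then have "f \<in> mpoly_hom G (int k)"
      using gsC \<open>f \<in> set ?fs\<close> g(2) by (auto simp: mpoly_hom_eq size_part_id_iff)
    then show ?thesis by blast
  qed
  moreover have "a_kernel ?P (sg_gr S) (gr_subst S) = Idl\<^bsub>?P\<^esub> (set ?fs)"
  proof -
    have "x \<in> Idl\<^bsub>?P\<^esub> (set ?fs) \<longleftrightarrow> sg_eval True S (Abs_mps x) = 0" if "x \<in> carrier ?P" for x
      using RS.genideal_mem[OF gsC that] that unfolding Abs gs(3) by (simp add: gr_relations_def mring_simps)
    moreover have "Idl\<^bsub>?P\<^esub> (set ?fs) \<subseteq> carrier ?P"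
    proof
      fix x assume "x \<in> Idl\<^bsub>?P\<^esub> (set ?fs)"
      then show "x \<in> carrier ?P"
        by (rule ideal.Icarr[OF ring.genideal_ideal[OF cring.axioms(1)[OF cring_mring] gsC]])
    qed
    ultimately show ?thesis unfolding kernel_gr_subst[OF S] by blast
  qed
  ultimately show ?thesis
    unfolding gr_complete_intersection_def Let_def by (auto simp: mring_def intro!: exI[of _ ?fs])
qed

end

theorem proposition4p6:
  fixes S E :: "nat set" and m s b :: nat
  assumes "numerical_semigroup S"
    and "homogeneous_type TYPE('k::field) S"
    and "m = ns_multiplicity S"
    and "s \<in> S - {0}"
    and "b \<in> S" and "odd b"
    and "2 * s + b \<in> apery m S"
    and "E = (\<lambda>x. s + x) ` S"
  shows "homogeneous_type TYPE('k) (duplication S b E) \<and>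
    \<not> homogeneous (duplication S b E) \<and>
    (\<not> gr_complete_intersection TYPE('k) S \<longrightarrow>
      \<not> gr_complete_intersection TYPE('k) (duplication S b E))"
proof -
  note S = assms(1) and cl = sg_closed[OF assms(1)]
  let ?c = "2 * s + b" and ?D = "duplication S b E"
  have s: "s \<in> S" "s \<noteq> 0" and b: "b \<noteq> 0" using assms(4,6) by (auto intro: Nat.gr0I)
  have E: "ns_ideal E S"
    unfolding ns_ideal_def assms(8) using cl s(1) by (auto simp: add.assoc image_iff)
  have D: "numerical_semigroup ?D" by (rule numerical_semigroup_duplication[OF S E assms(5,6)])
  have "sg_ord S s + sg_ord S s + sg_ord S b \<le> sg_ord S ?c"
    using ord_add_le[OF S s(1) s(1)] ord_add_le[OF S cl(2)[OF s(1) s(1)] assms(5)] by (simp add: mult_2)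
  then have ord: "3 \<le> sg_ord S ?c"
    using ord_pos[OF S s] ord_pos[OF S assms(5) b] by linarith
  have ds: "?D = {2 * x | x. x \<in> S} \<union> {2 * x + ?c | x. x \<in> S}"
  proof -
    have "{2 * e + b | e. e \<in> E} = {2 * x + ?c | x. x \<in> S}"
    proof (intro equalityI subsetI)
      fix y assume "y \<in> {2 * e + b | e. e \<in> E}"
      then obtain x where "x \<in> S" "y = 2 * (s + x) + b" unfolding assms(8) by blast
      then have "x \<in> S" "y = 2 * x + ?c" by simp_all
      then show "y \<in> {2 * x + ?c | x. x \<in> S}" by blast
    next
      fix y assume "y \<in> {2 * x + ?c | x. x \<in> S}"
      then obtain x where "x \<in> S" "y = 2 * x + ?c" by blast
      then have "s + x \<in> E" "y = 2 * (s + x) + b" unfolding assms(8) by simp_all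
      then show "y \<in> {2 * e + b | e. e \<in> E}" by blast
    qed
    then show ?thesis by (simp add: duplication_def)
  qed
  interpret semigroup_double S ?c ?D
  proof
    show "?c \<in> S" using cl(2)[OF cl(2)[OF s(1) s(1)] assms(5)] by (simp add: mult_2)
  qed (use S D ord ds assms(6) in auto)
  \<comment> \<open>The multiplicity is at most s, and c is 2 s + b.\<close>
  have "2 * ns_multiplicity S \<le> ?c"
    using ns_multiplicity_props(2)[OF S s] by simp
  then have "\<not> homogeneous ?D" using not_homogeneous assms(3,7) by simp
  then show ?thesis using homogeneous_type_double[OF assms(2)] gr_complete_intersection_descend[where 'k = 'k] by blast
qed

end
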